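(* Let $T>0$ be any finite time horizon and let $x_1\in\mathbb R^{n_1}$, $x_2\in\mathbb R^{n_2}$. Assume: (i) $\Delta_2$ is invertible; (ii) the algebraic Riccati equation $A_{22}^*P+PA_{22}+P\Delta_2P+Q_2=0$ admits a solution $\overline P_{22}\in\mathbb S^{n_2}$ such that all eigenvalues of $S:=A_{22}+\Delta_2\overline P_{22}$ have strictly negative real parts; (iii) the differential Riccati equation $\frac{d\overline P_{11}}{dt}+\widetilde A^*\overline P_{11}+\overline P_{11}\widetilde A+\overline P_{11}M\overline P_{11}+N=0$ on $[0,T]$, $\overline P_{11}(T)=0$, admits a unique solution $\overline P_{11}\in C([0,T];\mathbb S^{n_1})$; (iv) there is $\gamma>0$ with $\frac12(S^*+S)\le-\gamma I$; (v) for some $\delta\in(0,\gamma)$, $-\overline P_{22}$ lies in the interior of the closed ball $B_{\delta,q_2}$. Define $$\overline V(x_1,x_2)=\frac12\langle\overline P_{11}(0)x_1,x_1\rangle+\frac12\int_0^T\langle\overline P_{11}(t)\sigma_1,\sigma_1\rangle dt+\frac T2\langle\overline P_{22}\sigma_2,\sigma_2\rangle.$$ Then there exists a Tikhonov threshold $\epsilon^*$ (defined in the context) such that for all $0<\epsilon<\epsilon^*$, $$J^\epsilon(x_1,x_2;\widehat u_1^\epsilon,\widehat u_2^\epsilon)-\overline V(x_1,x_2)=O(\epsilon),$$ where $(\widehat u_1^\epsilon,\widehat u_2^\epsilon)$ is the feedback saddle point defined in the context.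
   Context: Notation: $M^*$ is the transpose of $M$; $\mathbb S^m$ is the space of symmetric $m\times m$ real matrices; matrices carry the inner product $\langle M,N\rangle=\mathrm{tr}(M^*N)$ and norm $|M|=\langle M,M\rangle^{1/2}$. $O(\epsilon)$ denotes a quantity bounded in norm by $C\epsilon$ for all $0<\epsilon<\epsilon^*$, with $C$ independent of $\epsilon$ (and of $t$, when the quantity depends on $t\in[0,T]$). Data: $n_1,n_2,k_1,k_2,m_1,m_2\ge1$ are integers; for $i,j\in\{1,2\}$, $A_{ij}\in\mathbb R^{n_i\times n_j}$, $B_{ij}\in\mathbb R^{n_i\times k_j}$, $\sigma_i\in\mathbb R^{n_i\times m_i}$, $Q_i\in\mathbb S^{n_i}$ are constant matrices. $W_1,W_2$ are independent $m_1$- and $m_2$-dimensional Brownian motions on $[0,T]$ on a complete probability space $(\Omega,\mathcal F,\mathbb P)$, with filtration their augmented natural filtration. $\mathbb A_T^{k}$ is the space of predictable processes in $L^2(\Omega\times[0,T];\mathbb R^k)$. The perturbation parameter satisfies $0<\epsilon\le1$. Put $\Delta_1=B_{11}B_{11}^*-B_{12}B_{12}^*$, $\Delta=B_{11}B_{21}^*-B_{12}B_{22}^*$, $\Delta_2=B_{21}B_{21}^*-B_{22}B_{22}^*$. Game: for $(u_1,u_2)\in\mathbb A_T^{k_1}\times\mathbb A_T^{k_2}$ the state solves $dX_1=[A_{11}X_1+A_{12}X_2^\epsilon+B_{11}u_1+B_{12}u_2]dt+\sigma_1dW_1$, $dX_2^\epsilon=\frac1\epsilon[A_{21}X_1+A_{22}X_2^\epsilon+B_{21}u_1+B_{22}u_2]dt+\frac{\sigma_2}{\sqrt\epsilon}dW_2$,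 $X_1(0)=x_1$, $X_2^\epsilon(0)=x_2$, and $J^\epsilon(x_1,x_2;u_1,u_2)=\frac12\mathbb E\int_0^T[\langle Q_1X_1,X_1\rangle+\langle Q_2X_2^\epsilon,X_2^\epsilon\rangle-|u_1|^2+|u_2|^2]dt$ (Player 1 maximises, Player 2 minimises). Full system: $\frac{dP_{11}^\epsilon}{dt}+f(P_{11}^\epsilon,P_{12}^\epsilon,P_{22}^\epsilon,\epsilon)=0$, $\epsilon\frac{dP_{12}^\epsilon}{dt}+g_1(P_{11}^\epsilon,P_{12}^\epsilon,P_{22}^\epsilon,\epsilon)=0$, $\epsilon\frac{dP_{22}^\epsilon}{dt}+g_2(P_{11}^\epsilon,P_{12}^\epsilon,P_{22}^\epsilon,\epsilon)=0$ on $[0,T]$, with $P_{11}^\epsilon(T)=0$, $P_{12}^\epsilon(T)=0$, $P_{22}^\epsilon(T)=0$, where $f(P_{11},P_{12},P_{22},\epsilon)=A_{11}^*P_{11}+A_{21}^*P_{12}^*+P_{11}A_{11}+P_{12}A_{21}+P_{11}\Delta_1P_{11}+P_{12}\Delta^*P_{11}+P_{11}\Delta P_{12}^*+P_{12}\Delta_2P_{12}^*+Q_1$; $g_1(P_{11},P_{12},P_{22},\epsilon)=\epsilon A_{11}^*P_{12}+A_{21}^*P_{22}+P_{11}A_{12}+P_{12}A_{22}+\epsilon P_{11}\Delta_1P_{12}+\epsilon P_{12}\Delta^*P_{12}+P_{11}\Delta P_{22}+P_{12}\Delta_2P_{22}$; $g_2(P_{11},P_{12},P_{22},\epsilon)=\epsilon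 A_{12}^*P_{12}+A_{22}^*P_{22}+\epsilon P_{12}^*A_{12}+P_{22}A_{22}+\epsilon^2P_{12}^*\Delta_1P_{12}+\epsilon P_{12}^*\Delta P_{22}+\epsilon P_{22}\Delta^*P_{12}+P_{22}\Delta_2P_{22}+Q_2$. Coefficients of the reduced differential Riccati equation: with $\Lambda=A_{22}^*\Delta_2^{-1}A_{22}-Q_2$ (which is invertible under (i) and (ii)), $\widetilde A=A_{11}-\Delta\Delta_2^{-1}[\Delta_2-A_{22}\Lambda^{-1}A_{22}^*]\Delta_2^{-1}A_{21}-A_{12}\Lambda^{-1}A_{22}^*\Delta_2^{-1}A_{21}$; $M=\Delta_1+A_{12}\Lambda^{-1}A_{12}^*-\Delta\Delta_2^{-1}A_{22}\Lambda^{-1}A_{12}^*-A_{12}\Lambda^{-1}A_{22}^*\Delta_2^{-1}\Delta^*-\Delta\Delta_2^{-1}[\Delta_2-A_{22}\Lambda^{-1}A_{22}^*]\Delta_2^{-1}\Delta^*$; $N=Q_1-A_{21}^*\Delta_2^{-1}[\Delta_2-A_{22}\Lambda^{-1}A_{22}^*]\Delta_2^{-1}A_{21}$. For $0<\delta<\gamma$ let $\mathcal R_\delta=\{P\in\mathbb S^{n_2}:\frac12[(S+\Delta_2P)^*+(S+\Delta_2P)]\le\delta I\}$; $B_{\delta,q_2}$ is the largest closed ball centred at $0$ in $\mathbb S^{n_2}$ contained in $\mathcal R_\delta$, and $q_2$ is its radius. Let $h(P_{11})=-(A_{21}^*\overline P_{22}+P_{11}A_{12}+P_{11}\Delta\overline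 P_{22})(A_{22}+\Delta_2\overline P_{22})^{-1}$ and $\overline P_{12}(t)=h(\overline P_{11}(t))$. The boundary-layer system on $\tau\ge0$ is $\frac{d\widehat P_{12}}{d\tau}=g_1(0,\widehat P_{12}+h(0),\widehat P_{22}+\overline P_{22},0)$, $\widehat P_{12}(0)=-h(0)$; $\frac{d\widehat P_{22}}{d\tau}=g_2(0,\widehat P_{12}+h(0),\widehat P_{22}+\overline P_{22},0)$, $\widehat P_{22}(0)=-\overline P_{22}$. Tikhonov threshold: a number $\epsilon^*\in(0,1]$ such that for all $0<\epsilon<\epsilon^*$ the full system has a unique solution $(P_{11}^\epsilon,P_{12}^\epsilon,P_{22}^\epsilon)\in C([0,T];\mathbb S^{n_1})\times C([0,T];\mathbb R^{n_1\times n_2})\times C([0,T];\mathbb S^{n_2})$, and, uniformly in $t\in[0,T]$, $P_{11}^\epsilon(t)-\overline P_{11}(t)=O(\epsilon)$, $P_{12}^\epsilon(t)-\overline P_{12}(t)-\widehat P_{12}((T-t)/\epsilon)=O(\epsilon)$, $P_{22}^\epsilon(t)-\overline P_{22}-\widehat P_{22}((T-t)/\epsilon)=O(\epsilon)$. Feedback saddle point: $\widehat u_1^\epsilon=[B_{11}^*P_{11}^\epsilon+B_{21}^*(P_{12}^\epsilon)^*]\widehat X_1^\epsilon+[\epsilon B_{11}^*P_{12}^\epsilon+B_{21}^*P_{22}^\epsilon]\widehat X_2^\epsilon$, $\widehat u_2^\epsilon=-[B_{12}^*P_{11}^\epsilon+B_{22}^*(P_{12}^\epsilon)^*]\widehat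 X_1^\epsilon-[\epsilon B_{12}^*P_{12}^\epsilon+B_{22}^*P_{22}^\epsilon]\widehat X_2^\epsilon$, where $(\widehat X_1^\epsilon,\widehat X_2^\epsilon)$ is the state process under these closed-loop controls. *)

theory Defs
  imports "HOL-Probability.Probability"
begin

definition sym_mats :: "(real^'n^'n) set" where
  "sym_mats = {P. transpose P = P}"

text \<open>Loewner order; only used for symmetric matrices. Note that the library matrix
  \<open>mat c\<close> is \<open>c\<close> times the identity.\<close>

definition mat_le :: "real^'n^'n \<Rightarrow> real^'n^'n \<Rightarrow> bool" where
  "mat_le A B \<longleftrightarrow> (\<forall>x. (A *v x) \<bullet> x \<le> (B *v x) \<bullet> x)"

definition sym_part :: "real^'n^'n \<Rightarrow> real^'n^'n" where
  "sym_part A = (1/2) *\<^sub>R (transpose A + A)"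

definition complex_eigenvalue :: "real^'n^'n \<Rightarrow> complex \<Rightarrow> bool" where
  "complex_eigenvalue A z \<longleftrightarrow> (\<exists>v. v \<noteq> 0 \<and> map_matrix complex_of_real A *v v = z *s v)"

text \<open>The library inner product and norm on matrices are the trace inner product and the
  norm that it induces.\<close>

lemma inner_matrix_eq_trace:
  fixes M N :: "real^'n^'m"
  shows "M \<bullet> N = trace (transpose M ** N)"
  unfolding trace_def transpose_def matrix_matrix_mult_def inner_vec_def
  by (simp add: inner_real_def) (rule sum.swap)

lemma norm_matrix_eq_trace:
  fixes M :: "real^'n^'m"
  shows "norm M = sqrt (trace (transpose M ** M))"
  by (simp add: norm_eq_sqrt_inner inner_matrix_eq_trace)

record ('n1, 'n2, 'k1, 'k2, 'm1, 'm2) game =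
  A11 :: "real^'n1^'n1"
  A12 :: "real^'n2^'n1"
  A21 :: "real^'n1^'n2"
  A22 :: "real^'n2^'n2"
  B11 :: "real^'k1^'n1"
  B12 :: "real^'k2^'n1"
  B21 :: "real^'k1^'n2"
  B22 :: "real^'k2^'n2"
  sigma1 :: "real^'m1^'n1"
  sigma2 :: "real^'m2^'n2"
  Q1 :: "real^'n1^'n1"
  Q2 :: "real^'n2^'n2"

type_synonym ('n1, 'n2) riccati_triple =
  "(real \<Rightarrow> real^'n1^'n1) \<times> (real \<Rightarrow> real^'n2^'n1) \<times> (real \<Rightarrow> real^'n2^'n2)"

definition Delta1 ::
  "('n1::finite, 'n2::finite, 'k1::finite, 'k2::finite, 'm1::finite, 'm2::finite) game
    \<Rightarrow> real^'n1^'n1" where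
  "Delta1 G = B11 G ** transpose (B11 G) - B12 G ** transpose (B12 G)"

definition Delta ::
  "('n1::finite, 'n2::finite, 'k1::finite, 'k2::finite, 'm1::finite, 'm2::finite) game
    \<Rightarrow> real^'n2^'n1" where
  "Delta G = B11 G ** transpose (B21 G) - B12 G ** transpose (B22 G)"

definition Delta2 ::
  "('n1::finite, 'n2::finite, 'k1::finite, 'k2::finite, 'm1::finite, 'm2::finite) game
    \<Rightarrow> real^'n2^'n2" where
  "Delta2 G = B21 G ** transpose (B21 G) - B22 G ** transpose (B22 G)"

definition ric_f ::
  "('n1::finite, 'n2::finite, 'k1::finite, 'k2::finite, 'm1::finite, 'm2::finite) game
    \<Rightarrow> real^'n1^'n1 \<Rightarrow> real^'n2^'n1 \<Rightarrow> real^'n2^'n2 \<Rightarrow> real \<Rightarrow> real^'n1^'n1" where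
  "ric_f G P11 P12 P22 \<epsilon> =
     transpose (A11 G) ** P11 + transpose (A21 G) ** transpose P12 + P11 ** A11 G + P12 ** A21 G
     + P11 ** Delta1 G ** P11 + P12 ** transpose (Delta G) ** P11
     + P11 ** Delta G ** transpose P12 + P12 ** Delta2 G ** transpose P12 + Q1 G"

definition ric_g1 ::
  "('n1::finite, 'n2::finite, 'k1::finite, 'k2::finite, 'm1::finite, 'm2::finite) game
    \<Rightarrow> real^'n1^'n1 \<Rightarrow> real^'n2^'n1 \<Rightarrow> real^'n2^'n2 \<Rightarrow> real \<Rightarrow> real^'n2^'n1" where
  "ric_g1 G P11 P12 P22 \<epsilon> =
     \<epsilon> *\<^sub>R (transpose (A11 G) ** P12) + transpose (A21 G) ** P22 + P11 ** A12 G + P12 ** A22 G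
     + \<epsilon> *\<^sub>R (P11 ** Delta1 G ** P12) + \<epsilon> *\<^sub>R (P12 ** transpose (Delta G) ** P12)
     + P11 ** Delta G ** P22 + P12 ** Delta2 G ** P22"

definition ric_g2 ::
  "('n1::finite, 'n2::finite, 'k1::finite, 'k2::finite, 'm1::finite, 'm2::finite) game
    \<Rightarrow> real^'n1^'n1 \<Rightarrow> real^'n2^'n1 \<Rightarrow> real^'n2^'n2 \<Rightarrow> real \<Rightarrow> real^'n2^'n2" where
  "ric_g2 G P11 P12 P22 \<epsilon> =
     \<epsilon> *\<^sub>R (transpose (A12 G) ** P12) + transpose (A22 G) ** P22
     + \<epsilon> *\<^sub>R (transpose P12 ** A12 G) + P22 ** A22 G
     + \<epsilon>^2 *\<^sub>R (transpose P12 ** Delta1 G ** P12)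
     + \<epsilon> *\<^sub>R (transpose P12 ** Delta G ** P22) + \<epsilon> *\<^sub>R (P22 ** transpose (Delta G) ** P12)
     + P22 ** Delta2 G ** P22 + Q2 G"

text \<open>Derivatives are taken within \<open>[0,T]\<close>, hence one-sided at the end points; in particular
  solutions are continuous on \<open>[0,T]\<close>. Values outside \<open>[0,T]\<close> are irrelevant.\<close>

definition full_solution ::
  "('n1::finite, 'n2::finite, 'k1::finite, 'k2::finite, 'm1::finite, 'm2::finite) game
    \<Rightarrow> real \<Rightarrow> real \<Rightarrow> ('n1, 'n2) riccati_triple \<Rightarrow> bool" where
  "full_solution G T \<epsilon> = (\<lambda>(P11, P12, P22).
     (\<forall>t\<in>{0..T}. P11 t \<in> sym_mats \<and> P22 t \<in> sym_mats) \<and>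
     P11 T = 0 \<and> P12 T = 0 \<and> P22 T = 0 \<and>
     (\<forall>t\<in>{0..T}. \<exists>D11 D12 D22.
        (P11 has_vector_derivative D11) (at t within {0..T}) \<and>
        (P12 has_vector_derivative D12) (at t within {0..T}) \<and>
        (P22 has_vector_derivative D22) (at t within {0..T}) \<and>
        D11 + ric_f G (P11 t) (P12 t) (P22 t) \<epsilon> = 0 \<and>
        \<epsilon> *\<^sub>R D12 + ric_g1 G (P11 t) (P12 t) (P22 t) \<epsilon> = 0 \<and>
        \<epsilon> *\<^sub>R D22 + ric_g2 G (P11 t) (P12 t) (P22 t) \<epsilon> = 0))"

definition Lambda ::
  "('n1::finite, 'n2::finite, 'k1::finite, 'k2::finite, 'm1::finite, 'm2::finite) game
    \<Rightarrow> real^'n2^'n2" where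
  "Lambda G = transpose (A22 G) ** matrix_inv (Delta2 G) ** A22 G - Q2 G"

text \<open>\<open>Delta2_bracket\<close> is the factor
  \<open>\<Delta>\<^sub>2\<^sup>-\<^sup>1 [\<Delta>\<^sub>2 - A\<^sub>2\<^sub>2 \<Lambda>\<^sup>-\<^sup>1 A\<^sub>2\<^sub>2\<^sup>*] \<Delta>\<^sub>2\<^sup>-\<^sup>1\<close> shared by the three coefficients of the reduced
  Riccati equation.\<close>

definition Delta2_bracket ::
  "('n1::finite, 'n2::finite, 'k1::finite, 'k2::finite, 'm1::finite, 'm2::finite) game
    \<Rightarrow> real^'n2^'n2" where
  "Delta2_bracket G =
     matrix_inv (Delta2 G) ** (Delta2 G - A22 G ** matrix_inv (Lambda G) ** transpose (A22 G))
       ** matrix_inv (Delta2 G)"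

definition A_red ::
  "('n1::finite, 'n2::finite, 'k1::finite, 'k2::finite, 'm1::finite, 'm2::finite) game
    \<Rightarrow> real^'n1^'n1" where
  "A_red G = A11 G - Delta G ** Delta2_bracket G ** A21 G
     - A12 G ** matrix_inv (Lambda G) ** transpose (A22 G) ** matrix_inv (Delta2 G) ** A21 G"

definition M_red ::
  "('n1::finite, 'n2::finite, 'k1::finite, 'k2::finite, 'm1::finite, 'm2::finite) game
    \<Rightarrow> real^'n1^'n1" where
  "M_red G = Delta1 G + A12 G ** matrix_inv (Lambda G) ** transpose (A12 G)
     - Delta G ** matrix_inv (Delta2 G) ** A22 G ** matrix_inv (Lambda G) ** transpose (A12 G)
     - A12 G ** matrix_inv (Lambda G) ** transpose (A22 G) ** matrix_inv (Delta2 G)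
         ** transpose (Delta G)
     - Delta G ** Delta2_bracket G ** transpose (Delta G)"

definition N_red ::
  "('n1::finite, 'n2::finite, 'k1::finite, 'k2::finite, 'm1::finite, 'm2::finite) game
    \<Rightarrow> real^'n1^'n1" where
  "N_red G = Q1 G - transpose (A21 G) ** Delta2_bracket G ** A21 G"

definition reduced_solution ::
  "('n1::finite, 'n2::finite, 'k1::finite, 'k2::finite, 'm1::finite, 'm2::finite) game
    \<Rightarrow> real \<Rightarrow> (real \<Rightarrow> real^'n1^'n1) \<Rightarrow> bool" where
  "reduced_solution G T P \<longleftrightarrow>
     (\<forall>t\<in>{0..T}. P t \<in> sym_mats) \<and> P T = 0 \<and>
     (\<forall>t\<in>{0..T}. \<exists>D. (P has_vector_derivative D) (at t within {0..T}) \<and>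
        D + transpose (A_red G) ** P t + P t ** A_red G + P t ** M_red G ** P t + N_red G = 0)"

definition R_set :: "real^'n^'n \<Rightarrow> real^'n^'n \<Rightarrow> real \<Rightarrow> (real^'n^'n) set" where
  "R_set S D2 \<delta> = {P \<in> sym_mats. mat_le (sym_part (S + D2 ** P)) (mat \<delta>)}"

text \<open>Closed ball of the space of symmetric matrices.\<close>

definition sym_cball :: "real \<Rightarrow> (real^'n^'n) set" where
  "sym_cball q = {P \<in> sym_mats. norm P \<le> q}"

definition largest_ball_radius :: "(real^'n^'n) set \<Rightarrow> real \<Rightarrow> bool" where
  "largest_ball_radius R q \<longleftrightarrow>
     0 \<le> q \<and> sym_cball q \<subseteq> R \<and> (\<forall>q'. sym_cball q' \<subseteq> R \<longrightarrow> q' \<le> q)"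

definition h_map ::
  "('n1::finite, 'n2::finite, 'k1::finite, 'k2::finite, 'm1::finite, 'm2::finite) game
    \<Rightarrow> real^'n2^'n2 \<Rightarrow> real^'n1^'n1 \<Rightarrow> real^'n2^'n1" where
  "h_map G P22bar P11 =
     - ((transpose (A21 G) ** P22bar + P11 ** A12 G + P11 ** Delta G ** P22bar)
         ** matrix_inv (A22 G + Delta2 G ** P22bar))"

definition boundary_layer ::
  "('n1::finite, 'n2::finite, 'k1::finite, 'k2::finite, 'm1::finite, 'm2::finite) game
    \<Rightarrow> real^'n2^'n2 \<Rightarrow> (real \<Rightarrow> real^'n2^'n1) \<Rightarrow> (real \<Rightarrow> real^'n2^'n2) \<Rightarrow> bool" where
  "boundary_layer G P22bar Ph12 Ph22 \<longleftrightarrow>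
     Ph12 0 = - h_map G P22bar 0 \<and> Ph22 0 = - P22bar \<and>
     (\<forall>\<tau>\<ge>0.
        (Ph12 has_vector_derivative
           ric_g1 G 0 (Ph12 \<tau> + h_map G P22bar 0) (Ph22 \<tau> + P22bar) 0) (at \<tau> within {0..}) \<and>
        (Ph22 has_vector_derivative
           ric_g2 G 0 (Ph12 \<tau> + h_map G P22bar 0) (Ph22 \<tau> + P22bar) 0) (at \<tau> within {0..}))"

text \<open>The unique solution of the full system is referred to by quantifying over all solutions.
  The boundary layer solution is unique too (its right-hand side is polynomial); its existence on
  all of \<open>\<tau> \<ge> 0\<close> is part of the claim.
  The function \<open>h_map G P22bar (P11bar t)\<close> is the limit of the \<open>P12\<close> component.\<close>

definition tikhonov_threshold ::
  "('n1::finite, 'n2::finite, 'k1::finite, 'k2::finite, 'm1::finite, 'm2::finite) game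
    \<Rightarrow> real \<Rightarrow> (real \<Rightarrow> real^'n1^'n1) \<Rightarrow> real^'n2^'n2 \<Rightarrow> real \<Rightarrow> bool" where
  "tikhonov_threshold G T P11bar P22bar \<epsilon>star \<longleftrightarrow>
     0 < \<epsilon>star \<and> \<epsilon>star \<le> 1 \<and>
     (\<forall>\<epsilon>. 0 < \<epsilon> \<and> \<epsilon> < \<epsilon>star \<longrightarrow>
        (\<exists>P. full_solution G T \<epsilon> P) \<and>
        (\<forall>P11 P12 P22 R11 R12 R22.
           full_solution G T \<epsilon> (P11, P12, P22) \<and> full_solution G T \<epsilon> (R11, R12, R22) \<longrightarrow>
           (\<forall>t\<in>{0..T}. P11 t = R11 t \<and> P12 t = R12 t \<and> P22 t = R22 t))) \<and>
     (\<exists>Ph12 Ph22. boundary_layer G P22bar Ph12 Ph22 \<and>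
        (\<exists>C. \<forall>\<epsilon> P11 P12 P22.
           0 < \<epsilon> \<and> \<epsilon> < \<epsilon>star \<and> full_solution G T \<epsilon> (P11, P12, P22) \<longrightarrow>
           (\<forall>t\<in>{0..T}.
              norm (P11 t - P11bar t) \<le> C * \<epsilon> \<and>
              norm (P12 t - h_map G P22bar (P11bar t) - Ph12 ((T - t) / \<epsilon>)) \<le> C * \<epsilon> \<and>
              norm (P22 t - P22bar - Ph22 ((T - t) / \<epsilon>)) \<le> C * \<epsilon>)))"

text \<open>The increments over \<open>[s,t]\<close> have law \<open>N(0, (t-s) I)\<close>: independent coordinates,
  each normal with standard deviation \<open>sqrt (t - s)\<close>.\<close>

definition brownian_motion :: "'w measure \<Rightarrow> real \<Rightarrow> (real \<Rightarrow> 'w \<Rightarrow> real^'m) \<Rightarrow> bool" where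
  "brownian_motion M T W \<longleftrightarrow>
     (\<forall>t\<in>{0..T}. W t \<in> borel_measurable M) \<and>
     (AE \<omega> in M. W 0 \<omega> = 0) \<and>
     (AE \<omega> in M. continuous_on {0..T} (\<lambda>t. W t \<omega>)) \<and>
     (\<forall>n (ts :: nat \<Rightarrow> real). 0 \<le> ts 0 \<and> (\<forall>i<n. ts i \<le> ts (Suc i)) \<and> ts n \<le> T \<longrightarrow>
        prob_space.indep_vars M (\<lambda>_. borel) (\<lambda>i \<omega>. W (ts (Suc i)) \<omega> - W (ts i) \<omega>) {..<n}) \<and>
     (\<forall>s t. 0 \<le> s \<and> s < t \<and> t \<le> T \<longrightarrow>
        prob_space.indep_vars M (\<lambda>_. borel) (\<lambda>j \<omega>. W t \<omega> $ j - W s \<omega> $ j) UNIV \<and>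
        (\<forall>j. distributed M lborel (\<lambda>\<omega>. W t \<omega> $ j - W s \<omega> $ j)
               (normal_density 0 (sqrt (t - s)))))"

definition path_events ::
  "'w measure \<Rightarrow> (real \<Rightarrow> 'w \<Rightarrow> real^'m) \<Rightarrow> real set \<Rightarrow> 'w set set" where
  "path_events M W I = {W s -` B \<inter> space M | s B. s \<in> I \<and> B \<in> sets borel}"

definition independent_processes ::
  "'w measure \<Rightarrow> real \<Rightarrow> (real \<Rightarrow> 'w \<Rightarrow> real^'m1) \<Rightarrow> (real \<Rightarrow> 'w \<Rightarrow> real^'m2) \<Rightarrow> bool" where
  "independent_processes M T W1 W2 \<longleftrightarrow>
     prob_space.indep_set M
       (sigma_sets (space M) (path_events M W1 {0..T}))
       (sigma_sets (space M) (path_events M W2 {0..T}))"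

definition aug_filtration ::
  "'w measure \<Rightarrow> (real \<Rightarrow> 'w \<Rightarrow> real^'m1) \<Rightarrow> (real \<Rightarrow> 'w \<Rightarrow> real^'m2) \<Rightarrow> real \<Rightarrow> 'w measure"
  where
  "aug_filtration M W1 W2 t =
     sigma (space M) (path_events M W1 {0..t} \<union> path_events M W2 {0..t} \<union> null_sets M)"

definition predictable_sigma :: "'w set \<Rightarrow> real \<Rightarrow> (real \<Rightarrow> 'w measure) \<Rightarrow> (real \<times> 'w) measure" where
  "predictable_sigma \<Omega> T F =
     sigma ({0..T} \<times> \<Omega>)
       ({{0} \<times> A | A. A \<in> sets (F 0)} \<union>
        {{s<..t} \<times> A | s t A. 0 \<le> s \<and> s < t \<and> t \<le> T \<and> A \<in> sets (F s)})"

definition admissible ::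
  "'w measure \<Rightarrow> real \<Rightarrow> (real \<Rightarrow> 'w \<Rightarrow> real^'m1) \<Rightarrow> (real \<Rightarrow> 'w \<Rightarrow> real^'m2)
    \<Rightarrow> (real \<Rightarrow> 'w \<Rightarrow> real^'k) \<Rightarrow> bool" where
  "admissible M T W1 W2 u \<longleftrightarrow>
     (\<lambda>(t, \<omega>). u t \<omega>) \<in>
       borel_measurable (predictable_sigma (space M) T (aug_filtration M W1 W2)) \<and>
     integrable (restrict_space lborel {0..T} \<Otimes>\<^sub>M M) (\<lambda>(t, \<omega>). (norm (u t \<omega>))\<^sup>2)"

text \<open>The diffusion coefficients are constant matrices and \<open>W\<^sub>i(0) = 0\<close>, so the stochastic integral
  of \<open>\<sigma>\<^sub>i\<close> over \<open>[0,t]\<close> is \<open>\<sigma>\<^sub>i W\<^sub>i(t)\<close>. All paths of the state are required to be continuous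
  (no loss, since null sets belong to the filtration at time 0), so that feedback controls are
  predictable.\<close>

definition is_state ::
  "('n1::finite, 'n2::finite, 'k1::finite, 'k2::finite, 'm1::finite, 'm2::finite) game
    \<Rightarrow> 'w measure \<Rightarrow> real \<Rightarrow> (real \<Rightarrow> 'w \<Rightarrow> real^'m1) \<Rightarrow> (real \<Rightarrow> 'w \<Rightarrow> real^'m2)
    \<Rightarrow> real \<Rightarrow> real^'n1 \<Rightarrow> real^'n2
    \<Rightarrow> (real \<Rightarrow> 'w \<Rightarrow> real^'k1) \<Rightarrow> (real \<Rightarrow> 'w \<Rightarrow> real^'k2)
    \<Rightarrow> (real \<Rightarrow> 'w \<Rightarrow> real^'n1) \<times> (real \<Rightarrow> 'w \<Rightarrow> real^'n2) \<Rightarrow> bool" where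
  "is_state G M T W1 W2 \<epsilon> x1 x2 u1 u2 = (\<lambda>(X1, X2).
     (\<forall>t\<in>{0..T}. X1 t \<in> borel_measurable (aug_filtration M W1 W2 t) \<and>
                  X2 t \<in> borel_measurable (aug_filtration M W1 W2 t)) \<and>
     (\<forall>\<omega>\<in>space M. continuous_on {0..T} (\<lambda>t. X1 t \<omega>) \<and> continuous_on {0..T} (\<lambda>t. X2 t \<omega>)) \<and>
     (AE \<omega> in M. \<forall>t\<in>{0..T}.
        X1 t \<omega> = x1
          + (LINT s:{0..t}|lborel. A11 G *v X1 s \<omega> + A12 G *v X2 s \<omega>
                                   + B11 G *v u1 s \<omega> + B12 G *v u2 s \<omega>)
          + sigma1 G *v W1 t \<omega> \<and>
        X2 t \<omega> = x2
          + (1 / \<epsilon>) *\<^sub>R (LINT s:{0..t}|lborel. A21 G *v X1 s \<omega> + A22 G *v X2 s \<omega>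
                                   + B21 G *v u1 s \<omega> + B22 G *v u2 s \<omega>)
          + (1 / sqrt \<epsilon>) *\<^sub>R (sigma2 G *v W2 t \<omega>)))"

text \<open>For admissible controls the state is unique up to indistinguishability, so the cost does
  not depend on the version that is chosen here.\<close>

definition state_process ::
  "('n1::finite, 'n2::finite, 'k1::finite, 'k2::finite, 'm1::finite, 'm2::finite) game
    \<Rightarrow> 'w measure \<Rightarrow> real \<Rightarrow> (real \<Rightarrow> 'w \<Rightarrow> real^'m1) \<Rightarrow> (real \<Rightarrow> 'w \<Rightarrow> real^'m2)
    \<Rightarrow> real \<Rightarrow> real^'n1 \<Rightarrow> real^'n2
    \<Rightarrow> (real \<Rightarrow> 'w \<Rightarrow> real^'k1) \<Rightarrow> (real \<Rightarrow> 'w \<Rightarrow> real^'k2)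
    \<Rightarrow> (real \<Rightarrow> 'w \<Rightarrow> real^'n1) \<times> (real \<Rightarrow> 'w \<Rightarrow> real^'n2)" where
  "state_process G M T W1 W2 \<epsilon> x1 x2 u1 u2 = (SOME X. is_state G M T W1 W2 \<epsilon> x1 x2 u1 u2 X)"

definition cost_J ::
  "('n1::finite, 'n2::finite, 'k1::finite, 'k2::finite, 'm1::finite, 'm2::finite) game
    \<Rightarrow> 'w measure \<Rightarrow> real \<Rightarrow> (real \<Rightarrow> 'w \<Rightarrow> real^'m1) \<Rightarrow> (real \<Rightarrow> 'w \<Rightarrow> real^'m2)
    \<Rightarrow> real \<Rightarrow> real^'n1 \<Rightarrow> real^'n2
    \<Rightarrow> (real \<Rightarrow> 'w \<Rightarrow> real^'k1) \<Rightarrow> (real \<Rightarrow> 'w \<Rightarrow> real^'k2) \<Rightarrow> real" where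
  "cost_J G M T W1 W2 \<epsilon> x1 x2 u1 u2 =
     (let (X1, X2) = state_process G M T W1 W2 \<epsilon> x1 x2 u1 u2 in
      1/2 * (LINT \<omega>|M. (LINT t:{0..T}|lborel.
        (Q1 G *v X1 t \<omega>) \<bullet> X1 t \<omega> + (Q2 G *v X2 t \<omega>) \<bullet> X2 t \<omega>
        - (norm (u1 t \<omega>))\<^sup>2 + (norm (u2 t \<omega>))\<^sup>2)))"

definition feedback1 ::
  "('n1::finite, 'n2::finite, 'k1::finite, 'k2::finite, 'm1::finite, 'm2::finite) game
    \<Rightarrow> real \<Rightarrow> ('n1, 'n2) riccati_triple
    \<Rightarrow> (real \<Rightarrow> 'w \<Rightarrow> real^'n1) \<times> (real \<Rightarrow> 'w \<Rightarrow> real^'n2) \<Rightarrow> real \<Rightarrow> 'w \<Rightarrow> real^'k1" where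
  "feedback1 G \<epsilon> = (\<lambda>(P11, P12, P22) (X1, X2) t \<omega>.
     (transpose (B11 G) ** P11 t + transpose (B21 G) ** transpose (P12 t)) *v X1 t \<omega>
     + (\<epsilon> *\<^sub>R (transpose (B11 G) ** P12 t) + transpose (B21 G) ** P22 t) *v X2 t \<omega>)"

definition feedback2 ::
  "('n1::finite, 'n2::finite, 'k1::finite, 'k2::finite, 'm1::finite, 'm2::finite) game
    \<Rightarrow> real \<Rightarrow> ('n1, 'n2) riccati_triple
    \<Rightarrow> (real \<Rightarrow> 'w \<Rightarrow> real^'n1) \<times> (real \<Rightarrow> 'w \<Rightarrow> real^'n2) \<Rightarrow> real \<Rightarrow> 'w \<Rightarrow> real^'k2" where
  "feedback2 G \<epsilon> = (\<lambda>(P11, P12, P22) (X1, X2) t \<omega>.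
     - ((transpose (B12 G) ** P11 t + transpose (B22 G) ** transpose (P12 t)) *v X1 t \<omega>)
     - (\<epsilon> *\<^sub>R (transpose (B12 G) ** P12 t) + transpose (B22 G) ** P22 t) *v X2 t \<omega>)"

definition closed_loop_state ::
  "('n1::finite, 'n2::finite, 'k1::finite, 'k2::finite, 'm1::finite, 'm2::finite) game
    \<Rightarrow> 'w measure \<Rightarrow> real \<Rightarrow> (real \<Rightarrow> 'w \<Rightarrow> real^'m1) \<Rightarrow> (real \<Rightarrow> 'w \<Rightarrow> real^'m2)
    \<Rightarrow> real \<Rightarrow> real^'n1 \<Rightarrow> real^'n2 \<Rightarrow> ('n1, 'n2) riccati_triple
    \<Rightarrow> (real \<Rightarrow> 'w \<Rightarrow> real^'n1) \<times> (real \<Rightarrow> 'w \<Rightarrow> real^'n2) \<Rightarrow> bool" where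
  "closed_loop_state G M T W1 W2 \<epsilon> x1 x2 P X \<longleftrightarrow>
     admissible M T W1 W2 (feedback1 G \<epsilon> P X) \<and> admissible M T W1 W2 (feedback2 G \<epsilon> P X) \<and>
     is_state G M T W1 W2 \<epsilon> x1 x2 (feedback1 G \<epsilon> P X) (feedback2 G \<epsilon> P X) X"

definition V_bar ::
  "('n1::finite, 'n2::finite, 'k1::finite, 'k2::finite, 'm1::finite, 'm2::finite) game
    \<Rightarrow> real \<Rightarrow> (real \<Rightarrow> real^'n1^'n1) \<Rightarrow> real^'n2^'n2 \<Rightarrow> real^'n1 \<Rightarrow> real^'n2 \<Rightarrow> real" where
  "V_bar G T P11bar P22bar x1 x2 =
     1/2 * ((P11bar 0 *v x1) \<bullet> x1)
     + 1/2 * (LINT t:{0..T}|lborel. (P11bar t ** sigma1 G) \<bullet> sigma1 G)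
     + T/2 * ((P22bar ** sigma2 G) \<bullet> sigma2 G)"

end

theory Submission
  imports Defs
begin

text \<open>In reversed time, subtract from the Riccati triple the composite approximation: the reduced
  solution plus the boundary layer. The ball condition keeps the layer in a region where the
  deviation from the algebraic solution decays at rate \<open>\<gamma> - \<delta>\<close>. As long as the triple stays in
  a fixed tube around the composite approximation, the fast components are dissipative up to an exponentially decaying
  coefficient, and a Gronwall argument for the slow one makes the error \<open>O(\<epsilon>)\<close>; for small \<open>\<epsilon>\<close> this is
  stronger than the tube condition, so the solution extends to the whole interval.

  No stochastic calculus is needed for the cost. The closed loop is linear with additive noise, so
  the state is obtained path by path, and Fubini's theorem together with the covariance of the
  Brownian motions gives a linear differential equation for its second moments. The cost is a linear
  functional of these moments, and the full Riccati system is the adjoint equation that evaluates it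
  as \<open>P\<^sub>i\<^sub>j(0)\<close> applied to the initial state plus the integrated trace terms. In the difference to the
  limit value, the boundary layer contributes only \<open>\<integral>exp(- \<beta> (T - t) / \<epsilon>) dt = O(\<epsilon>)\<close>.\<close>

section \<open>Ordinary differential equations\<close>

text \<open>The fast components start far from equilibrium, where the damping coming from
  \<open>S\<close> need not dominate the quadratic terms. There the growth rate may be positive of
  size 1 / \<epsilon>, but only for a time of order \<epsilon>, so its time integral is a constant:
  the estimates pick up factors such as exp(c / \<beta>) that do not depend on \<epsilon>. Slow and
  fast errors are coupled, and a term of size exp(- \<beta> s / \<epsilon>) drives the slow one. The
  energy |p|^2 + \<epsilon> |q|^2 absorbs the coupling and gives the right order for p, but leaves q
  of order sqrt \<epsilon>; a second use of the damping then restores order \<epsilon>. The layer is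
  computed with the slow variable frozen at its initial value 0. The mismatch is of size s exp(-
  \<beta> s / \<epsilon>), again O(\<epsilon>), because the reduced solution leaves 0 at bounded
  speed. In the moment equations the place of Ito's formula is taken by splitting the state into a
  part with differentiable paths, which obeys the ordinary product rule, and the noise, whose
  covariance grows linearly in time.\<close>

text \<open>Differentiability is demanded only where \<open>D\<close> is positive, which makes the
  criterion usable for norms although they are not differentiable at 0. After the last time
  \<open>s0\<close> before \<open>t\<close> with \<open>D s0 \<le> 0\<close>, the function D exp(- L
  s) is nonincreasing, so it cannot become positive.\<close>

lemma barrier:
  fixes D :: "real \<Rightarrow> real"
  assumes cont: "continuous_on {0..T} D" and D0: "D 0 \<le> 0"
    and der: "\<And>t. 0 < t \<Longrightarrow> t < T \<Longrightarrow> D t > 0 \<Longrightarrow> \<exists>d. DERIV D t :> d \<and> d \<le> L * D t"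
    and t: "t \<in> {0..T}"
  shows "D t \<le> 0"
proof (rule ccontr)
  assume "\<not> D t \<le> 0"
  then have Dt: "D t > 0" by simp
  define K where "K = {s \<in> {0..t}. D s \<le> 0}"
  have "closed ({0..t} \<inter> D -` {..0})"
    by (rule continuous_closed_preimage[OF continuous_on_subset[OF cont]]) (use t in auto)
  moreover have "K = {0..t} \<inter> D -` {..0}" by (auto simp: K_def)
  ultimately have clK: "closed K" by simp
  have K0: "0 \<in> K" using D0 t by (auto simp: K_def)
  have bdd: "bdd_above K" by (rule bdd_aboveI[of _ t]) (auto simp: K_def)
  define s0 where "s0 = Sup K"
  have s0K: "s0 \<in> K" unfolding s0_def
    using closed_contains_Sup[of K] K0 bdd clK by auto
  then have s0: "0 \<le> s0" "s0 \<le> t" "D s0 \<le> 0" by (auto simp: K_def)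
  have pos: "D s > 0" if "s0 < s" "s \<le> t" for s
  proof (rule ccontr)
    assume "\<not> D s > 0"
    then have "s \<in> K" using that s0 by (auto simp: K_def)
    then have "s \<le> s0" unfolding s0_def using bdd by (rule cSup_upper)
    with that show False by simp
  qed
  have s0t: "s0 < t" using s0 Dt by (cases "s0 = t") auto
  define E where "E s = D s * exp (- L * s)" for s
  have "E t \<le> E s0"
  proof (rule DERIV_nonpos_imp_decreasing_open[OF less_imp_le[OF s0t]])
    fix s assume s: "s0 < s" "s < t"
    then have "0 < s" "s < T" "D s > 0" using s0 t pos by auto
    from der[OF this] obtain d where d: "DERIV D s :> d" "d \<le> L * D s" by auto
    have "DERIV E s :> d * exp (- L * s) + D s * (exp (- L * s) * (- L))"
      unfolding E_def by (auto intro!: derivative_eq_intros d(1))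
    moreover have "d * exp (- L * s) + D s * (exp (- L * s) * (- L)) = (d - L * D s) * exp (- L * s)"
      by (simp add: algebra_simps)
    moreover have "\<dots> \<le> 0" using d(2) by (simp add: mult_le_0_iff)
    ultimately show "\<exists>y. DERIV E s :> y \<and> y \<le> 0" by auto
  next
    show "continuous_on {s0..t} E" unfolding E_def
      using cont s0 t by (auto intro!: continuous_intros intro: continuous_on_subset)
  qed
  moreover have "E s0 \<le> 0" using s0(3) by (simp add: E_def mult_le_0_iff)
  moreover have "E t > 0" using Dt by (simp add: E_def)
  ultimately show False by simp
qed

lemma has_vector_derivative_continuous_on:
  assumes "\<And>t. t \<in> A \<Longrightarrow> (y has_vector_derivative y' t) (at t within A)"
  shows "continuous_on A y"
  by (rule continuous_on_eq_continuous_within[THEN iffD2], rule ballI,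
      rule has_vector_derivative_continuous, rule assms)

text \<open>The inner product \<open>y t \<bullet> y' t\<close> is the norm times its derivative, so
  dissipativity can be inserted without dividing by the norm. The inequality is needed only where
  the norm exceeds \<open>u\<close>, and the term with \<open>L\<close> is slack: an error
  proportional to the excess over \<open>u\<close> is harmless.\<close>

lemma norm_comparison:
  fixes y :: "real \<Rightarrow> 'a::real_inner"
  assumes y: "\<And>t. t \<in> {0..T} \<Longrightarrow> (y has_vector_derivative y' t) (at t within {0..T})"
    and u: "\<And>t. t \<in> {0..T} \<Longrightarrow> (u has_real_derivative u' t) (at t within {0..T})"
    and init: "norm (y 0) \<le> u 0" and u_nonneg: "\<And>t. t \<in> {0..T} \<Longrightarrow> 0 \<le> u t"
    and ineq: "\<And>t. t \<in> {0..T} \<Longrightarrow> norm (y t) > u t \<Longrightarrow>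
      y t \<bullet> y' t \<le> (u' t + L * (norm (y t) - u t)) * norm (y t)"
    and t: "t \<in> {0..T}"
  shows "norm (y t) \<le> u t"
proof -
  have "norm (y t) - u t \<le> 0"
  proof (rule barrier[where D = "\<lambda>t. norm (y t) - u t" and L = L, OF _ _ _ t])
    show "continuous_on {0..T} (\<lambda>t. norm (y t) - u t)"
      using y u by (intro continuous_intros has_vector_derivative_continuous_on DERIV_continuous_on)
        (auto)
    show "norm (y 0) - u 0 \<le> 0" using init by simp
    fix s assume s: "0 < s" "s < T" "norm (y s) - u s > 0"
    then have ny: "norm (y s) > 0" using u_nonneg[of s] by auto
    have ys: "(y has_vector_derivative y' s) (at s)" using y[of s] s by (simp add: at_within_Icc_at)
    have us: "DERIV u s :> u' s" using u[of s] s by (simp add: at_within_Icc_at)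
    have "(norm has_derivative (\<lambda>h. h \<bullet> sgn (y s))) (at (y s))"
      using ny has_derivative_norm[of "y s"] by auto
    from has_derivative_compose[OF ys[unfolded has_vector_derivative_def] this]
    have "((\<lambda>s. norm (y s)) has_real_derivative (y' s \<bullet> sgn (y s))) (at s)"
      by (simp add: has_field_derivative_def mult.commute[of _ "_ \<bullet> _"])
    then have "((\<lambda>t. norm (y t) - u t) has_real_derivative (y' s \<bullet> sgn (y s) - u' s)) (at s)"
      using us by (rule DERIV_diff)
    moreover have "y' s \<bullet> sgn (y s) - u' s \<le> L * (norm (y s) - u s)"
    proof -
      have "y' s \<bullet> sgn (y s) = (y s \<bullet> y' s) / norm (y s)"
        by (simp add: sgn_div_norm inner_commute divide_inverse mult.commute)
      also have "\<dots> \<le> u' s + L * (norm (y s) - u s)"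
        using ineq[of s] s ny by (simp add: pos_divide_le_eq)
      finally show ?thesis by simp
    qed
    ultimately show "\<exists>d. ((\<lambda>t. norm (y t) - u t) has_real_derivative d) (at s) \<and>
        d \<le> L * (norm (y s) - u s)" by blast
  qed
  then show ?thesis by simp
qed

lemma ode_unique:
  fixes y z :: "real \<Rightarrow> 'a::real_inner"
  assumes y: "\<And>t. t \<in> {0..T} \<Longrightarrow> (y has_vector_derivative y' t) (at t within {0..T})"
    and z: "\<And>t. t \<in> {0..T} \<Longrightarrow> (z has_vector_derivative z' t) (at t within {0..T})"
    and init: "y 0 = z 0"
    and lip: "\<And>t. t \<in> {0..T} \<Longrightarrow> norm (y' t - z' t) \<le> L * norm (y t - z t)"
    and t: "t \<in> {0..T}"
  shows "y t = z t"
proof -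
  have "norm (y t - z t) \<le> 0"
  proof (rule norm_comparison[where y = "\<lambda>t. y t - z t" and L = L and u' = "\<lambda>_. 0", OF _ _ _ _ _ t])
    fix s assume s: "s \<in> {0..T}"
    show "((\<lambda>t. y t - z t) has_vector_derivative (y' s - z' s)) (at s within {0..T})"
      using y[OF s] z[OF s] by (rule has_vector_derivative_diff)
    have "(y s - z s) \<bullet> (y' s - z' s) \<le> norm (y s - z s) * norm (y' s - z' s)"
      by (rule norm_cauchy_schwarz)
    also have "\<dots> \<le> norm (y s - z s) * (L * norm (y s - z s))"
      using lip[OF s] by (intro mult_left_mono) auto
    finally show "(y s - z s) \<bullet> (y' s - z' s)
        \<le> (0 + L * (norm (y s - z s) - 0)) * norm (y s - z s)"
      by (simp add: algebra_simps)
  qed (use init in auto)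
  then show ?thesis by simp
qed

section \<open>Picard iteration for globally Lipschitz fields\<close>

fun picard :: "(real \<Rightarrow> 'a \<Rightarrow> 'a) \<Rightarrow> 'a \<Rightarrow> nat \<Rightarrow> real \<Rightarrow> 'a::banach" where
  "picard F y0 0 t = y0"
| "picard F y0 (Suc n) t = y0 + integral {0..t} (\<lambda>s. F s (picard F y0 n s))"

lemma continuous_on_field_comp:
  assumes "continuous_on (A \<times> UNIV) (\<lambda>(t, x). F t x)" "continuous_on A y"
  shows "continuous_on A (\<lambda>t. F t (y t))"
proof -
  have "continuous_on A ((\<lambda>(t, x). F t x) \<circ> (\<lambda>t. (t, y t)))"
    by (rule continuous_on_compose) (use assms in \<open>auto intro!: continuous_intros intro: continuous_on_subset\<close>)
  then show ?thesis by (simp add: o_def)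
qed

lemma continuous_on_picard:
  assumes "continuous_on ({0..T} \<times> UNIV) (\<lambda>(t, x). F t x)"
  shows "continuous_on {0..T} (picard F y0 n)"
proof (induction n)
  case 0
  show ?case by simp
next
  case (Suc n)
  have "continuous_on {0..T} (\<lambda>t. y0 + integral {0..t} (\<lambda>s. F s (picard F y0 n s)))"
    by (rule continuous_on_add[OF continuous_on_const indefinite_integral_continuous_1[OF
          integrable_continuous_real[OF continuous_on_field_comp[OF assms Suc]]]])
  then show ?case by simp
qed

text \<open>Integrating the Lipschitz estimate turns (L s)^n / n! into the next term of the
  exponential series, which later serves as the summable majorant.\<close>

lemma picard_step_bound:
  assumes cont: "continuous_on ({0..T} \<times> UNIV) (\<lambda>(t, x). F t x)"
    and lip: "\<And>t. t \<in> {0..T} \<Longrightarrow> L-lipschitz_on UNIV (F t)"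
    and B: "\<And>t. t \<in> {0..T} \<Longrightarrow> norm (picard F y0 1 t - y0) \<le> B"
    and t: "t \<in> {0..T}"
  shows "norm (picard F y0 (Suc n) t - picard F y0 n t) \<le> B * ((L * t) ^ n / fact n)"
  using t
proof (induction n arbitrary: t)
  case 0
  then show ?case using B[of t] by simp
next
  case (Suc n)
  let ?p = "picard F y0"
  have L: "L \<ge> 0" using lip Suc.prems lipschitz_on_nonneg by blast
  have ci: "(\<lambda>s. F s (?p m s)) integrable_on {0..t}" for m
    by (rule integrable_continuous_real,
        rule continuous_on_subset[OF continuous_on_field_comp[OF cont continuous_on_picard[OF cont]]])
      (use Suc.prems in auto)
  have fact_int: "((\<lambda>s. L * (B * ((L * s) ^ n / fact n))) has_integral
      (B * ((L * t) ^ Suc n / fact (Suc n)) - B * ((L * 0) ^ Suc n / fact (Suc n)))) {0..t}"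
  proof (rule fundamental_theorem_of_calculus)
    show "0 \<le> t" using Suc.prems by auto
    fix s assume "s \<in> {0..t}"
    have "((\<lambda>s. B * ((L * s) ^ Suc n / fact (Suc n))) has_real_derivative
        B * ((real (Suc n) * (L * s) ^ n * L) / fact (Suc n))) (at s within {0..t})"
      by (rule derivative_eq_intros refl | simp)+
    moreover have "B * ((real (Suc n) * (L * s) ^ n * L) / fact (Suc n)) = L * (B * ((L * s) ^ n / fact n))"
      unfolding fact_Suc by (simp del: of_nat_Suc)
    ultimately show "((\<lambda>s. B * ((L * s) ^ Suc n / fact (Suc n))) has_vector_derivative
        L * (B * ((L * s) ^ n / fact n))) (at s within {0..t})"
      by (simp only: has_real_derivative_iff_has_vector_derivative)
  qed
  have "norm (?p (Suc (Suc n)) t - ?p (Suc n) t)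
      = norm (integral {0..t} (\<lambda>s. F s (?p (Suc n) s) - F s (?p n s)))"
    using integral_diff[OF ci[of "Suc n"] ci[of n]] by simp
  also have "\<dots> \<le> integral {0..t} (\<lambda>s. L * (B * ((L * s) ^ n / fact n)))"
  proof (rule integral_norm_bound_integral)
    show "(\<lambda>s. F s (?p (Suc n) s) - F s (?p n s)) integrable_on {0..t}"
      by (intro integrable_diff ci)
    show "(\<lambda>s. L * (B * ((L * s) ^ n / fact n))) integrable_on {0..t}"
      using fact_int by (rule has_integral_integrable)
    fix s assume s: "s \<in> {0..t}"
    then have s': "s \<in> {0..T}" using Suc.prems by auto
    have "norm (F s (?p (Suc n) s) - F s (?p n s)) \<le> L * norm (?p (Suc n) s - ?p n s)"
      using lipschitz_on_normD[OF lip[OF s']] by auto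
    also have "\<dots> \<le> L * (B * ((L * s) ^ n / fact n))"
      using Suc.IH[OF s'] L by (rule mult_left_mono)
    finally show "norm (F s (?p (Suc n) s) - F s (?p n s)) \<le> L * (B * ((L * s) ^ n / fact n))" .
  qed
  also have "\<dots> = B * ((L * t) ^ Suc n / fact (Suc n))"
    using integral_unique[OF fact_int] by simp
  finally show ?case .
qed

lemma picard_uniform_limit:
  fixes F :: "real \<Rightarrow> 'a \<Rightarrow> 'a::banach"
  assumes cont: "continuous_on ({0..T} \<times> UNIV) (\<lambda>(t, x). F t x)"
    and lip: "\<And>t. t \<in> {0..T} \<Longrightarrow> L-lipschitz_on UNIV (F t)"
    and T: "T \<ge> 0"
  shows "\<exists>y. uniform_limit {0..T} (picard F y0) y sequentially"
proof -
  let ?p = "picard F y0"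
  have L: "L \<ge> 0" using lip[of 0] T lipschitz_on_nonneg by auto
  have "compact ((\<lambda>t. ?p 1 t - y0) ` {0..T})"
    by (rule compact_continuous_image[OF continuous_on_diff[OF continuous_on_picard[OF cont] continuous_on_const]])
      simp
  then have "bounded ((\<lambda>t. ?p 1 t - y0) ` {0..T})" by (rule compact_imp_bounded)
  then obtain B where B: "\<And>t. t \<in> {0..T} \<Longrightarrow> norm (?p 1 t - y0) \<le> B"
    unfolding bounded_iff by (metis imageI)
  have B0: "B \<ge> 0" using order_trans[OF norm_ge_zero B[of 0]] T by auto
  have "uniform_limit {0..T} (\<lambda>n t. \<Sum>i<n. ?p (Suc i) t - ?p i t) (\<lambda>t. \<Sum>i. ?p (Suc i) t - ?p i t) sequentially"
  proof (rule Weierstrass_m_test)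
    fix n t assume t: "t \<in> {0..T}"
    have "norm (?p (Suc n) t - ?p n t) \<le> B * ((L * t) ^ n / fact n)"
      by (rule picard_step_bound[OF cont lip B t])
    also have "\<dots> \<le> B * ((L * T) ^ n / fact n)"
      using t L B0 by (intro mult_left_mono divide_right_mono power_mono) auto
    finally show "norm (?p (Suc n) t - ?p n t) \<le> B * ((L * T) ^ n / fact n)" .
  next
    show "summable (\<lambda>n. B * ((L * T) ^ n / fact n))"
      using summable_exp_generic[of "L * T"] by (intro summable_mult) (simp add: divide_inverse mult.commute)
  qed
  moreover have "(\<Sum>i<n. ?p (Suc i) t - ?p i t) = ?p n t - y0" for n t
    by (induction n) (auto simp: algebra_simps)
  ultimately have "uniform_limit {0..T} (\<lambda>n t. ?p n t - y0) (\<lambda>t. \<Sum>i. ?p (Suc i) t - ?p i t) sequentially"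
    by simp
  then have "uniform_limit {0..T} (\<lambda>n t. y0 + (?p n t - y0))
      (\<lambda>t. y0 + (\<Sum>i. ?p (Suc i) t - ?p i t)) sequentially"
    by (intro uniform_limit_intros)
  then have "uniform_limit {0..T} ?p (\<lambda>t. y0 + (\<Sum>i. ?p (Suc i) t - ?p i t)) sequentially"
    by simp
  then show ?thesis by blast
qed

text \<open>The convergence of the iterates is exported together with the solution, because
  measurability of a solution depending on a random parameter is inherited from the
  iterates.\<close>

lemma picard_solution:
  fixes F :: "real \<Rightarrow> 'a \<Rightarrow> 'a::banach"
  assumes cont: "continuous_on ({0..T} \<times> UNIV) (\<lambda>(t, x). F t x)"
    and lip: "\<And>t. t \<in> {0..T} \<Longrightarrow> L-lipschitz_on UNIV (F t)"
    and T: "T \<ge> 0"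
  shows "\<exists>y. y 0 = y0 \<and> continuous_on {0..T} y \<and>
    (\<forall>t\<in>{0..T}. y t = y0 + integral {0..t} (\<lambda>s. F s (y s))) \<and>
    (\<forall>t\<in>{0..T}. (y has_vector_derivative F t (y t)) (at t within {0..T})) \<and>
    (\<forall>t\<in>{0..T}. (\<lambda>n. picard F y0 n t) \<longlonglongrightarrow> y t)"
proof -
  let ?p = "picard F y0"
  have L: "L \<ge> 0" using lip[of 0] T lipschitz_on_nonneg by auto
  obtain y where y: "uniform_limit {0..T} ?p y sequentially"
    using picard_uniform_limit[OF assms] by auto
  have conty: "continuous_on {0..T} y"
    by (rule uniform_limit_theorem[OF _ y]) (auto intro!: always_eventually continuous_on_picard[OF cont])
  have lim: "(\<lambda>n. ?p n t) \<longlonglongrightarrow> y t" if "t \<in> {0..T}" for t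
    using tendsto_uniform_limitI[OF y that] .
  have Flim: "uniform_limit {0..T} (\<lambda>n t. F t (?p n t)) (\<lambda>t. F t (y t)) sequentially"
  proof (rule uniform_limitI)
    fix e :: real assume e: "e > 0"
    have "\<forall>\<^sub>F n in sequentially. \<forall>t\<in>{0..T}. dist (?p n t) (y t) < e / (L + 1)"
      using uniform_limitD[OF y, of "e / (L + 1)"] e L by auto
    then show "\<forall>\<^sub>F n in sequentially. \<forall>t\<in>{0..T}. dist (F t (?p n t)) (F t (y t)) < e"
    proof eventually_elim
      case (elim n)
      show ?case
      proof
        fix t assume t: "t \<in> {0..T}"
        have "dist (F t (?p n t)) (F t (y t)) \<le> L * dist (?p n t) (y t)"
          using lipschitz_onD[OF lip[OF t]] by auto
        also have "\<dots> \<le> (L + 1) * dist (?p n t) (y t)" by (intro mult_right_mono) auto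
        also have "\<dots> < (L + 1) * (e / (L + 1))" using elim t L by (intro mult_strict_left_mono) auto
        also have "\<dots> = e" using L by auto
        finally show "dist (F t (?p n t)) (F t (y t)) < e" .
      qed
    qed
  qed
  have eq: "y t = y0 + integral {0..t} (\<lambda>s. F s (y s))" if t: "t \<in> {0..T}" for t
  proof -
    have cF: "continuous_on {0..t} (\<lambda>s. F s (?p n s))" for n
      by (rule continuous_on_subset[OF continuous_on_field_comp[OF cont continuous_on_picard[OF cont]]])
        (use t in auto)
    have u: "uniform_limit {0..t} (\<lambda>n s. F s (?p n s)) (\<lambda>s. F s (y s)) sequentially"
      by (rule uniform_limit_on_subset[OF Flim]) (use t in auto)
    obtain I J where IJ: "\<And>n. ((\<lambda>s. F s (?p n s)) has_integral I n) {0..t}"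
      "((\<lambda>s. F s (y s)) has_integral J) {0..t}" "I \<longlonglongrightarrow> J"
      using uniform_limit_integral[OF u cF] by auto
    have "(\<lambda>n. ?p (Suc n) t) \<longlonglongrightarrow> y0 + J"
      using tendsto_add[OF tendsto_const IJ(3), of y0] integral_unique[OF IJ(1)] by simp
    moreover have "(\<lambda>n. ?p (Suc n) t) \<longlonglongrightarrow> y t"
      using lim[OF t] by (rule LIMSEQ_Suc)
    ultimately have "y t = y0 + J" using LIMSEQ_unique by blast
    then show ?thesis using integral_unique[OF IJ(2)] by simp
  qed
  have der: "(y has_vector_derivative F t (y t)) (at t within {0..T})" if t: "t \<in> {0..T}" for t
  proof -
    have "((\<lambda>t. y0 + integral {0..t} (\<lambda>s. F s (y s))) has_vector_derivative F t (y t)) (at t within {0..T})"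
      using integral_has_vector_derivative[OF continuous_on_field_comp[OF cont conty] t]
      by (auto intro!: derivative_eq_intros)
    then show ?thesis
      by (rule has_vector_derivative_transform[OF t, rotated]) (use eq in auto)
  qed
  have "y 0 = y0" using eq[of 0] T by simp
  then show ?thesis using conty eq der lim by blast
qed

section \<open>Maps that are Lipschitz on bounded sets\<close>

text \<open>Riccati right-hand sides are quadratic, hence Lipschitz on balls but not globally. This
  class is closed under sums, bilinear products and bounded linear maps, so membership of every
  matrix polynomial follows by introduction rules.\<close>

definition lip_bdd :: "('a::real_normed_vector \<Rightarrow> 'b::real_normed_vector) \<Rightarrow> bool" where
  "lip_bdd f \<longleftrightarrow> (\<forall>R. \<exists>L. L-lipschitz_on (cball 0 R) f)"

lemma lip_bddD:
  assumes "lip_bdd f"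
  obtains L where "L \<ge> 0" "\<And>x y. norm x \<le> R \<Longrightarrow> norm y \<le> R \<Longrightarrow> norm (f x - f y) \<le> L * norm (x - y)"
proof -
  obtain L where L: "L-lipschitz_on (cball 0 R) f" using assms unfolding lip_bdd_def by blast
  show ?thesis
    by (rule that[OF lipschitz_on_nonneg[OF L]]) (use lipschitz_on_normD[OF L] in auto)
qed

lemma lip_bddI:
  assumes "\<And>R. R \<ge> 0 \<Longrightarrow> \<exists>L\<ge>0. \<forall>x y. norm x \<le> R \<longrightarrow> norm y \<le> R \<longrightarrow> norm (f x - f y) \<le> L * norm (x - y)"
  shows "lip_bdd f"
  unfolding lip_bdd_def
proof
  fix R :: real
  obtain L where "L \<ge> 0" "\<forall>x y. norm x \<le> max R 0 \<longrightarrow> norm y \<le> max R 0 \<longrightarrow> norm (f x - f y) \<le> L * norm (x - y)"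
    using assms[of "max R 0"] by auto
  then have "L-lipschitz_on (cball 0 R) f" by (intro lipschitz_onI) (auto simp: dist_norm)
  then show "\<exists>L. L-lipschitz_on (cball 0 R) f" ..
qed

lemma lip_bdd_bounded:
  fixes f :: "'a::real_normed_vector \<Rightarrow> 'b::real_normed_vector"
  assumes "lip_bdd f"
  obtains B where "B \<ge> 0" "\<And>x. norm x \<le> R \<Longrightarrow> norm (f x) \<le> B"
proof -
  obtain L where L: "L \<ge> 0" "\<And>x y. norm x \<le> max R 0 \<Longrightarrow> norm y \<le> max R 0 \<Longrightarrow> norm (f x - f y) \<le> L * norm (x - y)"
    using lip_bddD[OF assms] by metis
  show ?thesis
  proof (rule that)
    show "0 \<le> L * max R 0 + norm (f 0)" using L by auto
    fix x :: 'a assume x: "norm x \<le> R"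
    have "norm (f x) \<le> norm (f x - f 0) + norm (f 0)" using norm_triangle_ineq[of "f x - f 0" "f 0"] by simp
    also have "norm (f x - f 0) \<le> L * norm (x - 0)" by (rule L(2)) (use x in auto)
    also have "L * norm (x - 0) \<le> L * max R 0" using L x by (intro mult_left_mono) auto
    finally show "norm (f x) \<le> L * max R 0 + norm (f 0)" by simp
  qed
qed

named_theorems lip_bdd_intros

lemma lip_bdd_const [lip_bdd_intros]: "lip_bdd (\<lambda>x. c)"
  by (rule lip_bddI) auto

lemma lip_bdd_ident [lip_bdd_intros]: "lip_bdd (\<lambda>x. x)"
  by (rule lip_bddI) (auto intro!: exI[of _ 1])

lemma lip_bdd_add [lip_bdd_intros]:
  assumes "lip_bdd f" "lip_bdd g" shows "lip_bdd (\<lambda>x. f x + g x)"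
proof -
  have "\<exists>L. L-lipschitz_on (cball 0 R) (\<lambda>x. f x + g x)" for R
  proof -
    obtain L M where "L-lipschitz_on (cball 0 R) f" "M-lipschitz_on (cball 0 R) g"
      using assms unfolding lip_bdd_def by metis
    from lipschitz_on_add[OF this] show ?thesis by blast
  qed
  then show ?thesis by (simp add: lip_bdd_def)
qed

lemma lip_bdd_linear:
  assumes "bounded_linear h" "lip_bdd f" shows "lip_bdd (\<lambda>x. h (f x))"
proof (rule lip_bddI)
  interpret bounded_linear h by fact
  fix R :: real
  obtain L where L: "L \<ge> 0" "\<And>x y. norm x \<le> R \<Longrightarrow> norm y \<le> R \<Longrightarrow> norm (f x - f y) \<le> L * norm (x - y)"
    using lip_bddD[OF assms(2)] by metis
  obtain K where K: "K > 0" "\<And>x. norm (h x) \<le> norm x * K" using pos_bounded by auto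
  have "norm (h (f x) - h (f y)) \<le> K * L * norm (x - y)" if "norm x \<le> R" "norm y \<le> R" for x y
  proof -
    have "norm (h (f x) - h (f y)) \<le> norm (f x - f y) * K" using K(2)[of "f x - f y"] by (simp add: diff)
    also have "\<dots> \<le> (L * norm (x - y)) * K" using L(2)[OF that] K(1) by (intro mult_right_mono) auto
    finally show ?thesis by (simp add: algebra_simps)
  qed
  then show "\<exists>L\<ge>0. \<forall>x y. norm x \<le> R \<longrightarrow> norm y \<le> R \<longrightarrow> norm (h (f x) - h (f y)) \<le> L * norm (x - y)"
    using L(1) K(1) by (intro exI[of _ "K * L"]) auto
qed

lemmas lip_bdd_fst [lip_bdd_intros] = lip_bdd_linear[OF bounded_linear_fst]
lemmas lip_bdd_snd [lip_bdd_intros] = lip_bdd_linear[OF bounded_linear_snd]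
lemmas lip_bdd_minus [lip_bdd_intros] = lip_bdd_linear[OF bounded_linear_minus[OF bounded_linear_ident]]

lemma lip_bdd_bilinear:
  assumes "bounded_bilinear h" "lip_bdd f" "lip_bdd g" shows "lip_bdd (\<lambda>x. h (f x) (g x))"
proof (rule lip_bddI)
  interpret bounded_bilinear h by fact
  fix R :: real
  obtain L where L: "L \<ge> 0" "\<And>x y. norm x \<le> R \<Longrightarrow> norm y \<le> R \<Longrightarrow> norm (f x - f y) \<le> L * norm (x - y)"
    using lip_bddD[OF assms(2)] by metis
  obtain M where M: "M \<ge> 0" "\<And>x y. norm x \<le> R \<Longrightarrow> norm y \<le> R \<Longrightarrow> norm (g x - g y) \<le> M * norm (x - y)"
    using lip_bddD[OF assms(3)] by metis
  obtain B where B: "B \<ge> 0" "\<And>x. norm x \<le> R \<Longrightarrow> norm (f x) \<le> B" using lip_bdd_bounded[OF assms(2)] by metis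
  obtain C where C: "C \<ge> 0" "\<And>x. norm x \<le> R \<Longrightarrow> norm (g x) \<le> C" using lip_bdd_bounded[OF assms(3)] by metis
  obtain K where K: "K > 0" "\<And>a b. norm (h a b) \<le> norm a * norm b * K" using pos_bounded by auto
  have "norm (h (f x) (g x) - h (f y) (g y)) \<le> (L * C * K + B * M * K) * norm (x - y)"
    if xy: "norm x \<le> R" "norm y \<le> R" for x y
  proof -
    have "h (f x) (g x) - h (f y) (g y) = h (f x - f y) (g x) + h (f y) (g x - g y)"
      by (simp add: diff_left diff_right)
    also have "norm \<dots> \<le> norm (f x - f y) * norm (g x) * K + norm (f y) * norm (g x - g y) * K"
      by (intro order_trans[OF norm_triangle_ineq] add_mono K)
    also have "\<dots> \<le> (L * norm (x - y)) * C * K + B * (M * norm (x - y)) * K"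
      using L M B C K(1) xy by (intro add_mono mult_mono mult_right_mono) auto
    finally show ?thesis by (simp add: algebra_simps)
  qed
  then show "\<exists>L\<ge>0. \<forall>x y. norm x \<le> R \<longrightarrow> norm y \<le> R \<longrightarrow> norm (h (f x) (g x) - h (f y) (g y)) \<le> L * norm (x - y)"
    using L(1) M(1) B(1) C(1) K(1) by (intro exI[of _ "L * C * K + B * M * K"]) auto
qed

lemmas lip_bdd_scaleR [lip_bdd_intros] = lip_bdd_bilinear[OF bounded_bilinear_scaleR]

lemma lip_bdd_Pair [lip_bdd_intros]:
  assumes "lip_bdd f" "lip_bdd g" shows "lip_bdd (\<lambda>x. (f x, g x))"
proof -
  have "\<exists>L. L-lipschitz_on (cball 0 R) (\<lambda>x. (f x, g x))" for R
  proof -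
    obtain L M where "L-lipschitz_on (cball 0 R) f" "M-lipschitz_on (cball 0 R) g"
      using assms unfolding lip_bdd_def by metis
    from lipschitz_on_Pair[OF this] show ?thesis by blast
  qed
  then show ?thesis by (simp add: lip_bdd_def)
qed

lemma continuous_on_lip_bdd:
  assumes "lip_bdd f"
  shows "continuous_on A f"
proof -
  have "continuous (at x) f" for x
  proof -
    obtain L where "L-lipschitz_on (cball 0 (norm x + 1)) f" using assms unfolding lip_bdd_def by metis
    then have "continuous_on (cball 0 (norm x + 1)) f" by (rule lipschitz_on_continuous_on)
    then have "continuous_on (ball 0 (norm x + 1)) f" by (rule continuous_on_subset) auto
    then show ?thesis by (rule continuous_on_interior) auto
  qed
  then show ?thesis by (simp add: continuous_at_imp_continuous_on)
qed

lemma bounded_on_Icc: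
  fixes y :: "real \<Rightarrow> 'a::real_normed_vector"
  assumes "continuous_on {0..T} y"
  obtains B where "B \<ge> 0" "\<And>t. t \<in> {0..T} \<Longrightarrow> norm (y t) \<le> B"
proof -
  have "bounded (y ` {0..T})"
    using compact_imp_bounded[OF compact_continuous_image[OF assms]] by simp
  then obtain B where B: "\<forall>x\<in>y ` {0..T}. norm x \<le> B" unfolding bounded_iff by metis
  show ?thesis by (rule that[of "max B 0"]) (use B in \<open>auto simp: le_max_iff_disj\<close>)
qed

section \<open>Uniqueness, existence in a tube, gluing\<close>

lemma ode_unique_lipschitz:
  fixes y z :: "real \<Rightarrow> 'a::real_inner"
  assumes y: "\<And>t. t \<in> {0..T} \<Longrightarrow> (y has_vector_derivative F t (y t)) (at t within {0..T})"
    and z: "\<And>t. t \<in> {0..T} \<Longrightarrow> (z has_vector_derivative F t (z t)) (at t within {0..T})"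
    and init: "y 0 = z 0"
    and lip: "\<And>R. \<exists>L. \<forall>t\<in>{0..T}. L-lipschitz_on (cball 0 R) (F t)"
    and t: "t \<in> {0..T}"
  shows "y t = z t"
proof -
  obtain B where B: "\<And>t. t \<in> {0..T} \<Longrightarrow> norm (y t) \<le> B"
    using bounded_on_Icc[OF has_vector_derivative_continuous_on[OF y]] by metis
  obtain C where C: "\<And>t. t \<in> {0..T} \<Longrightarrow> norm (z t) \<le> C"
    using bounded_on_Icc[OF has_vector_derivative_continuous_on[OF z]] by metis
  obtain L where L: "\<forall>t\<in>{0..T}. L-lipschitz_on (cball 0 (max B C)) (F t)" using lip by blast
  show ?thesis
  proof (rule ode_unique[OF y z init _ t])
    fix s assume s: "s \<in> {0..T}"
    show "norm (F s (y s) - F s (z s)) \<le> L * norm (y s - z s)"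
      by (rule lipschitz_on_normD[OF L[rule_format, OF s]]) (use B[OF s] C[OF s] in auto)
  qed
qed

text \<open>Projecting the state onto the tube around \<open>c\<close> before applying
  \<open>F\<close> gives a globally Lipschitz field, which has a solution on the whole interval. Up
  to the first time this solution touches the boundary of the tube it also solves the original
  equation, and the strict a priori bound excludes such a time. This is the bootstrap used twice
  later, without continuation of maximal solutions.\<close>

lemma tube_existence:
  fixes F :: "real \<Rightarrow> 'a \<Rightarrow> 'a::euclidean_space"
  assumes T: "T \<ge> 0" and cont: "continuous_on ({0..T} \<times> UNIV) (\<lambda>(t, x). F t x)"
    and lip: "\<And>R. \<exists>L. \<forall>t\<in>{0..T}. L-lipschitz_on (cball 0 R) (F t)"
    and c: "continuous_on {0..T} c" and init: "norm (y0 - c 0) < \<eta>"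
    and apriori: "\<And>\<tau> y. \<tau> \<in> {0..T} \<Longrightarrow> y 0 = y0 \<Longrightarrow>
      (\<And>t. t \<in> {0..\<tau>} \<Longrightarrow> (y has_vector_derivative F t (y t)) (at t within {0..\<tau>})) \<Longrightarrow>
      (\<And>t. t \<in> {0..\<tau>} \<Longrightarrow> norm (y t - c t) \<le> \<eta>) \<Longrightarrow> norm (y \<tau> - c \<tau>) < \<eta>"
  obtains y where "y 0 = y0" "\<And>t. t \<in> {0..T} \<Longrightarrow> (y has_vector_derivative F t (y t)) (at t within {0..T})"
    "\<And>t. t \<in> {0..T} \<Longrightarrow> norm (y t - c t) \<le> \<eta>"
proof -
  have \<eta>: "\<eta> > 0" using init norm_ge_zero[of "y0 - c 0"] by linarith
  define cp where "cp = closest_point (cball (0::'a) \<eta>)"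
  have cp_in: "norm (cp x) \<le> \<eta>" for x
    using closest_point_in_set[of "cball (0::'a) \<eta>" x] \<eta> by (auto simp: cp_def)
  have cp_id: "cp x = x" if "norm x \<le> \<eta>" for x
    unfolding cp_def by (rule closest_point_self) (use that in auto)
  have cp_lip: "dist (cp x) (cp y) \<le> dist x y" for x y
    unfolding cp_def by (rule closest_point_lipschitz) (use \<eta> in auto)
  have cp_cont: "continuous_on A cp" for A
    unfolding cp_def by (rule continuous_on_closest_point) (use \<eta> in auto)
  obtain B where B: "\<And>t. t \<in> {0..T} \<Longrightarrow> norm (c t) \<le> B" using bounded_on_Icc[OF c] by metis
  obtain L where L: "\<forall>t\<in>{0..T}. L-lipschitz_on (cball 0 (B + \<eta>)) (F t)" using lip by blast
  define G where "G t x = F t (c t + cp (x - c t))" for t x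
  have in_ball: "norm (c t + cp x) \<le> B + \<eta>" if "t \<in> {0..T}" for t x
    using norm_triangle_ineq[of "c t" "cp x"] B[OF that] cp_in[of x] by linarith
  have Glip: "L-lipschitz_on UNIV (G t)" if t: "t \<in> {0..T}" for t
  proof (rule lipschitz_onI)
    show L0: "0 \<le> L" using lipschitz_on_nonneg[OF L[rule_format, OF t]] .
    fix x y
    have "dist (G t x) (G t y) \<le> L * dist (c t + cp (x - c t)) (c t + cp (y - c t))"
      unfolding G_def by (rule lipschitz_onD[OF L[rule_format, OF t]]) (use in_ball[OF t] in auto)
    also have "\<dots> = L * dist (cp (x - c t)) (cp (y - c t))" by simp
    also have "\<dots> \<le> L * dist (x - c t) (y - c t)" using cp_lip L0 by (intro mult_left_mono)
    finally show "dist (G t x) (G t y) \<le> L * dist x y" by (simp add: dist_norm)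
  qed
  have c': "continuous_on ({0..T} \<times> UNIV) (\<lambda>p. c (fst p))"
    by (rule continuous_on_compose2[OF c]) (auto intro!: continuous_intros)
  have "continuous_on ({0..T} \<times> UNIV) (\<lambda>p. (fst p, c (fst p) + cp (snd p - c (fst p))))"
    by (intro continuous_intros c' continuous_on_compose2[OF cp_cont[of UNIV]]) auto
  from continuous_on_compose2[OF cont this]
  have "continuous_on ({0..T} \<times> UNIV) (\<lambda>(t, x). G t x)"
    by (simp add: G_def case_prod_beta image_subset_iff)
  from picard_solution[OF this Glip T]
  obtain y where y0: "y 0 = y0"
    and y: "\<And>t. t \<in> {0..T} \<Longrightarrow> (y has_vector_derivative G t (y t)) (at t within {0..T})" by metis
  define D where "D t = norm (y t - c t)" for t
  have contD: "continuous_on {0..T} D" unfolding D_def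
    by (intro continuous_intros c has_vector_derivative_continuous_on[OF y]) auto
  have bound: "D t \<le> \<eta>" if t: "t \<in> {0..T}" for t
  proof (rule ccontr)
    assume "\<not> D t \<le> \<eta>"
    then have Dt: "D t > \<eta>" by simp
    \<comment> \<open>By the intermediate value theorem every exit is preceded by a time with
      distance exactly \<eta>, so the infimum of these times is a first hitting time, before which
      the solution stays inside.\<close>
    have cross: "\<exists>s\<ge>0. s \<le> r \<and> D s = \<eta>" if r: "r \<in> {0..t}" "D r > \<eta>" for r
    proof (rule IVT')
      show "D 0 \<le> \<eta>" using init y0 by (simp add: D_def)
      show "continuous_on {0..r} D" using r t by (intro continuous_on_subset[OF contD]) auto
    qed (use r in auto)
    define K where "K = {0..t} \<inter> D -` {\<eta>}"
    have clK: "closed K" unfolding K_def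
      by (rule continuous_closed_preimage[OF continuous_on_subset[OF contD]]) (use t in auto)
    have K_ne: "K \<noteq> {}" using cross[of t] Dt t by (auto simp: K_def)
    have K_bdd: "bdd_below K" by (rule bdd_belowI[of _ 0]) (auto simp: K_def)
    define s0 where "s0 = Inf K"
    have s0K: "s0 \<in> K" unfolding s0_def by (rule closed_contains_Inf[OF K_ne K_bdd clK])
    then have s0: "0 \<le> s0" "s0 \<le> t" "D s0 = \<eta>" by (auto simp: K_def)
    have le: "D s \<le> \<eta>" if s: "s \<in> {0..s0}" for s
    proof (rule ccontr)
      assume "\<not> D s \<le> \<eta>"
      then obtain r where r: "0 \<le> r" "r \<le> s" "D r = \<eta>" using cross[of s] s s0 by auto
      then have "r \<in> K" using s s0 by (auto simp: K_def)
      then have "s0 \<le> r" unfolding s0_def using K_bdd by (rule cInf_lower)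
      with r s have "r = s" by auto
      with r \<open>\<not> D s \<le> \<eta>\<close> show False by simp
    qed
    have "norm (y s0 - c s0) < \<eta>"
    proof (rule apriori)
      show "s0 \<in> {0..T}" "y 0 = y0" using s0 t y0 by auto
      fix r assume r: "r \<in> {0..s0}"
      then have r': "r \<in> {0..T}" using s0 t by auto
      show "norm (y r - c r) \<le> \<eta>" using le[OF r] by (simp add: D_def)
      then have "G r (y r) = F r (y r)" by (simp add: G_def cp_id)
      then show "(y has_vector_derivative F r (y r)) (at r within {0..s0})"
        using has_vector_derivative_within_subset[OF y[OF r'], of "{0..s0}"] s0 t by auto
    qed
    with s0 show False by (simp add: D_def)
  qed
  show ?thesis
  proof (rule that[of y, OF y0])
    fix t assume t: "t \<in> {0..T}"
    show b: "norm (y t - c t) \<le> \<eta>" using bound[OF t] by (simp add: D_def)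
    then have "G t (y t) = F t (y t)" by (simp add: G_def cp_id)
    then show "(y has_vector_derivative F t (y t)) (at t within {0..T})" using y[OF t] by simp
  qed
qed

text \<open>Uniqueness makes the solutions on different intervals agree, so the diagonal
  \<open>y t = Y t t\<close> is consistent. Near \<open>t\<close> it coincides with the solution on
  \<open>{0..t + 1}\<close>, where \<open>t\<close> is no right end point, and this gives the
  derivative on the half line.\<close>

lemma ode_glue:
  fixes F :: "real \<Rightarrow> 'a \<Rightarrow> 'a::real_inner"
  assumes sol: "\<And>T. T \<ge> 0 \<Longrightarrow> \<exists>y. y 0 = y0 \<and>
      (\<forall>t\<in>{0..T}. (y has_vector_derivative F t (y t)) (at t within {0..T}))"
    and lip: "\<And>T R. T \<ge> 0 \<Longrightarrow> \<exists>L. \<forall>t\<in>{0..T}. L-lipschitz_on (cball 0 R) (F t)"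
  obtains y where "y 0 = y0" "\<And>t. t \<ge> 0 \<Longrightarrow> (y has_vector_derivative F t (y t)) (at t within {0..})"
proof -
  obtain Y where Y0: "\<And>T. T \<ge> 0 \<Longrightarrow> Y T 0 = y0"
    and Y: "\<And>T t. T \<ge> 0 \<Longrightarrow> t \<in> {0..T} \<Longrightarrow> (Y T has_vector_derivative F t (Y T t)) (at t within {0..T})"
    using sol by metis
  define y where "y t = Y t t" for t
  have Y_eq: "y t = Y T t" if "0 \<le> t" "t \<le> T" for t T
    unfolding y_def
  proof (rule ode_unique_lipschitz[where F = F and T = t and y = "Y t" and z = "Y T"])
    fix s assume s: "s \<in> {0..t}"
    show "(Y t has_vector_derivative F s (Y t s)) (at s within {0..t})"
      using Y[of t s] s that by auto
    show "(Y T has_vector_derivative F s (Y T s)) (at s within {0..t})"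
      by (rule has_vector_derivative_within_subset[OF Y]) (use s that in auto)
  qed (use that Y0 lip in auto)
  show ?thesis
  proof (rule that[of y])
    show "y 0 = y0" using Y0 by (simp add: y_def)
    fix t :: real assume t: "t \<ge> 0"
    have "(Y (t + 1) has_vector_derivative F t (y t)) (at t within {0..t + 1})"
      using Y[of "t + 1" t] t Y_eq[of t "t + 1"] by auto
    moreover have "at t within {0..t + 1} = at t within {0..}"
      by (rule at_within_nhd[of _ "{..<t + 1}"]) auto
    ultimately have *: "(Y (t + 1) has_vector_derivative F t (y t)) (at t within {0..})" by simp
    show "(y has_vector_derivative F t (y t)) (at t within {0..})"
    proof (rule has_vector_derivative_transform_within[OF *, of 1])
      fix s assume "s \<in> {0..}" "dist s t < 1"
      then show "Y (t + 1) s = y s" using Y_eq[of s "t + 1"] by (auto simp: dist_real_def)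
    qed (use t in auto)
  qed
qed

section \<open>Matrices and the reduced Riccati coefficients\<close>

text \<open>Cauchy-Schwarz in each column. Applied to the rows of a product it makes the trace norm
  submultiplicative, so that matrix terms can be bounded by products of norms without further
  constants.\<close>

lemma norm_vector_matrix_mult_le: "norm (x v* A) \<le> norm x * norm (A :: real^'n^'m)"
proof -
  have "(norm (x v* A))\<^sup>2 = (\<Sum>j\<in>UNIV. (x \<bullet> column j A)\<^sup>2)"
    unfolding power2_norm_eq_inner inner_vec_def[of "x v* A"]
    by (simp add: vector_matrix_mult_def inner_vec_def column_def power2_eq_square mult.commute)
  also have "\<dots> \<le> (\<Sum>j\<in>UNIV. (norm x)\<^sup>2 * (norm (column j A))\<^sup>2)"
    using Cauchy_Schwarz_ineq2[of x] by (intro sum_mono) (metis power_mult_distrib norm_ge_zero abs_ge_zero power_mono power2_abs)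
  also have "\<dots> = (norm x)\<^sup>2 * (\<Sum>j\<in>UNIV. (norm (column j A))\<^sup>2)"
    by (simp add: sum_distrib_left)
  also have "(\<Sum>j\<in>UNIV. (norm (column j A))\<^sup>2) = (norm A)\<^sup>2"
    unfolding power2_norm_eq_inner by (simp add: inner_vec_def column_def) (rule sum.swap)
  finally have "(norm (x v* A))\<^sup>2 \<le> (norm x * norm A)\<^sup>2" by (simp add: power_mult_distrib)
  then show ?thesis by (rule power2_le_imp_le) simp
qed

lemma matrix_mult_row: "(A ** B) $ i = A $ i v* (B :: real^'n^'m)"
  by (simp add: vec_eq_iff matrix_matrix_mult_def vector_matrix_mult_def mult.commute)

lemma norm_matrix_mult_le: "norm (A ** B) \<le> norm A * norm (B :: real^'n^'m)"
  for A :: "real^'m^'k"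
proof -
  have "(norm (A ** B))\<^sup>2 = (\<Sum>i\<in>UNIV. (norm (A $ i v* B))\<^sup>2)"
    unfolding power2_norm_eq_inner inner_vec_def[of "A ** B"] by (simp add: matrix_mult_row)
  also have "\<dots> \<le> (\<Sum>i\<in>UNIV. (norm (A $ i) * norm B)\<^sup>2)"
    by (intro sum_mono power_mono norm_vector_matrix_mult_le) auto
  also have "\<dots> = (norm A)\<^sup>2 * (norm B)\<^sup>2"
    by (simp add: power_mult_distrib sum_distrib_right power2_norm_eq_inner inner_vec_def[of A A])
  finally have "(norm (A ** B))\<^sup>2 \<le> (norm A * norm B)\<^sup>2" by (simp add: power_mult_distrib)
  then show ?thesis by (rule power2_le_imp_le) simp
qed

lemma inner_transpose: "transpose A \<bullet> transpose B = A \<bullet> (B :: real^'n^'m)"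
  by (simp add: inner_vec_def transpose_def) (rule sum.swap)

lemma norm_transpose: "norm (transpose A) = norm (A :: real^'n^'m)"
  by (simp add: norm_eq_sqrt_inner inner_transpose)

lemma norm_matrix_vector_mult_le: "norm (A *v x) \<le> norm A * norm (x :: real^'n)" for A :: "real^'n^'m"
  using norm_vector_matrix_mult_le[of x "transpose A"] by (simp add: norm_transpose mult.commute)

lemma bounded_bilinear_matrix_mult:
  "bounded_bilinear ((**) :: real^'m^'k \<Rightarrow> real^'n^'m \<Rightarrow> real^'n^'k)"
  by unfold_locales
    (auto simp: matrix_add_ldistrib matrix_matrix_mult_def vec_eq_iff algebra_simps sum.distrib sum_distrib_left
      intro!: exI[of _ 1] norm_matrix_mult_le[unfolded matrix_matrix_mult_def])

lemma bounded_bilinear_matrix_vector_mult: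
  "bounded_bilinear ((*v) :: real^'m^'k \<Rightarrow> real^'m \<Rightarrow> real^'k)"
  by unfold_locales
    (auto simp: algebra_simps scaleR_matrix_vector_assoc[symmetric]
      intro!: exI[of _ 1] norm_matrix_vector_mult_le[THEN order_trans])

lemma bounded_linear_transpose: "bounded_linear (transpose :: real^'m^'k \<Rightarrow> real^'k^'m)"
  by unfold_locales (auto simp: transpose_def vec_eq_iff norm_transpose[unfolded transpose_def] intro!: exI[of _ 1])

lemmas lip_bdd_matrix_mult [lip_bdd_intros] = lip_bdd_bilinear[OF bounded_bilinear_matrix_mult]
lemmas lip_bdd_transpose [lip_bdd_intros] = lip_bdd_linear[OF bounded_linear_transpose]

lemmas transpose_linear_simps = linear_add[OF bounded_linear.linear[OF bounded_linear_transpose]] linear_diff[OF bounded_linear.linear[OF bounded_linear_transpose]] linear_neg[OF bounded_linear.linear[OF bounded_linear_transpose]]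
  linear_scale[OF bounded_linear.linear[OF bounded_linear_transpose]]

lemmas mat_expand = bounded_bilinear.add_left[OF bounded_bilinear_matrix_mult] bounded_bilinear.add_right[OF bounded_bilinear_matrix_mult]
  bounded_bilinear.diff_left[OF bounded_bilinear_matrix_mult] bounded_bilinear.diff_right[OF bounded_bilinear_matrix_mult]
  bounded_bilinear.minus_left[OF bounded_bilinear_matrix_mult] bounded_bilinear.minus_right[OF bounded_bilinear_matrix_mult]
  bounded_bilinear.scaleR_left[OF bounded_bilinear_matrix_mult] bounded_bilinear.scaleR_right[OF bounded_bilinear_matrix_mult]
  transpose_linear_simps matrix_transpose_mul matrix_mul_assoc

section \<open>Inverses, quadratic forms and elimination of the fast block\<close>

lemma matrix_inv_mult:
  fixes A :: "real^'n^'n"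
  assumes "invertible A"
  shows "A ** matrix_inv A = mat 1" "matrix_inv A ** A = mat 1"
  using someI_ex[OF assms[unfolded invertible_def]] unfolding matrix_inv_def by auto

lemma matrix_inv_unique:
  fixes A B :: "real^'n^'n"
  assumes "A ** B = mat 1" "B ** A = mat 1"
  shows "matrix_inv A = B"
proof -
  have "invertible A" using assms unfolding invertible_def by blast
  then have "matrix_inv A = matrix_inv A ** (A ** B)" "matrix_inv A ** A = mat 1"
    using assms matrix_inv_mult by auto
  then show ?thesis by (simp add: matrix_mul_assoc)
qed

lemma invertible_transpose_matrix:
  fixes A :: "real^'n^'n"
  assumes "invertible A"
  shows "invertible (transpose A)" "matrix_inv (transpose A) = transpose (matrix_inv A)"
proof -
  have *: "transpose A ** transpose (matrix_inv A) = mat 1" "transpose (matrix_inv A) ** transpose A = mat 1"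
    using matrix_inv_mult[OF assms] by (simp_all flip: matrix_transpose_mul)
  show "invertible (transpose A)" using * unfolding invertible_def by blast
  show "matrix_inv (transpose A) = transpose (matrix_inv A)" using * by (rule matrix_inv_unique)
qed

lemma mat_vec_scalar: "mat c *v x = c *\<^sub>R (x :: real^'n)"
  by (simp add: vec_eq_iff matrix_vector_mult_def mat_def if_distrib[where f = "\<lambda>z. z * _"] cong: if_cong)

lemma mat_le_sym_part_iff: "mat_le (sym_part S) (mat a) \<longleftrightarrow> (\<forall>x. (S *v x) \<bullet> x \<le> a * (x \<bullet> x))"
proof -
  have "(sym_part S *v x) \<bullet> x = (S *v x) \<bullet> x" for x
    by (simp add: sym_part_def scaleR_matrix_vector_assoc[symmetric] algebra_simps
        inner_add_left dot_lmul_matrix inner_commute[of _ "S *v x"])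
  then show ?thesis by (simp add: mat_le_def mat_vec_scalar)
qed

text \<open>Multiplication by \<open>S\<close> from the right acts on each row of \<open>Z\<close>
  separately, so a bound for the quadratic form of \<open>S\<close> on vectors carries over to the
  trace inner product with the same constant.\<close>

lemma inner_mult_right_le:
  assumes "\<And>x. (S *v x) \<bullet> x \<le> a * (x \<bullet> x)"
  shows "(Z ** S) \<bullet> Z \<le> a * (Z \<bullet> (Z :: real^'n^'m))"
proof -
  have "(Z ** S) \<bullet> Z = (\<Sum>i\<in>UNIV. (S *v (Z $ i)) \<bullet> (Z $ i))"
    unfolding inner_vec_def[of "Z ** S"] matrix_mult_row dot_lmul_matrix by (simp add: inner_commute)
  also have "\<dots> \<le> (\<Sum>i\<in>UNIV. a * (Z $ i \<bullet> Z $ i))" by (intro sum_mono assms)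
  also have "\<dots> = a * (Z \<bullet> Z)" by (simp add: inner_vec_def[of Z] sum_distrib_left)
  finally show ?thesis .
qed

lemma inner_mult_left_le:
  assumes "\<And>x. (S *v x) \<bullet> x \<le> a * (x \<bullet> x)"
  shows "(transpose S ** Z) \<bullet> Z \<le> a * (Z \<bullet> (Z :: real^'m^'n))"
proof -
  have "(transpose S ** Z) \<bullet> Z = (transpose Z ** S) \<bullet> transpose Z"
    by (subst inner_transpose[symmetric]) (simp add: matrix_transpose_mul)
  also have "\<dots> \<le> a * (transpose Z \<bullet> transpose Z)" by (rule inner_mult_right_le[OF assms])
  finally show ?thesis by (simp add: inner_transpose)
qed

lemma invertible_of_negative_sym_part:
  fixes S :: "real^'n^'n"
  assumes "\<And>x. (S *v x) \<bullet> x \<le> - \<gamma> * (x \<bullet> x)" "\<gamma> > 0"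
  shows "invertible S"
  unfolding invertible_left_inverse matrix_left_invertible_ker
proof (intro allI impI)
  fix x assume "S *v x = 0"
  then have "\<gamma> * (x \<bullet> x) \<le> 0" using assms(1)[of x] by simp
  then show "x = 0" using assms(2) inner_ge_zero[of x] by (simp add: mult_le_0_iff)
qed

lemma transpose_Delta1: "transpose (Delta1 G) = Delta1 G"
  and transpose_Delta2: "transpose (Delta2 G) = Delta2 G"
  by (simp_all add: Delta1_def Delta2_def transpose_linear_simps matrix_transpose_mul)

text \<open>Completing the square with the algebraic Riccati equation gives
  \<open>Lambda G = transpose S ** i2 ** S\<close>, whose inverse is
  \<open>iS ** D2 ** transpose iS\<close>. After the substitution \<open>A22 G = S - D2 ** R\<close>
  all inverses of \<open>Delta2\<close> cancel, and the published coefficients collapse to the slow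
  equation in which \<open>P12\<close> has been eliminated through \<open>h_map\<close>.\<close>

lemma reduced_rhs:
  fixes G :: "('n1::finite, 'n2::finite, 'k1::finite, 'k2::finite, 'm1::finite, 'm2::finite) game"
  assumes inv: "invertible (Delta2 G)" "invertible (A22 G + Delta2 G ** R)"
    and R: "transpose R = R"
      "transpose (A22 G) ** R + R ** A22 G + R ** Delta2 G ** R + Q2 G = 0"
    and p: "transpose p = p"
  shows "transpose (A_red G) ** p + p ** A_red G + p ** M_red G ** p + N_red G
    = ric_f G p (h_map G R p) r e"
proof -
  define S where "S = A22 G + Delta2 G ** R"
  define D2 where "D2 = Delta2 G"
  define i2 where "i2 = matrix_inv D2"
  define iS where "iS = matrix_inv S"
  define Li where "Li = iS ** D2 ** transpose iS"
  have D2t: "transpose D2 = D2" by (simp add: D2_def transpose_Delta2)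
  have i2: "D2 ** i2 = mat 1" "i2 ** D2 = mat 1"
    using matrix_inv_mult[OF inv(1)] by (auto simp: i2_def D2_def)
  have i2t: "transpose i2 = i2"
    using invertible_transpose_matrix(2)[OF inv(1)] by (simp add: i2_def D2_def transpose_Delta2)
  have iS: "S ** iS = mat 1" "iS ** S = mat 1"
    using matrix_inv_mult[of S] inv(2) by (auto simp: iS_def S_def)
  have iSt: "transpose iS ** transpose S = mat 1" "transpose S ** transpose iS = mat 1"
    using iS by (simp_all flip: matrix_transpose_mul)
  have cancel: "X ** D2 ** i2 = X" "X ** i2 ** D2 = X" "X ** S ** iS = X" "X ** iS ** S = X"
      "X ** transpose iS ** transpose S = X" "X ** transpose S ** transpose iS = X" for X :: "real^'n2^'z::finite"
    using i2 iS iSt by (simp_all flip: matrix_mul_assoc)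
  have A22: "A22 G = S - D2 ** R" by (simp add: S_def D2_def)
  have Lit: "transpose Li = Li" by (simp add: Li_def matrix_transpose_mul D2t matrix_mul_assoc)
  have Lambda: "Lambda G = transpose S ** i2 ** S"
  proof -
    have "transpose S ** i2 ** S = transpose (A22 G) ** i2 ** A22 G
        + (transpose (A22 G) ** R + R ** A22 G + R ** Delta2 G ** R)"
      unfolding S_def D2_def[symmetric] by (simp add: mat_expand R(1) D2t cancel)
    also have "transpose (A22 G) ** R + R ** A22 G + R ** Delta2 G ** R = - Q2 G"
      using R(2) by (simp only: eq_neg_iff_add_eq_0)
    also have "transpose (A22 G) ** i2 ** A22 G + - Q2 G = Lambda G"
      by (simp add: Lambda_def i2_def D2_def)
    finally show ?thesis by simp
  qed
  have iLambda: "matrix_inv (Lambda G) = Li"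
    by (rule matrix_inv_unique) (simp_all add: Lambda Li_def matrix_mul_assoc cancel iS iSt)
  \<comment> \<open>\<open>Li\<close>, multiplied by one factor \<open>A22\<close> and one inverse
    of \<open>Delta2\<close>, simplifies to an expression in \<open>iS\<close>, \<open>Li\<close>
    and \<open>R\<close>; this identity and its transpose remove every remaining inverse of
    \<open>Delta2\<close>.\<close>
  have LiA: "Li ** transpose (A22 G) ** i2 = iS - Li ** R"
    by (simp add: A22 mat_expand R(1) D2t cancel) (simp add: Li_def cancel)
  have ALi: "i2 ** A22 G ** Li = transpose iS - R ** Li"
    using arg_cong[OF LiA, of transpose] by (simp add: mat_expand R(1) i2t Lit)
  have bracket: "Delta2_bracket G = R ** iS + transpose iS ** R - R ** Li ** R"
  proof -
    have "Delta2_bracket G = i2 - i2 ** A22 G ** Li ** transpose (A22 G) ** i2"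
      unfolding Delta2_bracket_def iLambda by (simp add: mat_expand i2 flip: i2_def D2_def)
    also have "i2 ** A22 G ** Li ** transpose (A22 G) ** i2 = i2 ** A22 G ** (Li ** transpose (A22 G) ** i2)"
      by (simp add: matrix_mul_assoc)
    also have "\<dots> = i2 ** A22 G ** iS - (i2 ** A22 G ** Li) ** R"
      unfolding LiA by (simp add: mat_expand)
    also have "i2 ** A22 G ** iS = i2 - R ** iS" by (simp add: A22 mat_expand i2 cancel)
    finally show ?thesis unfolding ALi by (simp add: mat_expand)
  qed
  define Y where "Y = transpose (A21 G) ** R + p ** A12 G + p ** Delta G ** R"
  have h: "h_map G R p = - (Y ** iS)" by (simp add: h_map_def Y_def iS_def S_def)
  have hDh: "h_map G R p ** Delta2 G ** transpose (h_map G R p) = Y ** Li ** transpose Y"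
    by (simp add: h mat_expand Li_def flip: D2_def)
  have A_red: "A_red G = A11 G - Delta G ** Delta2_bracket G ** A21 G - A12 G ** (iS - Li ** R) ** A21 G"
    by (simp add: A_red_def iLambda LiA[symmetric] matrix_mul_assoc flip: i2_def D2_def)
  have M_red: "M_red G = Delta1 G + A12 G ** Li ** transpose (A12 G)
      - Delta G ** (transpose iS - R ** Li) ** transpose (A12 G)
      - A12 G ** (iS - Li ** R) ** transpose (Delta G)
      - Delta G ** Delta2_bracket G ** transpose (Delta G)"
    by (simp add: M_red_def iLambda LiA[symmetric] ALi[symmetric] matrix_mul_assoc flip: i2_def D2_def)
  show ?thesis
    unfolding ric_f_def hDh
    unfolding A_red M_red N_red_def bracket h Y_def
    by (simp add: mat_expand p R(1) Lit)
qed

section \<open>Fast and slow components\<close>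

text \<open>The comparison function \<open>u\<close> solves \<epsilon> u' = c exp(- \<beta> s /
  \<epsilon>) u and stays above m / \<gamma>. Above that level the damping swallows the forcing
  \<open>m\<close>, so only the layer coefficient produces growth; divided by \<epsilon>, its time
  integral is at most c / \<beta>. Hence the factor exp(c / \<beta>), uniform in \<epsilon> and in
  the length of the interval.\<close>

lemma fast_bound:
  fixes y :: "real \<Rightarrow> 'a::real_inner"
  assumes pos: "\<epsilon> > 0" "\<gamma> > 0" "\<beta> > 0" "c \<ge> 0" "m \<ge> 0"
    and y: "\<And>s. s \<in> {0..\<tau>} \<Longrightarrow> (y has_vector_derivative y' s) (at s within {0..\<tau>})"
    and ineq: "\<And>s. s \<in> {0..\<tau>} \<Longrightarrow> \<epsilon> * (y s \<bullet> y' s)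
      \<le> (- \<gamma> + c * exp (- \<beta> * s / \<epsilon>)) * (norm (y s))\<^sup>2 + m * norm (y s)"
    and s: "s \<in> {0..\<tau>}"
  shows "norm (y s) \<le> (m / \<gamma> + norm (y 0)) * exp (c / \<beta>)"
proof -
  define k where "k = m / \<gamma> + norm (y 0)"
  define u where "u s = k * exp ((c / \<beta>) * (1 - exp (- \<beta> * s / \<epsilon>)))" for s
  have k: "k \<ge> 0" "m / \<gamma> \<le> k" using pos by (auto simp: k_def)
  have u_ge: "u s \<ge> k" if "s \<ge> 0" for s
  proof -
    have "exp (- \<beta> * s / \<epsilon>) \<le> 1" using pos that by auto
    then have "exp ((c / \<beta>) * (1 - exp (- \<beta> * s / \<epsilon>))) \<ge> 1" using pos by auto
    then show ?thesis unfolding u_def using mult_left_mono[OF _ k(1), of 1] by auto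
  qed
  have "norm (y s) \<le> u s"
  proof (rule norm_comparison[where L = "c / \<epsilon>" and u' = "\<lambda>s. u s * (c / \<epsilon> * exp (- \<beta> * s / \<epsilon>))", OF y _ _ _ _ s])
    fix s assume "s \<in> {0..\<tau>}"
    show "(u has_real_derivative u s * (c / \<epsilon> * exp (- \<beta> * s / \<epsilon>))) (at s within {0..\<tau>})"
      unfolding u_def using pos by (auto intro!: derivative_eq_intros simp: field_simps)
  next
    show "norm (y 0) \<le> u 0" using pos by (simp add: u_def k_def)
  next
    fix s assume "s \<in> {0..\<tau>}"
    then show "0 \<le> u s" using u_ge[of s] k by auto
  next
    fix s assume s: "s \<in> {0..\<tau>}" and gt: "u s < norm (y s)"
    define e where "e = exp (- \<beta> * s / \<epsilon>)"
    have e: "0 \<le> e" "e \<le> 1" using s pos by (auto simp: e_def)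
    let ?n = "norm (y s)"
    have "m \<le> \<gamma> * ?n"
    proof -
      have "m / \<gamma> \<le> ?n" using k u_ge[of s] gt s by auto
      then show ?thesis using pos by (simp add: pos_divide_le_eq mult.commute)
    qed
    then have "(- \<gamma> + c * e) * ?n + m \<le> c * e * ?n" by (simp add: algebra_simps)
    also have "\<dots> = c * e * u s + e * (c * (?n - u s))" by (simp add: algebra_simps)
    also have "\<dots> \<le> c * e * u s + 1 * (c * (?n - u s))"
      using e gt pos by (intro add_left_mono mult_right_mono) auto
    finally have "((- \<gamma> + c * e) * ?n + m) * ?n \<le> (c * e * u s + c * (?n - u s)) * ?n"
      by (intro mult_right_mono) auto
    moreover have "\<epsilon> * (y s \<bullet> y' s) \<le> ((- \<gamma> + c * e) * ?n + m) * ?n"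
      using ineq[OF s] unfolding e_def by (simp add: power2_eq_square algebra_simps)
    ultimately have "\<epsilon> * (y s \<bullet> y' s) \<le> (c * e * u s + c * (?n - u s)) * ?n" by (rule order_trans[rotated])
    also have "\<dots> = \<epsilon> * ((u s * (c / \<epsilon> * e) + c / \<epsilon> * (?n - u s)) * ?n)"
      using pos by (simp add: field_simps)
    finally show "y s \<bullet> y' s \<le> (u s * (c / \<epsilon> * exp (- \<beta> * s / \<epsilon>)) + c / \<epsilon> * (?n - u s)) * ?n"
      using pos by (simp add: e_def)
  qed
  also have "u s \<le> k * exp (c / \<beta>)"
    unfolding u_def using k pos by (intro mult_left_mono) (auto simp: mult_left_le divide_right_mono)
  finally show ?thesis by (simp add: k_def)
qed

text \<open>A Gronwall argument with integrating factor \<open>v\<close> and accumulated forcing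
  \<open>w\<close>. The singular rate B / \<epsilon> exp(- \<beta> s / \<epsilon>) has integral at
  most B / \<beta>, while the forcing H \<epsilon> exp(- \<beta> s / \<epsilon>) integrates to at
  most H \<epsilon>^2 / \<beta>; both parts of \<open>w\<close> are therefore of order
  \<epsilon>^2.\<close>

lemma energy_bound:
  fixes E :: "real \<Rightarrow> real"
  assumes pos: "\<epsilon> > 0" "\<beta> > 0" "A \<ge> 0" "B \<ge> 0" "F \<ge> 0" "H \<ge> 0"
    and E: "\<And>s. s \<in> {0..\<tau>} \<Longrightarrow> (E has_real_derivative E' s) (at s within {0..\<tau>})"
    and E0: "E 0 \<le> 0"
    and ineq: "\<And>s. s \<in> {0..\<tau>} \<Longrightarrow>
      E' s \<le> (A + B / \<epsilon> * exp (- \<beta> * s / \<epsilon>)) * E s + F * \<epsilon>\<^sup>2 + H * \<epsilon> * exp (- \<beta> * s / \<epsilon>)"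
    and s: "s \<in> {0..\<tau>}"
  shows "E s \<le> \<epsilon>\<^sup>2 * ((F * \<tau> + H / \<beta>) * exp (A * \<tau> + B / \<beta>))"
proof -
  define e where "e s = exp (- \<beta> * s / \<epsilon>)" for s
  define v where "v s = exp (A * s + B / \<beta> * (1 - e s))" for s
  define w where "w s = F * \<epsilon>\<^sup>2 * s + H / \<beta> * \<epsilon>\<^sup>2 * (1 - e s)" for s
  have e: "0 \<le> e s" "e s \<le> 1" if "s \<ge> 0" for s using that pos by (auto simp: e_def)
  have v_ge: "1 \<le> v s" if "s \<ge> 0" for s using e that pos by (auto simp: v_def)
  have de: "(e has_real_derivative (- \<beta> / \<epsilon> * e s)) (at s within X)" for s X
    unfolding e_def using pos by (auto intro!: derivative_eq_intros)
  have dv: "(v has_real_derivative ((A + B / \<epsilon> * e s) * v s)) (at s within X)" for s X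
    unfolding v_def by (rule derivative_eq_intros de refl)+ (use pos in \<open>simp add: field_simps\<close>)
  have dw: "(w has_real_derivative (F * \<epsilon>\<^sup>2 + H * \<epsilon> * e s)) (at s within X)" for s X
    unfolding w_def by (rule derivative_eq_intros de refl)+ (use pos in \<open>simp add: field_simps power2_eq_square\<close>)
  have "E s - v s * w s \<le> 0"
  proof (rule barrier[where L = "A + B / \<epsilon>" and D = "\<lambda>s. E s - v s * w s", OF _ _ _ s])
    have "continuous_on {0..\<tau>} E" by (rule DERIV_continuous_on[OF E])
    moreover have "continuous_on {0..\<tau>} v" "continuous_on {0..\<tau>} w"
      by (rule DERIV_continuous_on[OF dv], rule DERIV_continuous_on[OF dw])
    ultimately show "continuous_on {0..\<tau>} (\<lambda>s. E s - v s * w s)" by (intro continuous_intros)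
    show "E 0 - v 0 * w 0 \<le> 0" using E0 by (simp add: w_def e_def)
    fix s assume s: "0 < s" "s < \<tau>" and gt: "0 < E s - v s * w s"
    have s': "s \<in> {0..\<tau>}" using s by auto
    let ?a = "A + B / \<epsilon> * e s"
    let ?b = "F * \<epsilon>\<^sup>2 + H * \<epsilon> * e s"
    have "DERIV E s :> E' s" using E[OF s'] s by (simp add: at_within_Icc_at)
    then have "DERIV (\<lambda>s. E s - v s * w s) s :> E' s - (?a * v s * w s + ?b * v s)"
      by (intro DERIV_diff DERIV_mult dv dw)
    moreover have "E' s - (?a * v s * w s + ?b * v s) \<le> (A + B / \<epsilon>) * (E s - v s * w s)"
    proof -
      have b: "?b \<ge> 0" using e[of s] s pos by auto
      \<comment> \<open>The product of \<open>v\<close> and \<open>w\<close> solves the equation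
        with the forcing multiplied by \<open>v\<close>. Since \<open>v\<close> is at least 1, this
        product is a supersolution.\<close>
      have "?b * 1 \<le> ?b * v s" by (rule mult_left_mono[OF v_ge b]) (use s in auto)
      moreover have "E' s \<le> ?a * E s + ?b" using ineq[OF s'] by (simp add: e_def)
      moreover have "x' - (a * v * w + b * v) \<le> a * (x - v * w)"
        if "b * 1 \<le> b * v" "x' \<le> a * x + b" for x x' a b v w :: real
        using that by (simp add: algebra_simps)
      ultimately have "E' s - (?a * v s * w s + ?b * v s) \<le> ?a * (E s - v s * w s)" by blast
      also have "\<dots> \<le> (A + B / \<epsilon>) * (E s - v s * w s)"
        using e[of s] s pos gt by (intro mult_right_mono add_left_mono) (auto simp: mult_left_le divide_right_mono)
      finally show ?thesis .
    qed
    ultimately show "\<exists>d. DERIV (\<lambda>s. E s - v s * w s) s :> d \<and> d \<le> (A + B / \<epsilon>) * (E s - v s * w s)"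
      by blast
  qed
  then have "E s \<le> w s * v s" by (simp add: mult.commute)
  also have "\<dots> \<le> (\<epsilon>\<^sup>2 * (F * \<tau> + H / \<beta>)) * exp (A * \<tau> + B / \<beta>)"
  proof (rule mult_mono)
    have "F * \<epsilon>\<^sup>2 * s \<le> F * \<epsilon>\<^sup>2 * \<tau>" "H / \<beta> * \<epsilon>\<^sup>2 * (1 - e s) \<le> H / \<beta> * \<epsilon>\<^sup>2 * 1"
      using e[of s] s pos by (intro mult_left_mono; simp)+
    then show "w s \<le> \<epsilon>\<^sup>2 * (F * \<tau> + H / \<beta>)" by (simp add: w_def algebra_simps)
    have "A * s \<le> A * \<tau>" "B / \<beta> * (1 - e s) \<le> B / \<beta> * 1"
      using e[of s] s pos by (intro mult_left_mono; auto)+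
    then show "v s \<le> exp (A * \<tau> + B / \<beta>)" by (simp add: v_def)
    show "0 \<le> \<epsilon>\<^sup>2 * (F * \<tau> + H / \<beta>)" using pos s by auto
    show "0 \<le> v s" by (simp add: v_def)
  qed
  finally show ?thesis by (simp add: algebra_simps)
qed

lemma young_ineq:
  fixes a b g :: real
  assumes "g > 0"
  shows "a * b \<le> g * b\<^sup>2 + a\<^sup>2 / (4 * g)"
proof -
  have "0 \<le> (2 * g * b - a)\<^sup>2 / (4 * g)" using assms by simp
  also have "\<dots> = g * b\<^sup>2 + a\<^sup>2 / (4 * g) - a * b"
    using assms by (simp add: field_simps power2_eq_square)
  finally show ?thesis by simp
qed

text \<open>\<open>K\<close> is fixed before \<epsilon>, \<tau> and the functions, so that the bound
  applies to partial solutions inside a bootstrap. The inequality for \<open>r\<close> is closed and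
  yields order \<epsilon> at once. Weighting |q|^2 by \<epsilon> cancels the singular factor in its
  equation, and the damping of \<open>q\<close> then pays for the coupling with \<open>p\<close>.
  The energy controls \<open>p\<close> to order \<epsilon>, but \<open>q\<close> only to order sqrt
  \<epsilon>, so the damping of \<open>q\<close> is used once more with \<open>p\<close> already
  known.\<close>

lemma fast_slow_estimate:
  fixes \<gamma> \<beta> c C T :: real
  assumes pos: "\<gamma> > 0" "\<beta> > 0" "c \<ge> 0" "C \<ge> 0" "T \<ge> 0"
  obtains K where "K \<ge> 0"
    "\<And>\<epsilon> \<tau> s (p :: real \<Rightarrow> 'a::real_inner) p' (q :: real \<Rightarrow> 'b::real_inner) q' (r :: real \<Rightarrow> 'c::real_inner) r'.
      0 < \<epsilon> \<Longrightarrow> 0 \<le> \<tau> \<Longrightarrow> \<tau> \<le> T \<Longrightarrow> p 0 = 0 \<Longrightarrow> q 0 = 0 \<Longrightarrow> r 0 = 0 \<Longrightarrow>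
      (\<And>s. s \<in> {0..\<tau>} \<Longrightarrow> (p has_vector_derivative p' s) (at s within {0..\<tau>})) \<Longrightarrow>
      (\<And>s. s \<in> {0..\<tau>} \<Longrightarrow> (q has_vector_derivative q' s) (at s within {0..\<tau>})) \<Longrightarrow>
      (\<And>s. s \<in> {0..\<tau>} \<Longrightarrow> (r has_vector_derivative r' s) (at s within {0..\<tau>})) \<Longrightarrow>
      (\<And>s. s \<in> {0..\<tau>} \<Longrightarrow> p s \<bullet> p' s \<le> C * (norm (p s) + norm (q s) + exp (- \<beta> * s / \<epsilon>)) * norm (p s)) \<Longrightarrow>
      (\<And>s. s \<in> {0..\<tau>} \<Longrightarrow> \<epsilon> * (q s \<bullet> q' s) \<le> (- \<gamma> + c * exp (- \<beta> * s / \<epsilon>)) * (norm (q s))\<^sup>2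
        + C * (norm (p s) + norm (r s) + \<epsilon>) * norm (q s)) \<Longrightarrow>
      (\<And>s. s \<in> {0..\<tau>} \<Longrightarrow> \<epsilon> * (r s \<bullet> r' s) \<le> (- \<gamma> + c * exp (- \<beta> * s / \<epsilon>)) * (norm (r s))\<^sup>2
        + C * \<epsilon> * norm (r s)) \<Longrightarrow>
      s \<in> {0..\<tau>} \<Longrightarrow> norm (p s) \<le> K * \<epsilon> \<and> norm (q s) \<le> K * \<epsilon> \<and> norm (r s) \<le> K * \<epsilon>"
proof -
  \<comment> \<open>\<open>K1\<close>, \<open>K2\<close> and \<open>K3\<close> bound
    \<open>r\<close>, \<open>p\<close> and \<open>q\<close>, in this order. \<open>A\<close> and
    \<open>B\<close> are the regular and the singular growth rate of the energy, and
    \<open>Z\<close> bounds the energy divided by \<epsilon>^2 up to time \<open>T\<close>.\<close>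
  define K1 where "K1 = C / \<gamma> * exp (c / \<beta>)"
  define C2 where "C2 = C * (K1 + 1)"
  define A where "A = 2 * C + 4 * C\<^sup>2 / \<gamma>"
  define B where "B = C + 2 * c"
  define Z where "Z = (C2\<^sup>2 / \<gamma> * T + C / \<beta>) * exp (A * T + B / \<beta>)"
  define K2 where "K2 = sqrt Z"
  define K3 where "K3 = (C * K2 + C2) / \<gamma> * exp (c / \<beta>)"
  have nonneg: "K1 \<ge> 0" "C2 \<ge> 0" "A \<ge> 0" "B \<ge> 0" "Z \<ge> 0" "K2 \<ge> 0" "K3 \<ge> 0"
  proof -
    show K1: "K1 \<ge> 0" using pos by (simp add: K1_def)
    then show C2: "C2 \<ge> 0" using pos by (simp add: C2_def)
    show A: "A \<ge> 0" using pos by (simp add: A_def)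
    show B: "B \<ge> 0" using pos by (simp add: B_def)
    show "Z \<ge> 0" using pos C2 by (simp add: Z_def)
    then show K2: "K2 \<ge> 0" by (simp add: K2_def)
    show "K3 \<ge> 0" using pos C2 K2 by (simp add: K3_def)
  qed
  show ?thesis
  proof (rule that[of "max K1 (max K2 K3)"])
    show "0 \<le> max K1 (max K2 K3)" using nonneg by simp
    fix \<epsilon> \<tau> s0 and p p' :: "real \<Rightarrow> 'a" and q q' :: "real \<Rightarrow> 'b" and r r' :: "real \<Rightarrow> 'c"
    assume \<epsilon>: "0 < \<epsilon>" and \<tau>: "0 \<le> \<tau>" "\<tau> \<le> T" and init: "p 0 = 0" "q 0 = 0" "r 0 = 0"
      and dp: "\<And>s. s \<in> {0..\<tau>} \<Longrightarrow> (p has_vector_derivative p' s) (at s within {0..\<tau>})"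
      and dq: "\<And>s. s \<in> {0..\<tau>} \<Longrightarrow> (q has_vector_derivative q' s) (at s within {0..\<tau>})"
      and dr: "\<And>s. s \<in> {0..\<tau>} \<Longrightarrow> (r has_vector_derivative r' s) (at s within {0..\<tau>})"
      and ip: "\<And>s. s \<in> {0..\<tau>} \<Longrightarrow> p s \<bullet> p' s \<le> C * (norm (p s) + norm (q s) + exp (- \<beta> * s / \<epsilon>)) * norm (p s)"
      and iq: "\<And>s. s \<in> {0..\<tau>} \<Longrightarrow> \<epsilon> * (q s \<bullet> q' s) \<le> (- \<gamma> + c * exp (- \<beta> * s / \<epsilon>)) * (norm (q s))\<^sup>2
        + C * (norm (p s) + norm (r s) + \<epsilon>) * norm (q s)"
      and ir: "\<And>s. s \<in> {0..\<tau>} \<Longrightarrow> \<epsilon> * (r s \<bullet> r' s) \<le> (- \<gamma> + c * exp (- \<beta> * s / \<epsilon>)) * (norm (r s))\<^sup>2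
        + C * \<epsilon> * norm (r s)"
      and s0: "s0 \<in> {0..\<tau>}"
    have r_bound: "norm (r s) \<le> K1 * \<epsilon>" if "s \<in> {0..\<tau>}" for s
      using fast_bound[OF \<epsilon> pos(1-3) _ dr ir that] \<epsilon> pos init by (simp add: K1_def algebra_simps)
    have iq2: "\<epsilon> * (q s \<bullet> q' s) \<le> (- \<gamma> + c * exp (- \<beta> * s / \<epsilon>)) * (norm (q s))\<^sup>2
        + (C * norm (p s) + C2 * \<epsilon>) * norm (q s)" if s: "s \<in> {0..\<tau>}" for s
    proof -
      have "C * (norm (p s) + norm (r s) + \<epsilon>) \<le> C * (norm (p s) + K1 * \<epsilon> + \<epsilon>)"
        using r_bound[OF s] pos by (intro mult_left_mono) auto
      also have "\<dots> = C * norm (p s) + C2 * \<epsilon>" by (simp add: C2_def algebra_simps)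
      finally have "C * (norm (p s) + norm (r s) + \<epsilon>) * norm (q s) \<le> (C * norm (p s) + C2 * \<epsilon>) * norm (q s)"
        by (intro mult_right_mono) auto
      then show ?thesis using iq[OF s] by linarith
    qed
    define E where "E s = p s \<bullet> p s + \<epsilon> * (q s \<bullet> q s)" for s
    define E' where "E' s = 2 * (p s \<bullet> p' s) + 2 * (\<epsilon> * (q s \<bullet> q' s))" for s
    have dE: "(E has_real_derivative E' s) (at s within {0..\<tau>})" if s: "s \<in> {0..\<tau>}" for s
    proof -
      have "((\<lambda>s. p s \<bullet> p s) has_real_derivative 2 * (p s \<bullet> p' s)) (at s within {0..\<tau>})"
        using bounded_bilinear.has_vector_derivative[OF bounded_bilinear_inner dp[OF s] dp[OF s]]
        by (simp add: has_real_derivative_iff_has_vector_derivative inner_commute)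
      moreover have "((\<lambda>s. q s \<bullet> q s) has_real_derivative 2 * (q s \<bullet> q' s)) (at s within {0..\<tau>})"
        using bounded_bilinear.has_vector_derivative[OF bounded_bilinear_inner dq[OF s] dq[OF s]]
        by (simp add: has_real_derivative_iff_has_vector_derivative inner_commute)
      ultimately show ?thesis unfolding E_def E'_def
        by (auto intro!: derivative_eq_intros)
    qed
    have iE: "E' s \<le> (A + B / \<epsilon> * exp (- \<beta> * s / \<epsilon>)) * E s + (C2\<^sup>2 / \<gamma>) * \<epsilon>\<^sup>2 + C * \<epsilon> * exp (- \<beta> * s / \<epsilon>)"
      if s: "s \<in> {0..\<tau>}" for s
    proof -
      define e where "e = exp (- \<beta> * s / \<epsilon>)"
      define x where "x = norm (p s)"
      define y where "y = norm (q s)"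
      have nn: "e \<ge> 0" "x \<ge> 0" "y \<ge> 0" by (auto simp: e_def x_def y_def)
      have Es: "E s = x\<^sup>2 + \<epsilon> * y\<^sup>2" by (simp add: E_def x_def y_def power2_norm_eq_inner)
      have "E' s \<le> 2 * (C * (x + y + e) * x) + 2 * ((- \<gamma> + c * e) * y\<^sup>2 + (C * x + C2 * \<epsilon>) * y)"
        unfolding E'_def e_def x_def y_def
        by (rule add_mono[OF mult_left_mono[OF ip[OF s]] mult_left_mono[OF iq2[OF s]]]) simp_all
      also have "\<dots> = 2 * C * x\<^sup>2 + (4 * C * x) * y + C * e * (2 * x) - 2 * \<gamma> * y\<^sup>2 + 2 * c * e * y\<^sup>2 + (2 * C2 * \<epsilon>) * y"
        by (simp add: algebra_simps power2_eq_square)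
      \<comment> \<open>The two available units of \<gamma> |q|^2 are spent by Young's inequality,
        one on the coupling with \<open>p\<close> and one on the forcing of order \<epsilon>. The
        layer term is split as 2 x \<le> \<epsilon> + x^2 / \<epsilon>: the first part is integrable
        forcing, the second belongs to the singular rate.\<close>
      also have "\<dots> \<le> 2 * C * x\<^sup>2 + (\<gamma> * y\<^sup>2 + (4 * C * x)\<^sup>2 / (4 * \<gamma>)) + C * e * (\<epsilon> + x\<^sup>2 / \<epsilon>) - 2 * \<gamma> * y\<^sup>2
          + 2 * c * e * y\<^sup>2 + (\<gamma> * y\<^sup>2 + (2 * C2 * \<epsilon>)\<^sup>2 / (4 * \<gamma>))"
      proof -
        have "2 * x \<le> \<epsilon> + x\<^sup>2 / \<epsilon>"
          using sum_squares_ge_zero[of "x - \<epsilon>" 0] \<epsilon> by (simp add: field_simps power2_eq_square)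
        then have "C * e * (2 * x) \<le> C * e * (\<epsilon> + x\<^sup>2 / \<epsilon>)" using pos nn by (intro mult_left_mono) auto
        then show ?thesis
          using young_ineq[OF pos(1), of "4 * C * x" y] young_ineq[OF pos(1), of "2 * C2 * \<epsilon>" y] by linarith
      qed
      also have "\<dots> = A * x\<^sup>2 + (C / \<epsilon> * e) * x\<^sup>2 + (2 * c / \<epsilon> * e) * (\<epsilon> * y\<^sup>2) + (C2\<^sup>2 / \<gamma>) * \<epsilon>\<^sup>2 + C * \<epsilon> * e"
        using \<epsilon> pos by (simp add: A_def field_simps power2_eq_square)
      also have "\<dots> \<le> A * E s + (C / \<epsilon> * e) * E s + (2 * c / \<epsilon> * e) * E s + (C2\<^sup>2 / \<gamma>) * \<epsilon>\<^sup>2 + C * \<epsilon> * e"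
        unfolding Es using \<epsilon> pos nn nonneg by (intro add_mono mult_left_mono order_refl) auto
      also have "\<dots> = (A + B / \<epsilon> * e) * E s + (C2\<^sup>2 / \<gamma>) * \<epsilon>\<^sup>2 + C * \<epsilon> * e"
        by (simp add: B_def algebra_simps add_divide_distrib)
      finally show ?thesis by (simp add: e_def)
    qed
    have p_bound: "norm (p s) \<le> K2 * \<epsilon>" if s: "s \<in> {0..\<tau>}" for s
    proof -
      have "(norm (p s))\<^sup>2 \<le> E s" using \<epsilon> by (simp add: E_def power2_norm_eq_inner)
      also have "E s \<le> \<epsilon>\<^sup>2 * ((C2\<^sup>2 / \<gamma> * \<tau> + C / \<beta>) * exp (A * \<tau> + B / \<beta>))"
        using energy_bound[OF \<epsilon> pos(2) _ _ _ _ dE _ iE s] nonneg pos init by (simp add: E_def)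
      also have "\<dots> \<le> \<epsilon>\<^sup>2 * Z"
        unfolding Z_def using nonneg pos \<tau> by (intro mult_left_mono mult_mono add_mono) (auto simp: mult_left_mono)
      also have "\<dots> = (K2 * \<epsilon>)\<^sup>2" using nonneg by (simp add: K2_def power_mult_distrib)
      finally show ?thesis by (rule power2_le_imp_le) (use nonneg \<epsilon> in auto)
    qed
    have q_bound: "norm (q s) \<le> K3 * \<epsilon>" if s: "s \<in> {0..\<tau>}" for s
    proof -
      have "norm (q s) \<le> ((C * K2 + C2) * \<epsilon> / \<gamma> + norm (q 0)) * exp (c / \<beta>)"
      proof (rule fast_bound[OF \<epsilon> pos(1-3) _ dq _ s])
        show "0 \<le> (C * K2 + C2) * \<epsilon>" using nonneg pos \<epsilon> by simp
        fix s assume s: "s \<in> {0..\<tau>}"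
        have "C * norm (p s) \<le> C * (K2 * \<epsilon>)" using p_bound[OF s] pos by (intro mult_left_mono)
        then have "C * norm (p s) + C2 * \<epsilon> \<le> (C * K2 + C2) * \<epsilon>" by (simp add: algebra_simps)
        then have "(C * norm (p s) + C2 * \<epsilon>) * norm (q s) \<le> (C * K2 + C2) * \<epsilon> * norm (q s)"
          by (intro mult_right_mono) auto
        then show "\<epsilon> * (q s \<bullet> q' s) \<le> (- \<gamma> + c * exp (- \<beta> * s / \<epsilon>)) * (norm (q s))\<^sup>2
            + (C * K2 + C2) * \<epsilon> * norm (q s)"
          using iq2[OF s] by linarith
      qed
      then show ?thesis using init by (simp add: K3_def algebra_simps)
    qed
    have "K1 * \<epsilon> \<le> max K1 (max K2 K3) * \<epsilon>" "K2 * \<epsilon> \<le> max K1 (max K2 K3) * \<epsilon>" "K3 * \<epsilon> \<le> max K1 (max K2 K3) * \<epsilon>"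
      using \<epsilon> by (intro mult_right_mono; simp)+
    then show "norm (p s0) \<le> max K1 (max K2 K3) * \<epsilon> \<and> norm (q s0) \<le> max K1 (max K2 K3) * \<epsilon>
        \<and> norm (r s0) \<le> max K1 (max K2 K3) * \<epsilon>"
      using p_bound[OF s0] q_bound[OF s0] r_bound[OF s0] by linarith
  qed
qed

section \<open>The boundary layer\<close>

text \<open>\<open>\<rho>\<close> is the radius of the ball in assumption (v), and
  \<open>ball_dissipative\<close> expresses in quadratic forms that the ball lies in the admissible
  region. \<open>R_small\<close> places the starting point \<open>- R\<close> of the layer strictly
  inside.\<close>

locale riccati_layer =
  fixes G :: "('n1::finite, 'n2::finite, 'k1::finite, 'k2::finite, 'm1::finite, 'm2::finite) game"
    and R :: "real^'n2^'n2" and \<gamma> \<delta> \<rho> :: real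
  assumes inv_Delta2: "invertible (Delta2 G)"
    and R_sym: "transpose R = R"
    and R_riccati: "transpose (A22 G) ** R + R ** A22 G + R ** Delta2 G ** R + Q2 G = 0"
    and S_dissipative: "((A22 G + Delta2 G ** R) *v x) \<bullet> x \<le> - \<gamma> * (x \<bullet> x)"
    and ball_dissipative: "transpose P = P \<Longrightarrow> norm P \<le> \<rho> \<Longrightarrow>
      ((A22 G + Delta2 G ** R + Delta2 G ** P) *v x) \<bullet> x \<le> \<delta> * (x \<bullet> x)"
    and R_small: "norm R < \<rho>"
    and \<delta>_pos: "0 < \<delta>" and \<delta>_less: "\<delta> < \<gamma>"
begin

definition S where "S = A22 G + Delta2 G ** R"
definition \<beta> where "\<beta> = \<gamma> - \<delta>"
definition h where "h = h_map G R"
text \<open>\<open>\<phi>\<close> and \<open>\<psi>\<close> are the fast right-hand sides at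
  \<epsilon> = 0 with the slow variable frozen at 0, in coordinates centred at the equilibrium
  \<open>(h 0, R)\<close>.\<close>

definition \<phi> where "\<phi> r = transpose S ** r + r ** S + r ** Delta2 G ** r"
definition \<psi> where "\<psi> q r = q ** (S + Delta2 G ** r) + (transpose (A21 G) + h 0 ** Delta2 G) ** r"

lemma \<gamma>_pos: "\<gamma> > 0" and \<beta>_pos: "\<beta> > 0" using \<delta>_pos \<delta>_less by (auto simp: \<beta>_def)

lemma S_le: "(S *v x) \<bullet> x \<le> - \<gamma> * (x \<bullet> x)" using S_dissipative by (simp add: S_def)

lemma inv_S: "invertible S" by (rule invertible_of_negative_sym_part[OF S_le \<gamma>_pos])

lemma transpose_S: "transpose S = transpose (A22 G) + R ** Delta2 G"
  by (simp add: S_def mat_expand R_sym transpose_Delta2)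

lemma h_S: "h p ** S = - (transpose (A21 G) ** R + p ** A12 G + p ** Delta G ** R)"
proof -
  have "h p ** S = - ((transpose (A21 G) ** R + p ** A12 G + p ** Delta G ** R) ** (matrix_inv S ** S))"
    by (simp add: h_def h_map_def S_def[symmetric] bounded_bilinear.minus_left[OF bounded_bilinear_matrix_mult]
        matrix_mul_assoc)
  then show ?thesis by (simp add: matrix_inv_mult(2)[OF inv_S])
qed

text \<open>\<open>h p\<close> is the zero of \<open>ric_g1\<close> in its second argument when
  \<open>P22 = R\<close> and \<epsilon> = 0, so only terms that vanish with \<open>q\<close> or with
  \<open>r\<close> survive. The slow variable \<open>p\<close> is kept general, because the
  difference to its frozen value 0 has to be estimated later.\<close>

lemma ric_g1_expand:
  "ric_g1 G p (q + h p) (r + R) 0 =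
    q ** (S + Delta2 G ** r) + (transpose (A21 G) + p ** Delta G + h p ** Delta2 G) ** r"
proof -
  have "ric_g1 G p (q + h p) (r + R) 0 = q ** (S + Delta2 G ** r)
      + (transpose (A21 G) + p ** Delta G + h p ** Delta2 G) ** r
      + (h p ** S + (transpose (A21 G) ** R + p ** A12 G + p ** Delta G ** R))"
    by (simp add: ric_g1_def S_def mat_expand)
  then show ?thesis by (simp add: h_S)
qed

lemma ric_g1_layer: "ric_g1 G 0 (q + h 0) (r + R) 0 = \<psi> q r"
  by (simp add: ric_g1_expand \<psi>_def)

lemma ric_g2_layer: "ric_g2 G p q (r + R) 0 = \<phi> r"
proof -
  have "ric_g2 G p q (r + R) 0 = \<phi> r + (transpose (A22 G) ** R + R ** A22 G + R ** Delta2 G ** R + Q2 G)"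
    by (simp add: ric_g2_def \<phi>_def transpose_S) (simp add: S_def mat_expand)
  then show ?thesis by (simp add: R_riccati)
qed

lemma lip_bdd_\<phi> [lip_bdd_intros]: "lip_bdd f \<Longrightarrow> lip_bdd (\<lambda>x. \<phi> (f x))"
  unfolding \<phi>_def by (intro lip_bdd_intros)

lemma lip_bdd_\<psi> [lip_bdd_intros]: "lip_bdd f \<Longrightarrow> lip_bdd g \<Longrightarrow> lip_bdd (\<lambda>x. \<psi> (f x) (g x))"
  unfolding \<psi>_def by (intro lip_bdd_intros)

lemma \<phi>_transpose: "\<phi> (transpose r) = transpose (\<phi> r)"
  by (simp add: \<phi>_def mat_expand transpose_Delta2)

text \<open>The quadratic term is paired with only one of the two linear ones:
  \<open>transpose S ** r\<close> contributes - \<gamma>, and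
  \<open>r ** (S + Delta2 G ** r)\<close> contributes \<delta> by the ball condition. The sum is the
  decay rate \<beta> = \<gamma> - \<delta>.\<close>

lemma inner_\<phi>_le:
  assumes "transpose r = r" "norm r \<le> \<rho>"
  shows "r \<bullet> \<phi> r \<le> - \<beta> * (norm r)\<^sup>2"
proof -
  have "r \<bullet> \<phi> r = (transpose S ** r) \<bullet> r + (r ** (S + Delta2 G ** r)) \<bullet> r"
    by (simp add: \<phi>_def mat_expand inner_add_right inner_commute)
  also have "\<dots> \<le> - \<gamma> * (r \<bullet> r) + \<delta> * (r \<bullet> r)"
    by (intro add_mono inner_mult_left_le inner_mult_right_le S_le)
      (use ball_dissipative[OF assms] in \<open>simp add: S_def\<close>)
  finally show ?thesis by (simp add: \<beta>_def power2_norm_eq_inner algebra_simps)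
qed

text \<open>The ball condition speaks about symmetric matrices, so symmetry has to come first: the
  transpose solves the same equation from the same initial value. Afterwards
  \<open>inner_\<phi>_le\<close> gives exponential decay.\<close>

lemma layer22_bounds:
  assumes y0: "y 0 = - R"
    and y: "\<And>t. t \<in> {0..T} \<Longrightarrow> (y has_vector_derivative \<phi> (y t)) (at t within {0..T})"
    and small: "\<And>t. t \<in> {0..T} \<Longrightarrow> norm (y t) \<le> \<rho>"
    and t: "t \<in> {0..T}"
  shows "transpose (y t) = y t" "norm (y t) \<le> norm R * exp (- \<beta> * t)"
proof -
  have sym: "transpose (y t) = y t" if t: "t \<in> {0..T}" for t
  proof (rule ode_unique_lipschitz[where F = "\<lambda>_. \<phi>" and z = y and y = "\<lambda>t. transpose (y t)", OF _ y _ _ t])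
    fix s assume s: "s \<in> {0..T}"
    show "((\<lambda>t. transpose (y t)) has_vector_derivative \<phi> (transpose (y s))) (at s within {0..T})"
      unfolding \<phi>_transpose by (rule bounded_linear.has_vector_derivative[OF bounded_linear_transpose y[OF s]])
  next
    show "transpose (y 0) = y 0" by (simp add: y0 mat_expand R_sym)
    show "\<exists>L. \<forall>t\<in>{0..T}. L-lipschitz_on (cball 0 Ra) \<phi>" for Ra
      using lip_bdd_\<phi>[OF lip_bdd_ident] unfolding lip_bdd_def by blast
  qed
  then show "transpose (y t) = y t" using t .
  show "norm (y t) \<le> norm R * exp (- \<beta> * t)"
  proof (rule norm_comparison[where L = "- \<beta>" and u = "\<lambda>t. norm R * exp (- \<beta> * t)"
        and u' = "\<lambda>t. - \<beta> * (norm R * exp (- \<beta> * t))", OF y _ _ _ _ t])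
    fix s assume s: "s \<in> {0..T}"
    show "((\<lambda>t. norm R * exp (- \<beta> * t)) has_real_derivative - \<beta> * (norm R * exp (- \<beta> * s))) (at s within {0..T})"
      by (auto intro!: derivative_eq_intros)
    show "y s \<bullet> \<phi> (y s) \<le> (- \<beta> * (norm R * exp (- \<beta> * s)) + - \<beta> * (norm (y s) - norm R * exp (- \<beta> * s))) * norm (y s)"
      using inner_\<phi>_le[OF sym[OF s] small[OF s]] by (simp add: algebra_simps power2_eq_square)
  qed (simp_all add: y0)
qed

text \<open>Decay keeps the norm below \<open>norm R\<close>, hence strictly below \<rho>, so the
  tube of radius \<rho> around 0 is never left.\<close>

lemma layer22_exists:
  assumes T: "T \<ge> 0"
  obtains y where "y 0 = - R" "\<And>t. t \<in> {0..T} \<Longrightarrow> (y has_vector_derivative \<phi> (y t)) (at t within {0..T})"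
    "\<And>t. t \<in> {0..T} \<Longrightarrow> norm (y t) \<le> \<rho>"
proof (rule tube_existence[where F = "\<lambda>_. \<phi>" and ?y0.0 = "- R" and c = "\<lambda>_. 0" and \<eta> = \<rho> and T = T])
  have "continuous_on UNIV \<phi>" by (rule continuous_on_lip_bdd[OF lip_bdd_\<phi>[OF lip_bdd_ident]])
  then show "continuous_on ({0..T} \<times> UNIV) (\<lambda>(t, x). \<phi> x)"
    unfolding case_prod_beta by (rule continuous_on_compose2) (auto intro!: continuous_intros)
  show "\<exists>L. \<forall>t\<in>{0..T}. L-lipschitz_on (cball 0 Ra) \<phi>" for Ra
    using lip_bdd_\<phi>[OF lip_bdd_ident] unfolding lip_bdd_def by blast
  show "norm (- R - 0) < \<rho>" using R_small by simp
next
  fix \<tau> y assume \<tau>: "\<tau> \<in> {0..T}" and y: "y 0 = - R"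
    "\<And>t. t \<in> {0..\<tau>} \<Longrightarrow> (y has_vector_derivative \<phi> (y t)) (at t within {0..\<tau>})"
    "\<And>t. t \<in> {0..\<tau>} \<Longrightarrow> norm (y t - 0) \<le> \<rho>"
  have "norm (y \<tau>) \<le> norm R * exp (- \<beta> * \<tau>)"
    by (rule layer22_bounds(2)[of y \<tau>]) (use y \<tau> in auto)
  also have "\<dots> \<le> norm R" using \<tau> \<beta>_pos by (simp add: mult_left_le)
  finally show "norm (y \<tau> - 0) < \<rho>" using R_small by simp
qed (use T that in auto)

text \<open>By uniqueness any solution coincides with the one constructed inside the ball, which
  discharges the smallness assumption of \<open>layer22_bounds\<close>.\<close>

lemma layer22_unique_bounds:
  assumes y0: "y 0 = - R"
    and y: "\<And>t. t \<in> {0..T} \<Longrightarrow> (y has_vector_derivative \<phi> (y t)) (at t within {0..T})"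
    and t: "t \<in> {0..T}"
  shows "norm (y t) \<le> norm R * exp (- \<beta> * t)"
proof -
  have "T \<ge> 0" using t by auto
  then obtain z where z: "z 0 = - R" "\<And>t. t \<in> {0..T} \<Longrightarrow> (z has_vector_derivative \<phi> (z t)) (at t within {0..T})"
    "\<And>t. t \<in> {0..T} \<Longrightarrow> norm (z t) \<le> \<rho>" using layer22_exists by blast
  have "y t = z t"
    by (rule ode_unique_lipschitz[where F = "\<lambda>_. \<phi>", OF y z(2) _ _ t])
      (use y0 z lip_bdd_\<phi>[OF lip_bdd_ident] in \<open>auto simp: lip_bdd_def\<close>)
  then show ?thesis using layer22_bounds(2)[OF z t] by simp
qed

text \<open>The system is triangular. The quadratic equation for the second component is solved
  inside the ball; given that solution, the equation for the first component is affine with bounded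
  coefficients, and Picard iteration applies globally.\<close>

lemma layer_exists:
  obtains y where "y 0 = (- h 0, - R)"
    "\<And>t. t \<ge> 0 \<Longrightarrow> (y has_vector_derivative (\<psi> (fst (y t)) (snd (y t)), \<phi> (snd (y t)))) (at t within {0..})"
proof (rule ode_glue[where F = "\<lambda>_ x. (\<psi> (fst x) (snd x), \<phi> (snd x))" and ?y0.0 = "(- h 0, - R)"])
  have lb: "lip_bdd (\<lambda>x. (\<psi> (fst x) (snd x), \<phi> (snd x)))" by (intro lip_bdd_intros)
  show "\<exists>L. \<forall>t\<in>{0..T}. L-lipschitz_on (cball 0 Ra) (\<lambda>x. (\<psi> (fst x) (snd x), \<phi> (snd x)))" for T Ra :: real
    using lb unfolding lip_bdd_def by blast
  fix T :: real assume T: "T \<ge> 0"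
  obtain r where r: "r 0 = - R" "\<And>t. t \<in> {0..T} \<Longrightarrow> (r has_vector_derivative \<phi> (r t)) (at t within {0..T})"
    "\<And>t. t \<in> {0..T} \<Longrightarrow> norm (r t) \<le> \<rho>" using layer22_exists[OF T] by blast
  have contr: "continuous_on {0..T} r" by (rule has_vector_derivative_continuous_on[OF r(2)])
  have "continuous_on ({0..T} \<times> UNIV) (\<lambda>p. (snd p, r (fst p)))"
    by (intro continuous_intros continuous_on_compose2[OF contr]) auto
  moreover have "continuous_on UNIV (\<lambda>x. \<psi> (fst x) (snd x))"
    by (intro continuous_on_lip_bdd lip_bdd_intros)
  ultimately have cont: "continuous_on ({0..T} \<times> UNIV) (\<lambda>(t, q). \<psi> q (r t))"
    using continuous_on_compose2[of UNIV "\<lambda>x. \<psi> (fst x) (snd x)"] by (fastforce simp: case_prod_beta)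
  have lip: "(norm S + norm (Delta2 G) * \<rho>)-lipschitz_on UNIV (\<lambda>q. \<psi> q (r t))" if t: "t \<in> {0..T}" for t
  proof (rule lipschitz_onI)
    have "\<rho> > 0" using R_small norm_ge_zero[of R] by linarith
    then show "0 \<le> norm S + norm (Delta2 G) * \<rho>" by simp
    fix x y
    have "norm (\<psi> x (r t) - \<psi> y (r t)) = norm ((x - y) ** (S + Delta2 G ** r t))"
      by (simp add: \<psi>_def bounded_bilinear.diff_left[OF bounded_bilinear_matrix_mult])
    also have "\<dots> \<le> norm (x - y) * (norm S + norm (Delta2 G) * \<rho>)"
      by (intro order_trans[OF norm_matrix_mult_le] mult_left_mono order_trans[OF norm_triangle_ineq] add_mono
          order_refl order_trans[OF norm_matrix_mult_le] r(3)[OF t]) auto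
    finally show "dist (\<psi> x (r t)) (\<psi> y (r t)) \<le> (norm S + norm (Delta2 G) * \<rho>) * dist x y"
      by (simp add: dist_norm mult.commute)
  qed
  obtain q where q: "q 0 = - h 0" "\<And>t. t \<in> {0..T} \<Longrightarrow> (q has_vector_derivative \<psi> (q t) (r t)) (at t within {0..T})"
    using picard_solution[OF cont lip T, of "- h 0"] by metis
  show "\<exists>y. y 0 = (- h 0, - R) \<and>
      (\<forall>t\<in>{0..T}. (y has_vector_derivative (\<psi> (fst (y t)) (snd (y t)), \<phi> (snd (y t)))) (at t within {0..T}))"
    by (rule exI[of _ "\<lambda>t. (q t, r t)"]) (use q r in \<open>auto intro!: has_vector_derivative_Pair\<close>)
qed (use that in auto)

text \<open>The first component is damped at rate \<gamma> but driven by the second one, which is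
  only known to decay at rate \<beta>. The surplus \<delta> = \<gamma> - \<beta> of damping makes
  both components decay at the common rate \<beta>.\<close>

lemma boundary_layer_exists:
  obtains Ph12 Ph22 K where "boundary_layer G R Ph12 Ph22" "K \<ge> 0"
    "\<And>\<tau>. \<tau> \<ge> 0 \<Longrightarrow> norm (Ph12 \<tau>) \<le> K * exp (- \<beta> * \<tau>)"
    "\<And>\<tau>. \<tau> \<ge> 0 \<Longrightarrow> norm (Ph22 \<tau>) \<le> K * exp (- \<beta> * \<tau>)"
proof -
  obtain y where y0: "y 0 = (- h 0, - R)"
    and y: "\<And>t. t \<ge> 0 \<Longrightarrow> (y has_vector_derivative (\<psi> (fst (y t)) (snd (y t)), \<phi> (snd (y t)))) (at t within {0..})"
    using layer_exists by blast
  define q where "q t = fst (y t)" for t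
  define r where "r t = snd (y t)" for t
  have dq: "(q has_vector_derivative \<psi> (q t) (r t)) (at t within {0..})" if "t \<ge> 0" for t
    unfolding q_def r_def using bounded_linear.has_vector_derivative[OF bounded_linear_fst y[OF that]] by simp
  have dr: "(r has_vector_derivative \<phi> (r t)) (at t within {0..})" if "t \<ge> 0" for t
    unfolding r_def using bounded_linear.has_vector_derivative[OF bounded_linear_snd y[OF that]] by simp
  have rb: "norm (r t) \<le> norm R * exp (- \<beta> * t)" if "t \<ge> 0" for t
  proof (rule layer22_unique_bounds[where T = t])
    fix s assume "s \<in> {0..t}"
    then show "(r has_vector_derivative \<phi> (r s)) (at s within {0..t})"
      by (intro has_vector_derivative_within_subset[OF dr]) auto
  qed (use y0 that in \<open>auto simp: r_def\<close>)
  define c where "c = norm (Delta2 G) * norm R"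
  define c' where "c' = norm (transpose (A21 G) + h 0 ** Delta2 G) * norm R"
  \<comment> \<open>The first entry covers the initial value. The second ensures
    \<open>c' \<le> \<delta> * k\<close>, so that the surplus damping absorbs the forcing c' exp(-
    \<beta> s).\<close>
  define k where "k = max (norm (h 0)) (c' / \<delta>)"
  have nn: "c \<ge> 0" "c' \<ge> 0" "k \<ge> 0" by (auto simp: c_def c'_def k_def le_max_iff_disj)
  have qb: "norm (q t) \<le> k * exp (c / \<beta>) * exp (- \<beta> * t)" if t: "t \<ge> 0" for t
  proof -
    \<comment> \<open>The factor with c / \<beta> stays bounded and pays for the product of
      \<open>q\<close> with the decaying \<open>r\<close>; the remaining factor is the desired
      decay.\<close>
    define u where "u s = k * exp (c / \<beta> * (1 - exp (- \<beta> * s)) - \<beta> * s)" for s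
    have "norm (q t) \<le> u t"
    proof (rule norm_comparison[where T = t and L = c and y = q and u = u
          and y' = "\<lambda>s. \<psi> (q s) (r s)" and u' = "\<lambda>s. u s * (c * exp (- \<beta> * s) - \<beta>)"])
      fix s assume s: "s \<in> {0..t}"
      show "(q has_vector_derivative \<psi> (q s) (r s)) (at s within {0..t})"
        by (rule has_vector_derivative_within_subset[OF dq]) (use s in auto)
      show "(u has_real_derivative u s * (c * exp (- \<beta> * s) - \<beta>)) (at s within {0..t})"
        unfolding u_def
        by (rule derivative_eq_intros refl)+ (use \<beta>_pos in \<open>simp add: field_simps\<close>)
      show "0 \<le> u s" using nn by (simp add: u_def)
      assume gt: "u s < norm (q s)"
      define e where "e = exp (- \<beta> * s)"
      have e: "0 \<le> e" "e \<le> 1" using s \<beta>_pos by (auto simp: e_def)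
      let ?n = "norm (q s)"
      have "q s \<bullet> \<psi> (q s) (r s) = (q s ** S) \<bullet> q s + q s \<bullet> (q s ** (Delta2 G ** r s))
          + q s \<bullet> ((transpose (A21 G) + h 0 ** Delta2 G) ** r s)"
        by (simp add: \<psi>_def bounded_bilinear.add_right[OF bounded_bilinear_matrix_mult] inner_add_right inner_commute)
      also have "\<dots> \<le> - \<gamma> * (q s \<bullet> q s) + ?n * (?n * (norm (Delta2 G) * (norm R * e)))
          + ?n * (norm (transpose (A21 G) + h 0 ** Delta2 G) * (norm R * e))"
        by (intro add_mono inner_mult_right_le S_le order_trans[OF norm_cauchy_schwarz] mult_left_mono
            order_trans[OF norm_matrix_mult_le] rb[unfolded e_def[symmetric]])
          (use rb[of s] s in \<open>auto simp: e_def\<close>)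
      also have "\<dots> = (- \<gamma> * ?n + c * e * ?n + c' * e) * ?n"
        by (simp add: c_def c'_def algebra_simps power2_norm_eq_inner[symmetric] power2_eq_square)
      also have "\<dots> \<le> (u s * (c * e - \<beta>) + c * (?n - u s)) * ?n"
      proof (rule mult_right_mono)
        have "c' * e \<le> \<delta> * u s"
        proof -
          have "c' \<le> \<delta> * k" using \<delta>_pos by (simp add: k_def pos_divide_le_eq[symmetric] mult.commute[of \<delta>] le_max_iff_disj)
          moreover have "k * e \<le> u s"
          proof -
            have "exp (- \<beta> * s) \<le> exp (c / \<beta> * (1 - exp (- \<beta> * s)) - \<beta> * s)"
              using e nn \<beta>_pos by (simp add: e_def)
            then show ?thesis unfolding u_def e_def using nn by (intro mult_left_mono)
          qed
          ultimately have "c' * e \<le> \<delta> * k * e" "\<delta> * (k * e) \<le> \<delta> * u s"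
            using e \<delta>_pos by (auto intro!: mult_right_mono mult_left_mono)
          then show ?thesis by simp
        qed
        moreover have "\<gamma> * u s \<le> \<gamma> * ?n" using gt \<gamma>_pos by simp
        moreover have "c * e * (?n - u s) \<le> c * 1 * (?n - u s)"
          using e nn gt by (intro mult_right_mono mult_left_mono) auto
        ultimately show "- \<gamma> * ?n + c * e * ?n + c' * e \<le> u s * (c * e - \<beta>) + c * (?n - u s)"
          by (simp add: \<beta>_def algebra_simps)
      qed simp
      finally show "q s \<bullet> \<psi> (q s) (r s) \<le> (u s * (c * exp (- \<beta> * s) - \<beta>) + c * (?n - u s)) * ?n"
        by (simp add: e_def)
    next
      show "norm (q 0) \<le> u 0" by (simp add: u_def q_def y0 k_def)
    qed (use t in auto)
    also have "u t \<le> k * (exp (c / \<beta>) * exp (- \<beta> * t))"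
      unfolding u_def exp_add[symmetric] using nn \<beta>_pos t
      by (intro mult_left_mono) (auto simp: mult_left_le divide_right_mono)
    finally show ?thesis by simp
  qed
  show ?thesis
  proof (rule that[of q r "max (norm R) (k * exp (c / \<beta>))"])
    show "boundary_layer G R q r"
      using dq dr y0 ric_g1_layer ric_g2_layer unfolding boundary_layer_def h_def by (simp add: q_def r_def)
    show "0 \<le> max (norm R) (k * exp (c / \<beta>))" by (simp add: le_max_iff_disj)
    fix t :: real assume t: "t \<ge> 0"
    show "norm (q t) \<le> max (norm R) (k * exp (c / \<beta>)) * exp (- \<beta> * t)"
      by (rule order_trans[OF qb[OF t]]) (intro mult_right_mono; simp)
    show "norm (r t) \<le> max (norm R) (k * exp (c / \<beta>)) * exp (- \<beta> * t)"
      by (rule order_trans[OF rb[OF t]]) (intro mult_right_mono; simp)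
  qed
qed

end

section \<open>The Tikhonov estimate\<close>

lemma lip_bdd_ric_f [lip_bdd_intros]:
  "lip_bdd p \<Longrightarrow> lip_bdd q \<Longrightarrow> lip_bdd r \<Longrightarrow> lip_bdd e \<Longrightarrow> lip_bdd (\<lambda>x. ric_f G (p x) (q x) (r x) (e x))"
  unfolding ric_f_def by (intro lip_bdd_intros)

lemma lip_bdd_ric_g1 [lip_bdd_intros]:
  "lip_bdd p \<Longrightarrow> lip_bdd q \<Longrightarrow> lip_bdd r \<Longrightarrow> lip_bdd e \<Longrightarrow> lip_bdd (\<lambda>x. ric_g1 G (p x) (q x) (r x) (e x))"
  unfolding ric_g1_def by (intro lip_bdd_intros)

lemma lip_bdd_ric_g2 [lip_bdd_intros]:
  "lip_bdd p \<Longrightarrow> lip_bdd q \<Longrightarrow> lip_bdd r \<Longrightarrow> lip_bdd e \<Longrightarrow> lip_bdd (\<lambda>x. ric_g2 G (p x) (q x) (r x) (e x))"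
  unfolding ric_g2_def power2_eq_square
  by (intro lip_bdd_intros lip_bdd_bilinear[OF bounded_bilinear_mult])

text \<open>The arguments are separated so that changes in a single one can be read off. With
  \<epsilon> itself as an argument, switching \<epsilon> to 0 costs O(\<epsilon>).\<close>

lemma lip_bdd_quad:
  fixes F :: "'a::real_normed_vector \<Rightarrow> 'b::real_normed_vector \<Rightarrow> 'c::real_normed_vector \<Rightarrow> real \<Rightarrow> 'd::real_normed_vector"
  assumes "lip_bdd (\<lambda>x. F (fst x) (fst (snd x)) (fst (snd (snd x))) (snd (snd (snd x))))"
  obtains L where "L \<ge> 0" "\<And>p q r e p' q' r' e'. norm p \<le> B \<Longrightarrow> norm q \<le> B \<Longrightarrow> norm r \<le> B \<Longrightarrow> \<bar>e\<bar> \<le> B \<Longrightarrow>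
      norm p' \<le> B \<Longrightarrow> norm q' \<le> B \<Longrightarrow> norm r' \<le> B \<Longrightarrow> \<bar>e'\<bar> \<le> B \<Longrightarrow>
      norm (F p q r e - F p' q' r' e') \<le> L * (norm (p - p') + norm (q - q') + norm (r - r') + \<bar>e - e'\<bar>)"
proof -
  \<comment> \<open>The norm of a quadruple is at most the sum of the norms of its four entries,
    hence the radius 4 B.\<close>
  obtain L where L: "L \<ge> 0" "\<And>x y. norm x \<le> 4 * B \<Longrightarrow> norm y \<le> 4 * B \<Longrightarrow>
      norm (F (fst x) (fst (snd x)) (fst (snd (snd x))) (snd (snd (snd x)))
        - F (fst y) (fst (snd y)) (fst (snd (snd y))) (snd (snd (snd y)))) \<le> L * norm (x - y)"
    using lip_bddD[OF assms] by metis
  have nrm: "norm (p, q, r, e) \<le> norm p + norm q + norm r + \<bar>e\<bar>" for p :: 'a and q :: 'b and r :: 'c and e :: real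
    using norm_Pair_le[of p "(q, r, e)"] norm_Pair_le[of q "(r, e)"] norm_Pair_le[of r e] by simp
  show ?thesis
  proof (rule that[OF L(1)])
    fix p p' :: 'a and q q' :: 'b and r r' :: 'c and e e' :: real
    assume b: "norm p \<le> B" "norm q \<le> B" "norm r \<le> B" "\<bar>e\<bar> \<le> B" "norm p' \<le> B" "norm q' \<le> B" "norm r' \<le> B" "\<bar>e'\<bar> \<le> B"
    have "norm (F p q r e - F p' q' r' e') \<le> L * norm ((p, q, r, e) - (p', q', r', e'))"
      using L(2)[of "(p, q, r, e)" "(p', q', r', e')"] nrm[of p q r e] nrm[of p' q' r' e'] b by simp
    also have "\<dots> \<le> L * (norm (p - p') + norm (q - q') + norm (r - r') + \<bar>e - e'\<bar>)"
      using nrm[of "p - p'" "q - q'" "r - r'" "e - e'"] L(1) by (intro mult_left_mono) auto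
    finally show "norm (F p q r e - F p' q' r' e') \<le> L * (norm (p - p') + norm (q - q') + norm (r - r') + \<bar>e - e'\<bar>)" .
  qed
qed

lemma norm_components_le: "norm (fst z) \<le> norm z" "norm (snd z) \<le> norm z"
  by (metis norm_fst_le prod.collapse, metis norm_snd_le prod.collapse)

text \<open>From x \<le> exp x with x = \<beta> s / \<epsilon>. It turns the linear growth of the
  reduced solution inside the layer into a factor \<epsilon>.\<close>

lemma times_exp_neg_le:
  assumes "\<beta> > 0" "\<epsilon> > (0::real)"
  shows "s * exp (- \<beta> * s / \<epsilon>) \<le> \<epsilon> / \<beta>"
proof -
  have "\<beta> * s / \<epsilon> \<le> exp (\<beta> * s / \<epsilon>)" using exp_ge_add_one_self[of "\<beta> * s / \<epsilon>"] by linarith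
  then have "\<beta> * s / \<epsilon> * exp (- (\<beta> * s / \<epsilon>)) \<le> exp (\<beta> * s / \<epsilon>) * exp (- (\<beta> * s / \<epsilon>))"
    by (intro mult_right_mono) auto
  then have "\<beta> * s / \<epsilon> * exp (- \<beta> * s / \<epsilon>) \<le> 1" by (simp add: exp_minus_inverse)
  then show ?thesis using assms by (simp add: field_simps)
qed

lemma has_vector_derivative_reverse:
  assumes "(y has_vector_derivative y') (at (T - t) within {0..T})"
  shows "((\<lambda>t. y (T - t)) has_vector_derivative - y') (at t within {0..T :: real})"
proof -
  have "(\<lambda>t. T - t) ` {0..T} = {0..T}"
    using image_diff_atLeastAtMost[of T 0 T] by simp
  then have "(y has_vector_derivative y') (at (T - t) within (\<lambda>t. T - t) ` {0..T})" using assms by simp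
  moreover have "((\<lambda>t. T - t) has_vector_derivative - 1) (at t within {0..T})"
    by (auto intro!: derivative_eq_intros)
  ultimately have "(y \<circ> (\<lambda>t. T - t) has_vector_derivative (- 1) *\<^sub>R y') (at t within {0..T})"
    by (intro vector_diff_chain_within)
  then show ?thesis by (simp add: o_def)
qed

section \<open>The composite approximation and the tube estimate\<close>

text \<open>\<open>pb\<close> is the reduced solution in reversed time: the terminal condition
  becomes an initial one, and stability of \<open>S\<close> becomes forward damping. The layer and
  its decay constant are parameters, so that one pair serves for all \<epsilon>.\<close>

locale tikhonov_data = riccati_layer G R \<gamma> \<delta> \<rho>
  for G :: "('n1::finite, 'n2::finite, 'k1::finite, 'k2::finite, 'm1::finite, 'm2::finite) game"
    and R :: "real^'n2^'n2" and \<gamma> \<delta> \<rho> :: real +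
  fixes T :: real and pb :: "real \<Rightarrow> real^'n1^'n1"
    and qh :: "real \<Rightarrow> real^'n2^'n1" and rh :: "real \<Rightarrow> real^'n2^'n2" and Kh :: real
  assumes T_nonneg: "T \<ge> 0"
    and Q_sym: "transpose (Q1 G) = Q1 G" "transpose (Q2 G) = Q2 G"
    and pb_0: "pb 0 = 0"
    and pb_deriv: "s \<in> {0..T} \<Longrightarrow> (pb has_vector_derivative ric_f G (pb s) (h (pb s)) 0 0) (at s within {0..T})"
    and layer: "boundary_layer G R qh rh"
    and Kh: "Kh \<ge> 0" "\<And>s. s \<ge> 0 \<Longrightarrow> norm (qh s) \<le> Kh * exp (- \<beta> * s)"
      "\<And>s. s \<ge> 0 \<Longrightarrow> norm (rh s) \<le> Kh * exp (- \<beta> * s)"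
begin

text \<open>The linear part of the affine map \<open>h\<close>. It carries both the difference of
  \<open>h (pb s)\<close> to \<open>h 0\<close> and the time derivative of the moving
  equilibrium.\<close>

definition hl :: "real^'n1^'n1 \<Rightarrow> real^'n2^'n1" where
  "hl p = - ((p ** A12 G + p ** Delta G ** R) ** matrix_inv S)"

lemma bounded_linear_hl: "bounded_linear hl"
  by (rule linear_conv_bounded_linear[THEN iffD1], rule linearI) (simp_all add: hl_def mat_expand scaleR_diff_right)

lemma h_affine: "h p = h 0 + hl p"
  by (simp add: h_def h_map_def hl_def S_def mat_expand)

definition rhs where
  "rhs \<epsilon> x = (ric_f G (fst x) (fst (snd x)) (snd (snd x)) \<epsilon>,
     (1 / \<epsilon>) *\<^sub>R ric_g1 G (fst x) (fst (snd x)) (snd (snd x)) \<epsilon>,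
     (1 / \<epsilon>) *\<^sub>R ric_g2 G (fst x) (fst (snd x)) (snd (snd x)) \<epsilon>)"

lemma lip_bdd_rhs: "lip_bdd (rhs \<epsilon>)"
  unfolding rhs_def by (intro lip_bdd_intros)

text \<open>The composite approximation in reversed time: reduced solution plus boundary layer.\<close>

definition cen where "cen \<epsilon> s = (pb s, qh (s / \<epsilon>) + h (pb s), rh (s / \<epsilon>) + R)"

lemma qh_0: "qh 0 = - h 0" and rh_0: "rh 0 = - R"
  using layer by (auto simp: boundary_layer_def h_def)

lemma cen_0: "cen \<epsilon> 0 = 0"
  by (simp add: cen_def pb_0 qh_0 rh_0 zero_prod_def)

lemma qh_deriv: "s \<ge> 0 \<Longrightarrow> (qh has_vector_derivative \<psi> (qh s) (rh s)) (at s within {0..})"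
  and rh_deriv: "s \<ge> 0 \<Longrightarrow> (rh has_vector_derivative \<phi> (rh s)) (at s within {0..})"
  using layer ric_g1_layer ric_g2_layer by (auto simp: boundary_layer_def h_def)

lemma scaled_deriv:
  assumes "\<epsilon> > 0" "s \<in> {0..\<tau>}" "\<And>s. s \<ge> 0 \<Longrightarrow> (y has_vector_derivative y' s) (at s within {0..})"
  shows "((\<lambda>s. y (s / \<epsilon>)) has_vector_derivative (1 / \<epsilon>) *\<^sub>R y' (s / \<epsilon>)) (at s within {0..\<tau>})"
proof -
  have "(y has_vector_derivative y' (s / \<epsilon>)) (at (s / \<epsilon>) within (\<lambda>s. s / \<epsilon>) ` {0..\<tau>})"
    by (rule has_vector_derivative_within_subset[OF assms(3)]) (use assms in auto)
  moreover have "((\<lambda>s. s / \<epsilon>) has_vector_derivative 1 / \<epsilon>) (at s within {0..\<tau>})"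
    using assms(1) by (auto intro!: derivative_eq_intros simp: has_real_derivative_iff_has_vector_derivative[symmetric])
  ultimately show ?thesis using vector_diff_chain_within[of "\<lambda>s. s / \<epsilon>"] by (auto simp: o_def)
qed

lemma cen_deriv:
  assumes "\<epsilon> > 0" "s \<in> {0..\<tau>}" "\<tau> \<le> T"
  shows "(pb has_vector_derivative ric_f G (pb s) (h (pb s)) 0 0) (at s within {0..\<tau>})"
    "((\<lambda>s. qh (s / \<epsilon>) + h (pb s)) has_vector_derivative
      (1 / \<epsilon>) *\<^sub>R \<psi> (qh (s / \<epsilon>)) (rh (s / \<epsilon>)) + hl (ric_f G (pb s) (h (pb s)) 0 0)) (at s within {0..\<tau>})"
    "((\<lambda>s. rh (s / \<epsilon>) + R) has_vector_derivative (1 / \<epsilon>) *\<^sub>R \<phi> (rh (s / \<epsilon>))) (at s within {0..\<tau>})"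
proof -
  show p: "(pb has_vector_derivative ric_f G (pb s) (h (pb s)) 0 0) (at s within {0..\<tau>})"
    by (rule has_vector_derivative_within_subset[OF pb_deriv]) (use assms in auto)
  have "((\<lambda>s. h 0 + hl (pb s)) has_vector_derivative 0 + hl (ric_f G (pb s) (h (pb s)) 0 0)) (at s within {0..\<tau>})"
    by (intro has_vector_derivative_add has_vector_derivative_const
        bounded_linear.has_vector_derivative[OF bounded_linear_hl p])
  then have "((\<lambda>s. h (pb s)) has_vector_derivative hl (ric_f G (pb s) (h (pb s)) 0 0)) (at s within {0..\<tau>})"
    by (simp flip: h_affine)
  then show "((\<lambda>s. qh (s / \<epsilon>) + h (pb s)) has_vector_derivative
      (1 / \<epsilon>) *\<^sub>R \<psi> (qh (s / \<epsilon>)) (rh (s / \<epsilon>)) + hl (ric_f G (pb s) (h (pb s)) 0 0)) (at s within {0..\<tau>})"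
    by (intro has_vector_derivative_add scaled_deriv[OF assms(1,2) qh_deriv])
  have "((\<lambda>s. rh (s / \<epsilon>) + R) has_vector_derivative (1 / \<epsilon>) *\<^sub>R \<phi> (rh (s / \<epsilon>)) + 0) (at s within {0..\<tau>})"
    by (intro has_vector_derivative_add has_vector_derivative_const scaled_deriv[OF assms(1,2) rh_deriv])
  then show "((\<lambda>s. rh (s / \<epsilon>) + R) has_vector_derivative (1 / \<epsilon>) *\<^sub>R \<phi> (rh (s / \<epsilon>))) (at s within {0..\<tau>})"
    by simp
qed

text \<open>Here both linear terms contribute - \<gamma>, and all quadratic terms are bounded by
  norms. With \<open>x\<close> on the layer, \<open>norm x\<close> decays exponentially, which is
  the origin of the decaying coefficient in the error inequalities; \<open>norm e\<close> is
  controlled by the tube.\<close>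

lemma inner_\<phi>_diff_le:
  "e \<bullet> (\<phi> (x + e) - \<phi> x) \<le> (- 2 * \<gamma> + 2 * norm (Delta2 G) * norm x + norm (Delta2 G) * norm e) * (norm e)\<^sup>2"
proof -
  let ?D = "Delta2 G"
  have mm: "norm (a ** ?D ** b) \<le> norm a * norm ?D * norm b" for a b :: "real^'n2^'n2"
    by (intro order_trans[OF norm_matrix_mult_le] mult_right_mono norm_matrix_mult_le) auto
  have "e \<bullet> (\<phi> (x + e) - \<phi> x) = (transpose S ** e) \<bullet> e + (e ** S) \<bullet> e
      + e \<bullet> (x ** ?D ** e) + e \<bullet> (e ** ?D ** x) + e \<bullet> (e ** ?D ** e)"
    by (simp add: \<phi>_def mat_expand inner_add_right inner_diff_right inner_commute)
  also have "\<dots> \<le> - \<gamma> * (e \<bullet> e) + - \<gamma> * (e \<bullet> e) + norm e * (norm x * norm ?D * norm e)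
      + norm e * (norm e * norm ?D * norm x) + norm e * (norm e * norm ?D * norm e)"
    by (intro add_mono inner_mult_left_le inner_mult_right_le S_le order_trans[OF norm_cauchy_schwarz] mult_left_mono mm) auto
  also have "\<dots> = (- 2 * \<gamma> + 2 * norm ?D * norm x + norm ?D * norm e) * (norm e)\<^sup>2"
    by (simp add: power2_norm_eq_inner[symmetric] power2_eq_square algebra_simps)
  finally show ?thesis .
qed

lemma forward_components:
  assumes "(y has_vector_derivative rhs \<epsilon> (y t)) (at t within A)"
  shows "((\<lambda>t. fst (y t)) has_vector_derivative ric_f G (fst (y t)) (fst (snd (y t))) (snd (snd (y t))) \<epsilon>) (at t within A)"
    "((\<lambda>t. fst (snd (y t))) has_vector_derivative
        (1 / \<epsilon>) *\<^sub>R ric_g1 G (fst (y t)) (fst (snd (y t))) (snd (snd (y t))) \<epsilon>) (at t within A)"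
    "((\<lambda>t. snd (snd (y t))) has_vector_derivative
        (1 / \<epsilon>) *\<^sub>R ric_g2 G (fst (y t)) (fst (snd (y t))) (snd (snd (y t))) \<epsilon>) (at t within A)"
proof -
  show "((\<lambda>t. fst (y t)) has_vector_derivative ric_f G (fst (y t)) (fst (snd (y t))) (snd (snd (y t))) \<epsilon>) (at t within A)"
    using bounded_linear.has_vector_derivative[OF bounded_linear_fst assms] by (simp add: rhs_def)
  have ds: "((\<lambda>t. snd (y t)) has_vector_derivative snd (rhs \<epsilon> (y t))) (at t within A)"
    using bounded_linear.has_vector_derivative[OF bounded_linear_snd assms] .
  show "((\<lambda>t. fst (snd (y t))) has_vector_derivative
        (1 / \<epsilon>) *\<^sub>R ric_g1 G (fst (y t)) (fst (snd (y t))) (snd (snd (y t))) \<epsilon>) (at t within A)"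
    using bounded_linear.has_vector_derivative[OF bounded_linear_fst ds] by (simp add: rhs_def)
  show "((\<lambda>t. snd (snd (y t))) has_vector_derivative
        (1 / \<epsilon>) *\<^sub>R ric_g2 G (fst (y t)) (fst (snd (y t))) (snd (snd (y t))) \<epsilon>) (at t within A)"
    using bounded_linear.has_vector_derivative[OF bounded_linear_snd ds] by (simp add: rhs_def)
qed

text \<open>\<open>K\<close> and \<open>\<eta>\<close> are independent of \<epsilon> and of the
  interval. \<open>\<eta>\<close> is chosen so that \<open>norm (Delta2 G) * \<eta>\<close> is at
  most \<gamma> / 2, and therefore \<open>fast_slow_estimate\<close> is applied with the damping
  \<gamma> / 2.\<close>

lemma tube_estimate:
  obtains K \<eta> where "K \<ge> 0" "\<eta> > 0"
    "\<And>\<epsilon> \<tau> y s. 0 < \<epsilon> \<Longrightarrow> \<epsilon> \<le> 1 \<Longrightarrow> \<tau> \<in> {0..T} \<Longrightarrow> y 0 = 0 \<Longrightarrow>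
      (\<And>t. t \<in> {0..\<tau>} \<Longrightarrow> (y has_vector_derivative rhs \<epsilon> (y t)) (at t within {0..\<tau>})) \<Longrightarrow>
      (\<And>t. t \<in> {0..\<tau>} \<Longrightarrow> norm (y t - cen \<epsilon> t) \<le> \<eta>) \<Longrightarrow> s \<in> {0..\<tau>} \<Longrightarrow>
      norm (fst (y s) - pb s) \<le> K * \<epsilon> \<and> norm (fst (snd (y s)) - (qh (s / \<epsilon>) + h (pb s))) \<le> K * \<epsilon> \<and>
      norm (snd (snd (y s)) - (rh (s / \<epsilon>) + R)) \<le> K * \<epsilon>"
proof -
  let ?d = "norm (Delta2 G)"
  have contpb: "continuous_on {0..T} pb" by (rule has_vector_derivative_continuous_on[OF pb_deriv])
  obtain M1 where M1: "M1 \<ge> 0" "\<And>s. s \<in> {0..T} \<Longrightarrow> norm (pb s) \<le> M1" using bounded_on_Icc[OF contpb] by metis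
  obtain Kl where Kl: "Kl > 0" "\<And>x. norm (hl x) \<le> norm x * Kl"
    using bounded_linear.pos_bounded[OF bounded_linear_hl] by auto
  define M2 where "M2 = norm (h 0) + M1 * Kl"
  have M2: "norm (h (pb s)) \<le> M2" if "s \<in> {0..T}" for s
  proof -
    have "norm (hl (pb s)) \<le> M1 * Kl"
      using order_trans[OF Kl(2) mult_right_mono[OF M1(2)[OF that] less_imp_le[OF Kl(1)]]] Kl(1) by simp
    then show ?thesis using norm_triangle_ineq[of "h 0" "hl (pb s)"] by (simp add: h_affine[of "pb s"] M2_def)
  qed
  have M2_0: "M2 \<ge> 0" using M1 Kl by (simp add: M2_def)
  \<comment> \<open>A single radius for all arguments at which the Riccati expressions are compared:
    the composite approximation, enlarged by a tube of radius at most 1, and \<epsilon> \<le>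
    1.\<close>
  define B where "B = M1 + M2 + Kh + norm R + norm (h 0) + 1"
  have B: "M1 + 1 \<le> B" "M2 + Kh + 1 \<le> B" "Kh + norm R + 1 \<le> B" "1 \<le> B" "0 \<le> B" "Kh + norm (h 0) \<le> B"
    using M1 M2_0 Kh(1) by (auto simp: B_def)
  obtain Lf where Lf: "Lf \<ge> 0" "\<And>p q r e p' q' r' e'. norm p \<le> B \<Longrightarrow> norm q \<le> B \<Longrightarrow> norm r \<le> B \<Longrightarrow> \<bar>e\<bar> \<le> B \<Longrightarrow>
      norm p' \<le> B \<Longrightarrow> norm q' \<le> B \<Longrightarrow> norm r' \<le> B \<Longrightarrow> \<bar>e'\<bar> \<le> B \<Longrightarrow>
      norm (ric_f G p q r e - ric_f G p' q' r' e') \<le> Lf * (norm (p - p') + norm (q - q') + norm (r - r') + \<bar>e - e'\<bar>)"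
    by (rule lip_bdd_quad[of "ric_f G" B]) (intro lip_bdd_intros, blast)
  obtain L1 where L1: "L1 \<ge> 0" "\<And>p q r e p' q' r' e'. norm p \<le> B \<Longrightarrow> norm q \<le> B \<Longrightarrow> norm r \<le> B \<Longrightarrow> \<bar>e\<bar> \<le> B \<Longrightarrow>
      norm p' \<le> B \<Longrightarrow> norm q' \<le> B \<Longrightarrow> norm r' \<le> B \<Longrightarrow> \<bar>e'\<bar> \<le> B \<Longrightarrow>
      norm (ric_g1 G p q r e - ric_g1 G p' q' r' e') \<le> L1 * (norm (p - p') + norm (q - q') + norm (r - r') + \<bar>e - e'\<bar>)"
    by (rule lip_bdd_quad[of "ric_g1 G" B]) (intro lip_bdd_intros, blast)
  obtain L2 where L2: "L2 \<ge> 0" "\<And>p q r e p' q' r' e'. norm p \<le> B \<Longrightarrow> norm q \<le> B \<Longrightarrow> norm r \<le> B \<Longrightarrow> \<bar>e\<bar> \<le> B \<Longrightarrow>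
      norm p' \<le> B \<Longrightarrow> norm q' \<le> B \<Longrightarrow> norm r' \<le> B \<Longrightarrow> \<bar>e'\<bar> \<le> B \<Longrightarrow>
      norm (ric_g2 G p q r e - ric_g2 G p' q' r' e') \<le> L2 * (norm (p - p') + norm (q - q') + norm (r - r') + \<bar>e - e'\<bar>)"
    by (rule lip_bdd_quad[of "ric_g2 G" B]) (intro lip_bdd_intros, blast)
  define P1 where "P1 = Lf * (M1 + M2) + norm (ric_f G 0 0 0 0)"
  have P1_0: "P1 \<ge> 0" using Lf M1 M2_0 by (simp add: P1_def)
  have P1: "norm (ric_f G (pb s) (h (pb s)) 0 0) \<le> P1" if s: "s \<in> {0..T}" for s
  proof -
    have "norm (ric_f G (pb s) (h (pb s)) 0 0 - ric_f G 0 0 0 0) \<le> Lf * (norm (pb s) + norm (h (pb s)))"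
      using Lf(2)[of "pb s" "h (pb s)" 0 0 0 0 0 0] M1(2)[OF s] M2[OF s] B Kh(1) by simp
    also have "\<dots> \<le> Lf * (M1 + M2)" using M1(2)[OF s] M2[OF s] Lf(1) by (intro mult_left_mono) auto
    finally show ?thesis
      using norm_triangle_ineq[of "ric_f G (pb s) (h (pb s)) 0 0 - ric_f G 0 0 0 0" "ric_f G 0 0 0 0"]
      by (simp add: P1_def)
  qed
  \<comment> \<open>The reduced solution starts at 0 with bounded speed. Its linear growth makes it
    small during the layer, which justifies freezing it there.\<close>
  have pb_lin: "norm (pb s) \<le> P1 * s" if s: "s \<in> {0..T}" for s
  proof (rule norm_comparison[where y = pb and u = "\<lambda>s. P1 * s" and u' = "\<lambda>_. P1" and L = 0, OF pb_deriv _ _ _ _ s])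
    fix t assume t: "t \<in> {0..T}"
    show "((*) P1 has_real_derivative P1) (at t within {0..T})" by (auto intro!: derivative_eq_intros)
    show "0 \<le> P1 * t" using P1_0 t by auto
    show "pb t \<bullet> ric_f G (pb t) (h (pb t)) 0 0 \<le> (P1 + 0 * (norm (pb t) - P1 * t)) * norm (pb t)"
      using norm_cauchy_schwarz[of "pb t" "ric_f G (pb t) (h (pb t)) 0 0"]
        mult_left_mono[OF P1[OF t] norm_ge_zero[of "pb t"]] by (simp add: mult.commute)
  qed (use pb_0 in auto)
  \<comment> \<open>The bound for the freezing error: P1 s times Kh exp(- \<beta> s / \<epsilon>) is
    at most P1 Kh \<epsilon> / \<beta>.\<close>
  define k3 where "k3 = (norm (Delta G) + Kl * ?d) * P1 * Kh / \<beta>"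
  define C where "C = max (Lf * (1 + Kh)) (max L2 (L1 + k3 + Kl * P1))"
  define \<eta> where "\<eta> = min 1 (\<gamma> / (2 * (?d + 1)))"
  have \<eta>: "\<eta> > 0" "\<eta> \<le> 1" using \<gamma>_pos norm_ge_zero[of "Delta2 G"]
    by (auto simp: \<eta>_def intro!: divide_pos_pos add_nonneg_pos)
  have d\<eta>: "?d * \<eta> \<le> \<gamma> / 2"
  proof -
    have "?d * \<eta> \<le> (?d + 1) * (\<gamma> / (2 * (?d + 1)))"
      using \<eta> by (intro mult_mono) (auto simp: \<eta>_def)
    also have "\<dots> = \<gamma> / 2"
    proof -
      have "x * (g / (2 * x)) = g / 2" if "x \<noteq> 0" for x g :: real using that by simp
      moreover have "?d + 1 \<noteq> 0" using norm_ge_zero[of "Delta2 G"] by linarith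
      ultimately show ?thesis by blast
    qed
    finally show ?thesis .
  qed
  have k3: "k3 \<ge> 0" using Kl P1_0 Kh \<beta>_pos by (simp add: k3_def)
  have C: "Lf * (1 + Kh) \<le> C" "L2 \<le> C" "L1 + k3 + Kl * P1 \<le> C" "C \<ge> 0"
    using Lf Kh L2 by (auto simp: C_def le_max_iff_disj)
  have c0: "2 * ?d * Kh \<ge> 0" using Kh by simp
  show ?thesis
  proof (rule fast_slow_estimate[of "\<gamma> / 2" \<beta> "2 * ?d * Kh" C T])
    show "\<gamma> / 2 > 0" "\<beta> > 0" "2 * ?d * Kh \<ge> 0" "C \<ge> 0" "T \<ge> 0"
      using \<gamma>_pos \<beta>_pos c0 C(4) T_nonneg by auto
    fix K :: real
    assume K: "K \<ge> 0" and est: "\<And>\<epsilon> \<tau> s (p :: real \<Rightarrow> real^'n1^'n1) p' (q :: real \<Rightarrow> real^'n2^'n1) q' (r :: real \<Rightarrow> real^'n2^'n2) r'.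
      0 < \<epsilon> \<Longrightarrow> 0 \<le> \<tau> \<Longrightarrow> \<tau> \<le> T \<Longrightarrow> p 0 = 0 \<Longrightarrow> q 0 = 0 \<Longrightarrow> r 0 = 0 \<Longrightarrow>
      (\<And>s. s \<in> {0..\<tau>} \<Longrightarrow> (p has_vector_derivative p' s) (at s within {0..\<tau>})) \<Longrightarrow>
      (\<And>s. s \<in> {0..\<tau>} \<Longrightarrow> (q has_vector_derivative q' s) (at s within {0..\<tau>})) \<Longrightarrow>
      (\<And>s. s \<in> {0..\<tau>} \<Longrightarrow> (r has_vector_derivative r' s) (at s within {0..\<tau>})) \<Longrightarrow>
      (\<And>s. s \<in> {0..\<tau>} \<Longrightarrow> p s \<bullet> p' s \<le> C * (norm (p s) + norm (q s) + exp (- \<beta> * s / \<epsilon>)) * norm (p s)) \<Longrightarrow>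
      (\<And>s. s \<in> {0..\<tau>} \<Longrightarrow> \<epsilon> * (q s \<bullet> q' s) \<le> (- (\<gamma> / 2) + 2 * ?d * Kh * exp (- \<beta> * s / \<epsilon>)) * (norm (q s))\<^sup>2
        + C * (norm (p s) + norm (r s) + \<epsilon>) * norm (q s)) \<Longrightarrow>
      (\<And>s. s \<in> {0..\<tau>} \<Longrightarrow> \<epsilon> * (r s \<bullet> r' s) \<le> (- (\<gamma> / 2) + 2 * ?d * Kh * exp (- \<beta> * s / \<epsilon>)) * (norm (r s))\<^sup>2
        + C * \<epsilon> * norm (r s)) \<Longrightarrow>
      s \<in> {0..\<tau>} \<Longrightarrow> norm (p s) \<le> K * \<epsilon> \<and> norm (q s) \<le> K * \<epsilon> \<and> norm (r s) \<le> K * \<epsilon>"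
    show ?thesis
  proof (rule that[OF K \<eta>(1)])
    fix \<epsilon> \<tau> s0 and y :: "real \<Rightarrow> (real^'n1^'n1) \<times> (real^'n2^'n1) \<times> (real^'n2^'n2)"
    assume \<epsilon>: "0 < \<epsilon>" "\<epsilon> \<le> 1" and \<tau>: "\<tau> \<in> {0..T}" and y0: "y 0 = 0"
      and y: "\<And>t. t \<in> {0..\<tau>} \<Longrightarrow> (y has_vector_derivative rhs \<epsilon> (y t)) (at t within {0..\<tau>})"
      and tube: "\<And>t. t \<in> {0..\<tau>} \<Longrightarrow> norm (y t - cen \<epsilon> t) \<le> \<eta>" and s0: "s0 \<in> {0..\<tau>}"
    define p where "p t = fst (y t)" for t
    define q where "q t = fst (snd (y t))" for t
    define r where "r t = snd (snd (y t))" for t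
    define qa where "qa t = qh (t / \<epsilon>) + h (pb t)" for t
    define ra where "ra t = rh (t / \<epsilon>) + R" for t
    define ep where "ep t = p t - pb t" for t
    define eq where "eq t = q t - qa t" for t
    define er where "er t = r t - ra t" for t
    define f' where "f' t = ric_f G (pb t) (h (pb t)) 0 0" for t
    have dp: "(p has_vector_derivative ric_f G (p t) (q t) (r t) \<epsilon>) (at t within {0..\<tau>})"
      and dq: "(q has_vector_derivative (1 / \<epsilon>) *\<^sub>R ric_g1 G (p t) (q t) (r t) \<epsilon>) (at t within {0..\<tau>})"
      and dr: "(r has_vector_derivative (1 / \<epsilon>) *\<^sub>R ric_g2 G (p t) (q t) (r t) \<epsilon>) (at t within {0..\<tau>})"
      if "t \<in> {0..\<tau>}" for t
      using forward_components[OF y[OF that]] unfolding p_def[abs_def] q_def[abs_def] r_def[abs_def] by simp_all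
    have \<tau>T: "\<tau> \<le> T" using \<tau> by auto
    have small: "norm (ep t) \<le> \<eta>" "norm (eq t) \<le> \<eta>" "norm (er t) \<le> \<eta>" if "t \<in> {0..\<tau>}" for t
    proof -
      have "norm (fst (y t - cen \<epsilon> t)) \<le> \<eta>" "norm (fst (snd (y t - cen \<epsilon> t))) \<le> \<eta>"
        "norm (snd (snd (y t - cen \<epsilon> t))) \<le> \<eta>"
        using tube[OF that] by (meson norm_components_le order_trans)+
      then show "norm (ep t) \<le> \<eta>" "norm (eq t) \<le> \<eta>" "norm (er t) \<le> \<eta>"
        by (auto simp: ep_def eq_def er_def p_def q_def r_def qa_def ra_def cen_def)
    qed
    have lay: "norm (qh (t / \<epsilon>)) \<le> Kh * exp (- \<beta> * t / \<epsilon>)" "norm (rh (t / \<epsilon>)) \<le> Kh * exp (- \<beta> * t / \<epsilon>)"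
      "norm (qh (t / \<epsilon>)) \<le> Kh" "norm (rh (t / \<epsilon>)) \<le> Kh" if "t \<in> {0..\<tau>}" for t
    proof -
      have t: "t / \<epsilon> \<ge> 0" using that \<epsilon> by auto
      show q1: "norm (qh (t / \<epsilon>)) \<le> Kh * exp (- \<beta> * t / \<epsilon>)" and r1: "norm (rh (t / \<epsilon>)) \<le> Kh * exp (- \<beta> * t / \<epsilon>)"
        using Kh(2)[OF t] Kh(3)[OF t] by simp_all
      have "Kh * exp (- \<beta> * t / \<epsilon>) \<le> Kh * 1" using Kh(1) that \<epsilon> \<beta>_pos by (intro mult_left_mono) auto
      then show "norm (qh (t / \<epsilon>)) \<le> Kh" "norm (rh (t / \<epsilon>)) \<le> Kh" using q1 r1 by auto
    qed
    have bnd: "norm (p t) \<le> B" "norm (q t) \<le> B" "norm (r t) \<le> B" "norm (pb t) \<le> B" "norm (qa t) \<le> B" "norm (ra t) \<le> B"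
      "norm (h (pb t)) \<le> B" "\<bar>\<epsilon>\<bar> \<le> B" if t: "t \<in> {0..\<tau>}" for t
    proof -
      have t': "t \<in> {0..T}" using t \<tau> by auto
      have qa: "norm (qa t) \<le> M2 + Kh" unfolding qa_def
        by (rule order_trans[OF norm_triangle_ineq]) (use lay(3)[OF t] M2[OF t'] in auto)
      have ra: "norm (ra t) \<le> Kh + norm R" unfolding ra_def
        by (rule order_trans[OF norm_triangle_ineq]) (use lay(4)[OF t] in auto)
      have "norm (p t) \<le> norm (ep t) + norm (pb t)" using norm_triangle_ineq[of "ep t" "pb t"] by (simp add: ep_def)
      then show "norm (p t) \<le> B" using small(1)[OF t] M1(2)[OF t'] B \<eta>(2) by linarith
      have "norm (q t) \<le> norm (eq t) + norm (qa t)" using norm_triangle_ineq[of "eq t" "qa t"] by (simp add: eq_def)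
      then show "norm (q t) \<le> B" using small(2)[OF t] qa B \<eta>(2) by linarith
      have "norm (r t) \<le> norm (er t) + norm (ra t)" using norm_triangle_ineq[of "er t" "ra t"] by (simp add: er_def)
      then show "norm (r t) \<le> B" using small(3)[OF t] ra B \<eta>(2) by linarith
      show "norm (pb t) \<le> B" "norm (qa t) \<le> B" "norm (ra t) \<le> B" "norm (h (pb t)) \<le> B" "\<bar>\<epsilon>\<bar> \<le> B"
        using M1(2)[OF t'] M2[OF t'] qa ra B \<epsilon> Kh(1) by linarith+
    qed
    have "norm (ep s0) \<le> K * \<epsilon> \<and> norm (eq s0) \<le> K * \<epsilon> \<and> norm (er s0) \<le> K * \<epsilon>"
    proof (rule est[OF \<epsilon>(1) _ \<tau>T _ _ _ _ _ _ _ _ _ s0])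
      show "0 \<le> \<tau>" using \<tau> by auto
      show "ep 0 = 0" "eq 0 = 0" "er 0 = 0"
        using y0 pb_0 qh_0 rh_0 by (auto simp: ep_def eq_def er_def p_def q_def r_def qa_def ra_def)
      fix t assume t: "t \<in> {0..\<tau>}"
      then have t': "t \<in> {0..T}" using \<tau> by auto
      let ?e = "exp (- \<beta> * t / \<epsilon>)"
      have e: "0 \<le> ?e" by simp
      show "(ep has_vector_derivative ric_f G (p t) (q t) (r t) \<epsilon> - f' t) (at t within {0..\<tau>})"
        unfolding ep_def f'_def by (rule has_vector_derivative_diff[OF dp[OF t] cen_deriv(1)[OF \<epsilon>(1) t \<tau>T]])
      show "(eq has_vector_derivative (1 / \<epsilon>) *\<^sub>R ric_g1 G (p t) (q t) (r t) \<epsilon>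
          - ((1 / \<epsilon>) *\<^sub>R \<psi> (qh (t / \<epsilon>)) (rh (t / \<epsilon>)) + hl (f' t))) (at t within {0..\<tau>})"
        unfolding eq_def f'_def qa_def by (rule has_vector_derivative_diff[OF dq[OF t] cen_deriv(2)[OF \<epsilon>(1) t \<tau>T]])
      show "(er has_vector_derivative (1 / \<epsilon>) *\<^sub>R ric_g2 G (p t) (q t) (r t) \<epsilon> - (1 / \<epsilon>) *\<^sub>R \<phi> (rh (t / \<epsilon>))) (at t within {0..\<tau>})"
        unfolding er_def ra_def by (rule has_vector_derivative_diff[OF dr[OF t] cen_deriv(3)[OF \<epsilon>(1) t \<tau>T]])
      show "ep t \<bullet> (ric_f G (p t) (q t) (r t) \<epsilon> - f' t) \<le> C * (norm (ep t) + norm (eq t) + ?e) * norm (ep t)"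
      proof -
        \<comment> \<open>The slow right-hand side sees only \<open>p\<close> and \<open>q\<close>.
          The layer thus enters through \<open>q t - h (pb t)\<close>, that is, through the error
          \<open>eq t\<close> and a layer part of size Kh exp(- \<beta> t / \<epsilon>).\<close>
        have "ric_f G (p t) (q t) (r t) \<epsilon> = ric_f G (p t) (q t) 0 0" by (simp add: ric_f_def)
        then have "norm (ric_f G (p t) (q t) (r t) \<epsilon> - f' t) \<le> Lf * (norm (ep t) + norm (q t - h (pb t)))"
          using Lf(2)[of "p t" "q t" 0 0 "pb t" "h (pb t)" 0 0] bnd[OF t] B by (simp add: f'_def ep_def)
        also have "norm (q t - h (pb t)) \<le> norm (eq t) + Kh * ?e"
          using norm_triangle_ineq[of "eq t" "qh (t / \<epsilon>)"] lay(1)[OF t] by (simp add: eq_def qa_def)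
        also have "Lf * (norm (ep t) + (norm (eq t) + Kh * ?e)) \<le> Lf * ((1 + Kh) * (norm (ep t) + norm (eq t) + ?e))"
        proof (rule mult_left_mono[OF _ Lf(1)])
          have "0 \<le> Kh * (norm (ep t) + norm (eq t)) + ?e" using Kh(1) by simp
          then show "norm (ep t) + (norm (eq t) + Kh * ?e) \<le> (1 + Kh) * (norm (ep t) + norm (eq t) + ?e)"
            by (simp add: algebra_simps)
        qed
        also have "\<dots> = Lf * (1 + Kh) * (norm (ep t) + norm (eq t) + ?e)" by simp
        also have "\<dots> \<le> C * (norm (ep t) + norm (eq t) + ?e)" using C(1) by (intro mult_right_mono) auto
        finally have "norm (ric_f G (p t) (q t) (r t) \<epsilon> - f' t) \<le> C * (norm (ep t) + norm (eq t) + ?e)"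
          using Lf(1) by (simp add: mult_left_mono)
        then show ?thesis
          by (intro order_trans[OF norm_cauchy_schwarz]) (simp add: mult.commute mult_left_mono)
      qed
      show "\<epsilon> * (er t \<bullet> ((1 / \<epsilon>) *\<^sub>R ric_g2 G (p t) (q t) (r t) \<epsilon> - (1 / \<epsilon>) *\<^sub>R \<phi> (rh (t / \<epsilon>))))
          \<le> (- (\<gamma> / 2) + 2 * ?d * Kh * ?e) * (norm (er t))\<^sup>2 + C * \<epsilon> * norm (er t)"
      proof -
        have r_eq: "r t = (rh (t / \<epsilon>) + er t) + R" by (simp add: er_def ra_def)
        have g0: "ric_g2 G (p t) (q t) (r t) 0 = \<phi> (rh (t / \<epsilon>) + er t)"
          unfolding r_eq by (rule ric_g2_layer)
        have "\<epsilon> * (er t \<bullet> ((1 / \<epsilon>) *\<^sub>R ric_g2 G (p t) (q t) (r t) \<epsilon> - (1 / \<epsilon>) *\<^sub>R \<phi> (rh (t / \<epsilon>))))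
            = er t \<bullet> (ric_g2 G (p t) (q t) (r t) \<epsilon> - ric_g2 G (p t) (q t) (r t) 0)
              + er t \<bullet> (\<phi> (rh (t / \<epsilon>) + er t) - \<phi> (rh (t / \<epsilon>)))"
          using \<epsilon>(1) unfolding g0 by (simp add: inner_diff_right right_diff_distrib)
        also have "\<dots> \<le> norm (er t) * (C * \<epsilon>)
            + (- 2 * \<gamma> + 2 * ?d * norm (rh (t / \<epsilon>)) + ?d * norm (er t)) * (norm (er t))\<^sup>2"
        proof (intro add_mono inner_\<phi>_diff_le order_trans[OF norm_cauchy_schwarz] mult_left_mono)
          have "norm (ric_g2 G (p t) (q t) (r t) \<epsilon> - ric_g2 G (p t) (q t) (r t) 0) \<le> L2 * \<epsilon>"
            using L2(2)[of "p t" "q t" "r t" \<epsilon> "p t" "q t" "r t" 0] bnd[OF t] B \<epsilon> by simp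
          also have "\<dots> \<le> C * \<epsilon>" using C(2) \<epsilon> by (intro mult_right_mono) auto
          finally show "norm (ric_g2 G (p t) (q t) (r t) \<epsilon> - ric_g2 G (p t) (q t) (r t) 0) \<le> C * \<epsilon>" .
        qed simp
        also have "\<dots> \<le> norm (er t) * (C * \<epsilon>) + (- (\<gamma> / 2) + 2 * ?d * Kh * ?e) * (norm (er t))\<^sup>2"
        proof (intro add_left_mono mult_right_mono)
          have "?d * norm (rh (t / \<epsilon>)) \<le> ?d * (Kh * ?e)" using lay(2)[OF t] by (intro mult_left_mono) auto
          moreover have "?d * norm (er t) \<le> ?d * \<eta>" using small(3)[OF t] by (intro mult_left_mono) auto
          ultimately show "- 2 * \<gamma> + 2 * ?d * norm (rh (t / \<epsilon>)) + ?d * norm (er t) \<le> - (\<gamma> / 2) + 2 * ?d * Kh * ?e"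
            using d\<eta> \<gamma>_pos by (simp add: mult.assoc)
        qed simp
        finally show ?thesis by (simp add: algebra_simps)
      qed
      show "\<epsilon> * (eq t \<bullet> ((1 / \<epsilon>) *\<^sub>R ric_g1 G (p t) (q t) (r t) \<epsilon>
          - ((1 / \<epsilon>) *\<^sub>R \<psi> (qh (t / \<epsilon>)) (rh (t / \<epsilon>)) + hl (f' t))))
          \<le> (- (\<gamma> / 2) + 2 * ?d * Kh * ?e) * (norm (eq t))\<^sup>2 + C * (norm (ep t) + norm (er t) + \<epsilon>) * norm (eq t)"
      proof -
        define g\<epsilon> where "g\<epsilon> = ric_g1 G (p t) (q t) (r t) \<epsilon>"
        define g0 where "g0 = ric_g1 G (p t) (q t) (r t) 0"
        define ga where "ga = ric_g1 G (p t) (qa t) (r t) 0"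
        define gb where "gb = ric_g1 G (pb t) (qa t) (ra t) 0"
        define lin where "lin = eq t ** S + eq t ** (Delta2 G ** (rh (t / \<epsilon>) + er t))"
        \<comment> \<open>The error made by freezing the slow variable at 0 in
          \<open>\<psi>\<close>. It is linear in \<open>pb t\<close> and in the layer, so the growth
          of one meets the decay of the other.\<close>
        define sl where "sl = (pb t ** Delta G + hl (pb t) ** Delta2 G) ** rh (t / \<epsilon>)"
        have d0: "g0 - ga = lin"
        proof -
          have r_eq: "r t = (rh (t / \<epsilon>) + er t) + R" by (simp add: er_def ra_def)
          have "g0 - ga = eq t ** (A22 G + Delta2 G ** r t)"
            by (simp add: g0_def ga_def ric_g1_def eq_def mat_expand)
          then show ?thesis unfolding r_eq by (simp add: lin_def S_def mat_expand)
        qed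
        have db: "gb - \<psi> (qh (t / \<epsilon>)) (rh (t / \<epsilon>)) = sl"
          unfolding gb_def qa_def ra_def ric_g1_expand
          by (simp add: \<psi>_def sl_def h_affine[of "pb t"] mat_expand)
        have "\<epsilon> * (eq t \<bullet> ((1 / \<epsilon>) *\<^sub>R g\<epsilon> - ((1 / \<epsilon>) *\<^sub>R \<psi> (qh (t / \<epsilon>)) (rh (t / \<epsilon>)) + hl (f' t))))
            = eq t \<bullet> ((g\<epsilon> - g0) + (g0 - ga) + (ga - gb) + (gb - \<psi> (qh (t / \<epsilon>)) (rh (t / \<epsilon>))) - \<epsilon> *\<^sub>R hl (f' t))"
          using \<epsilon>(1) by (simp add: inner_diff_right inner_add_right algebra_simps)
        also have "\<dots> = (eq t ** S) \<bullet> eq t + eq t \<bullet> (eq t ** (Delta2 G ** (rh (t / \<epsilon>) + er t)))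
            + eq t \<bullet> ((g\<epsilon> - g0) + (ga - gb) + sl - \<epsilon> *\<^sub>R hl (f' t))"
          unfolding d0 db lin_def by (simp add: inner_diff_right inner_add_right inner_commute)
        also have "\<dots> \<le> - \<gamma> * (eq t \<bullet> eq t) + norm (eq t) * (norm (eq t) * (?d * (Kh * ?e + \<eta>)))
            + norm (eq t) * (C * (norm (ep t) + norm (er t) + \<epsilon>))"
        proof (intro add_mono inner_mult_right_le S_le order_trans[OF norm_cauchy_schwarz] mult_left_mono
            order_trans[OF norm_matrix_mult_le] order_trans[OF norm_triangle_ineq] lay(2)[OF t] small(3)[OF t])
          have "norm (g\<epsilon> - g0) \<le> L1 * \<epsilon>" unfolding g\<epsilon>_def g0_def
            using L1(2)[of "p t" "q t" "r t" \<epsilon> "p t" "q t" "r t" 0] bnd[OF t] B \<epsilon> by simp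
          moreover have "norm (ga - gb) \<le> L1 * (norm (ep t) + norm (er t))" unfolding ga_def gb_def
            using L1(2)[of "p t" "qa t" "r t" 0 "pb t" "qa t" "ra t" 0] bnd[OF t] B by (simp add: ep_def er_def)
          moreover have "norm sl \<le> k3 * \<epsilon>"
          proof -
            have "norm sl \<le> (norm (pb t) * norm (Delta G) + norm (pb t) * Kl * ?d) * (Kh * ?e)"
              unfolding sl_def
              by (intro order_trans[OF norm_matrix_mult_le] mult_mono order_trans[OF norm_triangle_ineq] add_mono
                  mult_right_mono Kl lay(2)[OF t]) (use Kl(1) in auto)
            also have "\<dots> = norm (pb t) * ((norm (Delta G) + Kl * ?d) * Kh * ?e)" by (simp add: algebra_simps)
            also have "\<dots> \<le> (P1 * t) * ((norm (Delta G) + Kl * ?d) * Kh * ?e)"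
              using pb_lin[OF t'] Kl Kh by (intro mult_right_mono) auto
            also have "\<dots> = ((norm (Delta G) + Kl * ?d) * P1 * Kh) * (t * ?e)" by (simp add: algebra_simps)
            also have "\<dots> \<le> ((norm (Delta G) + Kl * ?d) * P1 * Kh) * (\<epsilon> / \<beta>)"
              using Kl Kh P1_0 by (intro mult_left_mono times_exp_neg_le \<beta>_pos \<epsilon>) auto
            finally show ?thesis by (simp add: k3_def)
          qed
          moreover have "norm (\<epsilon> *\<^sub>R hl (f' t)) \<le> Kl * P1 * \<epsilon>"
          proof -
            have "norm (hl (f' t)) \<le> P1 * Kl"
              using order_trans[OF Kl(2) mult_right_mono[OF P1[OF t'] less_imp_le[OF Kl(1)]]] Kl(1) by (simp add: f'_def)
            then show ?thesis using \<epsilon> by (simp add: mult.commute mult_left_mono)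
          qed
          ultimately have "norm ((g\<epsilon> - g0) + (ga - gb) + sl - \<epsilon> *\<^sub>R hl (f' t))
              \<le> L1 * \<epsilon> + L1 * (norm (ep t) + norm (er t)) + k3 * \<epsilon> + Kl * P1 * \<epsilon>"
            using norm_triangle_ineq4[of "(g\<epsilon> - g0) + (ga - gb) + sl" "\<epsilon> *\<^sub>R hl (f' t)"]
              norm_triangle_ineq[of "(g\<epsilon> - g0) + (ga - gb)" sl] norm_triangle_ineq[of "g\<epsilon> - g0" "ga - gb"]
            by linarith
          also have "\<dots> \<le> (L1 + k3 + Kl * P1) * (norm (ep t) + norm (er t) + \<epsilon>)"
          proof -
            have "0 \<le> (k3 + Kl * P1) * (norm (ep t) + norm (er t))" using k3 Kl P1_0 by simp
            then show ?thesis by (simp add: algebra_simps)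
          qed
          also have "\<dots> \<le> C * (norm (ep t) + norm (er t) + \<epsilon>)" using C(3) \<epsilon> by (intro mult_right_mono) auto
          finally show "norm ((g\<epsilon> - g0) + (ga - gb) + sl - \<epsilon> *\<^sub>R hl (f' t)) \<le> C * (norm (ep t) + norm (er t) + \<epsilon>)" .
        qed auto
        also have "\<dots> = (- \<gamma> + ?d * Kh * ?e + ?d * \<eta>) * (norm (eq t))\<^sup>2 + C * (norm (ep t) + norm (er t) + \<epsilon>) * norm (eq t)"
          by (simp add: power2_norm_eq_inner[symmetric] power2_eq_square algebra_simps)
        also have "\<dots> \<le> (- (\<gamma> / 2) + 2 * ?d * Kh * ?e) * (norm (eq t))\<^sup>2 + C * (norm (ep t) + norm (er t) + \<epsilon>) * norm (eq t)"
        proof (intro add_right_mono mult_right_mono)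
          have "0 \<le> ?d * Kh * ?e" using Kh by simp
          then show "- \<gamma> + ?d * Kh * ?e + ?d * \<eta> \<le> - (\<gamma> / 2) + 2 * ?d * Kh * ?e" using d\<eta> by linarith
        qed simp
        finally show ?thesis by (simp add: g\<epsilon>_def)
      qed
    qed
    then show "norm (fst (y s0) - pb s0) \<le> K * \<epsilon> \<and> norm (fst (snd (y s0)) - (qh (s0 / \<epsilon>) + h (pb s0))) \<le> K * \<epsilon> \<and>
      norm (snd (snd (y s0)) - (rh (s0 / \<epsilon>) + R)) \<le> K * \<epsilon>"
      by (simp add: ep_def eq_def er_def p_def q_def r_def qa_def ra_def)
  qed
  qed
qed

end

section \<open>From the reversed system to the full Riccati system\<close>

context tikhonov_data
begin

lemma forward_of_full:
  assumes \<epsilon>: "\<epsilon> > 0" and P: "full_solution G T \<epsilon> (P11, P12, P22)" and s: "s \<in> {0..T}"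
  shows "((\<lambda>s. (P11 (T - s), P12 (T - s), P22 (T - s))) has_vector_derivative
      rhs \<epsilon> (P11 (T - s), P12 (T - s), P22 (T - s))) (at s within {0..T})"
proof -
  have t: "T - s \<in> {0..T}" using s by auto
  obtain D11 D12 D22 where
    D: "(P11 has_vector_derivative D11) (at (T - s) within {0..T})"
      "(P12 has_vector_derivative D12) (at (T - s) within {0..T})"
      "(P22 has_vector_derivative D22) (at (T - s) within {0..T})"
    and eqs: "D11 + ric_f G (P11 (T - s)) (P12 (T - s)) (P22 (T - s)) \<epsilon> = 0"
      "\<epsilon> *\<^sub>R D12 + ric_g1 G (P11 (T - s)) (P12 (T - s)) (P22 (T - s)) \<epsilon> = 0"
      "\<epsilon> *\<^sub>R D22 + ric_g2 G (P11 (T - s)) (P12 (T - s)) (P22 (T - s)) \<epsilon> = 0"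
    using P t unfolding full_solution_def by blast
  have "- D11 = ric_f G (P11 (T - s)) (P12 (T - s)) (P22 (T - s)) \<epsilon>"
    using eqs(1) by (simp add: eq_neg_iff_add_eq_0[symmetric])
  moreover have "- D12 = (1 / \<epsilon>) *\<^sub>R ric_g1 G (P11 (T - s)) (P12 (T - s)) (P22 (T - s)) \<epsilon>"
    "- D22 = (1 / \<epsilon>) *\<^sub>R ric_g2 G (P11 (T - s)) (P12 (T - s)) (P22 (T - s)) \<epsilon>"
    using eqs(2,3) \<epsilon> by (simp_all add: add_eq_0_iff)
  ultimately show ?thesis
    using has_vector_derivative_Pair[OF has_vector_derivative_reverse[OF D(1)]
        has_vector_derivative_Pair[OF has_vector_derivative_reverse[OF D(2)] has_vector_derivative_reverse[OF D(3)]]]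
    by (simp add: rhs_def)
qed

text \<open>Terms with \<open>q\<close> occur in mutually transposed pairs, so transposing the value
  amounts to transposing \<open>p\<close> while \<open>q\<close> stays.\<close>

lemma transpose_ric_f: "transpose (ric_f G p q r e) = ric_f G (transpose p) q r e"
  by (simp add: ric_f_def mat_expand Q_sym transpose_Delta1 transpose_Delta2)

lemma transpose_ric_g2: "transpose (ric_g2 G p q r e) = ric_g2 G p q (transpose r) e"
  by (simp add: ric_g2_def mat_expand Q_sym transpose_Delta1 transpose_Delta2)

text \<open>Symmetry is not built into \<open>rhs\<close> and is recovered from uniqueness: with the
  other components regarded as given coefficients, the first component and its transpose solve the
  same equation with the same initial value, and likewise the third.\<close>

lemma forward_symmetric:
  assumes \<epsilon>: "\<epsilon> > 0" and y0: "y 0 = 0"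
    and y: "\<And>t. t \<in> {0..T} \<Longrightarrow> (y has_vector_derivative rhs \<epsilon> (y t)) (at t within {0..T})"
    and t: "t \<in> {0..T}"
  shows "transpose (fst (y t)) = fst (y t)" "transpose (snd (snd (y t))) = snd (snd (y t))"
proof -
  obtain B where B: "\<And>t. t \<in> {0..T} \<Longrightarrow> norm (y t) \<le> B"
    using bounded_on_Icc[OF has_vector_derivative_continuous_on[OF y]] by metis
  \<comment> \<open>The radius is enlarged to \<open>max B \<epsilon>\<close> because \<epsilon> is
    one of the arguments of the Lipschitz bound.\<close>
  have Bc: "norm (fst (y t)) \<le> max B \<epsilon>" "norm (fst (snd (y t))) \<le> max B \<epsilon>" "norm (snd (snd (y t))) \<le> max B \<epsilon>"
    if "t \<in> {0..T}" for t
  proof -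
    have "norm (fst (y t)) \<le> norm (y t)" "norm (fst (snd (y t))) \<le> norm (y t)" "norm (snd (snd (y t))) \<le> norm (y t)"
      by (meson norm_components_le order_trans)+
    then show "norm (fst (y t)) \<le> max B \<epsilon>" "norm (fst (snd (y t))) \<le> max B \<epsilon>" "norm (snd (snd (y t))) \<le> max B \<epsilon>"
      using B[OF that] by linarith+
  qed
  obtain Lf where Lf: "Lf \<ge> 0" "\<And>p q r e p' q' r' e'. norm p \<le> max B \<epsilon> \<Longrightarrow> norm q \<le> max B \<epsilon> \<Longrightarrow> norm r \<le> max B \<epsilon> \<Longrightarrow> \<bar>e\<bar> \<le> max B \<epsilon> \<Longrightarrow>
      norm p' \<le> max B \<epsilon> \<Longrightarrow> norm q' \<le> max B \<epsilon> \<Longrightarrow> norm r' \<le> max B \<epsilon> \<Longrightarrow> \<bar>e'\<bar> \<le> max B \<epsilon> \<Longrightarrow>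
      norm (ric_f G p q r e - ric_f G p' q' r' e') \<le> Lf * (norm (p - p') + norm (q - q') + norm (r - r') + \<bar>e - e'\<bar>)"
    by (rule lip_bdd_quad[of "ric_f G" "max B \<epsilon>"]) (intro lip_bdd_intros, blast)
  obtain L2 where L2: "L2 \<ge> 0" "\<And>p q r e p' q' r' e'. norm p \<le> max B \<epsilon> \<Longrightarrow> norm q \<le> max B \<epsilon> \<Longrightarrow> norm r \<le> max B \<epsilon> \<Longrightarrow> \<bar>e\<bar> \<le> max B \<epsilon> \<Longrightarrow>
      norm p' \<le> max B \<epsilon> \<Longrightarrow> norm q' \<le> max B \<epsilon> \<Longrightarrow> norm r' \<le> max B \<epsilon> \<Longrightarrow> \<bar>e'\<bar> \<le> max B \<epsilon> \<Longrightarrow>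
      norm (ric_g2 G p q r e - ric_g2 G p' q' r' e') \<le> L2 * (norm (p - p') + norm (q - q') + norm (r - r') + \<bar>e - e'\<bar>)"
    by (rule lip_bdd_quad[of "ric_g2 G" "max B \<epsilon>"]) (intro lip_bdd_intros, blast)
  have "fst (y t) = transpose (fst (y t))"
  proof (rule ode_unique[where T = T and y = "\<lambda>t. fst (y t)" and z = "\<lambda>t. transpose (fst (y t))" and L = Lf, OF _ _ _ _ t])
    fix s assume s: "s \<in> {0..T}"
    note d = forward_components(1)[OF y[OF s]]
    show "((\<lambda>t. fst (y t)) has_vector_derivative ric_f G (fst (y s)) (fst (snd (y s))) (snd (snd (y s))) \<epsilon>) (at s within {0..T})"
      by (rule d)
    show "((\<lambda>t. transpose (fst (y t))) has_vector_derivative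
        ric_f G (transpose (fst (y s))) (fst (snd (y s))) (snd (snd (y s))) \<epsilon>) (at s within {0..T})"
      unfolding transpose_ric_f[symmetric] by (rule bounded_linear.has_vector_derivative[OF bounded_linear_transpose d])
    show "norm (ric_f G (fst (y s)) (fst (snd (y s))) (snd (snd (y s))) \<epsilon>
        - ric_f G (transpose (fst (y s))) (fst (snd (y s))) (snd (snd (y s))) \<epsilon>)
        \<le> Lf * norm (fst (y s) - transpose (fst (y s)))"
      using Lf(2)[of "fst (y s)" "fst (snd (y s))" "snd (snd (y s))" \<epsilon> "transpose (fst (y s))" "fst (snd (y s))" "snd (snd (y s))" \<epsilon>]
        Bc[OF s] \<epsilon> by (simp add: norm_transpose)
  qed (simp add: y0 transpose_def vec_eq_iff)
  then show "transpose (fst (y t)) = fst (y t)" by simp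
  have "snd (snd (y t)) = transpose (snd (snd (y t)))"
  proof (rule ode_unique[where T = T and y = "\<lambda>t. snd (snd (y t))" and z = "\<lambda>t. transpose (snd (snd (y t)))" and L = "L2 / \<epsilon>", OF _ _ _ _ t])
    fix s assume s: "s \<in> {0..T}"
    note d = forward_components(3)[OF y[OF s]]
    show "((\<lambda>t. snd (snd (y t))) has_vector_derivative (1 / \<epsilon>) *\<^sub>R ric_g2 G (fst (y s)) (fst (snd (y s))) (snd (snd (y s))) \<epsilon>) (at s within {0..T})"
      by (rule d)
    show "((\<lambda>t. transpose (snd (snd (y t)))) has_vector_derivative
        (1 / \<epsilon>) *\<^sub>R ric_g2 G (fst (y s)) (fst (snd (y s))) (transpose (snd (snd (y s)))) \<epsilon>) (at s within {0..T})"
      using bounded_linear.has_vector_derivative[OF bounded_linear_transpose d]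
      by (simp add: transpose_ric_g2 transpose_linear_simps)
    have "norm (ric_g2 G (fst (y s)) (fst (snd (y s))) (snd (snd (y s))) \<epsilon>
        - ric_g2 G (fst (y s)) (fst (snd (y s))) (transpose (snd (snd (y s)))) \<epsilon>)
        \<le> L2 * norm (snd (snd (y s)) - transpose (snd (snd (y s))))"
      using L2(2)[of "fst (y s)" "fst (snd (y s))" "snd (snd (y s))" \<epsilon> "fst (y s)" "fst (snd (y s))" "transpose (snd (snd (y s)))" \<epsilon>]
        Bc[OF s] \<epsilon> by (simp add: norm_transpose)
    then show "norm ((1 / \<epsilon>) *\<^sub>R ric_g2 G (fst (y s)) (fst (snd (y s))) (snd (snd (y s))) \<epsilon>
        - (1 / \<epsilon>) *\<^sub>R ric_g2 G (fst (y s)) (fst (snd (y s))) (transpose (snd (snd (y s)))) \<epsilon>)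
        \<le> L2 / \<epsilon> * norm (snd (snd (y s)) - transpose (snd (snd (y s))))"
      using \<epsilon> by (simp add: scaleR_diff_right[symmetric] divide_right_mono del: scaleR_diff_right)
  qed (simp add: y0 transpose_def vec_eq_iff)
  then show "transpose (snd (snd (y t))) = snd (snd (y t))" by simp
qed

lemma full_of_forward:
  assumes \<epsilon>: "\<epsilon> > 0" and y0: "y 0 = 0"
    and y: "\<And>t. t \<in> {0..T} \<Longrightarrow> (y has_vector_derivative rhs \<epsilon> (y t)) (at t within {0..T})"
  shows "full_solution G T \<epsilon> (\<lambda>t. fst (y (T - t)), \<lambda>t. fst (snd (y (T - t))), \<lambda>t. snd (snd (y (T - t))))"
  unfolding full_solution_def prod.case
proof (intro conjI ballI)
  fix t assume t: "t \<in> {0..T}"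
  then have t': "T - t \<in> {0..T}" by auto
  show "fst (y (T - t)) \<in> sym_mats" "snd (snd (y (T - t))) \<in> sym_mats"
    using forward_symmetric[OF \<epsilon> y0 y t'] by (auto simp: sym_mats_def)
  note d = forward_components[OF y[OF t']]
  show "\<exists>D11 D12 D22.
      ((\<lambda>t. fst (y (T - t))) has_vector_derivative D11) (at t within {0..T}) \<and>
      ((\<lambda>t. fst (snd (y (T - t)))) has_vector_derivative D12) (at t within {0..T}) \<and>
      ((\<lambda>t. snd (snd (y (T - t)))) has_vector_derivative D22) (at t within {0..T}) \<and>
      D11 + ric_f G (fst (y (T - t))) (fst (snd (y (T - t)))) (snd (snd (y (T - t)))) \<epsilon> = 0 \<and>
      \<epsilon> *\<^sub>R D12 + ric_g1 G (fst (y (T - t))) (fst (snd (y (T - t)))) (snd (snd (y (T - t)))) \<epsilon> = 0 \<and>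
      \<epsilon> *\<^sub>R D22 + ric_g2 G (fst (y (T - t))) (fst (snd (y (T - t)))) (snd (snd (y (T - t)))) \<epsilon> = 0"
    by (intro exI conjI, rule has_vector_derivative_reverse[OF d(1)], rule has_vector_derivative_reverse[OF d(2)],
        rule has_vector_derivative_reverse[OF d(3)]) (use \<epsilon> in auto)
qed (use y0 in auto)

text \<open>The estimates are returned besides the threshold because the threshold hides its layer
  behind an existential quantifier, while the cost expansion needs this particular layer with its
  decay.\<close>

lemma tikhonov:
  obtains \<epsilon>star K where "tikhonov_threshold G T (\<lambda>t. pb (T - t)) R \<epsilon>star" "K \<ge> 0"
    "\<And>\<epsilon> P11 P12 P22 t. 0 < \<epsilon> \<Longrightarrow> \<epsilon> < \<epsilon>star \<Longrightarrow> full_solution G T \<epsilon> (P11, P12, P22) \<Longrightarrow> t \<in> {0..T} \<Longrightarrow>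
      norm (P11 t - pb (T - t)) \<le> K * \<epsilon> \<and> norm (P12 t - h (pb (T - t)) - qh ((T - t) / \<epsilon>)) \<le> K * \<epsilon> \<and>
      norm (P22 t - R - rh ((T - t) / \<epsilon>)) \<le> K * \<epsilon>"
proof -
  obtain K \<eta> where K: "K \<ge> 0" and \<eta>: "\<eta> > 0" and est:
    "\<And>\<epsilon> \<tau> y s. 0 < \<epsilon> \<Longrightarrow> \<epsilon> \<le> 1 \<Longrightarrow> \<tau> \<in> {0..T} \<Longrightarrow> y 0 = 0 \<Longrightarrow>
      (\<And>t. t \<in> {0..\<tau>} \<Longrightarrow> (y has_vector_derivative rhs \<epsilon> (y t)) (at t within {0..\<tau>})) \<Longrightarrow>
      (\<And>t. t \<in> {0..\<tau>} \<Longrightarrow> norm (y t - cen \<epsilon> t) \<le> \<eta>) \<Longrightarrow> s \<in> {0..\<tau>} \<Longrightarrow>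
      norm (fst (y s) - pb s) \<le> K * \<epsilon> \<and> norm (fst (snd (y s)) - (qh (s / \<epsilon>) + h (pb s))) \<le> K * \<epsilon> \<and>
      norm (snd (snd (y s)) - (rh (s / \<epsilon>) + R)) \<le> K * \<epsilon>"
    using tube_estimate by metis
  \<comment> \<open>The three component errors add up to at most 3 K \<epsilon>, which this choice
    makes strictly smaller than \<eta> and so closes the bootstrap; the summand 1 covers
    \<open>K = 0\<close>.\<close>
  define \<epsilon>star where "\<epsilon>star = min 1 (\<eta> / (3 * K + 1))"
  have \<epsilon>star: "0 < \<epsilon>star" "\<epsilon>star \<le> 1" using \<eta> K by (auto simp: \<epsilon>star_def intro!: divide_pos_pos)
  have small: "3 * (K * \<epsilon>) < \<eta>" if "0 < \<epsilon>" "\<epsilon> < \<epsilon>star" for \<epsilon>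
  proof -
    have "\<epsilon> < \<eta> / (3 * K + 1)" using that by (simp add: \<epsilon>star_def)
    then have "\<epsilon> * (3 * K + 1) < \<eta>" using K by (simp add: pos_less_divide_eq)
    then show ?thesis using that by (simp add: algebra_simps)
  qed
  have ulip: "\<exists>L. \<forall>t\<in>{0..T}. L-lipschitz_on (cball 0 Ra) (rhs \<epsilon>)" for Ra \<epsilon>
    using lip_bdd_rhs unfolding lip_bdd_def by blast
  have exist: "\<exists>y. y 0 = 0 \<and> (\<forall>t\<in>{0..T}. (y has_vector_derivative rhs \<epsilon> (y t)) (at t within {0..T})) \<and>
      (\<forall>t\<in>{0..T}. norm (y t - cen \<epsilon> t) \<le> \<eta>)" if \<epsilon>: "0 < \<epsilon>" "\<epsilon> < \<epsilon>star" for \<epsilon>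
  proof (rule tube_existence[where F = "\<lambda>_. rhs \<epsilon>" and ?y0.0 = 0 and c = "cen \<epsilon>" and \<eta> = \<eta> and T = T])
    show "continuous_on ({0..T} \<times> UNIV) (\<lambda>(t, x). rhs \<epsilon> x)"
      unfolding case_prod_beta
      by (rule continuous_on_compose2[OF continuous_on_lip_bdd[OF lip_bdd_rhs, of UNIV]]) (auto intro!: continuous_intros)
    show "continuous_on {0..T} (cen \<epsilon>)"
      unfolding cen_def
      by (intro continuous_on_Pair has_vector_derivative_continuous_on[OF cen_deriv(1)[OF \<epsilon>(1) _ order_refl]]
        has_vector_derivative_continuous_on[OF cen_deriv(2)[OF \<epsilon>(1) _ order_refl]]
        has_vector_derivative_continuous_on[OF cen_deriv(3)[OF \<epsilon>(1) _ order_refl]])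
    show "norm (0 - cen \<epsilon> 0) < \<eta>" using \<eta> by (simp add: cen_0)
    fix \<tau> y assume \<tau>: "\<tau> \<in> {0..T}" and y: "y 0 = 0"
      "\<And>t. t \<in> {0..\<tau>} \<Longrightarrow> (y has_vector_derivative rhs \<epsilon> (y t)) (at t within {0..\<tau>})"
      "\<And>t. t \<in> {0..\<tau>} \<Longrightarrow> norm (y t - cen \<epsilon> t) \<le> \<eta>"
    have \<tau>': "\<tau> \<in> {0..\<tau>}" using \<tau> by auto
    have e: "norm (fst (y \<tau>) - pb \<tau>) \<le> K * \<epsilon> \<and> norm (fst (snd (y \<tau>)) - (qh (\<tau> / \<epsilon>) + h (pb \<tau>))) \<le> K * \<epsilon> \<and>
      norm (snd (snd (y \<tau>)) - (rh (\<tau> / \<epsilon>) + R)) \<le> K * \<epsilon>"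
      by (rule est[OF \<epsilon>(1) _ \<tau> y \<tau>']) (use \<epsilon> \<epsilon>star in auto)
    have "y \<tau> - cen \<epsilon> \<tau> = (fst (y \<tau>) - pb \<tau>, fst (snd (y \<tau>)) - (qh (\<tau> / \<epsilon>) + h (pb \<tau>)), snd (snd (y \<tau>)) - (rh (\<tau> / \<epsilon>) + R))"
      by (simp add: cen_def prod_eq_iff)
    also have "norm \<dots> \<le> K * \<epsilon> + (K * \<epsilon> + K * \<epsilon>)"
      using e by (intro order_trans[OF norm_Pair_le] add_mono) auto
    finally show "norm (y \<tau> - cen \<epsilon> \<tau>) < \<eta>" using small[OF \<epsilon>] by simp
  qed (use T_nonneg ulip in auto)
  \<comment> \<open>The comparison is with an arbitrary solution of the full system, not only one
    inside the tube, so the estimates hold for every solution.\<close>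
  have unique: "(P11 t, P12 t, P22 t) = y (T - t)"
    if "0 < \<epsilon>" "full_solution G T \<epsilon> (P11, P12, P22)" "y 0 = 0"
      "\<And>t. t \<in> {0..T} \<Longrightarrow> (y has_vector_derivative rhs \<epsilon> (y t)) (at t within {0..T})" "t \<in> {0..T}"
    for \<epsilon> P11 P12 P22 t and y :: "real \<Rightarrow> (real^'n1^'n1) \<times> (real^'n2^'n1) \<times> (real^'n2^'n2)"
  proof -
    have "(\<lambda>s. (P11 (T - s), P12 (T - s), P22 (T - s))) (T - t) = y (T - t)"
    proof (rule ode_unique_lipschitz[where F = "\<lambda>_. rhs \<epsilon>" and T = T and z = y
          and y = "\<lambda>s. (P11 (T - s), P12 (T - s), P22 (T - s))"])
      show "(P11 (T - 0), P12 (T - 0), P22 (T - 0)) = y 0"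
        using that(2,3) by (simp add: full_solution_def zero_prod_def)
    qed (use forward_of_full[OF that(1,2)] that(4,5) ulip in auto)
    then show ?thesis by simp
  qed
  have bounds: "norm (P11 t - pb (T - t)) \<le> K * \<epsilon> \<and> norm (P12 t - h (pb (T - t)) - qh ((T - t) / \<epsilon>)) \<le> K * \<epsilon> \<and>
      norm (P22 t - R - rh ((T - t) / \<epsilon>)) \<le> K * \<epsilon>"
    if \<epsilon>: "0 < \<epsilon>" "\<epsilon> < \<epsilon>star" and P: "full_solution G T \<epsilon> (P11, P12, P22)" and t: "t \<in> {0..T}" for \<epsilon> P11 P12 P22 t
  proof -
    obtain y where y: "y 0 = 0" "\<And>t. t \<in> {0..T} \<Longrightarrow> (y has_vector_derivative rhs \<epsilon> (y t)) (at t within {0..T})"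
      "\<And>t. t \<in> {0..T} \<Longrightarrow> norm (y t - cen \<epsilon> t) \<le> \<eta>" using exist[OF \<epsilon>] by metis
    have eq: "y (T - t) = (P11 t, P12 t, P22 t)" using unique[OF \<epsilon>(1) P y(1,2) t] by simp
    have "norm (fst (y (T - t)) - pb (T - t)) \<le> K * \<epsilon> \<and>
      norm (fst (snd (y (T - t))) - (qh ((T - t) / \<epsilon>) + h (pb (T - t)))) \<le> K * \<epsilon> \<and>
      norm (snd (snd (y (T - t))) - (rh ((T - t) / \<epsilon>) + R)) \<le> K * \<epsilon>"
      by (rule est[OF \<epsilon>(1) _ _ y]) (use \<epsilon> \<epsilon>star T_nonneg t in auto)
    then show ?thesis unfolding eq by (simp add: algebra_simps)
  qed
  have "tikhonov_threshold G T (\<lambda>t. pb (T - t)) R \<epsilon>star"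
      unfolding tikhonov_threshold_def
    proof (intro conjI \<epsilon>star allI impI ballI)
      fix \<epsilon> assume \<epsilon>: "0 < \<epsilon> \<and> \<epsilon> < \<epsilon>star"
      then obtain y where y: "y 0 = 0" "\<And>t. t \<in> {0..T} \<Longrightarrow> (y has_vector_derivative rhs \<epsilon> (y t)) (at t within {0..T})"
        using exist by metis
      show "\<exists>P. full_solution G T \<epsilon> P" using full_of_forward[OF _ y] \<epsilon> by blast
      fix P11 P12 P22 R11 R12 R22 t
      assume P: "full_solution G T \<epsilon> (P11, P12, P22) \<and> full_solution G T \<epsilon> (R11, R12, R22)" and t: "t \<in> {0..T}"
      have "(P11 t, P12 t, P22 t) = (R11 t, R12 t, R22 t)"
        using unique[OF _ _ y t] P \<epsilon> by metis
      then show "P11 t = R11 t" "P12 t = R12 t" "P22 t = R22 t" by auto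
    next
      show "\<exists>Ph12 Ph22. boundary_layer G R Ph12 Ph22 \<and>
        (\<exists>C. \<forall>\<epsilon> P11 P12 P22.
           0 < \<epsilon> \<and> \<epsilon> < \<epsilon>star \<and> full_solution G T \<epsilon> (P11, P12, P22) \<longrightarrow>
           (\<forall>t\<in>{0..T}.
              norm (P11 t - pb (T - t)) \<le> C * \<epsilon> \<and>
              norm (P12 t - h_map G R (pb (T - t)) - Ph12 ((T - t) / \<epsilon>)) \<le> C * \<epsilon> \<and>
              norm (P22 t - R - Ph22 ((T - t) / \<epsilon>)) \<le> C * \<epsilon>))"
        using bounds layer unfolding h_def by blast
    qed
  then show ?thesis by (rule that[OF _ K]) (rule bounds)
qed

end

section \<open>Processes with continuous paths\<close>

text \<open>Paths are extended by their end values. They become continuous on the whole line, and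
  the discretization below needs no case distinction at the end points.\<close>

definition clamp_Icc :: "real \<Rightarrow> real \<Rightarrow> real" where
  "clamp_Icc T s = max 0 (min T s)"

lemma clamp_Icc: "T \<ge> 0 \<Longrightarrow> clamp_Icc T s \<in> {0..T}" "s \<in> {0..T} \<Longrightarrow> clamp_Icc T s = s"
  by (auto simp: clamp_Icc_def)

lemma continuous_on_clamp: "continuous_on {0..T} f \<Longrightarrow> T \<ge> 0 \<Longrightarrow> continuous_on A (\<lambda>s. f (clamp_Icc T s))"
  by (rule continuous_on_compose2[of "{0..T}" f])
    (auto simp: clamp_Icc_def intro!: continuous_intros)

text \<open>Time is rounded down to a grid: where the rounded time is constant, the process is a
  single random variable, and path continuity supplies the limit.\<close>

lemma measurable_continuous_process:
  fixes X :: "real \<Rightarrow> 'w \<Rightarrow> 'a::euclidean_space"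
  assumes X: "\<And>s. X s \<in> borel_measurable F"
    and cont: "\<And>\<omega>. \<omega> \<in> space F \<Longrightarrow> continuous_on UNIV (\<lambda>s. X s \<omega>)"
  shows "(\<lambda>p. X (fst p) (snd p)) \<in> borel_measurable (borel \<Otimes>\<^sub>M F)"
proof (rule borel_measurable_LIMSEQ_metric)
  fix n :: nat
  let ?g = "\<lambda>p :: real \<times> 'w. \<lfloor>real (Suc n) * fst p\<rfloor>"
  show "(\<lambda>p. X (of_int (?g p) / real (Suc n)) (snd p)) \<in> borel_measurable (borel \<Otimes>\<^sub>M F)"
  proof (rule measurable_compose_countable[where f = "\<lambda>i p. X (of_int i / real (Suc n)) (snd p)" and g = ?g])
    show "(\<lambda>p. X (of_int i / real (Suc n)) (snd p)) \<in> borel_measurable (borel \<Otimes>\<^sub>M F)" for i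
      by (rule measurable_compose[OF measurable_snd X])
    show "?g \<in> borel \<Otimes>\<^sub>M F \<rightarrow>\<^sub>M count_space UNIV"
      by measurable
  qed
next
  fix p :: "real \<times> 'w" assume "p \<in> space (borel \<Otimes>\<^sub>M F)"
  then have \<omega>: "snd p \<in> space F" by (auto simp: space_pair_measure)
  let ?s = "\<lambda>n. of_int \<lfloor>real (Suc n) * fst p\<rfloor> / real (Suc n)"
  have "?s \<longlonglongrightarrow> fst p"
  proof (rule tendsto_sandwich[of "\<lambda>n. fst p - inverse (real (Suc n))" _ _ "\<lambda>n. fst p"])
    show "\<forall>\<^sub>F n in sequentially. fst p - inverse (real (Suc n)) \<le> ?s n"
    proof (rule always_eventually, rule allI)
      fix n
      have "real (Suc n) * fst p - 1 \<le> of_int \<lfloor>real (Suc n) * fst p\<rfloor>" by linarith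
      then have "(real (Suc n) * fst p - 1) / real (Suc n) \<le> ?s n" by (rule divide_right_mono) simp
      then show "fst p - inverse (real (Suc n)) \<le> ?s n" by (simp add: diff_divide_distrib inverse_eq_divide)
    qed
    show "\<forall>\<^sub>F n in sequentially. ?s n \<le> fst p"
      by (rule always_eventually) (simp add: pos_divide_le_eq mult.commute del: of_nat_Suc)
    show "(\<lambda>n. fst p - inverse (real (Suc n))) \<longlonglongrightarrow> fst p"
      using tendsto_diff[OF tendsto_const LIMSEQ_inverse_real_of_nat, of "fst p"] by simp
  qed simp
  then show "(\<lambda>n. X (?s n) (snd p)) \<longlonglongrightarrow> X (fst p) (snd p)"
    using cont[OF \<omega>] by (intro isCont_tendsto_compose[where g = "\<lambda>s. X s (snd p)"])
      (auto simp: continuous_on_eq_continuous_at)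
qed

text \<open>\<open>F\<close> is the whole probability space in moment computations and a member of
  the filtration when adaptedness is proved.\<close>

locale cont_process =
  fixes F :: "'w measure" and T :: real and X :: "real \<Rightarrow> 'w \<Rightarrow> 'a::euclidean_space"
  assumes T_ge: "T \<ge> 0"
    and meas: "s \<in> {0..T} \<Longrightarrow> X s \<in> borel_measurable F"
    and cont: "\<omega> \<in> space F \<Longrightarrow> continuous_on {0..T} (\<lambda>s. X s \<omega>)"
begin

lemma measurable_joint: "(\<lambda>p. X (clamp_Icc T (fst p)) (snd p)) \<in> borel_measurable (borel \<Otimes>\<^sub>M F)"
  by (rule measurable_continuous_process) (auto intro!: meas clamp_Icc T_ge continuous_on_clamp cont)

lemma cont_le: "\<omega> \<in> space F \<Longrightarrow> t \<le> T \<Longrightarrow> continuous_on {0..t} (\<lambda>s. X s \<omega>)"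
  by (rule continuous_on_subset[OF cont]) auto

lemma lebesgue_integral_path:
  assumes "\<omega> \<in> space F" "t \<in> {0..T}"
  shows "(LINT s|lborel. indicator {0..t} s *\<^sub>R X (clamp_Icc T s) \<omega>) = integral {0..t} (\<lambda>s. X s \<omega>)"
    "(LINT s:{0..t}|lborel. X s \<omega>) = integral {0..t} (\<lambda>s. X s \<omega>)"
proof -
  have c: "continuous_on {0..t} (\<lambda>s. X s \<omega>)" using cont_le assms by auto
  show *: "(LINT s:{0..t}|lborel. X s \<omega>) = integral {0..t} (\<lambda>s. X s \<omega>)"
    by (rule set_borel_integral_eq_integral(2)[OF borel_integrable_atLeastAtMost'[OF c]])
  have "(LINT s|lborel. indicator {0..t} s *\<^sub>R X (clamp_Icc T s) \<omega>) = (LINT s:{0..t}|lborel. X s \<omega>)"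
    unfolding set_lebesgue_integral_def
    by (intro Bochner_Integration.integral_cong refl) (use assms clamp_Icc(2) in \<open>auto simp: indicator_def\<close>)
  then show "(LINT s|lborel. indicator {0..t} s *\<^sub>R X (clamp_Icc T s) \<omega>) = integral {0..t} (\<lambda>s. X s \<omega>)"
    using * by simp
qed

lemma measurable_integral:
  assumes "t \<in> {0..T}"
  shows "(\<lambda>\<omega>. integral {0..t} (\<lambda>s. X s \<omega>)) \<in> borel_measurable F"
proof -
  have "(\<lambda>p. (snd p, fst p)) \<in> F \<Otimes>\<^sub>M lborel \<rightarrow>\<^sub>M borel \<Otimes>\<^sub>M F"
    by (intro measurable_Pair) auto
  then have "(\<lambda>p. X (clamp_Icc T (snd p)) (fst p)) \<in> borel_measurable (F \<Otimes>\<^sub>M lborel)"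
    using measurable_compose[OF _ measurable_joint, of "\<lambda>p. (snd p, fst p)"] by simp
  then have "(\<lambda>p. indicator {0..t} (snd p) *\<^sub>R X (clamp_Icc T (snd p)) (fst p)) \<in> borel_measurable (F \<Otimes>\<^sub>M lborel)"
    by measurable
  then have "(\<lambda>\<omega>. LINT s|lborel. indicator {0..t} s *\<^sub>R X (clamp_Icc T s) \<omega>) \<in> borel_measurable F"
    using lborel.borel_measurable_lebesgue_integral[of "\<lambda>\<omega> s. indicator {0..t} s *\<^sub>R X (clamp_Icc T s) \<omega>" F]
    by (simp add: case_prod_beta)
  then show ?thesis
    by (rule measurable_cong[THEN iffD1, rotated]) (rule lebesgue_integral_path(1)[OF _ assms])
qed

text \<open>The uniform bound on absolute first moments makes the clamped integrand integrable on
  the product space, so the order of integration may be exchanged and the gauge integrals of paths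
  agree with the Lebesgue ones.\<close>

lemma fubini_path:
  assumes M: "prob_space F"
    and int: "\<And>s. s \<in> {0..T} \<Longrightarrow> integrable F (X s)"
    and bound: "\<And>s. s \<in> {0..T} \<Longrightarrow> (\<integral>\<omega>. norm (X s \<omega>) \<partial>F) \<le> C"
    and t: "t \<in> {0..T}"
  shows "integrable F (\<lambda>\<omega>. integral {0..t} (\<lambda>s. X s \<omega>))"
    "(\<lambda>s. \<integral>\<omega>. X s \<omega> \<partial>F) integrable_on {0..t}"
    "(\<integral>\<omega>. integral {0..t} (\<lambda>s. X s \<omega>) \<partial>F) = integral {0..t} (\<lambda>s. \<integral>\<omega>. X s \<omega> \<partial>F)"
proof -
  interpret prob_space F by fact
  have sf: "sigma_finite_measure F" by (rule sigma_finite_measure_axioms)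
  interpret pair_sigma_finite lborel F ..
  define f where "f p = indicator {0..t} (fst p) *\<^sub>R X (clamp_Icc T (fst p)) (snd p)" for p
  have "f \<in> borel_measurable (borel \<Otimes>\<^sub>M F)"
    unfolding f_def using measurable_joint by measurable
  moreover have "sets (lborel \<Otimes>\<^sub>M F) = sets (borel \<Otimes>\<^sub>M F)"
    by (rule sets_pair_measure_cong) auto
  ultimately have fm: "f \<in> borel_measurable (lborel \<Otimes>\<^sub>M F)"
    using measurable_cong_sets by blast
  have Xc: "integrable F (X (clamp_Icc T s))" "(\<integral>\<omega>. norm (X (clamp_Icc T s) \<omega>) \<partial>F) \<le> C" for s
    using int bound clamp_Icc(1)[OF T_ge] by auto
  have C: "C \<ge> 0"
    by (rule order_trans[OF Bochner_Integration.integral_nonneg Xc(2)[of 0]]) simp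
  have fint: "integrable (lborel \<Otimes>\<^sub>M F) f"
  proof (rule Fubini_integrable[OF fm])
    show "AE x in lborel. integrable F (\<lambda>y. f (x, y))" using Xc by (auto simp: f_def)
    have m: "(\<lambda>x. \<integral>y. norm (f (x, y)) \<partial>F) \<in> borel_measurable lborel"
      by (rule sigma_finite_measure.borel_measurable_lebesgue_integral[OF sf, where f = "\<lambda>x y. norm (f (x, y))"]) (use fm in simp)
    have i: "integrable lborel (\<lambda>x. C * indicator {0..t} x :: real)"
      by (intro integrable_mult_right integrable_real_indicator) (auto simp: emeasure_lborel_Icc_eq)
    have "norm (\<integral>y. norm (f (x, y)) \<partial>F) \<le> norm (C * indicator {0..t} x)" for x
    proof (cases "x \<in> {0..t}")
      case True
      have "0 \<le> (\<integral>\<omega>. norm (X (clamp_Icc T x) \<omega>) \<partial>F)" by (rule Bochner_Integration.integral_nonneg) simp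
      then show ?thesis using Xc(2)[of x] C True by (simp add: f_def)
    qed (simp add: f_def)
    then show "integrable lborel (\<lambda>x. \<integral>y. norm (f (x, y)) \<partial>F)"
      by (intro Bochner_Integration.integrable_bound[OF i m] AE_I2)
  qed
  then have fint': "integrable (lborel \<Otimes>\<^sub>M F) (case_prod (\<lambda>x y. f (x, y)))" by simp
  have inner: "(LINT s|lborel. f (s, \<omega>)) = integral {0..t} (\<lambda>s. X s \<omega>)" if "\<omega> \<in> space F" for \<omega>
    using lebesgue_integral_path(1)[OF that t] by (simp add: f_def)
  show i1: "integrable F (\<lambda>\<omega>. integral {0..t} (\<lambda>s. X s \<omega>))"
    using integrable_snd[OF fint']
    by (rule Bochner_Integration.integrable_cong[THEN iffD1, rotated 2]) (simp_all add: inner)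
  have outer: "(\<integral>\<omega>. f (s, \<omega>) \<partial>F) = indicator {0..t} s *\<^sub>R (\<integral>\<omega>. X s \<omega> \<partial>F)" for s
    using clamp_Icc(2)[of s T] t by (auto simp: f_def indicator_def)
  have si: "set_integrable lborel {0..t} (\<lambda>s. \<integral>\<omega>. X s \<omega> \<partial>F)"
    unfolding set_integrable_def using integrable_fst[OF fint'] by (simp add: outer)
  show "(\<lambda>s. \<integral>\<omega>. X s \<omega> \<partial>F) integrable_on {0..t}"
    using set_borel_integral_eq_integral(1)[OF si] .
  have "(\<integral>\<omega>. integral {0..t} (\<lambda>s. X s \<omega>) \<partial>F) = (\<integral>\<omega>. (LINT s|lborel. f (s, \<omega>)) \<partial>F)"
    by (intro Bochner_Integration.integral_cong refl) (simp add: inner)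
  also have "\<dots> = (LINT s|lborel. (\<integral>\<omega>. f (s, \<omega>) \<partial>F))"
    using integral_snd[OF fint'] integral_fst[OF fint'] by simp
  also have "\<dots> = (LINT s:{0..t}|lborel. (\<integral>\<omega>. X s \<omega> \<partial>F))"
    by (simp add: outer set_lebesgue_integral_def)
  also have "\<dots> = integral {0..t} (\<lambda>s. \<integral>\<omega>. X s \<omega> \<partial>F)"
    using set_borel_integral_eq_integral(2)[OF si] .
  finally show "(\<integral>\<omega>. integral {0..t} (\<lambda>s. X s \<omega>) \<partial>F) = integral {0..t} (\<lambda>s. \<integral>\<omega>. X s \<omega> \<partial>F)" .
qed

lemma fubini_path_bdd:
  assumes "prob_space F"
    and "\<exists>C. \<forall>s\<in>{0..T}. integrable F (X s) \<and> (\<integral>\<omega>. norm (X s \<omega>) \<partial>F) \<le> C"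
    and "t \<in> {0..T}"
  shows "integrable F (\<lambda>\<omega>. integral {0..t} (\<lambda>s. X s \<omega>))"
    "(\<lambda>s. \<integral>\<omega>. X s \<omega> \<partial>F) integrable_on {0..t}"
    "(\<integral>\<omega>. integral {0..t} (\<lambda>s. X s \<omega>) \<partial>F) = integral {0..t} (\<lambda>s. \<integral>\<omega>. X s \<omega> \<partial>F)"
proof -
  obtain C where C: "\<forall>s\<in>{0..T}. integrable F (X s) \<and> (\<integral>\<omega>. norm (X s \<omega>) \<partial>F) \<le> C"
    using assms(2) by blast
  show "integrable F (\<lambda>\<omega>. integral {0..t} (\<lambda>s. X s \<omega>))"
    "(\<lambda>s. \<integral>\<omega>. X s \<omega> \<partial>F) integrable_on {0..t}"
    "(\<integral>\<omega>. integral {0..t} (\<lambda>s. X s \<omega>) \<partial>F) = integral {0..t} (\<lambda>s. \<integral>\<omega>. X s \<omega> \<partial>F)"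
    by (rule fubini_path[OF assms(1) _ _ assms(3), of C]; use C in blast)+
qed

end

section \<open>Second moments of linear equations with additive noise\<close>

text \<open>The integral of \<phi> is compared with exp(L t) times the integral of \<open>A\<close>.
  The bound ends with an integral over all of \<open>{0..T}\<close>, a form that can be squared and
  averaged over \<omega>.\<close>

lemma gronwall_integral:
  fixes \<phi> A :: "real \<Rightarrow> real"
  assumes cont: "continuous_on {0..T} \<phi>" "continuous_on {0..T} A"
    and le: "\<And>t. t \<in> {0..T} \<Longrightarrow> \<phi> t \<le> A t + L * integral {0..t} \<phi>"
    and L: "L \<ge> 0" and A: "\<And>t. t \<in> {0..T} \<Longrightarrow> A t \<ge> 0" and t: "t \<in> {0..T}"
  shows "\<phi> t \<le> A t + L * exp (L * T) * integral {0..T} A"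
proof -
  define v where "v t = integral {0..t} \<phi>" for t
  define a where "a t = integral {0..t} A" for t
  have dv: "(v has_real_derivative \<phi> t) (at t within {0..T})" if "t \<in> {0..T}" for t
    unfolding v_def has_real_derivative_iff_has_vector_derivative
    by (rule integral_has_vector_derivative[OF cont(1) that])
  have da: "(a has_real_derivative A t) (at t within {0..T})" if "t \<in> {0..T}" for t
    unfolding a_def has_real_derivative_iff_has_vector_derivative
    by (rule integral_has_vector_derivative[OF cont(2) that])
  have "v t - exp (L * t) * a t \<le> 0"
  proof (rule barrier[where D = "\<lambda>t. v t - exp (L * t) * a t" and L = L, OF _ _ _ t])
    show "continuous_on {0..T} (\<lambda>t. v t - exp (L * t) * a t)"
      by (intro continuous_intros DERIV_continuous_on[OF dv] DERIV_continuous_on[OF da])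
    show "v 0 - exp (L * 0) * a 0 \<le> 0" by (simp add: v_def a_def)
    fix s assume s: "0 < s" "s < T"
    then have s': "s \<in> {0..T}" by auto
    have "DERIV v s :> \<phi> s" "DERIV a s :> A s" using dv[OF s'] da[OF s'] s by (auto simp: at_within_Icc_at)
    then have "DERIV (\<lambda>t. v t - exp (L * t) * a t) s :> \<phi> s - (exp (L * s) * L * a s + exp (L * s) * A s)"
      by (auto intro!: derivative_eq_intros)
    moreover have "\<phi> s - (exp (L * s) * L * a s + exp (L * s) * A s) \<le> L * (v s - exp (L * s) * a s)"
    proof -
      have "1 * A s \<le> exp (L * s) * A s" using A[OF s'] L s by (intro mult_right_mono) auto
      then show ?thesis using le[OF s'] by (simp add: v_def algebra_simps)
    qed
    ultimately show "\<exists>d. DERIV (\<lambda>t. v t - exp (L * t) * a t) s :> d \<and> d \<le> L * (v s - exp (L * s) * a s)"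
      by blast
  qed
  then have "v t \<le> exp (L * t) * a t" by simp
  also have "\<dots> \<le> exp (L * T) * a T"
  proof (rule mult_mono)
    show "exp (L * t) \<le> exp (L * T)" using t L by (simp add: mult_left_mono)
    show "a t \<le> a T" unfolding a_def
    proof (rule integral_subset_le)
      show "A integrable_on {0..t}" "A integrable_on {0..T}"
        using t by (auto intro!: integrable_continuous_real continuous_on_subset[OF cont(2)])
    qed (use t A in auto)
    show "0 \<le> a t" unfolding a_def
      by (rule Henstock_Kurzweil_Integration.integral_nonneg)
        (use t A in \<open>auto intro!: integrable_continuous_real continuous_on_subset[OF cont(2)]\<close>)
  qed auto
  finally have "L * v t \<le> L * (exp (L * T) * a T)" using L by (rule mult_left_mono)
  then show ?thesis using le[OF t] by (simp add: v_def a_def)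
qed

text \<open>Expand the nonnegative integral of (A - c)^2, where \<open>c\<close> is the mean of
  \<open>A\<close>.\<close>

lemma integral_square_le:
  fixes A :: "real \<Rightarrow> real"
  assumes "continuous_on {0..T} A" "T \<ge> 0"
  shows "(integral {0..T} A)\<^sup>2 \<le> T * integral {0..T} (\<lambda>t. (A t)\<^sup>2)"
proof (cases "T = 0")
  case False
  then have T: "T > 0" using assms by simp
  define c where "c = integral {0..T} A / T"
  have i: "A integrable_on {0..T}" "(\<lambda>t. (A t)\<^sup>2) integrable_on {0..T}"
    by (intro integrable_continuous_real continuous_intros assms)+
  have "0 \<le> integral {0..T} (\<lambda>t. (A t - c)\<^sup>2)"
    by (intro Henstock_Kurzweil_Integration.integral_nonneg integrable_continuous_real continuous_intros assms) auto
  also have "(\<lambda>t. (A t - c)\<^sup>2) = (\<lambda>t. ((A t)\<^sup>2 - (2 * c) * A t) + c\<^sup>2)"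
    by (auto simp: power2_eq_square algebra_simps)
  also have "integral {0..T} \<dots> = (integral {0..T} (\<lambda>t. (A t)\<^sup>2) - 2 * c * integral {0..T} A) + T * c\<^sup>2"
  proof (rule integral_unique)
    have "((\<lambda>t. c\<^sup>2) has_integral T * c\<^sup>2) {0..T}"
      using has_integral_const_real[of "c\<^sup>2" 0 T] T by simp
    then show "((\<lambda>t. (A t)\<^sup>2 - 2 * c * A t + c\<^sup>2) has_integral
        integral {0..T} (\<lambda>t. (A t)\<^sup>2) - 2 * c * integral {0..T} A + T * c\<^sup>2) {0..T}"
      by (intro has_integral_add has_integral_diff has_integral_mult_right integrable_integral i)
  qed
  also have "\<dots> = integral {0..T} (\<lambda>t. (A t)\<^sup>2) - (integral {0..T} A)\<^sup>2 / T"
    using T by (simp add: c_def power2_eq_square field_simps)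
  finally show ?thesis using T by (simp add: field_simps)
qed simp

lemma linear_inner_basis:
  fixes A :: "'a::euclidean_space \<Rightarrow> 'a"
  assumes "linear A"
  shows "A x \<bullet> y = (\<Sum>b\<in>Basis. \<Sum>c\<in>Basis. (A b \<bullet> c) * ((x \<bullet> b) * (y \<bullet> c)))"
proof -
  have "A x = (\<Sum>b\<in>Basis. (x \<bullet> b) *\<^sub>R A b)"
    using linear_sum[OF assms, of "\<lambda>b. (x \<bullet> b) *\<^sub>R b" Basis] linear_scale[OF assms] by (simp add: euclidean_representation)
  then have "A x \<bullet> y = (\<Sum>b\<in>Basis. (x \<bullet> b) * (A b \<bullet> y))"
    by (simp add: inner_sum_left)
  also have "\<dots> = (\<Sum>b\<in>Basis. (x \<bullet> b) * (\<Sum>c\<in>Basis. (A b \<bullet> c) * (y \<bullet> c)))"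
    by (subst euclidean_inner) simp
  finally show ?thesis by (simp add: sum_distrib_left algebra_simps)
qed

lemma linear_family_bound:
  fixes F :: "real \<Rightarrow> 'a::euclidean_space \<Rightarrow> 'b::real_normed_vector"
  assumes lin: "\<And>t. t \<in> {0..T} \<Longrightarrow> linear (F t)"
    and cont: "continuous_on ({0..T} \<times> UNIV) (\<lambda>(t, x). F t x)"
  obtains L where "L \<ge> 0" "\<And>t x. t \<in> {0..T} \<Longrightarrow> norm (F t x) \<le> L * norm x"
proof -
  have "compact ((\<lambda>(t, x). F t x) ` ({0..T} \<times> cball 0 1))"
    by (intro compact_continuous_image continuous_on_subset[OF cont] compact_Times) auto
  then have "bounded ((\<lambda>(t, x). F t x) ` ({0..T} \<times> cball 0 1))" by (rule compact_imp_bounded)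
  then obtain L0 where L0: "\<forall>y\<in>(\<lambda>(t, x). F t x) ` ({0..T} \<times> cball 0 1). norm y \<le> L0"
    unfolding bounded_iff by metis
  have L: "norm (F t x) \<le> L0" if "t \<in> {0..T}" "norm x \<le> 1" for t x
    using L0 that by force
  have "norm (F t x) \<le> max L0 0 * norm x" if t: "t \<in> {0..T}" for t x
  proof (cases "x = 0")
    case True
    then show ?thesis using linear_0[OF lin[OF t]] by simp
  next
    case False
    have "F t x = norm x *\<^sub>R F t (x /\<^sub>R norm x)"
      using False by (simp add: linear_scale[OF lin[OF t]])
    then have "norm (F t x) = norm x * norm (F t (x /\<^sub>R norm x))" by simp
    also have "\<dots> \<le> norm x * max L0 0"
      using L[OF t, of "x /\<^sub>R norm x"] False by (intro mult_left_mono) auto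
    finally show ?thesis by (simp add: mult.commute)
  qed
  then show ?thesis by (intro that[of "max L0 0"]) auto
qed

locale linear_field =
  fixes T :: real and F :: "real \<Rightarrow> 'a::euclidean_space \<Rightarrow> 'a"
  assumes T_nonneg: "T \<ge> 0"
    and F_linear: "t \<in> {0..T} \<Longrightarrow> linear (F t)"
    and F_cont: "continuous_on ({0..T} \<times> UNIV) (\<lambda>(t, x). F t x)"
begin

lemma F_bound: obtains L where "L \<ge> 0" "\<And>t x. t \<in> {0..T} \<Longrightarrow> norm (F t x) \<le> L * norm x"
  using linear_family_bound[OF F_linear F_cont] by blast

lemma F_lipschitz: obtains L where "\<And>t. t \<in> {0..T} \<Longrightarrow> L-lipschitz_on UNIV (F t)"
proof -
  obtain L where L: "L \<ge> 0" "\<And>t x. t \<in> {0..T} \<Longrightarrow> norm (F t x) \<le> L * norm x" using F_bound by metis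
  have "L-lipschitz_on UNIV (F t)" if "t \<in> {0..T}" for t
    using L(1) L(2)[OF that] by (intro lipschitz_onI) (auto simp: dist_norm simp flip: linear_diff[OF F_linear[OF that]])
  then show ?thesis using that by blast
qed

lemma continuous_on_F: "continuous_on A y \<Longrightarrow> A \<subseteq> {0..T} \<Longrightarrow> continuous_on A (\<lambda>s. F s (y s))"
  by (rule continuous_on_field_comp) (auto intro: continuous_on_subset[OF F_cont])

lemma measurable_F: "s \<in> {0..T} \<Longrightarrow> y \<in> borel_measurable M \<Longrightarrow> (\<lambda>\<omega>. F s (y \<omega>)) \<in> borel_measurable M"
  by (rule measurable_compose[of y M borel])
    (auto intro!: borel_measurable_continuous_onI linear_continuous_on simp: linear_conv_bounded_linear[symmetric] F_linear)

end

section \<open>Moments of the state\<close>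

text \<open>The driving processes enter through their means and covariances alone, so two Brownian
  motions of different dimensions can be merged into one finite family.\<close>

locale linear_sde = linear_field T F + prob_space M
  for T :: real and F :: "real \<Rightarrow> 'a::euclidean_space \<Rightarrow> 'a" and M :: "'w measure" +
  fixes \<beta> :: "'j::finite \<Rightarrow> real \<Rightarrow> 'w \<Rightarrow> real" and v :: "'j \<Rightarrow> 'a" and x0 :: 'a
    and X :: "real \<Rightarrow> 'w \<Rightarrow> 'a"
  assumes \<beta>_meas: "t \<in> {0..T} \<Longrightarrow> \<beta> j t \<in> borel_measurable M"
    and \<beta>_sq: "t \<in> {0..T} \<Longrightarrow> integrable M (\<lambda>\<omega>. (\<beta> j t \<omega>)\<^sup>2)"
    and \<beta>_mean: "t \<in> {0..T} \<Longrightarrow> expectation (\<beta> j t) = 0"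
    and \<beta>_cov: "s \<in> {0..T} \<Longrightarrow> t \<in> {0..T} \<Longrightarrow>
      expectation (\<lambda>\<omega>. \<beta> i s \<omega> * \<beta> j t \<omega>) = (if i = j then min s t else 0)"
    and X_meas: "t \<in> {0..T} \<Longrightarrow> X t \<in> borel_measurable M"
    and X_cont: "\<omega> \<in> space M \<Longrightarrow> continuous_on {0..T} (\<lambda>t. X t \<omega>)"
    and X_eq: "AE \<omega> in M. \<forall>t\<in>{0..T}. X t \<omega> = x0 + integral {0..t} (\<lambda>s. F s (X s \<omega>)) + (\<Sum>j\<in>UNIV. \<beta> j t \<omega> *\<^sub>R v j)"
begin

text \<open>\<open>Y\<close> is the part of the state with differentiable paths, \<open>N\<close>
  the noise, and \<open>\<Gamma>\<close> the covariance of \<open>N\<close> per unit of time.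
  Products of coordinates of \<open>Y\<close> obey the ordinary product rule; the second-order
  correction will come from \<open>\<Gamma>\<close>.\<close>

definition Y where "Y t \<omega> = x0 + integral {0..t} (\<lambda>s. F s (X s \<omega>))"
definition N where "N t \<omega> = (\<Sum>j\<in>UNIV. \<beta> j t \<omega> *\<^sub>R v j)"
definition \<Gamma> where "\<Gamma> a b = (\<Sum>j\<in>UNIV. (v j \<bullet> a) * (v j \<bullet> b))"

lemma X_decomp: "AE \<omega> in M. \<forall>t\<in>{0..T}. X t \<omega> = Y t \<omega> + N t \<omega>"
  using X_eq by (simp add: Y_def N_def)

lemma X_decomp_at: "t \<in> {0..T} \<Longrightarrow> AE \<omega> in M. X t \<omega> = Y t \<omega> + N t \<omega>"
  using X_decomp by (auto elim: AE_mp)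

lemma process_D: "cont_process M T (\<lambda>s \<omega>. F s (X s \<omega>))"
  by unfold_locales (use T_nonneg measurable_F[OF _ X_meas] continuous_on_F[OF X_cont] in auto)

lemma Y_meas: "t \<in> {0..T} \<Longrightarrow> Y t \<in> borel_measurable M"
  unfolding Y_def[abs_def] by (intro borel_measurable_add borel_measurable_const cont_process.measurable_integral[OF process_D])

lemma Y_deriv: "\<omega> \<in> space M \<Longrightarrow> t \<in> {0..T} \<Longrightarrow>
    ((\<lambda>t. Y t \<omega>) has_vector_derivative F t (X t \<omega>)) (at t within {0..T})"
  unfolding Y_def using integral_has_vector_derivative[OF continuous_on_F[OF X_cont]]
  by (auto intro!: derivative_eq_intros)

lemma Y_cont: "\<omega> \<in> space M \<Longrightarrow> continuous_on {0..T} (\<lambda>t. Y t \<omega>)"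
  by (rule has_vector_derivative_continuous_on[OF Y_deriv])

lemma process_Y: "cont_process M T Y"
  by unfold_locales (auto intro: T_nonneg Y_meas Y_cont)

lemma \<beta>_prod: "s \<in> {0..T} \<Longrightarrow> t \<in> {0..T} \<Longrightarrow> integrable M (\<lambda>\<omega>. \<beta> i s \<omega> * \<beta> j t \<omega>)"
proof (rule Bochner_Integration.integrable_bound[of M "\<lambda>\<omega>. (\<beta> i s \<omega>)\<^sup>2 + (\<beta> j t \<omega>)\<^sup>2"])
  assume st: "s \<in> {0..T}" "t \<in> {0..T}"
  show "integrable M (\<lambda>\<omega>. (\<beta> i s \<omega>)\<^sup>2 + (\<beta> j t \<omega>)\<^sup>2)" using \<beta>_sq st by auto
  show "(\<lambda>\<omega>. \<beta> i s \<omega> * \<beta> j t \<omega>) \<in> borel_measurable M" using \<beta>_meas st by auto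
  have "\<bar>x * y\<bar> \<le> x\<^sup>2 + y\<^sup>2" for x y :: real
    using sum_squares_bound[of "\<bar>x\<bar>" "\<bar>y\<bar>"] mult_nonneg_nonneg[OF abs_ge_zero abs_ge_zero, of x y]
    unfolding abs_mult mult.assoc power2_abs by linarith
  then show "AE \<omega> in M. norm (\<beta> i s \<omega> * \<beta> j t \<omega>) \<le> norm ((\<beta> i s \<omega>)\<^sup>2 + (\<beta> j t \<omega>)\<^sup>2)" by auto
qed

lemma \<beta>_int: "t \<in> {0..T} \<Longrightarrow> integrable M (\<beta> j t)"
  using square_integrable_imp_integrable[OF \<beta>_meas \<beta>_sq] by auto

lemma N_inner: "N t \<omega> \<bullet> a = (\<Sum>j\<in>UNIV. (v j \<bullet> a) * \<beta> j t \<omega>)"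
  by (simp add: N_def inner_sum_left mult.commute)

lemma N_meas: "t \<in> {0..T} \<Longrightarrow> N t \<in> borel_measurable M"
  unfolding N_def[abs_def] using \<beta>_meas by auto

lemma N_prod_int: "s \<in> {0..T} \<Longrightarrow> t \<in> {0..T} \<Longrightarrow> integrable M (\<lambda>\<omega>. (N s \<omega> \<bullet> a) * (N t \<omega> \<bullet> b))"
  and N_cov: "s \<in> {0..T} \<Longrightarrow> t \<in> {0..T} \<Longrightarrow>
    expectation (\<lambda>\<omega>. (N s \<omega> \<bullet> a) * (N t \<omega> \<bullet> b)) = min s t * \<Gamma> a b"
proof -
  have eq: "(N s \<omega> \<bullet> a) * (N t \<omega> \<bullet> b) = (\<Sum>i\<in>UNIV. \<Sum>j\<in>UNIV. (v i \<bullet> a) * (v j \<bullet> b) * (\<beta> i s \<omega> * \<beta> j t \<omega>))" for s t \<omega>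
    by (simp add: N_inner sum_product algebra_simps)
  assume st: "s \<in> {0..T}" "t \<in> {0..T}"
  show "integrable M (\<lambda>\<omega>. (N s \<omega> \<bullet> a) * (N t \<omega> \<bullet> b))"
    unfolding eq by (intro Bochner_Integration.integrable_sum integrable_mult_right \<beta>_prod st)
  have "expectation (\<lambda>\<omega>. (N s \<omega> \<bullet> a) * (N t \<omega> \<bullet> b))
      = (\<Sum>i\<in>UNIV. \<Sum>j\<in>UNIV. (v i \<bullet> a) * (v j \<bullet> b) * (if i = j then min s t else 0))"
    unfolding eq using \<beta>_prod[OF st]
    by (simp add: Bochner_Integration.integral_sum Bochner_Integration.integrable_sum \<beta>_cov[OF st])
  also have "\<dots> = min s t * \<Gamma> a b"
    by (simp add: \<Gamma>_def if_distrib sum.delta sum_distrib_left mult.commute cong: if_cong)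
  finally show "expectation (\<lambda>\<omega>. (N s \<omega> \<bullet> a) * (N t \<omega> \<bullet> b)) = min s t * \<Gamma> a b" .
qed

lemma N_int: "t \<in> {0..T} \<Longrightarrow> integrable M (\<lambda>\<omega>. N t \<omega> \<bullet> a)"
  and N_mean: "t \<in> {0..T} \<Longrightarrow> expectation (\<lambda>\<omega>. N t \<omega> \<bullet> a) = 0"
  unfolding N_inner using \<beta>_int \<beta>_mean by (auto simp: Bochner_Integration.integral_sum)

lemma norm_sq_basis: "(norm x)\<^sup>2 = (\<Sum>b\<in>Basis. (x \<bullet> b) * (x \<bullet> b))" for x :: 'a
  unfolding power2_norm_eq_inner by (rule euclidean_inner)

lemma N_sq_int: "t \<in> {0..T} \<Longrightarrow> integrable M (\<lambda>\<omega>. (norm (N t \<omega>))\<^sup>2)"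
  and N_sq: "t \<in> {0..T} \<Longrightarrow> expectation (\<lambda>\<omega>. (norm (N t \<omega>))\<^sup>2) = t * (\<Sum>b\<in>Basis. \<Gamma> b b)"
  unfolding norm_sq_basis using N_prod_int N_cov
  by (auto simp: Bochner_Integration.integral_sum sum_distrib_left intro!: Bochner_Integration.integrable_sum)

text \<open>Gronwall's inequality is applied for each \<omega> and squared; the averaged right-hand
  side then depends only on the second moments of the noise.\<close>

lemma second_moment:
  obtains C where "C \<ge> 0" "\<And>t. t \<in> {0..T} \<Longrightarrow> integrable M (\<lambda>\<omega>. (norm (X t \<omega>))\<^sup>2)"
    "\<And>t. t \<in> {0..T} \<Longrightarrow> expectation (\<lambda>\<omega>. (norm (X t \<omega>))\<^sup>2) \<le> C"
proof -
  obtain L where L: "L \<ge> 0" "\<And>t x. t \<in> {0..T} \<Longrightarrow> norm (F t x) \<le> L * norm x" using F_bound by metis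
  \<comment> \<open>\<open>X t \<omega> - Y t \<omega>\<close> equals the noise almost surely, but
    in contrast to the noise it is known to be continuous in \<open>t\<close> for every \<omega>, as
    the pathwise argument requires.\<close>
  define A where "A t \<omega> = norm x0 + norm (X t \<omega> - Y t \<omega>)" for t \<omega>
  define C1 where "C1 = 2 * (norm x0)\<^sup>2 + 2 * (T * (\<Sum>b\<in>Basis. \<Gamma> b b))"
  have \<Gamma>_nonneg: "0 \<le> (\<Sum>b\<in>Basis. \<Gamma> b b)" by (auto simp: \<Gamma>_def intro!: sum_nonneg)
  have C1: "C1 \<ge> 0" using \<Gamma>_nonneg T_nonneg by (simp add: C1_def)
  have A_cont: "continuous_on {0..T} (\<lambda>t. A t \<omega>)" if "\<omega> \<in> space M" for \<omega>
    unfolding A_def by (intro continuous_intros X_cont Y_cont that)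
  have A_meas: "A t \<in> borel_measurable M" if "t \<in> {0..T}" for t
    unfolding A_def[abs_def] using X_meas[OF that] Y_meas[OF that] by measurable
  have sq_add: "(x + y)\<^sup>2 \<le> 2 * x\<^sup>2 + 2 * y\<^sup>2" for x y :: real
    using sum_squares_bound[of x y] by (simp add: power2_sum)
  have A_sq: "integrable M (\<lambda>\<omega>. (A t \<omega>)\<^sup>2) \<and> expectation (\<lambda>\<omega>. (A t \<omega>)\<^sup>2) \<le> C1" if t: "t \<in> {0..T}" for t
  proof -
    have i: "integrable M (\<lambda>\<omega>. 2 * (norm x0)\<^sup>2 + 2 * (norm (N t \<omega>))\<^sup>2)" using N_sq_int[OF t] by auto
    have le: "AE \<omega> in M. (A t \<omega>)\<^sup>2 \<le> 2 * (norm x0)\<^sup>2 + 2 * (norm (N t \<omega>))\<^sup>2"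
      using X_decomp_at[OF t] by eventually_elim (auto simp: A_def intro: sq_add)
    have int: "integrable M (\<lambda>\<omega>. (A t \<omega>)\<^sup>2)"
      by (rule Bochner_Integration.integrable_bound[OF i]) (use le A_meas[OF t] in auto)
    have "expectation (\<lambda>\<omega>. (A t \<omega>)\<^sup>2) \<le> expectation (\<lambda>\<omega>. 2 * (norm x0)\<^sup>2 + 2 * (norm (N t \<omega>))\<^sup>2)"
      by (rule integral_mono_AE[OF int i le])
    also have "\<dots> = 2 * (norm x0)\<^sup>2 + 2 * (t * (\<Sum>b\<in>Basis. \<Gamma> b b))"
      using N_sq_int[OF t] N_sq[OF t] by (simp add: prob_space)
    also have "\<dots> \<le> C1" unfolding C1_def using t \<Gamma>_nonneg by (simp add: mult_right_mono)
    finally show ?thesis using int by simp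
  qed
  have pA2: "cont_process M T (\<lambda>t \<omega>. (A t \<omega>)\<^sup>2)"
    by unfold_locales (use T_nonneg borel_measurable_power[OF A_meas] continuous_on_power[OF A_cont] in auto)
  have TT: "T \<in> {0..T}" using T_nonneg by auto
  have I: "integrable M (\<lambda>\<omega>. integral {0..T} (\<lambda>s. (A s \<omega>)\<^sup>2))"
    "expectation (\<lambda>\<omega>. integral {0..T} (\<lambda>s. (A s \<omega>)\<^sup>2)) = integral {0..T} (\<lambda>s. expectation (\<lambda>\<omega>. (A s \<omega>)\<^sup>2))"
    "(\<lambda>s. expectation (\<lambda>\<omega>. (A s \<omega>)\<^sup>2)) integrable_on {0..T}"
    by (rule cont_process.fubini_path_bdd[OF pA2 prob_space_axioms _ TT]; use A_sq in \<open>auto intro!: exI[of _ C1]\<close>)+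
  have EI: "expectation (\<lambda>\<omega>. integral {0..T} (\<lambda>s. (A s \<omega>)\<^sup>2)) \<le> T * C1"
  proof -
    have "integral {0..T} (\<lambda>s. expectation (\<lambda>\<omega>. (A s \<omega>)\<^sup>2)) \<le> integral {0..T} (\<lambda>s. C1)"
      by (rule integral_le[OF I(3)]) (use A_sq in auto)
    then show ?thesis using I(2) T_nonneg by simp
  qed
  define K where "K = L * exp (L * T)"
  have path: "(norm (X t \<omega>))\<^sup>2 \<le> 2 * (A t \<omega>)\<^sup>2 + 2 * K\<^sup>2 * T * integral {0..T} (\<lambda>s. (A s \<omega>)\<^sup>2)"
    if \<omega>: "\<omega> \<in> space M" and t: "t \<in> {0..T}" for t \<omega>
  proof -
    have "norm (X t \<omega>) \<le> A t \<omega> + L * exp (L * T) * integral {0..T} (\<lambda>s. A s \<omega>)"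
    proof (rule gronwall_integral[OF _ A_cont[OF \<omega>] _ L(1) _ t])
      show "continuous_on {0..T} (\<lambda>t. norm (X t \<omega>))" by (intro continuous_intros X_cont \<omega>)
      show "0 \<le> A t \<omega>" for t by (simp add: A_def)
      fix t assume t: "t \<in> {0..T}"
      have cX: "continuous_on {0..t} (\<lambda>s. X s \<omega>)" using t by (intro continuous_on_subset[OF X_cont[OF \<omega>]]) auto
      have "X t \<omega> = (X t \<omega> - Y t \<omega>) + (x0 + integral {0..t} (\<lambda>s. F s (X s \<omega>)))" by (simp add: Y_def)
      also have "norm \<dots> \<le> norm (X t \<omega> - Y t \<omega>) + (norm x0 + norm (integral {0..t} (\<lambda>s. F s (X s \<omega>))))"
        by (intro order_trans[OF norm_triangle_ineq] add_mono order_refl norm_triangle_ineq)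
      also have "norm (integral {0..t} (\<lambda>s. F s (X s \<omega>))) \<le> integral {0..t} (\<lambda>s. L * norm (X s \<omega>))"
        by (rule integral_norm_bound_integral)
          (use t L(2) in \<open>auto intro!: integrable_continuous_real continuous_intros continuous_on_F cX\<close>)
      also have "\<dots> = L * integral {0..t} (\<lambda>s. norm (X s \<omega>))" by simp
      finally show "norm (X t \<omega>) \<le> A t \<omega> + L * integral {0..t} (\<lambda>s. norm (X s \<omega>))"
        by (simp add: A_def)
    qed
    then have "(norm (X t \<omega>))\<^sup>2 \<le> (A t \<omega> + K * integral {0..T} (\<lambda>s. A s \<omega>))\<^sup>2"
      by (intro power_mono) (auto simp: K_def)
    also have "\<dots> \<le> 2 * (A t \<omega>)\<^sup>2 + 2 * (K * integral {0..T} (\<lambda>s. A s \<omega>))\<^sup>2" by (rule sq_add)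
    also have "(K * integral {0..T} (\<lambda>s. A s \<omega>))\<^sup>2 \<le> K\<^sup>2 * (T * integral {0..T} (\<lambda>s. (A s \<omega>)\<^sup>2))"
      unfolding power_mult_distrib by (intro mult_left_mono integral_square_le A_cont \<omega> T_nonneg) auto
    finally show ?thesis by (simp add: algebra_simps)
  qed
  show ?thesis
  proof (rule that)
    show "0 \<le> 2 * C1 + 2 * K\<^sup>2 * T * (T * C1)" using C1 T_nonneg by simp
    fix t assume t: "t \<in> {0..T}"
    have i: "integrable M (\<lambda>\<omega>. 2 * (A t \<omega>)\<^sup>2 + 2 * K\<^sup>2 * T * integral {0..T} (\<lambda>s. (A s \<omega>)\<^sup>2))"
      using A_sq[OF t] I(1) by auto
    have "AE \<omega> in M. norm ((norm (X t \<omega>))\<^sup>2) \<le> norm (2 * (A t \<omega>)\<^sup>2 + 2 * K\<^sup>2 * T * integral {0..T} (\<lambda>s. (A s \<omega>)\<^sup>2))"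
      using path t by (intro AE_I2) (auto intro: order_trans[OF _ abs_ge_self])
    then show int: "integrable M (\<lambda>\<omega>. (norm (X t \<omega>))\<^sup>2)"
      by (rule Bochner_Integration.integrable_bound[OF i _ , rotated]) (use X_meas[OF t] in measurable)
    have "expectation (\<lambda>\<omega>. (norm (X t \<omega>))\<^sup>2)
        \<le> expectation (\<lambda>\<omega>. 2 * (A t \<omega>)\<^sup>2 + 2 * K\<^sup>2 * T * integral {0..T} (\<lambda>s. (A s \<omega>)\<^sup>2))"
      by (rule integral_mono[OF int i path[OF _ t]])
    also have "\<dots> = 2 * expectation (\<lambda>\<omega>. (A t \<omega>)\<^sup>2)
        + 2 * K\<^sup>2 * T * expectation (\<lambda>\<omega>. integral {0..T} (\<lambda>s. (A s \<omega>)\<^sup>2))"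
      using A_sq[OF t] I(1) by simp
    also have "\<dots> \<le> 2 * C1 + 2 * K\<^sup>2 * T * (T * C1)"
      using A_sq[OF t] EI T_nonneg by (intro add_mono mult_left_mono) auto
    finally show "expectation (\<lambda>\<omega>. (norm (X t \<omega>))\<^sup>2) \<le> 2 * C1 + 2 * K\<^sup>2 * T * (T * C1)" .
  qed
qed

end

section \<open>Uniformly square integrable coordinates and future increments\<close>

context linear_sde
begin

text \<open>The uniformity in time gives the product of two such processes a uniform bound on its
  first absolute moment, which is the hypothesis of \<open>fubini_path_bdd\<close>.\<close>

definition L2_bdd :: "(real \<Rightarrow> 'w \<Rightarrow> real) \<Rightarrow> bool" where
  "L2_bdd f \<longleftrightarrow> (\<exists>C. \<forall>s\<in>{0..T}. f s \<in> borel_measurable M \<and> integrable M (\<lambda>\<omega>. (f s \<omega>)\<^sup>2) \<and>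
    expectation (\<lambda>\<omega>. (f s \<omega>)\<^sup>2) \<le> C)"

lemma L2_bdd_dominated:
  assumes meas: "\<And>s. s \<in> {0..T} \<Longrightarrow> f s \<in> borel_measurable M"
    and int: "\<And>s. s \<in> {0..T} \<Longrightarrow> integrable M (g s)"
    and le: "\<And>s. s \<in> {0..T} \<Longrightarrow> AE \<omega> in M. (f s \<omega>)\<^sup>2 \<le> g s \<omega>"
    and C: "\<And>s. s \<in> {0..T} \<Longrightarrow> expectation (g s) \<le> C"
  shows "L2_bdd f"
  unfolding L2_bdd_def
proof (intro exI ballI conjI)
  fix s assume s: "s \<in> {0..T}"
  show "f s \<in> borel_measurable M" by (rule meas[OF s])
  show int': "integrable M (\<lambda>\<omega>. (f s \<omega>)\<^sup>2)"
  proof (rule Bochner_Integration.integrable_bound[OF int[OF s]])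
    show "(\<lambda>\<omega>. (f s \<omega>)\<^sup>2) \<in> borel_measurable M" using meas[OF s] by measurable
    show "AE \<omega> in M. norm ((f s \<omega>)\<^sup>2) \<le> norm (g s \<omega>)" using le[OF s] by eventually_elim auto
  qed
  show "expectation (\<lambda>\<omega>. (f s \<omega>)\<^sup>2) \<le> C"
    using integral_mono_AE[OF int' int[OF s] le[OF s]] C[OF s] by linarith
qed

lemma L2_bdd_add:
  assumes "L2_bdd f" "L2_bdd g"
  shows "L2_bdd (\<lambda>s \<omega>. f s \<omega> + g s \<omega>)"
proof -
  obtain C where C: "\<And>s. s \<in> {0..T} \<Longrightarrow> f s \<in> borel_measurable M \<and> integrable M (\<lambda>\<omega>. (f s \<omega>)\<^sup>2) \<and>
    expectation (\<lambda>\<omega>. (f s \<omega>)\<^sup>2) \<le> C" using assms(1) unfolding L2_bdd_def by metis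
  obtain D where D: "\<And>s. s \<in> {0..T} \<Longrightarrow> g s \<in> borel_measurable M \<and> integrable M (\<lambda>\<omega>. (g s \<omega>)\<^sup>2) \<and>
    expectation (\<lambda>\<omega>. (g s \<omega>)\<^sup>2) \<le> D" using assms(2) unfolding L2_bdd_def by metis
  show ?thesis
  proof (rule L2_bdd_dominated[where g = "\<lambda>s \<omega>. 2 * (f s \<omega>)\<^sup>2 + 2 * (g s \<omega>)\<^sup>2" and C = "2 * C + 2 * D"])
    fix s assume s: "s \<in> {0..T}"
    show "(\<lambda>\<omega>. f s \<omega> + g s \<omega>) \<in> borel_measurable M"
      by (rule borel_measurable_add) (use C[OF s] D[OF s] in auto)
    show "integrable M (\<lambda>\<omega>. 2 * (f s \<omega>)\<^sup>2 + 2 * (g s \<omega>)\<^sup>2)" using C[OF s] D[OF s] by simp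
    have "(x + y)\<^sup>2 \<le> 2 * x\<^sup>2 + 2 * y\<^sup>2" for x y :: real
      using sum_squares_bound[of x y] by (simp add: power2_sum)
    then show "AE \<omega> in M. (f s \<omega> + g s \<omega>)\<^sup>2 \<le> 2 * (f s \<omega>)\<^sup>2 + 2 * (g s \<omega>)\<^sup>2" by simp
    show "expectation (\<lambda>\<omega>. 2 * (f s \<omega>)\<^sup>2 + 2 * (g s \<omega>)\<^sup>2) \<le> 2 * C + 2 * D" using C[OF s] D[OF s] by simp
  qed
qed

lemma L2_bdd_minus: "L2_bdd f \<Longrightarrow> L2_bdd (\<lambda>s \<omega>. - f s \<omega>)"
  unfolding L2_bdd_def by simp

lemma L2_bdd_mult:
  assumes "L2_bdd f" "L2_bdd g"
  shows "\<exists>C. \<forall>s\<in>{0..T}. integrable M (\<lambda>\<omega>. f s \<omega> * g s \<omega>) \<and>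
    expectation (\<lambda>\<omega>. norm (f s \<omega> * g s \<omega>)) \<le> C"
proof -
  obtain C where C: "\<And>s. s \<in> {0..T} \<Longrightarrow> f s \<in> borel_measurable M \<and> integrable M (\<lambda>\<omega>. (f s \<omega>)\<^sup>2) \<and>
    expectation (\<lambda>\<omega>. (f s \<omega>)\<^sup>2) \<le> C" using assms(1) unfolding L2_bdd_def by metis
  obtain D where D: "\<And>s. s \<in> {0..T} \<Longrightarrow> g s \<in> borel_measurable M \<and> integrable M (\<lambda>\<omega>. (g s \<omega>)\<^sup>2) \<and>
    expectation (\<lambda>\<omega>. (g s \<omega>)\<^sup>2) \<le> D" using assms(2) unfolding L2_bdd_def by metis
  have le: "\<bar>x * y\<bar> \<le> x\<^sup>2 + y\<^sup>2" for x y :: real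
    using sum_squares_bound[of "\<bar>x\<bar>" "\<bar>y\<bar>"] mult_nonneg_nonneg[OF abs_ge_zero abs_ge_zero, of x y]
    unfolding abs_mult mult.assoc power2_abs by linarith
  have i: "integrable M (\<lambda>\<omega>. f s \<omega> * g s \<omega>)" if s: "s \<in> {0..T}" for s
    by (rule Bochner_Integration.integrable_bound[of M "\<lambda>\<omega>. (f s \<omega>)\<^sup>2 + (g s \<omega>)\<^sup>2"])
      (use C[OF s] D[OF s] le in auto)
  show ?thesis
  proof (intro exI[of _ "C + D"] ballI conjI)
    fix s assume s: "s \<in> {0..T}"
    show "integrable M (\<lambda>\<omega>. f s \<omega> * g s \<omega>)" by (rule i[OF s])
    have "expectation (\<lambda>\<omega>. norm (f s \<omega> * g s \<omega>)) \<le> expectation (\<lambda>\<omega>. (f s \<omega>)\<^sup>2 + (g s \<omega>)\<^sup>2)"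
      by (rule integral_mono) (use i[OF s] C[OF s] D[OF s] le in auto)
    also have "\<dots> \<le> C + D" using C[OF s] D[OF s] by simp
    finally show "expectation (\<lambda>\<omega>. norm (f s \<omega> * g s \<omega>)) \<le> C + D" .
  qed
qed

lemma inner_sq_le: "(x \<bullet> a)\<^sup>2 \<le> (norm a)\<^sup>2 * (norm x)\<^sup>2" for x a :: 'a
  using Cauchy_Schwarz_ineq[of x a] by (simp add: power2_norm_eq_inner mult.commute)

lemma L2_bdd_X: "L2_bdd (\<lambda>s \<omega>. X s \<omega> \<bullet> a)"
proof -
  obtain C where C: "C \<ge> 0" "\<And>t. t \<in> {0..T} \<Longrightarrow> integrable M (\<lambda>\<omega>. (norm (X t \<omega>))\<^sup>2)"
    "\<And>t. t \<in> {0..T} \<Longrightarrow> expectation (\<lambda>\<omega>. (norm (X t \<omega>))\<^sup>2) \<le> C" using second_moment by metis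
  show ?thesis
    by (rule L2_bdd_dominated[where g = "\<lambda>s \<omega>. (norm a)\<^sup>2 * (norm (X s \<omega>))\<^sup>2" and C = "(norm a)\<^sup>2 * C"])
      (use X_meas C inner_sq_le in \<open>auto intro!: mult_left_mono\<close>)
qed

lemma L2_bdd_N: "L2_bdd (\<lambda>s \<omega>. N s \<omega> \<bullet> a)"
proof (rule L2_bdd_dominated[where g = "\<lambda>s \<omega>. (N s \<omega> \<bullet> a) * (N s \<omega> \<bullet> a)" and C = "T * \<Gamma> a a"])
  fix s assume s: "s \<in> {0..T}"
  show "(\<lambda>\<omega>. N s \<omega> \<bullet> a) \<in> borel_measurable M" using N_meas[OF s] by measurable
  show "integrable M (\<lambda>\<omega>. (N s \<omega> \<bullet> a) * (N s \<omega> \<bullet> a))" by (rule N_prod_int[OF s s])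
  show "AE \<omega> in M. (N s \<omega> \<bullet> a)\<^sup>2 \<le> (N s \<omega> \<bullet> a) * (N s \<omega> \<bullet> a)" by (simp add: power2_eq_square)
  have "0 \<le> \<Gamma> a a" by (auto simp: \<Gamma>_def intro!: sum_nonneg)
  then show "expectation (\<lambda>\<omega>. (N s \<omega> \<bullet> a) * (N s \<omega> \<bullet> a)) \<le> T * \<Gamma> a a"
    using s by (simp add: N_cov[OF s s] mult_right_mono)
qed

lemma L2_bdd_const_time:
  assumes "L2_bdd f" "t \<in> {0..T}"
  shows "L2_bdd (\<lambda>_. f t)"
  unfolding L2_bdd_def
  by (rule exE[OF assms(1)[unfolded L2_bdd_def]]) (drule bspec[OF _ assms(2)], rule exI, rule ballI, assumption)

lemma L2_bdd_Y: "L2_bdd (\<lambda>s \<omega>. Y s \<omega> \<bullet> a)"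
proof -
  obtain C where C: "\<forall>s\<in>{0..T}. (\<lambda>\<omega>. X s \<omega> \<bullet> a + - (N s \<omega> \<bullet> a)) \<in> borel_measurable M \<and>
      integrable M (\<lambda>\<omega>. (X s \<omega> \<bullet> a + - (N s \<omega> \<bullet> a))\<^sup>2) \<and>
      expectation (\<lambda>\<omega>. (X s \<omega> \<bullet> a + - (N s \<omega> \<bullet> a))\<^sup>2) \<le> C"
    using L2_bdd_add[OF L2_bdd_X L2_bdd_minus[OF L2_bdd_N], of a a] unfolding L2_bdd_def by (rule exE)
  show ?thesis
  proof (rule L2_bdd_dominated[where g = "\<lambda>s \<omega>. (X s \<omega> \<bullet> a + - (N s \<omega> \<bullet> a))\<^sup>2" and C = C])
    fix s assume s: "s \<in> {0..T}"
    show "(\<lambda>\<omega>. Y s \<omega> \<bullet> a) \<in> borel_measurable M" using Y_meas[OF s] by measurable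
    show "AE \<omega> in M. (Y s \<omega> \<bullet> a)\<^sup>2 \<le> (X s \<omega> \<bullet> a + - (N s \<omega> \<bullet> a))\<^sup>2"
      using X_decomp_at[OF s] by eventually_elim (simp add: inner_add_left)
    note Cs = bspec[OF C s]
    show "integrable M (\<lambda>\<omega>. (X s \<omega> \<bullet> a + - (N s \<omega> \<bullet> a))\<^sup>2)" by (rule conjunct1[OF conjunct2[OF Cs]])
    show "expectation (\<lambda>\<omega>. (X s \<omega> \<bullet> a + - (N s \<omega> \<bullet> a))\<^sup>2) \<le> C" by (rule conjunct2[OF conjunct2[OF Cs]])
  qed
qed

lemma L2_bdd_D: "L2_bdd (\<lambda>s \<omega>. F s (X s \<omega>) \<bullet> a)"
proof -
  obtain C where C: "C \<ge> 0" "\<And>t. t \<in> {0..T} \<Longrightarrow> integrable M (\<lambda>\<omega>. (norm (X t \<omega>))\<^sup>2)"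
    "\<And>t. t \<in> {0..T} \<Longrightarrow> expectation (\<lambda>\<omega>. (norm (X t \<omega>))\<^sup>2) \<le> C" using second_moment by metis
  obtain L where L: "L \<ge> 0" "\<And>t x. t \<in> {0..T} \<Longrightarrow> norm (F t x) \<le> L * norm x" using F_bound by metis
  show ?thesis
  proof (rule L2_bdd_dominated[where g = "\<lambda>s \<omega>. ((norm a)\<^sup>2 * L\<^sup>2) * (norm (X s \<omega>))\<^sup>2" and C = "((norm a)\<^sup>2 * L\<^sup>2) * C"])
    fix s assume s: "s \<in> {0..T}"
    show "(\<lambda>\<omega>. F s (X s \<omega>) \<bullet> a) \<in> borel_measurable M" using measurable_F[OF s X_meas[OF s]] by measurable
    have "(F s x \<bullet> a)\<^sup>2 \<le> ((norm a)\<^sup>2 * L\<^sup>2) * (norm x)\<^sup>2" for x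
    proof -
      have "(F s x \<bullet> a)\<^sup>2 \<le> (norm a)\<^sup>2 * (norm (F s x))\<^sup>2" by (rule inner_sq_le)
      also have "\<dots> \<le> (norm a)\<^sup>2 * (L * norm x)\<^sup>2" by (intro mult_left_mono power_mono L(2)[OF s]) auto
      finally show ?thesis by (simp add: power_mult_distrib mult.assoc)
    qed
    then show "AE \<omega> in M. (F s (X s \<omega>) \<bullet> a)\<^sup>2 \<le> ((norm a)\<^sup>2 * L\<^sup>2) * (norm (X s \<omega>))\<^sup>2" by simp
  qed (use C in \<open>auto intro!: mult_left_mono\<close>)
qed

lemma L2_bdd_prod_int:
  assumes "L2_bdd f" "L2_bdd g" "s \<in> {0..T}"
  shows "integrable M (\<lambda>\<omega>. f s \<omega> * g s \<omega>)"
  by (rule exE[OF L2_bdd_mult[OF assms(1,2)]]) (drule bspec[OF _ assms(3)], erule conjunct1)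

lemma X_prod_int: "t \<in> {0..T} \<Longrightarrow> integrable M (\<lambda>\<omega>. (X t \<omega> \<bullet> a) * (X t \<omega> \<bullet> b))"
  by (rule L2_bdd_prod_int[OF L2_bdd_X L2_bdd_X])

text \<open>Replaces the independence of the past and the increments of the noise: the correlation of
  \<open>X r\<close> with a later increment solves the homogeneous linear equation with initial value 0.\<close>

lemma future_increment:
  assumes st: "s0 \<in> {0..T}" "t0 \<in> {0..T}" "s0 \<le> t0" and r: "r \<in> {0..s0}"
  shows "expectation (\<lambda>\<omega>. (X r \<omega> \<bullet> a) * ((N t0 \<omega> - N s0 \<omega>) \<bullet> b)) = 0"
proof -
  define n where "n \<omega> = N t0 \<omega> \<bullet> b + - (N s0 \<omega> \<bullet> b)" for \<omega>
  have n2: "L2_bdd (\<lambda>_. n)"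
    unfolding n_def using L2_bdd_add[OF L2_bdd_const_time[OF L2_bdd_N st(2)] L2_bdd_minus[OF L2_bdd_const_time[OF L2_bdd_N st(1)]], of b b] .
  have n_meas: "n \<in> borel_measurable M" unfolding n_def[abs_def] using N_meas[OF st(1)] N_meas[OF st(2)] by measurable
  have "0 \<in> {0..T}" using T_nonneg by simp
  then have n_int: "integrable M n" using square_integrable_imp_integrable[OF n_meas] n2 unfolding L2_bdd_def by blast
  have n_mean: "expectation n = 0"
    unfolding n_def[abs_def] using N_int N_mean st by simp
  define m where "m c r = expectation (\<lambda>\<omega>. n \<omega> * (X r \<omega> \<bullet> c))" for c r
  \<comment> \<open>The vector of correlations of the increment \<open>n\<close> with the
    coordinates of the state. Expectation commutes with the linear map \<open>F s\<close>, so
    \<open>V\<close> satisfies the same linear equation as the drift part.\<close>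
  define V where "V r = (\<Sum>c\<in>Basis. m c r *\<^sub>R c)" for r
  have m_int: "integrable M (\<lambda>\<omega>. n \<omega> * (X r \<omega> \<bullet> c))" if "r \<in> {0..T}" for r c
    by (rule L2_bdd_prod_int[OF n2 L2_bdd_X that])
  have F_m: "expectation (\<lambda>\<omega>. n \<omega> * (F s (X s \<omega>) \<bullet> c)) = F s (V s) \<bullet> c" if s: "s \<in> {0..T}" for s c
  proof -
    have lin: "F s x \<bullet> c = (\<Sum>e\<in>Basis. (x \<bullet> e) * (F s e \<bullet> c))" for x
    proof -
      have "F s x = F s (\<Sum>e\<in>Basis. (x \<bullet> e) *\<^sub>R e)" by (simp add: euclidean_representation)
      also have "\<dots> = (\<Sum>e\<in>Basis. (x \<bullet> e) *\<^sub>R F s e)"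
        by (simp add: linear_sum[OF F_linear[OF s]] linear_scale[OF F_linear[OF s]])
      finally show ?thesis by (simp add: inner_sum_left)
    qed
    have "expectation (\<lambda>\<omega>. n \<omega> * (F s (X s \<omega>) \<bullet> c)) = expectation (\<lambda>\<omega>. \<Sum>e\<in>Basis. (n \<omega> * (X s \<omega> \<bullet> e)) * (F s e \<bullet> c))"
      unfolding lin[of "X s _"] by (simp add: sum_distrib_left mult.assoc)
    also have "\<dots> = (\<Sum>e\<in>Basis. m e s * (F s e \<bullet> c))"
      using m_int[OF s] by (simp add: Bochner_Integration.integral_sum m_def)
    also have "\<dots> = F s (V s) \<bullet> c"
      unfolding lin[of "V s"] by (intro sum.cong refl) (simp add: V_def inner_sum_left inner_Basis if_distrib sum.delta cong: if_cong)
    finally show ?thesis .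
  qed
  have m_eq: "(\<lambda>s. F s (V s) \<bullet> c) integrable_on {0..r}" "m c r = integral {0..r} (\<lambda>s. F s (V s) \<bullet> c)"
    if r: "r \<in> {0..s0}" for r c
  proof -
    have rT: "r \<in> {0..T}" using r st by auto
    have proc: "cont_process M T (\<lambda>s \<omega>. n \<omega> * (F s (X s \<omega>) \<bullet> c))"
    proof unfold_locales
      fix s assume s: "s \<in> {0..T}"
      show "(\<lambda>\<omega>. n \<omega> * (F s (X s \<omega>) \<bullet> c)) \<in> borel_measurable M"
        using n_meas measurable_F[OF s X_meas[OF s]] by measurable
    next
      fix \<omega> assume "\<omega> \<in> space M"
      then show "continuous_on {0..T} (\<lambda>s. n \<omega> * (F s (X s \<omega>) \<bullet> c))"
        by (intro continuous_intros continuous_on_F X_cont) auto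
    qed (rule T_nonneg)
    note fp = cont_process.fubini_path_bdd[OF proc prob_space_axioms L2_bdd_mult[OF n2 L2_bdd_D] rT]
    have eqF: "expectation (\<lambda>\<omega>. n \<omega> * (F s (X s \<omega>) \<bullet> c)) = F s (V s) \<bullet> c" if "s \<in> {0..r}" for s
      by (rule F_m) (use that rT in auto)
    show "(\<lambda>s. F s (V s) \<bullet> c) integrable_on {0..r}"
      using fp(2) by (rule integrable_eq) (rule eqF)
    have ae: "AE \<omega> in M. n \<omega> * (X r \<omega> \<bullet> c) = (x0 \<bullet> c) * n \<omega> + integral {0..r} (\<lambda>s. n \<omega> * (F s (X s \<omega>) \<bullet> c)) + n \<omega> * (N r \<omega> \<bullet> c)"
      using X_decomp_at[OF rT] AE_space
    proof eventually_elim
      case (elim \<omega>)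
      have "continuous_on {0..r} (\<lambda>s. F s (X s \<omega>))"
        using rT by (intro continuous_on_F continuous_on_subset[OF X_cont[OF elim(2)]]) auto
      then have "integral {0..r} (\<lambda>s. F s (X s \<omega>)) \<bullet> c = integral {0..r} (\<lambda>s. F s (X s \<omega>) \<bullet> c)"
        using integral_linear[OF integrable_continuous_real bounded_linear_inner_left] by (fastforce simp: o_def)
      then show ?case using elim(1) by (simp add: Y_def inner_add_left algebra_simps)
    qed
    define J where "J \<omega> = integral {0..r} (\<lambda>s. n \<omega> * (F s (X s \<omega>) \<bullet> c))" for \<omega>
    have J: "integrable M J" "expectation J = integral {0..r} (\<lambda>s. expectation (\<lambda>\<omega>. n \<omega> * (F s (X s \<omega>) \<bullet> c)))"
      using fp(1,3) unfolding J_def[abs_def] .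
    have "m c r = expectation (\<lambda>\<omega>. (x0 \<bullet> c) * n \<omega> + J \<omega> + n \<omega> * (N r \<omega> \<bullet> c))"
      unfolding m_def
    proof (rule integral_cong_AE)
      show "(\<lambda>\<omega>. n \<omega> * (X r \<omega> \<bullet> c)) \<in> borel_measurable M" using m_int[OF rT] by simp
      show "(\<lambda>\<omega>. (x0 \<bullet> c) * n \<omega> + J \<omega> + n \<omega> * (N r \<omega> \<bullet> c)) \<in> borel_measurable M"
        using n_meas J(1) N_meas[OF rT] by measurable
      show "AE \<omega> in M. n \<omega> * (X r \<omega> \<bullet> c) = (x0 \<bullet> c) * n \<omega> + J \<omega> + n \<omega> * (N r \<omega> \<bullet> c)"
        using ae by (simp add: J_def)
    qed
    also have "\<dots> = (x0 \<bullet> c) * expectation n + expectation J + expectation (\<lambda>\<omega>. n \<omega> * (N r \<omega> \<bullet> c))"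
      using n_int J(1) L2_bdd_prod_int[OF n2 L2_bdd_N rT, of c] by simp
    also note J(2)
    \<comment> \<open>Both minima in the covariance equal \<open>r\<close>, because \<open>r\<close>
      does not exceed \<open>s0\<close>: the noise up to time \<open>r\<close> is uncorrelated with
      the later increment.\<close>
    also have "expectation (\<lambda>\<omega>. n \<omega> * (N r \<omega> \<bullet> c)) = 0"
    proof -
      have "expectation (\<lambda>\<omega>. n \<omega> * (N r \<omega> \<bullet> c))
          = expectation (\<lambda>\<omega>. (N t0 \<omega> \<bullet> b) * (N r \<omega> \<bullet> c) - (N s0 \<omega> \<bullet> b) * (N r \<omega> \<bullet> c))"
        by (simp add: n_def algebra_simps)
      also have "\<dots> = min t0 r * \<Gamma> b c - min s0 r * \<Gamma> b c"
        using N_prod_int[OF st(2) rT] N_prod_int[OF st(1) rT] N_cov[OF st(2) rT] N_cov[OF st(1) rT] by simp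
      also have "\<dots> = 0" using r st by (simp add: min_def)
      finally show ?thesis .
    qed
    also have "integral {0..r} (\<lambda>s. expectation (\<lambda>\<omega>. n \<omega> * (F s (X s \<omega>) \<bullet> c))) = integral {0..r} (\<lambda>s. F s (V s) \<bullet> c)"
      by (rule Henstock_Kurzweil_Integration.integral_cong) (rule eqF)
    finally show "m c r = integral {0..r} (\<lambda>s. F s (V s) \<bullet> c)" by (simp add: n_mean)
  qed
  have s0: "s0 \<in> {0..s0}" using st by auto
  have m_cont: "continuous_on {0..s0} (m c)" for c
    using indefinite_integral_continuous_1[OF m_eq(1)[OF s0]]
    by (rule continuous_on_eq) (use m_eq(2) in auto)
  have V_cont: "continuous_on {0..s0} V"
    unfolding V_def[abs_def] by (intro continuous_intros m_cont)
  have V_deriv: "(V has_vector_derivative F s (V s)) (at s within {0..s0})" if s: "s \<in> {0..s0}" for s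
  proof -
    have "((\<lambda>u. integral {0..u} (\<lambda>s. F s (V s) \<bullet> c)) has_vector_derivative F s (V s) \<bullet> c) (at s within {0..s0})" for c
      by (rule integral_has_vector_derivative[OF _ s]) (use st in \<open>auto intro!: continuous_intros continuous_on_F V_cont\<close>)
    then have "(m c has_vector_derivative F s (V s) \<bullet> c) (at s within {0..s0})" for c
      by (rule has_vector_derivative_transform[OF s, rotated]) (use m_eq(2) in auto)
    then have "((\<lambda>s. m c s *\<^sub>R c) has_vector_derivative (F s (V s) \<bullet> c) *\<^sub>R c) (at s within {0..s0})" for c
      using bounded_linear.has_vector_derivative[OF bounded_linear_scaleR_left] by blast
    then have "(V has_vector_derivative (\<Sum>c\<in>Basis. (F s (V s) \<bullet> c) *\<^sub>R c)) (at s within {0..s0})"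
      unfolding V_def[abs_def] by (intro has_vector_derivative_sum)
    then show ?thesis by (simp add: euclidean_representation)
  qed
  obtain L where L: "L \<ge> 0" "\<And>t x. t \<in> {0..T} \<Longrightarrow> norm (F t x) \<le> L * norm x" using F_bound by metis
  have V0: "V s = 0" if s: "s \<in> {0..s0}" for s
  proof (rule ode_unique[where z = "\<lambda>_. 0" and z' = "\<lambda>_. 0" and L = L, OF V_deriv _ _ _ s])
    have "0 \<in> {0..s0}" using st by auto
    then have "m c 0 = 0" for c using m_eq(2)[of 0 c] by simp
    then show "V 0 = 0" by (simp add: V_def)
    fix s assume "s \<in> {0..s0}"
    then show "norm (F s (V s) - 0) \<le> L * norm (V s - 0)" using L(2)[of s "V s"] st by auto
  qed auto
  have rT: "r \<in> {0..T}" using r st by auto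
  have "expectation (\<lambda>\<omega>. (X r \<omega> \<bullet> a) * ((N t0 \<omega> - N s0 \<omega>) \<bullet> b)) = expectation (\<lambda>\<omega>. \<Sum>c\<in>Basis. (a \<bullet> c) * (n \<omega> * (X r \<omega> \<bullet> c)))"
  proof (rule Bochner_Integration.integral_cong[OF refl])
    fix \<omega>
    have "X r \<omega> \<bullet> a = (\<Sum>c\<in>Basis. (X r \<omega> \<bullet> c) * (a \<bullet> c))" by (rule euclidean_inner)
    then show "(X r \<omega> \<bullet> a) * ((N t0 \<omega> - N s0 \<omega>) \<bullet> b) = (\<Sum>c\<in>Basis. (a \<bullet> c) * (n \<omega> * (X r \<omega> \<bullet> c)))"
      by (simp add: n_def inner_diff_left sum_distrib_right sum_distrib_left mult.assoc mult.commute mult.left_commute)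
  qed
  also have "\<dots> = (\<Sum>c\<in>Basis. (a \<bullet> c) * m c r)"
    using m_int[OF rT] by (simp add: Bochner_Integration.integral_sum m_def)
  also have "\<dots> = a \<bullet> V r" by (simp add: V_def inner_sum_right mult.commute)
  finally show ?thesis using V0[OF r] by simp
qed

end

section \<open>The differential equation of the second moments\<close>

context linear_sde
begin

definition \<sigma> where "\<sigma> a b t = expectation (\<lambda>\<omega>. (X t \<omega> \<bullet> a) * (X t \<omega> \<bullet> b))"
definition DX where "DX a b s = expectation (\<lambda>\<omega>. (F s (X s \<omega>) \<bullet> a) * (X s \<omega> \<bullet> b))"

lemma process_inner: "cont_process M T Z \<Longrightarrow> cont_process M T (\<lambda>s \<omega>. Z s \<omega> \<bullet> a)"
  for Z :: "real \<Rightarrow> 'w \<Rightarrow> 'a" and a :: 'a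
  unfolding cont_process_def by (auto intro!: continuous_intros borel_measurable_inner borel_measurable_const)

lemma process_mult: "cont_process M T f \<Longrightarrow> cont_process M T g \<Longrightarrow> cont_process M T (\<lambda>s \<omega>. f s \<omega> * g s \<omega> :: real)"
  unfolding cont_process_def by (auto intro!: continuous_intros borel_measurable_times)

lemma process_const: "Z \<in> borel_measurable M \<Longrightarrow> cont_process M T (\<lambda>_. Z :: 'w \<Rightarrow> real)"
  unfolding cont_process_def using T_nonneg by auto

lemma fubini_mult:
  assumes "cont_process M T f" "cont_process M T g" "L2_bdd f" "L2_bdd g" "t \<in> {0..T}"
  shows "integrable M (\<lambda>\<omega>. integral {0..t} (\<lambda>s. f s \<omega> * g s \<omega>))"
    "(\<lambda>s. expectation (\<lambda>\<omega>. f s \<omega> * g s \<omega>)) integrable_on {0..t}"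
    "expectation (\<lambda>\<omega>. integral {0..t} (\<lambda>s. f s \<omega> * g s \<omega>)) = integral {0..t} (\<lambda>s. expectation (\<lambda>\<omega>. f s \<omega> * g s \<omega>))"
  by (rule cont_process.fubini_path_bdd[OF process_mult[OF assms(1,2)] prob_space_axioms L2_bdd_mult[OF assms(3,4)] assms(5)])+

text \<open>The adjoint moves \<open>F s\<close> to the fixed vector, which reduces the claim to
  \<open>future_increment\<close> at time \<open>s\<close>.\<close>

lemma future_increment_D:
  assumes st: "s \<in> {0..T}" "t \<in> {0..T}" "s \<le> t"
  shows "expectation (\<lambda>\<omega>. (F s (X s \<omega>) \<bullet> a) * (N t \<omega> \<bullet> b)) = expectation (\<lambda>\<omega>. (F s (X s \<omega>) \<bullet> a) * (N s \<omega> \<bullet> b))"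
proof -
  have adj: "F s x \<bullet> a = x \<bullet> adjoint (F s) a" for x
    using adjoint_works[OF F_linear[OF st(1)], of x a] by (simp add: inner_commute)
  have i: "integrable M (\<lambda>\<omega>. (F s (X s \<omega>) \<bullet> a) * (N u \<omega> \<bullet> b))" if "u \<in> {0..T}" for u
    by (rule L2_bdd_prod_int[OF L2_bdd_D L2_bdd_const_time[OF L2_bdd_N that] st(1)])
  have "expectation (\<lambda>\<omega>. (F s (X s \<omega>) \<bullet> a) * (N t \<omega> \<bullet> b)) - expectation (\<lambda>\<omega>. (F s (X s \<omega>) \<bullet> a) * (N s \<omega> \<bullet> b))
      = expectation (\<lambda>\<omega>. (F s (X s \<omega>) \<bullet> a) * ((N t \<omega> - N s \<omega>) \<bullet> b))"
    using Bochner_Integration.integral_diff[OF i[OF st(2)] i[OF st(1)]] by (simp add: inner_diff_left algebra_simps)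
  also have "\<dots> = 0"
    unfolding adj by (rule future_increment[OF st]) (use st in auto)
  finally show ?thesis by simp
qed

text \<open>Fubini correlates the drift at time \<open>s\<close> with the noise at the later time
  \<open>t\<close>. Replacing the latter by the noise at \<open>s\<close> leaves an integrand
  without \<open>t\<close>, so the result can be differentiated in \<open>t\<close>.\<close>

lemma cross_moment:
  assumes t: "t \<in> {0..T}"
  shows "(\<lambda>s. expectation (\<lambda>\<omega>. (F s (X s \<omega>) \<bullet> a) * (N s \<omega> \<bullet> b))) integrable_on {0..t}"
    "expectation (\<lambda>\<omega>. (Y t \<omega> \<bullet> a) * (N t \<omega> \<bullet> b)) = integral {0..t} (\<lambda>s. expectation (\<lambda>\<omega>. (F s (X s \<omega>) \<bullet> a) * (N s \<omega> \<bullet> b)))"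
proof -
  have Nm: "(\<lambda>\<omega>. N t \<omega> \<bullet> b) \<in> borel_measurable M" using N_meas[OF t] by measurable
  note fm = fubini_mult[OF process_inner[OF process_D] process_const[OF Nm] L2_bdd_D L2_bdd_const_time[OF L2_bdd_N t] t, of a]
  have eq: "expectation (\<lambda>\<omega>. (F s (X s \<omega>) \<bullet> a) * (N t \<omega> \<bullet> b)) = expectation (\<lambda>\<omega>. (F s (X s \<omega>) \<bullet> a) * (N s \<omega> \<bullet> b))"
    if "s \<in> {0..t}" for s
    by (rule future_increment_D) (use that t in auto)
  show "(\<lambda>s. expectation (\<lambda>\<omega>. (F s (X s \<omega>) \<bullet> a) * (N s \<omega> \<bullet> b))) integrable_on {0..t}"
    using fm(2) by (rule integrable_eq) (rule eq)
  define J where "J \<omega> = integral {0..t} (\<lambda>s. (F s (X s \<omega>) \<bullet> a) * (N t \<omega> \<bullet> b))" for \<omega>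
  have J: "integrable M J" "expectation J = integral {0..t} (\<lambda>s. expectation (\<lambda>\<omega>. (F s (X s \<omega>) \<bullet> a) * (N t \<omega> \<bullet> b)))"
    using fm(1,3) unfolding J_def[abs_def] .
  have Y_dec: "(Y t \<omega> \<bullet> a) * (N t \<omega> \<bullet> b) = (x0 \<bullet> a) * (N t \<omega> \<bullet> b) + J \<omega>" if \<omega>: "\<omega> \<in> space M" for \<omega>
  proof -
    have "continuous_on {0..t} (\<lambda>s. F s (X s \<omega>))"
      using t by (intro continuous_on_F continuous_on_subset[OF X_cont[OF \<omega>]]) auto
    then have "integral {0..t} (\<lambda>s. F s (X s \<omega>)) \<bullet> a = integral {0..t} (\<lambda>s. F s (X s \<omega>) \<bullet> a)"
      using integral_linear[OF integrable_continuous_real bounded_linear_inner_left] by (fastforce simp: o_def)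
    then show ?thesis by (simp add: Y_def J_def inner_add_left algebra_simps)
  qed
  have "expectation (\<lambda>\<omega>. (Y t \<omega> \<bullet> a) * (N t \<omega> \<bullet> b)) = expectation (\<lambda>\<omega>. (x0 \<bullet> a) * (N t \<omega> \<bullet> b) + J \<omega>)"
    by (rule Bochner_Integration.integral_cong[OF refl Y_dec])
  also have "\<dots> = (x0 \<bullet> a) * expectation (\<lambda>\<omega>. N t \<omega> \<bullet> b) + expectation J"
    using N_int[OF t] J(1) by simp
  also have "\<dots> = integral {0..t} (\<lambda>s. expectation (\<lambda>\<omega>. (F s (X s \<omega>) \<bullet> a) * (N s \<omega> \<bullet> b)))"
    unfolding J(2) N_mean[OF t] by simp (rule Henstock_Kurzweil_Integration.integral_cong[OF eq])
  finally show "expectation (\<lambda>\<omega>. (Y t \<omega> \<bullet> a) * (N t \<omega> \<bullet> b)) = \<dots>" .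
qed

lemma DY_moment:
  assumes t: "t \<in> {0..T}"
  shows "(\<lambda>s. expectation (\<lambda>\<omega>. (F s (X s \<omega>) \<bullet> a) * (Y s \<omega> \<bullet> b))) integrable_on {0..t}"
    "expectation (\<lambda>\<omega>. (Y t \<omega> \<bullet> a) * (Y t \<omega> \<bullet> b)) = (x0 \<bullet> a) * (x0 \<bullet> b)
      + integral {0..t} (\<lambda>s. expectation (\<lambda>\<omega>. (F s (X s \<omega>) \<bullet> a) * (Y s \<omega> \<bullet> b)))
      + integral {0..t} (\<lambda>s. expectation (\<lambda>\<omega>. (F s (X s \<omega>) \<bullet> b) * (Y s \<omega> \<bullet> a)))"
proof -
  note fm = fubini_mult[OF process_inner[OF process_D] process_inner[OF process_Y] L2_bdd_D L2_bdd_Y t]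
  show "(\<lambda>s. expectation (\<lambda>\<omega>. (F s (X s \<omega>) \<bullet> a) * (Y s \<omega> \<bullet> b))) integrable_on {0..t}" by (rule fm(2))
  define J where "J a b \<omega> = integral {0..t} (\<lambda>s. (F s (X s \<omega>) \<bullet> a) * (Y s \<omega> \<bullet> b))" for a b \<omega>
  have J: "integrable M (J a b)"
    "expectation (J a b) = integral {0..t} (\<lambda>s. expectation (\<lambda>\<omega>. (F s (X s \<omega>) \<bullet> a) * (Y s \<omega> \<bullet> b)))" for a b
    using fm(1,3)[of a b] unfolding J_def[abs_def] .
  have path: "(Y t \<omega> \<bullet> a) * (Y t \<omega> \<bullet> b) = (x0 \<bullet> a) * (x0 \<bullet> b) + J a b \<omega> + J b a \<omega>" if \<omega>: "\<omega> \<in> space M" for \<omega>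
  proof -
    have sub: "{0..t} \<subseteq> {0..T}" using t by auto
    have c: "continuous_on {0..t} (\<lambda>s. F s (X s \<omega>))" "continuous_on {0..t} (\<lambda>s. Y s \<omega>)"
      using continuous_on_F[OF continuous_on_subset[OF X_cont[OF \<omega>] sub] sub] continuous_on_subset[OF Y_cont[OF \<omega>] sub] by auto
    have "((\<lambda>s. (F s (X s \<omega>) \<bullet> a) * (Y s \<omega> \<bullet> b) + (F s (X s \<omega>) \<bullet> b) * (Y s \<omega> \<bullet> a)) has_integral
        (Y t \<omega> \<bullet> a) * (Y t \<omega> \<bullet> b) - (Y 0 \<omega> \<bullet> a) * (Y 0 \<omega> \<bullet> b)) {0..t}"
    proof (rule fundamental_theorem_of_calculus)
      show "0 \<le> t" using t by auto
      fix s assume s: "s \<in> {0..t}"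
      then have "((\<lambda>t. Y t \<omega>) has_vector_derivative F s (X s \<omega>)) (at s within {0..t})"
        using has_vector_derivative_within_subset[OF Y_deriv[OF \<omega>] sub] sub by auto
      then have d: "((\<lambda>t. Y t \<omega> \<bullet> c) has_real_derivative F s (X s \<omega>) \<bullet> c) (at s within {0..t})" for c
        using bounded_linear.has_vector_derivative[OF bounded_linear_inner_left]
        by (simp add: has_real_derivative_iff_has_vector_derivative)
      show "((\<lambda>t. (Y t \<omega> \<bullet> a) * (Y t \<omega> \<bullet> b)) has_vector_derivative
          (F s (X s \<omega>) \<bullet> a) * (Y s \<omega> \<bullet> b) + (F s (X s \<omega>) \<bullet> b) * (Y s \<omega> \<bullet> a)) (at s within {0..t})"
        unfolding has_real_derivative_iff_has_vector_derivative[symmetric]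
        using DERIV_mult[OF d[of a] d[of b]] by simp
    qed
    from integral_unique[OF this]
    have "(Y t \<omega> \<bullet> a) * (Y t \<omega> \<bullet> b) - (x0 \<bullet> a) * (x0 \<bullet> b)
        = integral {0..t} (\<lambda>s. (F s (X s \<omega>) \<bullet> a) * (Y s \<omega> \<bullet> b) + (F s (X s \<omega>) \<bullet> b) * (Y s \<omega> \<bullet> a))"
      by (simp add: Y_def)
    also have "\<dots> = J a b \<omega> + J b a \<omega>"
      unfolding J_def
      by (intro Henstock_Kurzweil_Integration.integral_add integrable_continuous_real continuous_intros c)
    finally show ?thesis by simp
  qed
  have "expectation (\<lambda>\<omega>. (Y t \<omega> \<bullet> a) * (Y t \<omega> \<bullet> b)) = expectation (\<lambda>\<omega>. (x0 \<bullet> a) * (x0 \<bullet> b) + J a b \<omega> + J b a \<omega>)"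
    by (rule Bochner_Integration.integral_cong[OF refl path])
  also have "\<dots> = (x0 \<bullet> a) * (x0 \<bullet> b) + expectation (J a b) + expectation (J b a)"
    using J(1) by (simp add: prob_space)
  finally show "expectation (\<lambda>\<omega>. (Y t \<omega> \<bullet> a) * (Y t \<omega> \<bullet> b)) = (x0 \<bullet> a) * (x0 \<bullet> b)
      + integral {0..t} (\<lambda>s. expectation (\<lambda>\<omega>. (F s (X s \<omega>) \<bullet> a) * (Y s \<omega> \<bullet> b)))
      + integral {0..t} (\<lambda>s. expectation (\<lambda>\<omega>. (F s (X s \<omega>) \<bullet> b) * (Y s \<omega> \<bullet> a)))"
    unfolding J(2) .
qed

text \<open>The product of the two states is expanded into four products. The mixed ones complete
  \<open>Y\<close> to \<open>X\<close> inside the drift integrals, and the product of the noises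
  contributes t times \<open>\<Gamma>\<close>, the Ito correction.\<close>

lemma \<sigma>_eq:
  assumes t: "t \<in> {0..T}"
  shows "DX a b integrable_on {0..t}"
    "\<sigma> a b t = (x0 \<bullet> a) * (x0 \<bullet> b) + integral {0..t} (DX a b) + integral {0..t} (DX b a) + t * \<Gamma> a b"
proof -
  have int: "integrable M (\<lambda>\<omega>. (Y t \<omega> \<bullet> a) * (Y t \<omega> \<bullet> b))" "integrable M (\<lambda>\<omega>. (Y t \<omega> \<bullet> a) * (N t \<omega> \<bullet> b))"
    if "t \<in> {0..T}" for t a b
    by (rule L2_bdd_prod_int[OF L2_bdd_Y L2_bdd_Y that], rule L2_bdd_prod_int[OF L2_bdd_Y L2_bdd_N that])
  have DX: "DX a b s = expectation (\<lambda>\<omega>. (F s (X s \<omega>) \<bullet> a) * (Y s \<omega> \<bullet> b)) + expectation (\<lambda>\<omega>. (F s (X s \<omega>) \<bullet> a) * (N s \<omega> \<bullet> b))"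
    if s: "s \<in> {0..t}" for s a b
  proof -
    have sT: "s \<in> {0..T}" using s t by auto
    have i: "integrable M (\<lambda>\<omega>. (F s (X s \<omega>) \<bullet> a) * (X s \<omega> \<bullet> b))"
      "integrable M (\<lambda>\<omega>. (F s (X s \<omega>) \<bullet> a) * (Y s \<omega> \<bullet> b))"
      "integrable M (\<lambda>\<omega>. (F s (X s \<omega>) \<bullet> a) * (N s \<omega> \<bullet> b))"
      by (rule L2_bdd_prod_int[OF L2_bdd_D L2_bdd_X sT], rule L2_bdd_prod_int[OF L2_bdd_D L2_bdd_Y sT],
          rule L2_bdd_prod_int[OF L2_bdd_D L2_bdd_N sT])
    have "DX a b s = expectation (\<lambda>\<omega>. (F s (X s \<omega>) \<bullet> a) * (Y s \<omega> \<bullet> b) + (F s (X s \<omega>) \<bullet> a) * (N s \<omega> \<bullet> b))"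
      unfolding DX_def
    proof (rule integral_cong_AE)
      show "AE \<omega> in M. (F s (X s \<omega>) \<bullet> a) * (X s \<omega> \<bullet> b)
          = (F s (X s \<omega>) \<bullet> a) * (Y s \<omega> \<bullet> b) + (F s (X s \<omega>) \<bullet> a) * (N s \<omega> \<bullet> b)"
        using X_decomp_at[OF sT]
      proof eventually_elim
        case (elim \<omega>)
        then have "X s \<omega> \<bullet> b = Y s \<omega> \<bullet> b + N s \<omega> \<bullet> b" by (simp add: inner_add_left)
        then show ?case by (simp only: distrib_left)
      qed
    qed (use i in auto)
    then show ?thesis using Bochner_Integration.integral_add[OF i(2,3)] by simp
  qed
  have DXi: "DX a b integrable_on {0..t}"
    "integral {0..t} (DX a b) = integral {0..t} (\<lambda>s. expectation (\<lambda>\<omega>. (F s (X s \<omega>) \<bullet> a) * (Y s \<omega> \<bullet> b)))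
      + integral {0..t} (\<lambda>s. expectation (\<lambda>\<omega>. (F s (X s \<omega>) \<bullet> a) * (N s \<omega> \<bullet> b)))" for a b
  proof -
    show "DX a b integrable_on {0..t}"
      using integrable_add[OF DY_moment(1)[OF t] cross_moment(1)[OF t]] by (rule integrable_eq) (simp add: DX)
    show "integral {0..t} (DX a b) = integral {0..t} (\<lambda>s. expectation (\<lambda>\<omega>. (F s (X s \<omega>) \<bullet> a) * (Y s \<omega> \<bullet> b)))
      + integral {0..t} (\<lambda>s. expectation (\<lambda>\<omega>. (F s (X s \<omega>) \<bullet> a) * (N s \<omega> \<bullet> b)))"
      unfolding Henstock_Kurzweil_Integration.integral_add[OF DY_moment(1)[OF t] cross_moment(1)[OF t], symmetric]
      by (rule Henstock_Kurzweil_Integration.integral_cong[OF DX])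
  qed
  show "DX a b integrable_on {0..t}" by (rule DXi)
  have "\<sigma> a b t = expectation (\<lambda>\<omega>. (Y t \<omega> \<bullet> a) * (Y t \<omega> \<bullet> b) + (Y t \<omega> \<bullet> a) * (N t \<omega> \<bullet> b)
      + (Y t \<omega> \<bullet> b) * (N t \<omega> \<bullet> a) + (N t \<omega> \<bullet> a) * (N t \<omega> \<bullet> b))"
    unfolding \<sigma>_def
  proof (rule integral_cong_AE)
    show "AE \<omega> in M. (X t \<omega> \<bullet> a) * (X t \<omega> \<bullet> b) = (Y t \<omega> \<bullet> a) * (Y t \<omega> \<bullet> b) + (Y t \<omega> \<bullet> a) * (N t \<omega> \<bullet> b)
      + (Y t \<omega> \<bullet> b) * (N t \<omega> \<bullet> a) + (N t \<omega> \<bullet> a) * (N t \<omega> \<bullet> b)"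
      using X_decomp_at[OF t] by eventually_elim (simp add: inner_add_left algebra_simps)
    show "(\<lambda>\<omega>. (X t \<omega> \<bullet> a) * (X t \<omega> \<bullet> b)) \<in> borel_measurable M" using X_prod_int[OF t] by auto
    show "(\<lambda>\<omega>. (Y t \<omega> \<bullet> a) * (Y t \<omega> \<bullet> b) + (Y t \<omega> \<bullet> a) * (N t \<omega> \<bullet> b)
      + (Y t \<omega> \<bullet> b) * (N t \<omega> \<bullet> a) + (N t \<omega> \<bullet> a) * (N t \<omega> \<bullet> b)) \<in> borel_measurable M"
      using Y_meas[OF t] N_meas[OF t] by measurable
  qed
  also have "\<dots> = expectation (\<lambda>\<omega>. (Y t \<omega> \<bullet> a) * (Y t \<omega> \<bullet> b)) + expectation (\<lambda>\<omega>. (Y t \<omega> \<bullet> a) * (N t \<omega> \<bullet> b))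
      + expectation (\<lambda>\<omega>. (Y t \<omega> \<bullet> b) * (N t \<omega> \<bullet> a)) + expectation (\<lambda>\<omega>. (N t \<omega> \<bullet> a) * (N t \<omega> \<bullet> b))"
    using int[OF t] N_prod_int[OF t t] by simp
  also have "\<dots> = (x0 \<bullet> a) * (x0 \<bullet> b) + integral {0..t} (DX a b) + integral {0..t} (DX b a) + t * \<Gamma> a b"
    unfolding DY_moment(2)[OF t] cross_moment(2)[OF t] DXi(2) N_cov[OF t t] by simp
  finally show "\<sigma> a b t = (x0 \<bullet> a) * (x0 \<bullet> b) + integral {0..t} (DX a b) + integral {0..t} (DX b a) + t * \<Gamma> a b" .
qed

text \<open>Regularity is gained in steps: \<open>DX\<close> is at first only integrable, which
  makes \<open>\<sigma>\<close> continuous. As \<open>DX\<close> is a linear combination of second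
  moments with continuous coefficients, it is continuous too, and then \<open>\<sigma>\<close> is
  differentiable.\<close>

lemma \<sigma>_cont: "continuous_on {0..T} (\<sigma> a b)"
proof -
  have TT: "T \<in> {0..T}" using T_nonneg by auto
  have "continuous_on {0..T} (\<lambda>t. (x0 \<bullet> a) * (x0 \<bullet> b) + integral {0..t} (DX a b) + integral {0..t} (DX b a) + t * \<Gamma> a b)"
    by (intro continuous_intros indefinite_integral_continuous_1 \<sigma>_eq(1) TT)
  then show ?thesis by (rule continuous_on_eq) (simp add: \<sigma>_eq(2))
qed

lemma DX_eq: "s \<in> {0..T} \<Longrightarrow> DX a b s = (\<Sum>e\<in>Basis. (F s e \<bullet> a) * \<sigma> e b s)"
proof -
  assume s: "s \<in> {0..T}"
  have lin: "F s x \<bullet> a = (\<Sum>e\<in>Basis. (x \<bullet> e) * (F s e \<bullet> a))" for x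
  proof -
    have "F s x = F s (\<Sum>e\<in>Basis. (x \<bullet> e) *\<^sub>R e)" by (simp add: euclidean_representation)
    also have "\<dots> = (\<Sum>e\<in>Basis. (x \<bullet> e) *\<^sub>R F s e)"
      by (simp add: linear_sum[OF F_linear[OF s]] linear_scale[OF F_linear[OF s]])
    finally show ?thesis by (simp add: inner_sum_left)
  qed
  have "DX a b s = expectation (\<lambda>\<omega>. \<Sum>e\<in>Basis. (F s e \<bullet> a) * ((X s \<omega> \<bullet> e) * (X s \<omega> \<bullet> b)))"
    unfolding DX_def
  proof (rule Bochner_Integration.integral_cong[OF refl])
    fix \<omega>
    show "(F s (X s \<omega>) \<bullet> a) * (X s \<omega> \<bullet> b) = (\<Sum>e\<in>Basis. (F s e \<bullet> a) * ((X s \<omega> \<bullet> e) * (X s \<omega> \<bullet> b)))"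
      unfolding lin[of "X s \<omega>"] sum_distrib_right by (intro sum.cong refl) simp
  qed
  also have "\<dots> = (\<Sum>e\<in>Basis. (F s e \<bullet> a) * \<sigma> e b s)"
    using X_prod_int[OF s] by (simp add: Bochner_Integration.integral_sum \<sigma>_def)
  finally show ?thesis .
qed

lemma DX_cont: "continuous_on {0..T} (DX a b)"
proof -
  have "continuous_on {0..T} (\<lambda>s. \<Sum>e\<in>Basis. (F s e \<bullet> a) * \<sigma> e b s)"
    by (intro continuous_intros \<sigma>_cont continuous_on_F) auto
  then show ?thesis by (rule continuous_on_eq) (simp add: DX_eq)
qed

lemma \<sigma>_deriv:
  assumes t: "t \<in> {0..T}"
  shows "(\<sigma> a b has_real_derivative DX a b t + DX b a t + \<Gamma> a b) (at t within {0..T})"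
proof -
  have i: "((\<lambda>t. integral {0..t} (DX a b)) has_real_derivative DX a b t) (at t within {0..T})" for a b
    unfolding has_real_derivative_iff_has_vector_derivative by (rule integral_has_vector_derivative[OF DX_cont t])
  have "((\<lambda>t. (x0 \<bullet> a) * (x0 \<bullet> b) + integral {0..t} (DX a b) + integral {0..t} (DX b a) + t * \<Gamma> a b)
      has_real_derivative 0 + DX a b t + DX b a t + 1 * \<Gamma> a b) (at t within {0..T})"
    by (intro DERIV_add DERIV_const i DERIV_cmult_right DERIV_ident)
  then have "((\<lambda>t. (x0 \<bullet> a) * (x0 \<bullet> b) + integral {0..t} (DX a b) + integral {0..t} (DX b a) + t * \<Gamma> a b)
      has_vector_derivative DX a b t + DX b a t + \<Gamma> a b) (at t within {0..T})"
    by (simp add: has_real_derivative_iff_has_vector_derivative)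
  then show ?thesis
    unfolding has_real_derivative_iff_has_vector_derivative
    by (rule has_vector_derivative_transform[OF t, rotated]) (simp add: \<sigma>_eq(2))
qed

lemma expectation_double_sum:
  fixes w :: "'b \<Rightarrow> 'c \<Rightarrow> real"
  assumes "\<And>b c. integrable M (f b c)"
  shows "integrable M (\<lambda>\<omega>. \<Sum>b\<in>A. \<Sum>c\<in>B. w b c * f b c \<omega>)"
    "expectation (\<lambda>\<omega>. \<Sum>b\<in>A. \<Sum>c\<in>B. w b c * f b c \<omega>) = (\<Sum>b\<in>A. \<Sum>c\<in>B. w b c * expectation (f b c))"
  using assms by (simp_all add: Bochner_Integration.integral_sum Bochner_Integration.integrable_sum)

text \<open>\<open>W t\<close> is the expectation of
  \<open>H t (X t \<omega>) \<bullet> X t \<omega>\<close>, written with second moments. Its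
  derivative is the expectation of the left-hand side of \<open>k_eq\<close> plus the trace term, so
  integrating up to \<open>T\<close>, where \<open>H\<close> vanishes, evaluates the running cost.
  This is the verification argument of linear-quadratic control in terms of moments.\<close>

lemma value_identity:
  fixes H H' :: "real \<Rightarrow> 'a \<Rightarrow> 'a" and k :: "real \<Rightarrow> 'a \<Rightarrow> real"
  assumes H_linear: "\<And>t. t \<in> {0..T} \<Longrightarrow> linear (H t)" "\<And>t. t \<in> {0..T} \<Longrightarrow> linear (H' t)"
    and H_deriv: "\<And>t x. t \<in> {0..T} \<Longrightarrow> ((\<lambda>t. H t x) has_vector_derivative H' t x) (at t within {0..T})"
    and H_T: "\<And>x. H T x = 0"
    and k_eq: "\<And>t x. t \<in> {0..T} \<Longrightarrow> H' t x \<bullet> x + H t (F t x) \<bullet> x + H t x \<bullet> F t x = - k t x"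
    and k_cont: "continuous_on ({0..T} \<times> UNIV) (\<lambda>(t, x). k t x)"
    and k_bound: "\<And>t x. t \<in> {0..T} \<Longrightarrow> \<bar>k t x\<bar> \<le> Ck * (norm x)\<^sup>2"
  shows "expectation (\<lambda>\<omega>. integral {0..T} (\<lambda>t. k t (X t \<omega>)))
    = H 0 x0 \<bullet> x0 + integral {0..T} (\<lambda>t. \<Sum>j\<in>UNIV. H t (v j) \<bullet> v j)"
proof -
  have TT: "T \<in> {0..T}" "0 \<in> {0..T}" using T_nonneg by auto
  define W where "W t = (\<Sum>b\<in>Basis. \<Sum>c\<in>Basis. (H t b \<bullet> c) * \<sigma> b c t)" for t
  define Ek where "Ek t = expectation (\<lambda>\<omega>. k t (X t \<omega>))" for t
  define tr where "tr t = (\<Sum>j\<in>UNIV. H t (v j) \<bullet> v j)" for t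
  have tr_eq: "tr t = (\<Sum>b\<in>Basis. \<Sum>c\<in>Basis. (H t b \<bullet> c) * \<Gamma> b c)" if t: "t \<in> {0..T}" for t
  proof -
    have "tr t = (\<Sum>j\<in>UNIV. \<Sum>b\<in>Basis. \<Sum>c\<in>Basis. (H t b \<bullet> c) * ((v j \<bullet> b) * (v j \<bullet> c)))"
      unfolding tr_def by (intro sum.cong refl linear_inner_basis H_linear t)
    also have "\<dots> = (\<Sum>b\<in>Basis. \<Sum>c\<in>Basis. \<Sum>j\<in>UNIV. (H t b \<bullet> c) * ((v j \<bullet> b) * (v j \<bullet> c)))"
      by (subst sum.swap, intro sum.cong refl, subst sum.swap, rule refl)
    finally show ?thesis by (simp add: \<Gamma>_def sum_distrib_left)
  qed
  have W': "(W has_vector_derivative - Ek t + tr t) (at t within {0..T})" if t: "t \<in> {0..T}" for t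
  proof -
    have "((\<lambda>t. H t b \<bullet> c) has_real_derivative H' t b \<bullet> c) (at t within {0..T})" for b c
      using bounded_linear.has_vector_derivative[OF bounded_linear_inner_left H_deriv[OF t]]
      by (simp add: has_real_derivative_iff_has_vector_derivative)
    then have "(W has_real_derivative (\<Sum>b\<in>Basis. \<Sum>c\<in>Basis. (H' t b \<bullet> c) * \<sigma> b c t
        + (DX b c t + DX c b t + \<Gamma> b c) * (H t b \<bullet> c))) (at t within {0..T})"
      unfolding W_def[abs_def] by (intro DERIV_sum DERIV_mult \<sigma>_deriv[OF t])
    moreover have "(\<Sum>b\<in>Basis. \<Sum>c\<in>Basis. (H' t b \<bullet> c) * \<sigma> b c t + (DX b c t + DX c b t + \<Gamma> b c) * (H t b \<bullet> c)) = - Ek t + tr t"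
    proof -
      have i1: "integrable M (\<lambda>\<omega>. (X t \<omega> \<bullet> b) * (X t \<omega> \<bullet> c))"
        and i2: "integrable M (\<lambda>\<omega>. (F t (X t \<omega>) \<bullet> b) * (X t \<omega> \<bullet> c))"
        and i3: "integrable M (\<lambda>\<omega>. (X t \<omega> \<bullet> b) * (F t (X t \<omega>) \<bullet> c))" for b c
        by (rule L2_bdd_prod_int[OF L2_bdd_X L2_bdd_X t], rule L2_bdd_prod_int[OF L2_bdd_D L2_bdd_X t],
            rule L2_bdd_prod_int[OF L2_bdd_X L2_bdd_D t])
      have e1: "integrable M (\<lambda>\<omega>. H' t (X t \<omega>) \<bullet> X t \<omega>)"
        "expectation (\<lambda>\<omega>. H' t (X t \<omega>) \<bullet> X t \<omega>) = (\<Sum>b\<in>Basis. \<Sum>c\<in>Basis. (H' t b \<bullet> c) * \<sigma> b c t)"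
        unfolding linear_inner_basis[OF H_linear(2)[OF t], of "X t _" "X t _"] \<sigma>_def
        by (rule expectation_double_sum[OF i1])+
      have e2: "integrable M (\<lambda>\<omega>. H t (F t (X t \<omega>)) \<bullet> X t \<omega>)"
        "expectation (\<lambda>\<omega>. H t (F t (X t \<omega>)) \<bullet> X t \<omega>) = (\<Sum>b\<in>Basis. \<Sum>c\<in>Basis. (H t b \<bullet> c) * DX b c t)"
        unfolding linear_inner_basis[OF H_linear(1)[OF t], of "F t (X t _)" "X t _"] DX_def
        by (rule expectation_double_sum[OF i2])+
      have e3: "integrable M (\<lambda>\<omega>. H t (X t \<omega>) \<bullet> F t (X t \<omega>))"
        "expectation (\<lambda>\<omega>. H t (X t \<omega>) \<bullet> F t (X t \<omega>)) = (\<Sum>b\<in>Basis. \<Sum>c\<in>Basis. (H t b \<bullet> c) * DX c b t)"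
        unfolding linear_inner_basis[OF H_linear(1)[OF t], of "X t _" "F t (X t _)"] DX_def mult.commute[of "F t _ \<bullet> _" "X t _ \<bullet> _"]
        by (rule expectation_double_sum[OF i3])+
      have "- Ek t = expectation (\<lambda>\<omega>. H' t (X t \<omega>) \<bullet> X t \<omega> + H t (F t (X t \<omega>)) \<bullet> X t \<omega> + H t (X t \<omega>) \<bullet> F t (X t \<omega>))"
        unfolding k_eq[OF t] by (simp add: Ek_def)
      also have "\<dots> = (\<Sum>b\<in>Basis. \<Sum>c\<in>Basis. (H' t b \<bullet> c) * \<sigma> b c t) + (\<Sum>b\<in>Basis. \<Sum>c\<in>Basis. (H t b \<bullet> c) * DX b c t)
          + (\<Sum>b\<in>Basis. \<Sum>c\<in>Basis. (H t b \<bullet> c) * DX c b t)"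
        using e1 e2 e3 by simp
      finally show ?thesis unfolding tr_eq[OF t] by (simp add: sum.distrib[symmetric] algebra_simps)
    qed
    ultimately show ?thesis by (simp add: has_real_derivative_iff_has_vector_derivative)
  qed
  have proc: "cont_process M T (\<lambda>t \<omega>. k t (X t \<omega>))"
  proof unfold_locales
    fix s assume s: "s \<in> {0..T}"
    have "continuous_on UNIV (k s)"
    proof -
      have "continuous_on UNIV (\<lambda>x :: 'a. (s, x))" by (intro continuous_intros)
      from continuous_on_compose2[OF k_cont this] show ?thesis using s by (simp add: image_subset_iff)
    qed
    then show "(\<lambda>\<omega>. k s (X s \<omega>)) \<in> borel_measurable M"
      by (intro measurable_compose[OF X_meas[OF s]] borel_measurable_continuous_onI)
  next
    fix \<omega> assume "\<omega> \<in> space M"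
    then show "continuous_on {0..T} (\<lambda>s. k s (X s \<omega>))"
      by (intro continuous_on_field_comp[OF k_cont] X_cont)
  qed (rule T_nonneg)
  obtain C where C: "C \<ge> 0" "\<And>t. t \<in> {0..T} \<Longrightarrow> integrable M (\<lambda>\<omega>. (norm (X t \<omega>))\<^sup>2)"
    "\<And>t. t \<in> {0..T} \<Longrightarrow> expectation (\<lambda>\<omega>. (norm (X t \<omega>))\<^sup>2) \<le> C" using second_moment by metis
  have Ck: "\<bar>k t x\<bar> \<le> max Ck 0 * (norm x)\<^sup>2" if "t \<in> {0..T}" for t x
    using k_bound[OF that, of x] mult_right_mono[of Ck "max Ck 0" "(norm x)\<^sup>2"] by auto
  have kint: "integrable M (\<lambda>\<omega>. k s (X s \<omega>)) \<and> expectation (\<lambda>\<omega>. norm (k s (X s \<omega>))) \<le> max Ck 0 * C" if s: "s \<in> {0..T}" for s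
  proof
    have i: "integrable M (\<lambda>\<omega>. max Ck 0 * (norm (X s \<omega>))\<^sup>2)" using C(2)[OF s] by simp
    show ki: "integrable M (\<lambda>\<omega>. k s (X s \<omega>))"
      by (rule Bochner_Integration.integrable_bound[OF i])
        (use cont_process.meas[OF proc s] Ck[OF s] in \<open>auto simp: abs_mult\<close>)
    have "expectation (\<lambda>\<omega>. norm (k s (X s \<omega>))) \<le> expectation (\<lambda>\<omega>. max Ck 0 * (norm (X s \<omega>))\<^sup>2)"
      by (rule integral_mono[OF integrable_norm[OF ki] i]) (use Ck[OF s] in auto)
    also have "\<dots> \<le> max Ck 0 * C" using C(3)[OF s] by (simp add: mult_left_mono)
    finally show "expectation (\<lambda>\<omega>. norm (k s (X s \<omega>))) \<le> max Ck 0 * C" .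
  qed
  have "\<exists>C. \<forall>s\<in>{0..T}. integrable M (\<lambda>\<omega>. k s (X s \<omega>)) \<and> expectation (\<lambda>\<omega>. norm (k s (X s \<omega>))) \<le> C"
    by (rule exI, rule ballI, rule kint)
  note fk = cont_process.fubini_path_bdd[OF proc prob_space_axioms this TT(1)]
  have Ek_int: "Ek integrable_on {0..T}" unfolding Ek_def[abs_def] by (rule fk(2))
  have "continuous_on {0..T} (\<lambda>t. H t x)" for x by (rule has_vector_derivative_continuous_on[OF H_deriv])
  then have tr_int: "tr integrable_on {0..T}"
    unfolding tr_def[abs_def] by (intro integrable_continuous_real continuous_intros)
  have "((\<lambda>t. - Ek t + tr t) has_integral W T - W 0) {0..T}"
    by (rule fundamental_theorem_of_calculus[OF T_nonneg W'])
  then have "W T - W 0 = integral {0..T} (\<lambda>t. - Ek t + tr t)" by (simp add: integral_unique)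
  also have "\<dots> = - integral {0..T} Ek + integral {0..T} tr"
    using Henstock_Kurzweil_Integration.integral_add[OF integrable_neg[OF Ek_int] tr_int] by simp
  finally have "integral {0..T} Ek = W 0 - W T + integral {0..T} tr" by simp
  moreover have "W T = 0" by (simp add: W_def H_T)
  moreover have "W 0 = H 0 x0 \<bullet> x0"
    unfolding W_def linear_inner_basis[OF H_linear(1)[OF TT(2)], of x0 x0] using \<sigma>_eq(2)[OF TT(2)] by simp
  ultimately show ?thesis
    using fk(3) by (simp add: Ek_def[abs_def] tr_def[abs_def])
qed

end

section \<open>Adapted solutions and Brownian moments\<close>

lemma borel_measurable_mono:
  assumes "f \<in> borel_measurable M" "sets M \<subseteq> sets N" "space M = space N"
  shows "f \<in> borel_measurable N"
  using assms measurable_mono[of borel borel M N] by auto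

text \<open>Subtracting the noise leaves an ordinary equation for each \<omega>. Each Picard iterate
  at time \<open>t\<close> integrates values known up to \<open>t\<close>, hence is measurable at
  time \<open>t\<close>, and the pointwise limit inherits this.\<close>

lemma (in linear_field) adapted_solution_exists:
  fixes Fil :: "real \<Rightarrow> 'w measure" and Nz :: "real \<Rightarrow> 'w \<Rightarrow> 'a"
  assumes space: "\<And>t. t \<in> {0..T} \<Longrightarrow> space (Fil t) = \<Omega>"
    and mono: "\<And>s t. s \<in> {0..T} \<Longrightarrow> t \<in> {0..T} \<Longrightarrow> s \<le> t \<Longrightarrow> sets (Fil s) \<subseteq> sets (Fil t)"
    and N_meas: "\<And>t. t \<in> {0..T} \<Longrightarrow> Nz t \<in> borel_measurable (Fil t)"
    and N_cont: "\<And>\<omega>. \<omega> \<in> \<Omega> \<Longrightarrow> continuous_on {0..T} (\<lambda>t. Nz t \<omega>)"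
  obtains X where "\<And>t. t \<in> {0..T} \<Longrightarrow> X t \<in> borel_measurable (Fil t)"
    "\<And>\<omega>. \<omega> \<in> \<Omega> \<Longrightarrow> continuous_on {0..T} (\<lambda>t. X t \<omega>)"
    "\<And>\<omega> t. \<omega> \<in> \<Omega> \<Longrightarrow> t \<in> {0..T} \<Longrightarrow> X t \<omega> = x0 + integral {0..t} (\<lambda>s. F s (X s \<omega>)) + Nz t \<omega>"
proof -
  obtain L where L: "\<And>t. t \<in> {0..T} \<Longrightarrow> L-lipschitz_on UNIV (F t)" using F_lipschitz by metis
  define G where "G \<omega> s y = F s (y + Nz s \<omega>)" for \<omega> s y
  have G_cont: "continuous_on ({0..T} \<times> UNIV) (\<lambda>(s, y). G \<omega> s y)" if \<omega>: "\<omega> \<in> \<Omega>" for \<omega>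
  proof -
    have "continuous_on ({0..T} \<times> UNIV) (\<lambda>p. Nz (fst p) \<omega>)"
      by (rule continuous_on_compose2[OF N_cont[OF \<omega>]]) (auto intro!: continuous_intros)
    then have "continuous_on ({0..T} \<times> UNIV) (\<lambda>p. (fst p, snd p + Nz (fst p) \<omega>))"
      by (intro continuous_intros)
    from continuous_on_compose2[OF F_cont this] show ?thesis
      by (simp add: G_def case_prod_beta image_subset_iff)
  qed
  have G_lip: "L-lipschitz_on UNIV (G \<omega> t)" if "t \<in> {0..T}" for t \<omega>
  proof (rule lipschitz_onI)
    show "0 \<le> L" by (rule lipschitz_on_nonneg[OF L[OF that]])
    show "dist (G \<omega> t x) (G \<omega> t y) \<le> L * dist x y" for x y
      using lipschitz_onD[OF L[OF that], of "x + Nz t \<omega>" "y + Nz t \<omega>"] by (simp add: G_def)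
  qed
  define good where "good \<omega> y \<longleftrightarrow> continuous_on {0..T} y \<and> (\<forall>t\<in>{0..T}. y t = x0 + integral {0..t} (\<lambda>s. G \<omega> s (y s))) \<and>
      (\<forall>t\<in>{0..T}. (\<lambda>n. picard (G \<omega>) x0 n t) \<longlonglongrightarrow> y t)" for \<omega> y
  \<comment> \<open>A solution is chosen for each \<omega> separately. Measurability in \<omega> is
    restored by the property, part of \<open>good\<close>, that it is the limit of the
    iterates.\<close>
  define Y where "Y \<omega> = (SOME y. good \<omega> y)" for \<omega>
  have "good \<omega> (Y \<omega>)" if om: "\<omega> \<in> \<Omega>" for \<omega>
  proof -
    obtain y where "y 0 = x0 \<and> continuous_on {0..T} y \<and>
        (\<forall>t\<in>{0..T}. y t = x0 + integral {0..t} (\<lambda>s. G \<omega> s (y s))) \<and>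
        (\<forall>t\<in>{0..T}. (y has_vector_derivative G \<omega> t (y t)) (at t within {0..T})) \<and>
        (\<forall>t\<in>{0..T}. (\<lambda>n. picard (G \<omega>) x0 n t) \<longlonglongrightarrow> y t)"
      using picard_solution[OF G_cont[OF om] G_lip T_nonneg] by (rule exE)
    then have "good \<omega> y" unfolding good_def by (elim conjE) (intro conjI)
    then show ?thesis unfolding Y_def by (rule someI[of "good \<omega>"])
  qed
  then have Y: "\<And>\<omega>. \<omega> \<in> \<Omega> \<Longrightarrow> continuous_on {0..T} (Y \<omega>)"
    "\<And>\<omega> t. \<omega> \<in> \<Omega> \<Longrightarrow> t \<in> {0..T} \<Longrightarrow> Y \<omega> t = x0 + integral {0..t} (\<lambda>s. G \<omega> s (Y \<omega> s))"
    "\<And>\<omega> t. \<omega> \<in> \<Omega> \<Longrightarrow> t \<in> {0..T} \<Longrightarrow> (\<lambda>n. picard (G \<omega>) x0 n t) \<longlonglongrightarrow> Y \<omega> t"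
    unfolding good_def by blast+
  have p_meas: "(\<lambda>\<omega>. picard (G \<omega>) x0 n t) \<in> borel_measurable (Fil t)" if "t \<in> {0..T}" for n t
    using that
  proof (induction n arbitrary: t)
    case 0
    then show ?case by simp
  next
    case (Suc n)
    have "cont_process (Fil t) t (\<lambda>s \<omega>. G \<omega> s (picard (G \<omega>) x0 n s))"
    proof (rule cont_process.intro)
      show "0 \<le> t" using Suc.prems by simp
      fix s assume s: "s \<in> {0..t}"
      then have sT: "s \<in> {0..T}" using Suc.prems by auto
      have "(\<lambda>\<omega>. G \<omega> s (picard (G \<omega>) x0 n s)) \<in> borel_measurable (Fil s)"
        unfolding G_def[of _ s] by (rule measurable_F[OF sT]) (intro borel_measurable_add N_meas[OF sT] Suc.IH[OF sT])
      then show "(\<lambda>\<omega>. G \<omega> s (picard (G \<omega>) x0 n s)) \<in> borel_measurable (Fil t)"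
        by (rule borel_measurable_mono) (use mono[OF sT Suc.prems] space sT Suc.prems s in auto)
    next
      fix \<omega> assume "\<omega> \<in> space (Fil t)"
      then have \<omega>: "\<omega> \<in> \<Omega>" using space Suc.prems by auto
      show "continuous_on {0..t} (\<lambda>s. G \<omega> s (picard (G \<omega>) x0 n s))"
        by (rule continuous_on_subset[OF continuous_on_field_comp[OF G_cont[OF \<omega>] continuous_on_picard[OF G_cont[OF \<omega>]]]])
          (use Suc.prems in auto)
    qed
    from cont_process.measurable_integral[OF this, of t] Suc.prems
    show ?case by simp
  qed
  have Y_meas: "(\<lambda>\<omega>. Y \<omega> t) \<in> borel_measurable (Fil t)" if t: "t \<in> {0..T}" for t
    by (rule borel_measurable_LIMSEQ_metric[where f = "\<lambda>n \<omega>. picard (G \<omega>) x0 n t"])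
      (use p_meas Y(3) space t in auto)
  show ?thesis
  proof (rule that[of "\<lambda>t \<omega>. Y \<omega> t + Nz t \<omega>"])
    show "(\<lambda>\<omega>. Y \<omega> t + Nz t \<omega>) \<in> borel_measurable (Fil t)" if t: "t \<in> {0..T}" for t
      by (intro borel_measurable_add Y_meas N_meas t)
    show "continuous_on {0..T} (\<lambda>t. Y \<omega> t + Nz t \<omega>)" if "\<omega> \<in> \<Omega>" for \<omega>
      by (intro continuous_intros Y(1) N_cont that)
    show "Y \<omega> t + Nz t \<omega> = x0 + integral {0..t} (\<lambda>s. F s (Y \<omega> s + Nz s \<omega>)) + Nz t \<omega>"
      if "\<omega> \<in> \<Omega>" "t \<in> {0..T}" for \<omega> t
      using Y(2)[OF that] by (simp add: G_def)
  qed
qed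

text \<open>On each interval open on the left the process is approximated by its value at the left
  end point, which is known at that time; this matches the generating rectangles. Path continuity
  gives convergence.\<close>

lemma predictable_continuous_adapted:
  fixes X :: "real \<Rightarrow> 'w \<Rightarrow> 'a::euclidean_space"
  assumes T: "T > 0"
    and space: "\<And>t. t \<in> {0..T} \<Longrightarrow> space (Fil t) = \<Omega>"
    and meas: "\<And>t. t \<in> {0..T} \<Longrightarrow> X t \<in> borel_measurable (Fil t)"
    and cont: "\<And>\<omega>. \<omega> \<in> \<Omega> \<Longrightarrow> continuous_on {0..T} (\<lambda>t. X t \<omega>)"
  shows "(\<lambda>(t, \<omega>). X t \<omega>) \<in> borel_measurable (predictable_sigma \<Omega> T Fil)"
proof -
  let ?gen = "{{0} \<times> A | A. A \<in> sets (Fil 0)} \<union>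
        {{s<..t} \<times> A | s t A. 0 \<le> s \<and> s < t \<and> t \<le> T \<and> A \<in> sets (Fil s)}"
  let ?P = "predictable_sigma \<Omega> T Fil"
  have sub: "A \<subseteq> \<Omega>" if "A \<in> sets (Fil s)" "s \<in> {0..T}" for A s
    using sets.sets_into_space[OF that(1)] space[OF that(2)] by simp
  have gen: "?gen \<subseteq> Pow ({0..T} \<times> \<Omega>)"
    using T by (auto dest: sub)
  have space_P: "space ?P = {0..T} \<times> \<Omega>"
    unfolding predictable_sigma_def by (rule space_measure_of[OF gen])
  have in_P: "B \<in> sets ?P" if "B \<in> ?gen" for B
    unfolding predictable_sigma_def sets_measure_of[OF gen] using that by (rule sigma_sets.Basic)
  have step: "(\<lambda>p. if fst p \<in> I then X s (snd p) else 0) \<in> borel_measurable ?P"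
    if I: "\<And>A. A \<in> sets (Fil s) \<Longrightarrow> I \<times> A \<in> sets ?P" and s: "s \<in> {0..T}" for I s
  proof (rule measurableI)
    fix B :: "'a set" assume B: "B \<in> sets borel"
    have 1: "I \<times> (X s -` B \<inter> \<Omega>) \<in> sets ?P"
      using I measurable_sets[OF meas[OF s] B] space[OF s] by simp
    have "I \<times> \<Omega> \<in> sets ?P" using I sets.top[of "Fil s"] space[OF s] by simp
    then have 2: "(if 0 \<in> B then space ?P - I \<times> \<Omega> else {}) \<in> sets ?P" by auto
    have "I \<times> \<Omega> \<subseteq> space ?P" using \<open>I \<times> \<Omega> \<in> sets ?P\<close> by (rule sets.sets_into_space)
    then have "(\<lambda>p. if fst p \<in> I then X s (snd p) else 0) -` B \<inter> space ?P
        = I \<times> (X s -` B \<inter> \<Omega>) \<union> (if 0 \<in> B then space ?P - I \<times> \<Omega> else {})"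
      using space_P by (auto split: if_splits)
    then show "(\<lambda>p. if fst p \<in> I then X s (snd p) else 0) -` B \<inter> space ?P \<in> sets ?P"
      using 1 2 by auto
  qed simp
  define h where "h n = T / real (Suc n)" for n
  have h: "h n > 0" "real (Suc n) * h n = T" for n using T by (auto simp: h_def simp del: of_nat_Suc)
  define f where "f n p = (if fst p \<in> {0} then X 0 (snd p) else 0)
      + (\<Sum>k<Suc n. if fst p \<in> {real k * h n<..real (Suc k) * h n} then X (real k * h n) (snd p) else 0)" for n p
  \<comment> \<open>The last grid point strictly before \<open>t\<close>, hence the ceiling minus 1:
    the rectangles contain their right but not their left end. The time 0 has its own generator
    \<open>{0} \<times> A\<close>.\<close>
  define \<tau> where "\<tau> n t = (if t = 0 then 0 else (real_of_int \<lceil>t / h n\<rceil> - 1) * h n)" for n t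
  have f_meas: "f n \<in> borel_measurable ?P" for n
    unfolding f_def
  proof (intro borel_measurable_add borel_measurable_sum step)
    show "0 \<in> {0..T}" using T by auto
    fix A assume "A \<in> sets (Fil 0)"
    then show "{0} \<times> A \<in> sets ?P" by (intro in_P) blast
  next
    fix k assume "k \<in> {..<Suc n}"
    then have "real (Suc k) \<le> real (Suc n)" by auto
    then have le: "real (Suc k) * h n \<le> T" using h[of n] mult_right_mono[of "real (Suc k)" "real (Suc n)" "h n"] by linarith
    have lt: "real k * h n < real (Suc k) * h n" using h(1)[of n] by (intro mult_strict_right_mono) auto
    have ge: "0 \<le> real k * h n" using h(1)[of n] by simp
    show "real k * h n \<in> {0..T}" using le lt ge by auto
    fix A assume "A \<in> sets (Fil (real k * h n))"
    then show "{real k * h n<..real (Suc k) * h n} \<times> A \<in> sets ?P" using le lt ge by (intro in_P) blast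
  qed
  have f_eq: "f n (t, \<omega>) = X (\<tau> n t) \<omega>" and \<tau>_bounds: "\<tau> n t \<in> {0..T}" "t - h n \<le> \<tau> n t" "\<tau> n t \<le> t"
    if t: "t \<in> {0..T}" for n t \<omega>
  proof -
    have "f n (t, \<omega>) = X (\<tau> n t) \<omega> \<and> \<tau> n t \<in> {0..T} \<and> t - h n \<le> \<tau> n t \<and> \<tau> n t \<le> t"
    proof (cases "t = 0")
      case True
      have "\<not> real k * h n < 0" for k using h(1)[of n] by (simp add: not_less)
      then show ?thesis using True h(1)[of n] T by (simp add: f_def \<tau>_def less_imp_le)
    next
      case False
      then have tpos: "t > 0" using t by auto
      have q: "t / h n > 0" using tpos h(1) by simp
      then have c1: "\<lceil>t / h n\<rceil> \<ge> 1" by linarith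
      define k0 where "k0 = nat (\<lceil>t / h n\<rceil> - 1)"
      have k0: "int k0 = \<lceil>t / h n\<rceil> - 1" using c1 by (simp add: k0_def)
      then have k0r: "real k0 = real_of_int \<lceil>t / h n\<rceil> - 1" by (metis of_int_1 of_int_diff of_int_of_nat_eq)
      have in_iff: "t \<in> {real k * h n<..real (Suc k) * h n} \<longleftrightarrow> k = k0" for k
      proof -
        have "t \<in> {real k * h n<..real (Suc k) * h n} \<longleftrightarrow> real k < t / h n \<and> t / h n \<le> real k + 1"
          using h(1)[of n] by (auto simp: pos_less_divide_eq pos_divide_le_eq algebra_simps)
        also have "\<dots> \<longleftrightarrow> \<lceil>t / h n\<rceil> = int k + 1" by (simp add: ceiling_eq_iff)
        also have "\<dots> \<longleftrightarrow> k = k0" using k0 by auto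
        finally show ?thesis .
      qed
      have tle: "t / h n \<le> real (Suc n)" using t h[of n] by (simp add: pos_divide_le_eq)
      then have "\<lceil>t / h n\<rceil> \<le> int (Suc n)" by (simp add: ceiling_le_iff)
      then have k0n: "k0 < Suc n" using k0 by linarith
      have "f n (t, \<omega>) = (\<Sum>k<Suc n. if k = k0 then X (real k * h n) \<omega> else 0)"
        using False unfolding f_def fst_conv snd_conv in_iff by simp
      also have "\<dots> = X (real k0 * h n) \<omega>" using k0n by (simp add: sum.delta del: sum.lessThan_Suc)
      finally have fe: "f n (t, \<omega>) = X (real k0 * h n) \<omega>" .
      have te: "\<tau> n t = real k0 * h n" using False k0r by (simp add: \<tau>_def)
      have "t \<in> {real k0 * h n<..real (Suc k0) * h n}" using in_iff by blast
      then have "t - h n \<le> real k0 * h n" "real k0 * h n \<le> t" by (auto simp: algebra_simps)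
      moreover have "0 \<le> real k0 * h n" using h(1)[of n] by simp
      ultimately show ?thesis using fe te t by auto
    qed
    then show "f n (t, \<omega>) = X (\<tau> n t) \<omega>" "\<tau> n t \<in> {0..T}" "t - h n \<le> \<tau> n t" "\<tau> n t \<le> t" by auto
  qed
  have h0: "h \<longlonglongrightarrow> 0"
    unfolding h_def[abs_def] by (rule LIMSEQ_Suc[OF lim_const_over_n])
  have "(\<lambda>p. X (fst p) (snd p)) \<in> borel_measurable ?P"
  proof (rule borel_measurable_LIMSEQ_metric[OF f_meas])
    fix p assume "p \<in> space ?P"
    then obtain t \<omega> where p: "p = (t, \<omega>)" "t \<in> {0..T}" "\<omega> \<in> \<Omega>" using space_P by auto
    have "(\<lambda>n. \<tau> n t) \<longlonglongrightarrow> t"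
      by (rule tendsto_sandwich[of "\<lambda>n. t - h n" _ _ "\<lambda>_. t"])
        (use \<tau>_bounds[OF p(2)] tendsto_diff[OF tendsto_const h0, of t] in \<open>auto intro: always_eventually\<close>)
    then have "(\<lambda>n. X (\<tau> n t) \<omega>) \<longlonglongrightarrow> X t \<omega>"
      by (rule continuous_on_tendsto_compose[OF cont[OF p(3)]]) (use \<tau>_bounds(1)[OF p(2)] p(2) in \<open>auto intro: always_eventually\<close>)
    then show "(\<lambda>n. f n p) \<longlonglongrightarrow> X (fst p) (snd p)" using f_eq[OF p(2)] by (simp add: p(1))
  qed
  then show ?thesis by (simp add: case_prod_beta')
qed

section \<open>Means and covariances of the Brownian motions\<close>

lemma borel_measurable_vec_nth: "(\<lambda>x :: real^'n. x $ i) \<in> borel_measurable borel"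
  by (intro borel_measurable_continuous_onI continuous_intros)

lemma (in prob_space) indep_pair_expectation:
  fixes Z :: "'i \<Rightarrow> 'a \<Rightarrow> real"
  assumes "indep_vars (\<lambda>_. borel) Z I" "i \<in> I" "j \<in> I" "i \<noteq> j" "integrable M (Z i)" "integrable M (Z j)"
  shows "expectation (\<lambda>\<omega>. Z i \<omega> * Z j \<omega>) = expectation (Z i) * expectation (Z j)"
proof -
  have "indep_vars (\<lambda>_. borel) Z {i, j}" by (rule indep_vars_subset[OF assms(1)]) (use assms in auto)
  from indep_vars_lebesgue_integral[OF _ this] assms
  show ?thesis by auto
qed

lemma brownian_increment:
  assumes M: "prob_space M" and W: "brownian_motion M T W" and st: "0 \<le> s" "s < t" "t \<le> T"
  shows "integrable M (\<lambda>\<omega>. (W t \<omega> $ j - W s \<omega> $ j)\<^sup>2)"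
    "integrable M (\<lambda>\<omega>. W t \<omega> $ j - W s \<omega> $ j)"
    "(\<integral>\<omega>. W t \<omega> $ j - W s \<omega> $ j \<partial>M) = 0"
    "(\<integral>\<omega>. (W t \<omega> $ i - W s \<omega> $ i) * (W t \<omega> $ j - W s \<omega> $ j) \<partial>M) = (if i = j then t - s else 0)"
proof -
  interpret prob_space M by fact
  have indep: "indep_vars (\<lambda>_. borel) (\<lambda>j \<omega>. W t \<omega> $ j - W s \<omega> $ j) UNIV"
    and dist: "\<And>j. distributed M lborel (\<lambda>\<omega>. W t \<omega> $ j - W s \<omega> $ j) (normal_density 0 (sqrt (t - s)))"
    using W st unfolding brownian_motion_def by blast+
  have pos: "sqrt (t - s) > 0" using st by simp
  show sq: "integrable M (\<lambda>\<omega>. (W t \<omega> $ j - W s \<omega> $ j)\<^sup>2)" for j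
    using distributed_integrable[OF dist[of j], of "\<lambda>x. x\<^sup>2"] integrable_normal_moment[OF pos, of 0 2] by simp
  show i1: "integrable M (\<lambda>\<omega>. W t \<omega> $ j - W s \<omega> $ j)" for j
    using distributed_integrable[OF dist[of j], of "\<lambda>x. x"] integrable_normal_moment[OF pos, of 0 1] by simp
  show mean: "expectation (\<lambda>\<omega>. W t \<omega> $ j - W s \<omega> $ j) = 0" for j
    by (rule normal_distributed_expectation[OF pos dist])
  have var: "expectation (\<lambda>\<omega>. (W t \<omega> $ j - W s \<omega> $ j)\<^sup>2) = t - s" for j
    using normal_distributed_variance[OF pos dist[of j]] st unfolding mean by simp
  show "expectation (\<lambda>\<omega>. (W t \<omega> $ i - W s \<omega> $ i) * (W t \<omega> $ j - W s \<omega> $ j)) = (if i = j then t - s else 0)"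
  proof (cases "i = j")
    case True
    then show ?thesis using var[of j] by (simp add: power2_eq_square)
  next
    case False
    then show ?thesis using indep_pair_expectation[OF indep _ _ False i1 i1] mean by simp
  qed
qed

lemma brownian_moments:
  assumes M: "prob_space M" and W: "brownian_motion M T W" and t: "t \<in> {0..T}"
  shows "integrable M (\<lambda>\<omega>. (W t \<omega> $ j)\<^sup>2)" "(\<integral>\<omega>. W t \<omega> $ j \<partial>M) = 0" "integrable M (\<lambda>\<omega>. W t \<omega> $ j)"
    "(\<integral>\<omega>. W t \<omega> $ i * W t \<omega> $ j \<partial>M) = (if i = j then t else 0)"
proof -
  interpret prob_space M by fact
  have meas: "W t \<in> borel_measurable M" if "t \<in> {0..T}" for t using W that unfolding brownian_motion_def by blast
  have z: "AE \<omega> in M. W 0 \<omega> = 0" using W unfolding brownian_motion_def by blast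
  have "0 \<in> {0..T}" using t by auto
  note m = meas[OF t] meas[OF this]
  have mj: "(\<lambda>\<omega>. W t \<omega> $ j) \<in> borel_measurable M" "(\<lambda>\<omega>. W t \<omega> $ j - W 0 \<omega> $ j) \<in> borel_measurable M" for j
    using m by (auto intro!: measurable_compose[OF _ borel_measurable_vec_nth] borel_measurable_diff)
  have eq: "AE \<omega> in M. W t \<omega> $ j = W t \<omega> $ j - W 0 \<omega> $ j" for j using z by eventually_elim simp
  have eq': "AE \<omega> in M. W t \<omega> $ j - W 0 \<omega> $ j = W t \<omega> $ j" for j using z by eventually_elim simp
  have all: "integrable M (\<lambda>\<omega>. (W t \<omega> $ j - W 0 \<omega> $ j)\<^sup>2) \<and> integrable M (\<lambda>\<omega>. W t \<omega> $ j - W 0 \<omega> $ j) \<and>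
      expectation (\<lambda>\<omega>. W t \<omega> $ j - W 0 \<omega> $ j) = 0 \<and>
      expectation (\<lambda>\<omega>. (W t \<omega> $ i - W 0 \<omega> $ i) * (W t \<omega> $ j - W 0 \<omega> $ j)) = (if i = j then t else 0)" for i j
  proof (cases "t = 0")
    case False
    then show ?thesis using brownian_increment[OF M W, of 0 t] t by auto
  qed simp
  show "integrable M (\<lambda>\<omega>. (W t \<omega> $ j)\<^sup>2)"
  proof (rule integrable_cong_AE_imp[of M "\<lambda>\<omega>. (W t \<omega> $ j - W 0 \<omega> $ j)\<^sup>2"])
    show "AE \<omega> in M. (W t \<omega> $ j - W 0 \<omega> $ j)\<^sup>2 = (W t \<omega> $ j)\<^sup>2" using eq[of j] by eventually_elim simp
  qed (use all mj in \<open>auto intro: borel_measurable_power\<close>)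
  show "integrable M (\<lambda>\<omega>. W t \<omega> $ j)"
    by (rule integrable_cong_AE_imp[of M "\<lambda>\<omega>. W t \<omega> $ j - W 0 \<omega> $ j"]) (use all mj eq' in auto)
  have "expectation (\<lambda>\<omega>. W t \<omega> $ j) = expectation (\<lambda>\<omega>. W t \<omega> $ j - W 0 \<omega> $ j)"
    by (rule integral_cong_AE[OF mj eq])
  then show "expectation (\<lambda>\<omega>. W t \<omega> $ j) = 0" using all by simp
  have "expectation (\<lambda>\<omega>. W t \<omega> $ i * W t \<omega> $ j) = expectation (\<lambda>\<omega>. (W t \<omega> $ i - W 0 \<omega> $ i) * (W t \<omega> $ j - W 0 \<omega> $ j))"
  proof (rule integral_cong_AE)
    show "AE \<omega> in M. W t \<omega> $ i * W t \<omega> $ j = (W t \<omega> $ i - W 0 \<omega> $ i) * (W t \<omega> $ j - W 0 \<omega> $ j)"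
      using z by eventually_elim simp
  qed (intro borel_measurable_times mj)+
  then show "expectation (\<lambda>\<omega>. W t \<omega> $ i * W t \<omega> $ j) = (if i = j then t else 0)" using all by simp
qed

text \<open>Since \<open>W 0\<close> vanishes almost surely, \<open>W s\<close> is itself an
  increment and is independent of the increment from \<open>s\<close> to \<open>t\<close>, which has
  mean 0. Only the variance at time \<open>s\<close> remains.\<close>

lemma brownian_cov_le:
  assumes M: "prob_space M" and W: "brownian_motion M T W" and st: "0 \<le> s" "s \<le> t" "t \<le> T"
  shows "(\<integral>\<omega>. W s \<omega> $ i * W t \<omega> $ j \<partial>M) = (if i = j then s else 0)"
proof (cases "s = t")
  case True
  then show ?thesis using brownian_moments(4)[OF M W, of t i j] st by auto
next
  case False
  interpret prob_space M by fact
  have st': "s < t" "s \<in> {0..T}" "0 \<in> {0..T}" "t \<in> {0..T}" using False st by auto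
  have meas: "(\<lambda>\<omega>. W t \<omega> $ j) \<in> borel_measurable M" if "t \<in> {0..T}" for t j
    using W that unfolding brownian_motion_def by (auto intro!: measurable_compose[OF _ borel_measurable_vec_nth])
  have z: "AE \<omega> in M. W 0 \<omega> = 0" using W unfolding brownian_motion_def by blast
  \<comment> \<open>The partition 0, s, t: index 0 gives the increment up to \<open>s\<close>, and
    index 1 the later one.\<close>
  define ts :: "nat \<Rightarrow> real" where "ts k = (if k = 0 then 0 else if k = 1 then s else t)" for k
  have "0 \<le> ts 0 \<and> (\<forall>i<2. ts i \<le> ts (Suc i)) \<and> ts 2 \<le> T" using st by (auto simp: ts_def)
  then have "indep_vars (\<lambda>_. borel) (\<lambda>k \<omega>. W (ts (Suc k)) \<omega> - W (ts k) \<omega>) {..<2}"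
    using W unfolding brownian_motion_def by blast
  then have "indep_vars (\<lambda>_. borel) (\<lambda>k \<omega>. (W (ts (Suc k)) \<omega> - W (ts k) \<omega>) $ (if k = 0 then i else j)) {..<2}"
    by (rule indep_vars_compose2) (rule borel_measurable_vec_nth)
  then have ind: "expectation (\<lambda>\<omega>. ((W s \<omega> - W 0 \<omega>) $ i) * ((W t \<omega> - W s \<omega>) $ j))
      = expectation (\<lambda>\<omega>. (W s \<omega> - W 0 \<omega>) $ i) * expectation (\<lambda>\<omega>. (W t \<omega> - W s \<omega>) $ j)"
  proof -
    assume iv: "indep_vars (\<lambda>_. borel) (\<lambda>k \<omega>. (W (ts (Suc k)) \<omega> - W (ts k) \<omega>) $ (if k = 0 then i else j)) {..<2}"
    have "integrable M (\<lambda>\<omega>. W s \<omega> $ i - W 0 \<omega> $ i)" "integrable M (\<lambda>\<omega>. W t \<omega> $ j - W s \<omega> $ j)"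
      by (intro Bochner_Integration.integrable_diff brownian_moments(3)[OF M W] st')+
    then show ?thesis using indep_pair_expectation[OF iv, of 0 1] by (simp add: ts_def)
  qed
  have i: "integrable M (\<lambda>\<omega>. W s \<omega> $ i * W t \<omega> $ j)" if "s \<in> {0..T}" "t \<in> {0..T}" for s t i j
  proof (rule Bochner_Integration.integrable_bound[of M "\<lambda>\<omega>. (W s \<omega> $ i)\<^sup>2 + (W t \<omega> $ j)\<^sup>2"])
    show "integrable M (\<lambda>\<omega>. (W s \<omega> $ i)\<^sup>2 + (W t \<omega> $ j)\<^sup>2)"
      using brownian_moments(1)[OF M W] that by simp
    have "\<bar>x * y\<bar> \<le> x\<^sup>2 + y\<^sup>2" for x y :: real
      using sum_squares_bound[of "\<bar>x\<bar>" "\<bar>y\<bar>"] mult_nonneg_nonneg[OF abs_ge_zero abs_ge_zero, of x y]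
      unfolding abs_mult mult.assoc power2_abs by linarith
    then show "AE \<omega> in M. norm (W s \<omega> $ i * W t \<omega> $ j) \<le> norm ((W s \<omega> $ i)\<^sup>2 + (W t \<omega> $ j)\<^sup>2)" by simp
  qed (intro borel_measurable_times meas that)
  have "expectation (\<lambda>\<omega>. W s \<omega> $ i * W t \<omega> $ j) - expectation (\<lambda>\<omega>. W s \<omega> $ i * W s \<omega> $ j)
      = expectation (\<lambda>\<omega>. W s \<omega> $ i * W t \<omega> $ j - W s \<omega> $ i * W s \<omega> $ j)"
    using i st' by simp
  also have "\<dots> = expectation (\<lambda>\<omega>. ((W s \<omega> - W 0 \<omega>) $ i) * ((W t \<omega> - W s \<omega>) $ j))"
  proof (rule integral_cong_AE)
    show "AE \<omega> in M. W s \<omega> $ i * W t \<omega> $ j - W s \<omega> $ i * W s \<omega> $ j = ((W s \<omega> - W 0 \<omega>) $ i) * ((W t \<omega> - W s \<omega>) $ j)"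
      using z by eventually_elim (simp add: algebra_simps)
    show "(\<lambda>\<omega>. W s \<omega> $ i * W t \<omega> $ j - W s \<omega> $ i * W s \<omega> $ j) \<in> borel_measurable M"
      by (intro borel_measurable_diff borel_measurable_times meas st')
    show "(\<lambda>\<omega>. ((W s \<omega> - W 0 \<omega>) $ i) * ((W t \<omega> - W s \<omega>) $ j)) \<in> borel_measurable M"
      unfolding vector_minus_component by (intro borel_measurable_diff borel_measurable_times meas st')
  qed
  also have "\<dots> = 0"
    unfolding ind using brownian_increment(3)[OF M W st(1) st'(1) st(3), of j] by simp
  finally show ?thesis using brownian_moments(4)[OF M W st'(2), of i j] by simp
qed

lemma brownian_cov:
  assumes M: "prob_space M" and W: "brownian_motion M T W" and st: "s \<in> {0..T}" "t \<in> {0..T}"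
  shows "(\<integral>\<omega>. W s \<omega> $ i * W t \<omega> $ j \<partial>M) = (if i = j then min s t else 0)"
  using brownian_cov_le[OF M W, of s t i j] brownian_cov_le[OF M W, of t s j i] st
  by (cases "s \<le> t") (auto simp: mult.commute min_def)

text \<open>A single coordinate at a single time generates a sub-\<sigma>-algebra of the path
  events, so independence of the processes passes to these random variables and the expectation
  factorizes into means equal to 0.\<close>

lemma independent_cov:
  assumes M: "prob_space M" and W: "brownian_motion M T W1" "brownian_motion M T W2"
    and indep: "independent_processes M T W1 W2" and st: "s \<in> {0..T}" "t \<in> {0..T}"
  shows "(\<integral>\<omega>. W1 s \<omega> $ i * W2 t \<omega> $ j \<partial>M) = 0"
proof -
  interpret prob_space M by fact
  have m1: "W1 s \<in> borel_measurable M" and m2: "W2 t \<in> borel_measurable M"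
    using W st unfolding brownian_motion_def by blast+
  have "indep_var borel (\<lambda>\<omega>. W1 s \<omega> $ i) borel (\<lambda>\<omega>. W2 t \<omega> $ j)"
    unfolding indep_var_eq
  proof (intro conjI measurable_compose[OF m1 borel_measurable_vec_nth] measurable_compose[OF m2 borel_measurable_vec_nth])
    have sub: "sigma_sets (space M) {(\<lambda>\<omega>. W u \<omega> $ l) -` A \<inter> space M |A. A \<in> sets borel} \<subseteq> sigma_sets (space M) (path_events M W {0..T})"
      if u: "u \<in> {0..T}" for W :: "real \<Rightarrow> 'a \<Rightarrow> real^'z::finite" and u l
    proof (rule sigma_sets_mono', safe)
      fix A :: "real set" assume "A \<in> sets borel"
      then have "(\<lambda>x :: real^'z. x $ l) -` A \<in> sets borel"
        using measurable_sets[OF borel_measurable_vec_nth, of A l] by simp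
      moreover have "(\<lambda>\<omega>. W u \<omega> $ l) -` A \<inter> space M = W u -` ((\<lambda>x. x $ l) -` A) \<inter> space M" by auto
      ultimately show "(\<lambda>\<omega>. W u \<omega> $ l) -` A \<inter> space M \<in> path_events M W {0..T}"
        using u unfolding path_events_def by blast
    qed
    show "indep_set (sigma_sets (space M) {(\<lambda>\<omega>. W1 s \<omega> $ i) -` A \<inter> space M |A. A \<in> sets borel})
        (sigma_sets (space M) {(\<lambda>\<omega>. W2 t \<omega> $ j) -` A \<inter> space M |A. A \<in> sets borel})"
      using indep sub[OF st(1), of W1 i] sub[OF st(2), of W2 j] unfolding independent_processes_def indep_set_def
      by (elim indep_sets_mono_sets) (auto split: bool.split)
  qed
  then have "expectation (\<lambda>\<omega>. W1 s \<omega> $ i * W2 t \<omega> $ j) = expectation (\<lambda>\<omega>. W1 s \<omega> $ i) * expectation (\<lambda>\<omega>. W2 t \<omega> $ j)"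
    using indep_var_lebesgue_integral[of "\<lambda>\<omega>. W1 s \<omega> $ i" "\<lambda>\<omega>. W2 t \<omega> $ j"]
      brownian_moments(3)[OF M W(1) st(1), of i] brownian_moments(3)[OF M W(2) st(2), of j] by (simp add: o_def)
  then show ?thesis using brownian_moments(2)[OF M W(1) st(1), of i] by simp
qed

section \<open>The controlled state equation\<close>

lemma path_eventI: "s \<in> I \<Longrightarrow> B \<in> sets borel \<Longrightarrow> W s -` B \<inter> space M \<in> path_events M W I"
  unfolding path_events_def by blast

lemma path_events_mono: "I \<subseteq> J \<Longrightarrow> path_events M W I \<subseteq> path_events M W J"
  unfolding path_events_def by blast

text \<open>The columns are the directions in which the scalar noises act, so this links the trace
  terms of the value with the sum over noises in \<open>value_identity\<close>.\<close>

lemma inner_matrix_mult_columns: "(A ** B) \<bullet> B = (\<Sum>j\<in>UNIV. (A *v column j B) \<bullet> column j B)"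
  for A :: "real^'n^'n" and B :: "real^'m^'n"
proof -
  have row: "transpose B $ j = column j B" for j
    by (simp add: vec_eq_iff transpose_def column_def)
  have "(A ** B) \<bullet> B = (transpose B ** transpose A) \<bullet> transpose B"
    by (subst inner_transpose[symmetric]) (simp add: matrix_transpose_mul)
  also have "\<dots> = (\<Sum>j\<in>UNIV. (A *v column j B) \<bullet> column j B)"
    by (simp add: inner_vec_def[of "transpose B ** transpose A"] matrix_mult_row row)
  finally show ?thesis .
qed

lemma matrix_vector_columns: "A *v x = (\<Sum>j\<in>UNIV. x $ j *\<^sub>R column j A)" for A :: "real^'m^'n"
  by (simp add: matrix_mult_sum scalar_mult_eq_scaleR)

lemmas matrix_vector_linear =
  bounded_bilinear.add_left[OF bounded_bilinear_matrix_vector_mult]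
  bounded_bilinear.add_right[OF bounded_bilinear_matrix_vector_mult]
  bounded_bilinear.diff_left[OF bounded_bilinear_matrix_vector_mult]
  bounded_bilinear.diff_right[OF bounded_bilinear_matrix_vector_mult]
  bounded_bilinear.minus_left[OF bounded_bilinear_matrix_vector_mult]
  bounded_bilinear.minus_right[OF bounded_bilinear_matrix_vector_mult]
  bounded_bilinear.scaleR_left[OF bounded_bilinear_matrix_vector_mult]
  bounded_bilinear.scaleR_right[OF bounded_bilinear_matrix_vector_mult]

lemmas continuous_on_matrix_mult [continuous_intros] = bounded_bilinear.continuous_on[OF bounded_bilinear_matrix_mult]
lemmas continuous_on_matrix_vector [continuous_intros] = bounded_bilinear.continuous_on[OF bounded_bilinear_matrix_vector_mult]
lemmas continuous_on_transpose [continuous_intros] = bounded_linear.continuous_on[OF bounded_linear_transpose]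

text \<open>The controls are separate arguments so that one expression serves both for the closed
  loop, where they depend on the state, and for the state equation, where they are given
  processes.\<close>

definition drift ::
  "('n1::finite, 'n2::finite, 'k1::finite, 'k2::finite, 'm1::finite, 'm2::finite) game
    \<Rightarrow> real \<Rightarrow> (real^'n1) \<times> (real^'n2) \<Rightarrow> real^'k1 \<Rightarrow> real^'k2 \<Rightarrow> (real^'n1) \<times> (real^'n2)" where
  "drift G \<epsilon> x a b =
    (A11 G *v fst x + A12 G *v snd x + B11 G *v a + B12 G *v b,
     (1 / \<epsilon>) *\<^sub>R (A21 G *v fst x + A22 G *v snd x + B21 G *v a + B22 G *v b))"

lemma drift_add: "drift G \<epsilon> (x + y) (a + a') (b + b') = drift G \<epsilon> x a b + drift G \<epsilon> y a' b'"
  by (simp add: drift_def matrix_vector_linear scaleR_add_right)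

lemma drift_scaleR: "drift G \<epsilon> (c *\<^sub>R x) (c *\<^sub>R a) (c *\<^sub>R b) = c *\<^sub>R drift G \<epsilon> x a b"
  by (simp add: drift_def matrix_vector_linear scaleR_add_right mult.commute)

lemma continuous_on_drift [continuous_intros]:
  "continuous_on A x \<Longrightarrow> continuous_on A a \<Longrightarrow> continuous_on A b \<Longrightarrow> continuous_on A (\<lambda>s. drift G \<epsilon> (x s) (a s) (b s))"
  unfolding drift_def by (intro continuous_intros)

lemma drift_diff_controls_eq: "drift G \<epsilon> x a b - drift G \<epsilon> y a b = drift G \<epsilon> (x - y) 0 0"
  by (simp add: drift_def matrix_vector_linear scaleR_diff_right[symmetric])

text \<open>For continuous paths the Lebesgue and the gauge integral coincide and projections
  commute with the latter, so the two equations can be handled as one in the product space.\<close>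

lemma state_equation_iff:
  fixes X1 :: "real \<Rightarrow> real^'n1" and X2 :: "real \<Rightarrow> real^'n2"
  assumes t: "t \<ge> 0"
    and c: "continuous_on {0..t} X1" "continuous_on {0..t} X2" "continuous_on {0..t} a" "continuous_on {0..t} b"
  shows "(X1 t = x1 + (LINT s:{0..t}|lborel. A11 G *v X1 s + A12 G *v X2 s + B11 G *v a s + B12 G *v b s) + n1 \<and>
      X2 t = x2 + (1 / \<epsilon>) *\<^sub>R (LINT s:{0..t}|lborel. A21 G *v X1 s + A22 G *v X2 s + B21 G *v a s + B22 G *v b s) + n2)
    \<longleftrightarrow> (X1 t, X2 t) = (x1, x2) + integral {0..t} (\<lambda>s. drift G \<epsilon> (X1 s, X2 s) (a s) (b s)) + (n1, n2)"
proof -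
  let ?d = "\<lambda>s. drift G \<epsilon> (X1 s, X2 s) (a s) (b s)"
  let ?d1 = "\<lambda>s. A11 G *v X1 s + A12 G *v X2 s + B11 G *v a s + B12 G *v b s"
  let ?d2 = "\<lambda>s. A21 G *v X1 s + A22 G *v X2 s + B21 G *v a s + B22 G *v b s"
  have i: "?d integrable_on {0..t}" by (intro integrable_continuous_real continuous_intros c)
  have c1: "continuous_on {0..t} ?d1" and c2: "continuous_on {0..t} ?d2" by (intro continuous_intros c)+
  have l: "(LINT s:{0..t}|lborel. ?d1 s) = integral {0..t} ?d1" "(LINT s:{0..t}|lborel. ?d2 s) = integral {0..t} ?d2"
    by (rule set_borel_integral_eq_integral(2)[OF borel_integrable_atLeastAtMost'[OF c1]],
        rule set_borel_integral_eq_integral(2)[OF borel_integrable_atLeastAtMost'[OF c2]])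
  have "fst (integral {0..t} ?d) = integral {0..t} ?d1"
    using integral_linear[OF i bounded_linear_fst] by (simp add: o_def drift_def)
  moreover have "snd (integral {0..t} ?d) = (1 / \<epsilon>) *\<^sub>R integral {0..t} ?d2"
    using integral_linear[OF i bounded_linear_snd] by (simp add: o_def drift_def)
  ultimately show ?thesis unfolding l by (auto simp: prod_eq_iff)
qed

lemma linear_integral_equation_zero:
  fixes d :: "real \<Rightarrow> 'a::euclidean_space"
  assumes cont: "continuous_on {0..T} d" and A: "bounded_linear A"
    and eq: "\<And>t. t \<in> {0..T} \<Longrightarrow> d t = integral {0..t} (\<lambda>s. A (d s))" and t: "t \<in> {0..T}"
  shows "d t = 0"
proof -
  obtain K where K: "\<And>x. norm (A x) \<le> norm x * K" using bounded_linear.bounded[OF A] by auto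
  have c: "continuous_on {0..T} (\<lambda>s. A (d s))" by (rule bounded_linear.continuous_on[OF A cont])
  show ?thesis
  proof (rule ode_unique[where T = T and z = "\<lambda>_. 0" and z' = "\<lambda>_. 0" and y = d and y' = "\<lambda>s. A (d s)" and L = K, OF _ _ _ _ t])
    fix s assume s: "s \<in> {0..T}"
    show "(d has_vector_derivative A (d s)) (at s within {0..T})"
      by (rule has_vector_derivative_transform[OF s _ integral_has_vector_derivative[OF c s]]) (use eq in auto)
    show "norm (A (d s) - 0) \<le> K * norm (d s - 0)" using K[of "d s"] by (simp add: mult.commute)
  next
    show "d 0 = 0" using eq[of 0] t by simp
  qed auto
qed

section \<open>The augmented filtration and admissible controls\<close>

context
  fixes M :: "'w measure" and T :: real and W1 :: "real \<Rightarrow> 'w \<Rightarrow> real^'m1" and W2 :: "real \<Rightarrow> 'w \<Rightarrow> real^'m2"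
  assumes M: "prob_space M" and T: "T > 0"
    and W: "brownian_motion M T W1" "brownian_motion M T W2"
begin

lemma W_meas: "t \<in> {0..T} \<Longrightarrow> W1 t \<in> borel_measurable M" "t \<in> {0..T} \<Longrightarrow> W2 t \<in> borel_measurable M"
  using W unfolding brownian_motion_def by blast+

lemma aug_generators:
  "path_events M W1 {0..t} \<union> path_events M W2 {0..t} \<union> null_sets M \<subseteq> Pow (space M)"
  by (auto simp: path_events_def dest: sets.sets_into_space)

lemma space_aug: "space (aug_filtration M W1 W2 t) = space M"
  unfolding aug_filtration_def by (rule space_measure_of[OF aug_generators])

lemma sets_aug: "sets (aug_filtration M W1 W2 t)
    = sigma_sets (space M) (path_events M W1 {0..t} \<union> path_events M W2 {0..t} \<union> null_sets M)"
  unfolding aug_filtration_def by (rule sets_measure_of[OF aug_generators])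

lemma sets_aug_mono: "s \<le> t \<Longrightarrow> sets (aug_filtration M W1 W2 s) \<subseteq> sets (aug_filtration M W1 W2 t)"
  unfolding sets_aug by (intro sigma_sets_mono' Un_mono path_events_mono) auto

lemma sets_aug_subset: "t \<le> T \<Longrightarrow> sets (aug_filtration M W1 W2 t) \<subseteq> sets M"
proof -
  assume t: "t \<le> T"
  have "path_events M W1 {0..t} \<subseteq> sets M" "path_events M W2 {0..t} \<subseteq> sets M"
    using W_meas t by (auto simp: path_events_def intro: measurable_sets)
  then show ?thesis unfolding sets_aug by (intro sets.sigma_sets_subset) (auto simp: null_sets_def)
qed

lemma aug_meas_imp_meas: "t \<le> T \<Longrightarrow> f \<in> borel_measurable (aug_filtration M W1 W2 t) \<Longrightarrow> f \<in> borel_measurable M"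
  by (rule borel_measurable_mono[OF _ sets_aug_subset space_aug])

lemma aug_W_meas: "t \<ge> 0 \<Longrightarrow> W1 t \<in> borel_measurable (aug_filtration M W1 W2 t)"
  "t \<ge> 0 \<Longrightarrow> W2 t \<in> borel_measurable (aug_filtration M W1 W2 t)"
proof -
  assume t: "t \<ge> 0"
  show "W1 t \<in> borel_measurable (aug_filtration M W1 W2 t)"
  proof (rule measurableI)
    fix B :: "(real^'m1) set" assume "B \<in> sets borel"
    then show "W1 t -` B \<inter> space (aug_filtration M W1 W2 t) \<in> sets (aug_filtration M W1 W2 t)"
      unfolding sets_aug space_aug using t by (intro sigma_sets.Basic UnI1 path_eventI) auto
  qed simp
  show "W2 t \<in> borel_measurable (aug_filtration M W1 W2 t)"
  proof (rule measurableI)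
    fix B :: "(real^'m2) set" assume "B \<in> sets borel"
    then show "W2 t -` B \<inter> space (aug_filtration M W1 W2 t) \<in> sets (aug_filtration M W1 W2 t)"
      unfolding sets_aug space_aug using t by (intro sigma_sets.Basic UnI1[OF UnI2] path_eventI) auto
  qed simp
qed

text \<open>Outside a null set the Brownian paths are continuous; since null sets belong to the
  filtration, the paths can be set to 0 there without losing adaptedness.\<close>

lemma continuous_versions:
  obtains V1 :: "real \<Rightarrow> 'w \<Rightarrow> real^'m1" and V2 :: "real \<Rightarrow> 'w \<Rightarrow> real^'m2"
  where "\<And>t. t \<in> {0..T} \<Longrightarrow> V1 t \<in> borel_measurable (aug_filtration M W1 W2 t)"
    "\<And>t. t \<in> {0..T} \<Longrightarrow> V2 t \<in> borel_measurable (aug_filtration M W1 W2 t)"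
    "\<And>\<omega>. continuous_on {0..T} (\<lambda>t. V1 t \<omega>)" "\<And>\<omega>. continuous_on {0..T} (\<lambda>t. V2 t \<omega>)"
    "AE \<omega> in M. \<forall>t. V1 t \<omega> = W1 t \<omega> \<and> V2 t \<omega> = W2 t \<omega>"
proof -
  have "AE \<omega> in M. continuous_on {0..T} (\<lambda>t. W1 t \<omega>) \<and> continuous_on {0..T} (\<lambda>t. W2 t \<omega>)"
    using W unfolding brownian_motion_def by (auto elim: AE_mp)
  then obtain N where N: "N \<in> null_sets M"
    "{\<omega> \<in> space M. \<not> (continuous_on {0..T} (\<lambda>t. W1 t \<omega>) \<and> continuous_on {0..T} (\<lambda>t. W2 t \<omega>))} \<subseteq> N"
    unfolding eventually_ae_filter by auto
  define V1 where "V1 t \<omega> = (if \<omega> \<in> space M - N then W1 t \<omega> else 0)" for t \<omega>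
  define V2 where "V2 t \<omega> = (if \<omega> \<in> space M - N then W2 t \<omega> else 0)" for t \<omega>
  have NF: "N \<in> sets (aug_filtration M W1 W2 t)" for t
    unfolding sets_aug using N(1) by (intro sigma_sets.Basic) auto
  have SN: "space M - N \<in> sets (aug_filtration M W1 W2 t)" for t
    using sets.compl_sets[OF NF[of t]] by (simp add: space_aug)
  show ?thesis
  proof (rule that[of V1 V2])
    fix t assume t: "t \<in> {0..T}"
    then have t0: "t \<ge> 0" by simp
    have "{\<omega> \<in> space (aug_filtration M W1 W2 t). \<omega> \<in> space M - N} = space M - N" by (auto simp: space_aug)
    then have pred: "{\<omega> \<in> space (aug_filtration M W1 W2 t). \<omega> \<in> space M - N} \<in> sets (aug_filtration M W1 W2 t)"
      using SN[of t] by simp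
    show "V1 t \<in> borel_measurable (aug_filtration M W1 W2 t)"
      unfolding V1_def[abs_def] by (rule measurable_If[OF aug_W_meas(1)[OF t0] _ pred]) simp
    show "V2 t \<in> borel_measurable (aug_filtration M W1 W2 t)"
      unfolding V2_def[abs_def] by (rule measurable_If[OF aug_W_meas(2)[OF t0] _ pred]) simp
  next
    fix \<omega>
    show "continuous_on {0..T} (\<lambda>t. V1 t \<omega>)" "continuous_on {0..T} (\<lambda>t. V2 t \<omega>)"
      using N(2) by (cases "\<omega> \<in> space M - N"; auto simp: V1_def V2_def)+
  next
    show "AE \<omega> in M. \<forall>t. V1 t \<omega> = W1 t \<omega> \<and> V2 t \<omega> = W2 t \<omega>"
      using AE_not_in[OF N(1)] AE_space by eventually_elim (auto simp: V1_def V2_def)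
  qed
qed

lemma admissible_continuous_adapted:
  assumes meas: "\<And>t. t \<in> {0..T} \<Longrightarrow> u t \<in> borel_measurable (aug_filtration M W1 W2 t)"
    and cont: "\<And>\<omega>. \<omega> \<in> space M \<Longrightarrow> continuous_on {0..T} (\<lambda>t. u t \<omega>)"
    and int: "\<And>t. t \<in> {0..T} \<Longrightarrow> integrable M (\<lambda>\<omega>. (norm (u t \<omega>))\<^sup>2)"
    and bound: "\<And>t. t \<in> {0..T} \<Longrightarrow> (\<integral>\<omega>. (norm (u t \<omega>))\<^sup>2 \<partial>M) \<le> C"
  shows "admissible M T W1 W2 u"
  unfolding admissible_def
proof (intro conjI)
  interpret prob_space M by (rule M)
  show "(\<lambda>(t, \<omega>). u t \<omega>) \<in> borel_measurable (predictable_sigma (space M) T (aug_filtration M W1 W2))"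
    by (rule predictable_continuous_adapted[OF T space_aug meas cont])
  define L where "L = restrict_space lborel {0..T}"
  have spL: "space L = {0..T}" by (simp add: L_def space_restrict_space)
  interpret L: finite_measure L
  proof (rule finite_measureI)
    show "emeasure L (space L) \<noteq> \<infinity>" unfolding spL by (simp add: L_def emeasure_restrict_space emeasure_lborel_Icc_eq)
  qed
  interpret P: pair_sigma_finite L M ..
  have meas_joint: "(\<lambda>p. u (clamp_Icc T (fst p)) (snd p)) \<in> borel_measurable (borel \<Otimes>\<^sub>M M)"
  proof (rule cont_process.measurable_joint, rule cont_process.intro)
    fix s assume s: "s \<in> {0..T}"
    show "u s \<in> borel_measurable M" by (rule aug_meas_imp_meas[OF _ meas[OF s]]) (use s in auto)
  qed (use T cont in auto)
  have "(\<lambda>p. (fst p, snd p)) \<in> L \<Otimes>\<^sub>M M \<rightarrow>\<^sub>M borel \<Otimes>\<^sub>M M"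
  proof (rule measurable_Pair[OF _ measurable_snd])
    have "(\<lambda>x. x) \<in> L \<rightarrow>\<^sub>M borel" unfolding L_def by (rule measurable_restrict_space1) simp
    then show "fst \<in> L \<Otimes>\<^sub>M M \<rightarrow>\<^sub>M borel" using measurable_compose[OF measurable_fst] by blast
  qed
  from measurable_compose[OF this meas_joint]
  have "(\<lambda>p. u (clamp_Icc T (fst p)) (snd p)) \<in> borel_measurable (L \<Otimes>\<^sub>M M)" by simp
  then have "(\<lambda>p. u (fst p) (snd p)) \<in> borel_measurable (L \<Otimes>\<^sub>M M)"
    by (rule measurable_cong[THEN iffD1, rotated]) (auto simp: space_pair_measure spL clamp_Icc(2))
  then have m: "(\<lambda>p. (norm (u (fst p) (snd p)))\<^sup>2) \<in> borel_measurable (L \<Otimes>\<^sub>M M)" by measurable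
  have "integrable (L \<Otimes>\<^sub>M M) (\<lambda>p. (norm (u (fst p) (snd p)))\<^sup>2)"
  proof (rule P.Fubini_integrable[OF m])
    show "AE x in L. integrable M (\<lambda>y. (norm (u (fst (x, y)) (snd (x, y))))\<^sup>2)"
      by (rule AE_I2) (use int spL in auto)
    have m2: "(\<lambda>x. \<integral>y. norm ((norm (u (fst (x, y)) (snd (x, y))))\<^sup>2) \<partial>M) \<in> borel_measurable L"
      using sigma_finite_measure.borel_measurable_lebesgue_integral[OF sigma_finite_measure_axioms,
          of "\<lambda>x y. norm ((norm (u x y))\<^sup>2)" L] m by (simp add: case_prod_beta')
    show "integrable L (\<lambda>x. \<integral>y. norm ((norm (u (fst (x, y)) (snd (x, y))))\<^sup>2) \<partial>M)"
    proof (rule L.integrable_const_bound[OF _ m2])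
      show "AE x in L. norm (\<integral>y. norm ((norm (u (fst (x, y)) (snd (x, y))))\<^sup>2) \<partial>M) \<le> C"
      proof (rule AE_I2)
        fix x assume "x \<in> space L"
        then have "(\<integral>y. (norm (u x y))\<^sup>2 \<partial>M) \<le> C" using bound spL by auto
        moreover have "0 \<le> (\<integral>y. (norm (u x y))\<^sup>2 \<partial>M)" by (rule Bochner_Integration.integral_nonneg) simp
        ultimately show "norm (\<integral>y. norm ((norm (u (fst (x, y)) (snd (x, y))))\<^sup>2) \<partial>M) \<le> C" by simp
      qed
    qed
  qed
  then show "integrable (restrict_space lborel {0..T} \<Otimes>\<^sub>M M) (\<lambda>(t, \<omega>). (norm (u t \<omega>))\<^sup>2)"
    by (simp add: L_def case_prod_beta')
qed

end

section \<open>The closed loop and its cost\<close>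

lemma inner_transpose_mult: "(transpose A *v z) \<bullet> x = z \<bullet> (A *v x)" for A :: "real^'n^'m"
  by (simp add: dot_lmul_matrix)

text \<open>\<open>y1\<close> and \<open>y2\<close> act as costates. The three Riccati expressions
  are the blocks of one quadratic form, and in these variables every explicit power of \<epsilon>
  disappears; the feedback controls are linear in the same variables.\<close>

lemma riccati_quadratic:
  fixes G :: "('n1::finite, 'n2::finite, 'k1::finite, 'k2::finite, 'm1::finite, 'm2::finite) game"
    and p :: "real^'n1^'n1" and q :: "real^'n2^'n1" and r :: "real^'n2^'n2" and e :: real
    and x1 :: "real^'n1" and x2 :: "real^'n2"
  assumes sym: "transpose p = p" "transpose r = r"
  defines "y1 \<equiv> p *v x1 + e *\<^sub>R (q *v x2)" and "y2 \<equiv> transpose q *v x1 + r *v x2"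
  shows "(ric_f G p q r e *v x1) \<bullet> x1 + 2 * ((ric_g1 G p q r e *v x2) \<bullet> x1) + (ric_g2 G p q r e *v x2) \<bullet> x2
    = 2 * (y1 \<bullet> (A11 G *v x1 + A12 G *v x2) + y2 \<bullet> (A21 G *v x1 + A22 G *v x2))
      + y1 \<bullet> (Delta1 G *v y1) + 2 * (y1 \<bullet> (Delta G *v y2)) + y2 \<bullet> (Delta2 G *v y2)
      + (Q1 G *v x1) \<bullet> x1 + (Q2 G *v x2) \<bullet> x2"
proof -
  define a where "a = p *v x1"
  define b where "b = q *v x2"
  define c where "c = transpose q *v x1"
  define d where "d = r *v x2"
  note [simp del] = transpose_matrix_vector
  have pm: "(p *v z) \<bullet> x1 = a \<bullet> z" for z
    using inner_transpose_mult[of p z x1] by (simp add: sym a_def inner_commute)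
  have rm: "(r *v z) \<bullet> x2 = d \<bullet> z" for z
    using inner_transpose_mult[of r z x2] by (simp add: sym d_def inner_commute)
  have qm: "(q *v z) \<bullet> x1 = c \<bullet> z" for z
    using inner_transpose_mult[of "transpose q" z x1] by (simp add: c_def inner_commute)
  have qtm: "(transpose q *v z) \<bullet> x2 = b \<bullet> z" for z
    using inner_transpose_mult[of q z x2] by (simp add: b_def inner_commute)
  have dt: "w \<bullet> (transpose (Delta G) *v z) = z \<bullet> (Delta G *v w)" for w z
    using inner_transpose_mult[of "Delta G" z w] by (simp add: inner_commute)
  have s1: "b \<bullet> (Delta1 G *v a) = a \<bullet> (Delta1 G *v b)"
    using inner_transpose_mult[of "Delta1 G" b a] by (simp add: transpose_Delta1 inner_commute)
  have s2: "d \<bullet> (Delta2 G *v c) = c \<bullet> (Delta2 G *v d)"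
    using inner_transpose_mult[of "Delta2 G" d c] by (simp add: transpose_Delta2 inner_commute)
  note expand = matrix_vector_linear matrix_vector_mul_assoc[symmetric] inner_add_left inner_scaleR_left
    inner_transpose_mult a_def[symmetric] b_def[symmetric] c_def[symmetric] d_def[symmetric]
  have f: "(ric_f G p q r e *v x1) \<bullet> x1 = 2 * (a \<bullet> (A11 G *v x1)) + 2 * (c \<bullet> (A21 G *v x1))
      + a \<bullet> (Delta1 G *v a) + 2 * (a \<bullet> (Delta G *v c)) + c \<bullet> (Delta2 G *v c) + (Q1 G *v x1) \<bullet> x1"
    by (simp add: ric_f_def expand pm qm dt)
  have g1: "(ric_g1 G p q r e *v x2) \<bullet> x1 = e * (b \<bullet> (A11 G *v x1)) + d \<bullet> (A21 G *v x1) + a \<bullet> (A12 G *v x2)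
      + c \<bullet> (A22 G *v x2) + e * (a \<bullet> (Delta1 G *v b)) + e * (b \<bullet> (Delta G *v c)) + a \<bullet> (Delta G *v d) + c \<bullet> (Delta2 G *v d)"
    by (simp add: ric_g1_def expand pm qm dt)
  have g2: "(ric_g2 G p q r e *v x2) \<bullet> x2 = 2 * e * (b \<bullet> (A12 G *v x2)) + 2 * (d \<bullet> (A22 G *v x2))
      + e\<^sup>2 * (b \<bullet> (Delta1 G *v b)) + 2 * e * (b \<bullet> (Delta G *v d)) + d \<bullet> (Delta2 G *v d) + (Q2 G *v x2) \<bullet> x2"
    by (simp add: ric_g2_def expand rm qtm dt inner_commute[of _ b])
  show ?thesis
    unfolding f g1 g2 y1_def y2_def a_def[symmetric] b_def[symmetric] c_def[symmetric] d_def[symmetric]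
    by (simp add: matrix_vector_linear inner_add_left inner_add_right s1 s2 algebra_simps power2_eq_square)
qed

section \<open>Closed-loop data and the adjoint identity\<close>

locale closed_loop_game = prob_space M
  for G :: "('n1::finite, 'n2::finite, 'k1::finite, 'k2::finite, 'm1::finite, 'm2::finite) game"
    and M :: "'w measure" and T :: real
    and W1 :: "real \<Rightarrow> 'w \<Rightarrow> real^'m1" and W2 :: "real \<Rightarrow> 'w \<Rightarrow> real^'m2"
    and x1 :: "real^'n1" and x2 :: "real^'n2" and \<epsilon> :: real
    and P11 :: "real \<Rightarrow> real^'n1^'n1" and P12 :: "real \<Rightarrow> real^'n2^'n1" and P22 :: "real \<Rightarrow> real^'n2^'n2" +
  assumes T_pos: "T > 0"
    and brownian: "brownian_motion M T W1" "brownian_motion M T W2"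
    and indep: "independent_processes M T W1 W2"
    and \<epsilon>_pos: "\<epsilon> > 0"
    and full: "full_solution G T \<epsilon> (P11, P12, P22)"
begin

abbreviation "f t \<equiv> ric_f G (P11 t) (P12 t) (P22 t) \<epsilon>"
abbreviation "g1 t \<equiv> ric_g1 G (P11 t) (P12 t) (P22 t) \<epsilon>"
abbreviation "g2 t \<equiv> ric_g2 G (P11 t) (P12 t) (P22 t) \<epsilon>"

definition K1 :: "real \<Rightarrow> (real^'n1) \<times> (real^'n2) \<Rightarrow> real^'k1" where
  "K1 t x = (transpose (B11 G) ** P11 t + transpose (B21 G) ** transpose (P12 t)) *v fst x
     + (\<epsilon> *\<^sub>R (transpose (B11 G) ** P12 t) + transpose (B21 G) ** P22 t) *v snd x"

definition K2 :: "real \<Rightarrow> (real^'n1) \<times> (real^'n2) \<Rightarrow> real^'k2" where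
  "K2 t x = - ((transpose (B12 G) ** P11 t + transpose (B22 G) ** transpose (P12 t)) *v fst x)
     - (\<epsilon> *\<^sub>R (transpose (B12 G) ** P12 t) + transpose (B22 G) ** P22 t) *v snd x"

definition F where "F t x = drift G \<epsilon> x (K1 t x) (K2 t x)"

text \<open>The symmetric block matrix with blocks \<open>P11\<close>, \<epsilon> \<open>P12\<close>
  and \<epsilon> \<open>P22\<close>. The weights compensate for the factor 1 / \<epsilon> of the
  fast state equation; in the derivative \<open>H'\<close> they cancel against the same factor in
  the full Riccati system.\<close>

definition H :: "real \<Rightarrow> (real^'n1) \<times> (real^'n2) \<Rightarrow> (real^'n1) \<times> (real^'n2)" where
  "H t x = (P11 t *v fst x + \<epsilon> *\<^sub>R (P12 t *v snd x), \<epsilon> *\<^sub>R (transpose (P12 t) *v fst x + P22 t *v snd x))"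

definition H' :: "real \<Rightarrow> (real^'n1) \<times> (real^'n2) \<Rightarrow> (real^'n1) \<times> (real^'n2)" where
  "H' t x = (- (f t *v fst x) - g1 t *v snd x, - (transpose (g1 t) *v fst x) - g2 t *v snd x)"

definition k where
  "k t x = (Q1 G *v fst x) \<bullet> fst x + (Q2 G *v snd x) \<bullet> snd x - (norm (K1 t x))\<^sup>2 + (norm (K2 t x))\<^sup>2"

text \<open>A sum type indexes the coordinates of both Brownian motions as one family of scalar
  noises; \<open>v\<close> lists the matching columns of the joint diffusion matrix, with the
  scaling 1 / sqrt \<epsilon> of the fast ones.\<close>

definition \<beta> :: "'m1 + 'm2 \<Rightarrow> real \<Rightarrow> 'w \<Rightarrow> real" where
  "\<beta> j t \<omega> = (case j of Inl i \<Rightarrow> W1 t \<omega> $ i | Inr i \<Rightarrow> W2 t \<omega> $ i)"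

definition v :: "'m1 + 'm2 \<Rightarrow> (real^'n1) \<times> (real^'n2)" where
  "v j = (case j of Inl i \<Rightarrow> (column i (sigma1 G), 0) | Inr i \<Rightarrow> (0, (1 / sqrt \<epsilon>) *\<^sub>R column i (sigma2 G)))"

lemma P_sym: "t \<in> {0..T} \<Longrightarrow> transpose (P11 t) = P11 t" "t \<in> {0..T} \<Longrightarrow> transpose (P22 t) = P22 t"
  using full by (auto simp: full_solution_def sym_mats_def)

lemma P_final: "P11 T = 0" "P12 T = 0" "P22 T = 0"
  using full by (auto simp: full_solution_def)

lemma P_deriv:
  assumes t: "t \<in> {0..T}"
  shows "(P11 has_vector_derivative - f t) (at t within {0..T})"
    "(P12 has_vector_derivative - (1 / \<epsilon>) *\<^sub>R g1 t) (at t within {0..T})"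
    "(P22 has_vector_derivative - (1 / \<epsilon>) *\<^sub>R g2 t) (at t within {0..T})"
proof -
  obtain D11 D12 D22 where D: "(P11 has_vector_derivative D11) (at t within {0..T})"
      "(P12 has_vector_derivative D12) (at t within {0..T})"
      "(P22 has_vector_derivative D22) (at t within {0..T})"
      and eqs: "D11 + f t = 0" "\<epsilon> *\<^sub>R D12 + g1 t = 0" "\<epsilon> *\<^sub>R D22 + g2 t = 0"
    using full t unfolding full_solution_def by blast
  have "D11 = - f t" using eqs(1) by (simp only: eq_neg_iff_add_eq_0)
  then show "(P11 has_vector_derivative - f t) (at t within {0..T})" using D(1) by simp
  have solve: "D = - (1 / \<epsilon>) *\<^sub>R g" if "\<epsilon> *\<^sub>R D + g = 0" for D g :: "'z::real_vector"
  proof -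
    have "\<epsilon> *\<^sub>R D = - g" using that by (simp only: eq_neg_iff_add_eq_0)
    then have "(1 / \<epsilon>) *\<^sub>R (\<epsilon> *\<^sub>R D) = (1 / \<epsilon>) *\<^sub>R (- g)" by simp
    then show ?thesis using \<epsilon>_pos by simp
  qed
  show "(P12 has_vector_derivative - (1 / \<epsilon>) *\<^sub>R g1 t) (at t within {0..T})"
    using D(2) unfolding solve[OF eqs(2)] .
  show "(P22 has_vector_derivative - (1 / \<epsilon>) *\<^sub>R g2 t) (at t within {0..T})"
    using D(3) unfolding solve[OF eqs(3)] .
qed

lemma P_cont: "continuous_on {0..T} P11" "continuous_on {0..T} P12" "continuous_on {0..T} P22"
  by (rule has_vector_derivative_continuous_on, erule P_deriv)+

lemma P_cont_fst:
  "continuous_on ({0..T} \<times> UNIV) (\<lambda>z. P11 (fst z))"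
  "continuous_on ({0..T} \<times> UNIV) (\<lambda>z. P12 (fst z))"
  "continuous_on ({0..T} \<times> UNIV) (\<lambda>z. P22 (fst z))"
  by (rule continuous_on_compose2[OF P_cont(1)], auto intro!: continuous_intros,
      rule continuous_on_compose2[OF P_cont(2)], auto intro!: continuous_intros,
      rule continuous_on_compose2[OF P_cont(3)], auto intro!: continuous_intros)

lemma K_cont: "continuous_on ({0..T} \<times> UNIV) (\<lambda>(t, x). K1 t x)" "continuous_on ({0..T} \<times> UNIV) (\<lambda>(t, x). K2 t x)"
  unfolding K1_def K2_def case_prod_beta by (intro continuous_intros P_cont_fst)+

lemma F_cont: "continuous_on ({0..T} \<times> UNIV) (\<lambda>(t, x). F t x)"
  unfolding F_def case_prod_beta using K_cont by (intro continuous_intros) (simp_all add: case_prod_beta)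

lemma H_cont: "continuous_on ({0..T} \<times> UNIV) (\<lambda>(t, x). H t x)"
  unfolding H_def case_prod_beta by (intro continuous_intros P_cont_fst)

lemma H'_cont: "continuous_on ({0..T} \<times> UNIV) (\<lambda>(t, x). H' t x)"
  unfolding H'_def ric_f_def ric_g1_def ric_g2_def case_prod_beta by (intro continuous_intros P_cont_fst)

lemma k_cont: "continuous_on ({0..T} \<times> UNIV) (\<lambda>(t, x). k t x)"
  unfolding k_def case_prod_beta using K_cont by (intro continuous_intros) (simp_all add: case_prod_beta)

lemma K_linear: "linear (K1 t)" "linear (K2 t)"
  by (rule linearI; simp add: K1_def K2_def matrix_vector_linear scaleR_diff_right scaleR_add_right)+

lemma F_linear: "linear (F t)"
  by (rule linearI) (simp_all add: F_def linear_add[OF K_linear(1)] linear_add[OF K_linear(2)]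
      linear_scale[OF K_linear(1)] linear_scale[OF K_linear(2)] drift_add drift_scaleR)

lemma H_linear: "linear (H t)" "linear (H' t)"
  by (rule linearI; simp add: H_def H'_def matrix_vector_linear scaleR_add_right scaleR_diff_right mult.commute)+

sublocale linear_field T F
  by (rule linear_field.intro[OF less_imp_le[OF T_pos] F_linear F_cont])

lemma H_deriv:
  assumes t: "t \<in> {0..T}"
  shows "((\<lambda>t. H t x) has_vector_derivative H' t x) (at t within {0..T})"
proof -
  have mv: "((\<lambda>t. A t *v z) has_vector_derivative A' *v z) (at t within {0..T})"
    if "(A has_vector_derivative A') (at t within {0..T})" for A :: "real \<Rightarrow> real^'c^'d" and A' z
    by (rule bounded_linear.has_vector_derivative[OF bounded_bilinear.bounded_linear_left[OF bounded_bilinear_matrix_vector_mult] that])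
  have sc: "((\<lambda>t. \<epsilon> *\<^sub>R A t) has_vector_derivative \<epsilon> *\<^sub>R A') (at t within {0..T})"
    if "(A has_vector_derivative A') (at t within {0..T})" for A :: "real \<Rightarrow> 'z::real_normed_vector" and A'
    by (rule bounded_linear.has_vector_derivative[OF bounded_linear_scaleR_right that])
  note P12t = bounded_linear.has_vector_derivative[OF bounded_linear_transpose P_deriv(2)[OF t]]
  have "((\<lambda>t. H t x) has_vector_derivative
     (- f t *v fst x + \<epsilon> *\<^sub>R ((- (1 / \<epsilon>) *\<^sub>R g1 t) *v snd x),
      \<epsilon> *\<^sub>R (transpose (- (1 / \<epsilon>) *\<^sub>R g1 t) *v fst x + (- (1 / \<epsilon>) *\<^sub>R g2 t) *v snd x))) (at t within {0..T})"
    unfolding H_def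
    by (intro has_vector_derivative_Pair has_vector_derivative_add sc mv P_deriv[OF t] P12t)
  moreover have "(- f t *v fst x + \<epsilon> *\<^sub>R ((- (1 / \<epsilon>) *\<^sub>R g1 t) *v snd x),
      \<epsilon> *\<^sub>R (transpose (- (1 / \<epsilon>) *\<^sub>R g1 t) *v fst x + (- (1 / \<epsilon>) *\<^sub>R g2 t) *v snd x)) = H' t x"
    using \<epsilon>_pos by (simp add: H'_def matrix_vector_linear transpose_linear_simps scaleR_add_right scaleR_diff_right del: transpose_matrix_vector)
  ultimately show ?thesis by simp
qed

lemma H_symmetric: "t \<in> {0..T} \<Longrightarrow> H t z \<bullet> w = z \<bullet> H t w"
proof -
  assume t: "t \<in> {0..T}"
  note [simp del] = transpose_matrix_vector
  have "(P11 t *v a) \<bullet> b = a \<bullet> (P11 t *v b)" for a b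
    using inner_transpose_mult[of "P11 t" a b] by (simp add: P_sym[OF t])
  moreover have "(P22 t *v a) \<bullet> b = a \<bullet> (P22 t *v b)" for a b
    using inner_transpose_mult[of "P22 t" a b] by (simp add: P_sym[OF t])
  moreover have "(P12 t *v a) \<bullet> b = a \<bullet> (transpose (P12 t) *v b)" for a b
    using inner_transpose_mult[of "transpose (P12 t)" a b] by simp
  ultimately show ?thesis
    by (simp add: H_def inner_prod_def inner_add_left inner_add_right inner_transpose_mult algebra_simps)
qed

text \<open>Along the closed loop, \<open>H t x \<bullet> F t x\<close> contains the control terms
  |K1|^2 - |K2|^2, which equal the quadratic form of the \<open>Delta\<close> matrices in the
  costates. The two cross terms produce them twice and the Riccati expressions remove them once;
  what is left is the control part of the running cost.\<close>

lemma k_identity: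
  assumes t: "t \<in> {0..T}"
  shows "H' t x \<bullet> x + H t (F t x) \<bullet> x + H t x \<bullet> F t x = - k t x"
proof -
  note [simp del] = transpose_matrix_vector
  define y1 where "y1 = P11 t *v fst x + \<epsilon> *\<^sub>R (P12 t *v snd x)"
  define y2 where "y2 = transpose (P12 t) *v fst x + P22 t *v snd x"
  have K1: "K1 t x = transpose (B11 G) *v y1 + transpose (B21 G) *v y2"
    by (simp add: K1_def y1_def y2_def matrix_vector_linear matrix_vector_mul_assoc)
  have K2: "K2 t x = - (transpose (B12 G) *v y1 + transpose (B22 G) *v y2)"
    by (simp add: K2_def y1_def y2_def matrix_vector_linear matrix_vector_mul_assoc)
  have Hx: "H t x = (y1, \<epsilon> *\<^sub>R y2)" by (simp add: H_def y1_def y2_def)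
  have KK1: "K1 t x \<bullet> z = y1 \<bullet> (B11 G *v z) + y2 \<bullet> (B21 G *v z)" for z
    by (simp add: K1 inner_add_left inner_transpose_mult)
  have KK2: "K2 t x \<bullet> z = - (y1 \<bullet> (B12 G *v z) + y2 \<bullet> (B22 G *v z))" for z
    by (simp add: K2 inner_add_left inner_diff_left inner_transpose_mult)
  have HF: "H t x \<bullet> F t x = y1 \<bullet> (A11 G *v fst x + A12 G *v snd x) + y2 \<bullet> (A21 G *v fst x + A22 G *v snd x)
      + (K1 t x \<bullet> K1 t x - K2 t x \<bullet> K2 t x)"
    using \<epsilon>_pos unfolding KK1[of "K1 t x"] KK2[of "K2 t x"]
    by (simp add: Hx F_def drift_def inner_prod_def inner_add_right add_divide_distrib)
  have quad: "K1 t x \<bullet> K1 t x - K2 t x \<bullet> K2 t x = y1 \<bullet> (Delta1 G *v y1) + 2 * (y1 \<bullet> (Delta G *v y2)) + y2 \<bullet> (Delta2 G *v y2)"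
  proof -
    have c: "y2 \<bullet> (B21 G *v (transpose (B11 G) *v y1)) = y1 \<bullet> (B11 G *v (transpose (B21 G) *v y2))"
      "y2 \<bullet> (B22 G *v (transpose (B12 G) *v y1)) = y1 \<bullet> (B12 G *v (transpose (B22 G) *v y2))"
      by (metis inner_transpose_mult inner_commute)+
    show ?thesis
      unfolding KK1[of "K1 t x"] KK2[of "K2 t x"] unfolding K1 K2
      by (simp add: Delta1_def Delta_def Delta2_def matrix_vector_linear matrix_vector_mul_assoc[symmetric]
          inner_add_right inner_diff_right c)
  qed
  have H'x: "H' t x \<bullet> x = - ((f t *v fst x) \<bullet> fst x + 2 * ((g1 t *v snd x) \<bullet> fst x) + (g2 t *v snd x) \<bullet> snd x)"
    by (simp add: H'_def inner_prod_def inner_diff_left inner_transpose_mult inner_commute[of "fst x"])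
  have "H t (F t x) \<bullet> x = H t x \<bullet> F t x" by (simp add: H_symmetric[OF t] inner_commute)
  then show ?thesis
    unfolding H'x riccati_quadratic[OF P_sym(1)[OF t] P_sym(2)[OF t]] y1_def[symmetric] y2_def[symmetric] HF k_def power2_norm_eq_inner
    using quad by simp
qed

text \<open>By \<open>k_identity\<close> the running cost is a combination of \<open>H\<close>,
  \<open>H'\<close> and \<open>F\<close>, and each of these linear families is uniformly bounded on
  the compact time interval.\<close>

lemma k_bound: obtains C where "\<And>t x. t \<in> {0..T} \<Longrightarrow> \<bar>k t x\<bar> \<le> C * (norm x)\<^sup>2"
proof -
  obtain L where L: "L \<ge> 0" "\<And>t x. t \<in> {0..T} \<Longrightarrow> norm (F t x) \<le> L * norm x" using F_bound by metis
  obtain L1 where L1: "L1 \<ge> 0" "\<And>t x. t \<in> {0..T} \<Longrightarrow> norm (H t x) \<le> L1 * norm x"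
    using linear_family_bound[OF H_linear(1) H_cont] by metis
  obtain L2 where L2: "L2 \<ge> 0" "\<And>t x. t \<in> {0..T} \<Longrightarrow> norm (H' t x) \<le> L2 * norm x"
    using linear_family_bound[OF H_linear(2) H'_cont] by metis
  have "\<bar>k t x\<bar> \<le> (L2 + 2 * (L1 * L)) * (norm x)\<^sup>2" if t: "t \<in> {0..T}" for t x
  proof -
    have "H t (F t x) \<bullet> x = H t x \<bullet> F t x" by (simp add: H_symmetric[OF t] inner_commute)
    then have "\<bar>k t x\<bar> = \<bar>H' t x \<bullet> x + 2 * (H t x \<bullet> F t x)\<bar>" using k_identity[OF t, of x] by simp
    also have "\<dots> \<le> norm (H' t x) * norm x + 2 * (norm (H t x) * norm (F t x))"
      using Cauchy_Schwarz_ineq2[of "H' t x" x] Cauchy_Schwarz_ineq2[of "H t x" "F t x"] by linarith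
    also have "\<dots> \<le> (L2 * norm x) * norm x + 2 * ((L1 * norm x) * (L * norm x))"
      using L L1 L2 t by (intro add_mono mult_mono mult_left_mono) auto
    finally show ?thesis by (simp add: power2_eq_square algebra_simps)
  qed
  then show ?thesis using that by blast
qed

lemma noise_sum: "(\<Sum>j\<in>UNIV. \<beta> j t \<omega> *\<^sub>R v j) = (sigma1 G *v W1 t \<omega>, (1 / sqrt \<epsilon>) *\<^sub>R (sigma2 G *v W2 t \<omega>))"
  unfolding UNIV_Plus_UNIV[symmetric]
  by (simp add: sum.Plus \<beta>_def v_def o_def prod_eq_iff fst_sum snd_sum matrix_vector_columns scaleR_sum_right mult.commute
      del: UNIV_Plus_UNIV)

lemma feedback_eq: "feedback1 G \<epsilon> (P11, P12, P22) (X1, X2) t \<omega> = K1 t (X1 t \<omega>, X2 t \<omega>)"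
  "feedback2 G \<epsilon> (P11, P12, P22) (X1, X2) t \<omega> = K2 t (X1 t \<omega>, X2 t \<omega>)"
  by (simp_all add: feedback1_def feedback2_def K1_def K2_def)

lemma linear_sde_of_solution:
  assumes meas: "\<And>t. t \<in> {0..T} \<Longrightarrow> X t \<in> borel_measurable M"
    and cont: "\<And>\<omega>. \<omega> \<in> space M \<Longrightarrow> continuous_on {0..T} (\<lambda>t. X t \<omega>)"
    and eq: "AE \<omega> in M. \<forall>t\<in>{0..T}. X t \<omega> = (x1, x2) + integral {0..t} (\<lambda>s. F s (X s \<omega>))
      + (sigma1 G *v W1 t \<omega>, (1 / sqrt \<epsilon>) *\<^sub>R (sigma2 G *v W2 t \<omega>))"
  shows "linear_sde T F M \<beta> v (x1, x2) X"
proof (unfold_locales, goal_cases)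
  case (1 t j)
  then show ?case
    using W_meas[OF prob_space_axioms T_pos brownian]
    by (cases j) (auto simp: \<beta>_def[abs_def] intro!: measurable_compose[OF _ borel_measurable_vec_nth])
next
  case (2 t j)
  then show ?case using brownian_moments(1)[OF prob_space_axioms brownian(1)] brownian_moments(1)[OF prob_space_axioms brownian(2)]
    by (cases j) (auto simp: \<beta>_def)
next
  case (3 t j)
  then show ?case using brownian_moments(2)[OF prob_space_axioms brownian(1)] brownian_moments(2)[OF prob_space_axioms brownian(2)]
    by (cases j) (auto simp: \<beta>_def[abs_def])
next
  case (4 s t i j)
  note c = brownian_cov[OF prob_space_axioms brownian(1) 4] brownian_cov[OF prob_space_axioms brownian(2) 4]
    independent_cov[OF prob_space_axioms brownian indep 4] independent_cov[OF prob_space_axioms brownian indep 4(2,1)]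
  show ?case using c by (cases i; cases j) (auto simp: \<beta>_def mult.commute)
next
  case (5 t)
  then show ?case by (rule meas)
next
  case (6 \<omega>)
  then show ?case by (rule cont)
next
  case 7
  then show ?case using eq by (simp add: noise_sum)
qed

text \<open>The weight \<epsilon> in the lower block of \<open>H\<close> cancels against the square
  of the noise scaling 1 / sqrt \<epsilon>.\<close>

lemma trace_term:
  "(\<Sum>j\<in>UNIV. H t (v j) \<bullet> v j) = (P11 t ** sigma1 G) \<bullet> sigma1 G + (P22 t ** sigma2 G) \<bullet> sigma2 G"
proof -
  have s: "\<epsilon> * (1 / sqrt \<epsilon>) * (1 / sqrt \<epsilon>) = 1" using \<epsilon>_pos by (simp add: field_simps)
  have "H t (v (Inl i)) \<bullet> v (Inl i) = (P11 t *v column i (sigma1 G)) \<bullet> column i (sigma1 G)" for i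
    by (simp add: H_def v_def inner_prod_def)
  moreover have "H t (v (Inr i)) \<bullet> v (Inr i) = (P22 t *v column i (sigma2 G)) \<bullet> column i (sigma2 G)" for i
  proof -
    have "H t (v (Inr i)) \<bullet> v (Inr i) = (\<epsilon> * (1 / sqrt \<epsilon>) * (1 / sqrt \<epsilon>)) * ((P22 t *v column i (sigma2 G)) \<bullet> column i (sigma2 G))"
      by (simp add: H_def v_def inner_prod_def matrix_vector_linear)
    then show ?thesis unfolding s by simp
  qed
  ultimately show ?thesis
    unfolding UNIV_Plus_UNIV[symmetric] by (simp add: sum.Plus o_def inner_matrix_mult_columns del: UNIV_Plus_UNIV)
qed

end

text \<open>The cost refers to some chosen solution of the state equation for given controls;
  pathwise uniqueness allows the closed-loop state to be substituted for it. In the difference of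
  two solutions the fixed controls and the noise cancel, and a homogeneous linear equation
  remains.\<close>

lemma state_path_unique:
  fixes X Z :: "real \<Rightarrow> (real^'n1) \<times> (real^'n2)"
  assumes c: "continuous_on {0..T} X" "continuous_on {0..T} Z" "continuous_on {0..T} a" "continuous_on {0..T} b"
    and X: "\<And>t. t \<in> {0..T} \<Longrightarrow> X t = x0 + integral {0..t} (\<lambda>s. drift G \<epsilon> (X s) (a s) (b s)) + n t"
    and Z: "\<And>t. t \<in> {0..T} \<Longrightarrow> Z t = x0 + integral {0..t} (\<lambda>s. drift G \<epsilon> (Z s) (a s) (b s)) + n t"
    and t: "t \<in> {0..T}"
  shows "Z t = X t"
proof -
  have A: "bounded_linear (\<lambda>d. drift G \<epsilon> d 0 0)"
    unfolding linear_conv_bounded_linear[symmetric]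
    by (rule linearI) (use drift_add[of G \<epsilon> _ _ 0 0 0 0] drift_scaleR[of G \<epsilon> _ _ 0 0] in auto)
  have "Z t - X t = 0"
  proof (rule linear_integral_equation_zero[OF _ A _ t])
    show "continuous_on {0..T} (\<lambda>t. Z t - X t)" by (intro continuous_intros c)
    fix s assume s: "s \<in> {0..T}"
    have i: "(\<lambda>r. drift G \<epsilon> (Y r) (a r) (b r)) integrable_on {0..s}" if "continuous_on {0..T} Y" for Y
      by (intro integrable_continuous_real continuous_intros) (use s that c in \<open>auto elim: continuous_on_subset\<close>)
    have "integral {0..s} (\<lambda>r. drift G \<epsilon> (Z r - X r) 0 0)
      = integral {0..s} (\<lambda>r. drift G \<epsilon> (Z r) (a r) (b r) - drift G \<epsilon> (X r) (a r) (b r))"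
      by (simp only: drift_diff_controls_eq)
    then show "Z s - X s = integral {0..s} (\<lambda>r. drift G \<epsilon> (Z r - X r) 0 0)"
      using X[OF s] Z[OF s] integral_diff[OF i[OF c(2)] i[OF c(1)]] by simp
  qed
  then show ?thesis by simp
qed

section \<open>Existence and cost of the closed loop\<close>

context closed_loop_game
begin

lemmas space_fil = space_aug[OF prob_space_axioms T_pos brownian]
lemmas fil_meas = aug_meas_imp_meas[OF prob_space_axioms T_pos brownian]

abbreviation "noise t \<omega> \<equiv> (sigma1 G *v W1 t \<omega>, (1 / sqrt \<epsilon>) *\<^sub>R (sigma2 G *v W2 t \<omega>))"

lemma K_path: "continuous_on {0..t} y \<Longrightarrow> t \<le> T \<Longrightarrow> continuous_on {0..t} (\<lambda>s. K1 s (y s))"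
  "continuous_on {0..t} y \<Longrightarrow> t \<le> T \<Longrightarrow> continuous_on {0..t} (\<lambda>s. K2 s (y s))"
proof -
  assume y: "continuous_on {0..t} y" and "t \<le> T"
  then have sub: "{0..t} \<times> UNIV \<subseteq> {0..T} \<times> UNIV" by (intro Sigma_mono) auto
  show "continuous_on {0..t} (\<lambda>s. K1 s (y s))" "continuous_on {0..t} (\<lambda>s. K2 s (y s))"
    by (rule continuous_on_field_comp[OF continuous_on_subset[OF K_cont(1) sub] y],
        rule continuous_on_field_comp[OF continuous_on_subset[OF K_cont(2) sub] y])
qed

lemma feedback_abs: "feedback1 G \<epsilon> (P11, P12, P22) (X1, X2) = (\<lambda>t \<omega>. K1 t (X1 t \<omega>, X2 t \<omega>))"
  "feedback2 G \<epsilon> (P11, P12, P22) (X1, X2) = (\<lambda>t \<omega>. K2 t (X1 t \<omega>, X2 t \<omega>))"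
  by (intro ext feedback_eq)+

lemma is_state_imp:
  assumes st: "is_state G M T W1 W2 \<epsilon> x1 x2 a b (Z1, Z2)"
    and c: "\<forall>\<omega>\<in>space M. continuous_on {0..T} (\<lambda>s. a s \<omega>)" "\<forall>\<omega>\<in>space M. continuous_on {0..T} (\<lambda>s. b s \<omega>)"
  shows "t \<in> {0..T} \<Longrightarrow> Z1 t \<in> borel_measurable M" "t \<in> {0..T} \<Longrightarrow> Z2 t \<in> borel_measurable M"
    "\<omega> \<in> space M \<Longrightarrow> continuous_on {0..T} (\<lambda>t. Z1 t \<omega>)" "\<omega> \<in> space M \<Longrightarrow> continuous_on {0..T} (\<lambda>t. Z2 t \<omega>)"
    "AE \<omega> in M. \<forall>t\<in>{0..T}. (Z1 t \<omega>, Z2 t \<omega>) = (x1, x2) + integral {0..t} (\<lambda>s. drift G \<epsilon> (Z1 s \<omega>, Z2 s \<omega>) (a s \<omega>) (b s \<omega>)) + noise t \<omega>"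
proof -
  show "t \<in> {0..T} \<Longrightarrow> Z1 t \<in> borel_measurable M" "t \<in> {0..T} \<Longrightarrow> Z2 t \<in> borel_measurable M"
    using st by (auto simp: is_state_def intro!: fil_meas)
  have Zc: "\<omega> \<in> space M \<Longrightarrow> continuous_on {0..T} (\<lambda>t. Z1 t \<omega>)" "\<omega> \<in> space M \<Longrightarrow> continuous_on {0..T} (\<lambda>t. Z2 t \<omega>)" for \<omega>
    using st by (auto simp: is_state_def)
  show "\<omega> \<in> space M \<Longrightarrow> continuous_on {0..T} (\<lambda>t. Z1 t \<omega>)" "\<omega> \<in> space M \<Longrightarrow> continuous_on {0..T} (\<lambda>t. Z2 t \<omega>)"
    by (fact Zc)+
  have "AE \<omega> in M. \<forall>t\<in>{0..T}.
        Z1 t \<omega> = x1 + (LINT s:{0..t}|lborel. A11 G *v Z1 s \<omega> + A12 G *v Z2 s \<omega> + B11 G *v a s \<omega> + B12 G *v b s \<omega>)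
          + sigma1 G *v W1 t \<omega> \<and>
        Z2 t \<omega> = x2 + (1 / \<epsilon>) *\<^sub>R (LINT s:{0..t}|lborel. A21 G *v Z1 s \<omega> + A22 G *v Z2 s \<omega> + B21 G *v a s \<omega> + B22 G *v b s \<omega>)
          + (1 / sqrt \<epsilon>) *\<^sub>R (sigma2 G *v W2 t \<omega>)"
    using st unfolding is_state_def by simp
  then show "AE \<omega> in M. \<forall>t\<in>{0..T}. (Z1 t \<omega>, Z2 t \<omega>) = (x1, x2) + integral {0..t} (\<lambda>s. drift G \<epsilon> (Z1 s \<omega>, Z2 s \<omega>) (a s \<omega>) (b s \<omega>)) + noise t \<omega>"
    using AE_space
  proof eventually_elim
    case (elim \<omega>)
    show ?case
    proof
      fix t assume t: "t \<in> {0..T}"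
      then have sub: "{0..t} \<subseteq> {0..T}" and t0: "t \<ge> 0" by auto
      show "(Z1 t \<omega>, Z2 t \<omega>) = (x1, x2) + integral {0..t} (\<lambda>s. drift G \<epsilon> (Z1 s \<omega>, Z2 s \<omega>) (a s \<omega>) (b s \<omega>)) + noise t \<omega>"
        by (rule state_equation_iff[OF t0, THEN iffD1])
          (use elim t c in \<open>auto intro!: continuous_on_subset[OF _ sub] Zc\<close>)
    qed
  qed
qed

lemma closed_loop_sde:
  assumes "closed_loop_state G M T W1 W2 \<epsilon> x1 x2 (P11, P12, P22) (X1, X2)"
  shows "linear_sde T F M \<beta> v (x1, x2) (\<lambda>t \<omega>. (X1 t \<omega>, X2 t \<omega>))"
proof -
  have st: "is_state G M T W1 W2 \<epsilon> x1 x2 (\<lambda>t \<omega>. K1 t (X1 t \<omega>, X2 t \<omega>)) (\<lambda>t \<omega>. K2 t (X1 t \<omega>, X2 t \<omega>)) (X1, X2)"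
    using assms unfolding closed_loop_state_def feedback_abs by blast
  then have c: "\<omega> \<in> space M \<Longrightarrow> continuous_on {0..T} (\<lambda>t. (X1 t \<omega>, X2 t \<omega>))" for \<omega>
    by (auto simp: is_state_def intro!: continuous_on_Pair)
  then have cK: "\<forall>\<omega>\<in>space M. continuous_on {0..T} (\<lambda>t. K1 t (X1 t \<omega>, X2 t \<omega>))"
    "\<forall>\<omega>\<in>space M. continuous_on {0..T} (\<lambda>t. K2 t (X1 t \<omega>, X2 t \<omega>))"
    using K_path by simp_all
  note s = is_state_imp[OF st cK]
  show ?thesis
    by (rule linear_sde_of_solution)
      (use s(5) c in \<open>auto simp: F_def intro!: borel_measurable_Pair s(1,2)\<close>)
qed

lemma closed_loop_exists: obtains X where "closed_loop_state G M T W1 W2 \<epsilon> x1 x2 (P11, P12, P22) X"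
proof -
  obtain V1 :: "real \<Rightarrow> 'w \<Rightarrow> real^'m1" and V2 :: "real \<Rightarrow> 'w \<Rightarrow> real^'m2" where
    V_meas: "\<And>t. t \<in> {0..T} \<Longrightarrow> V1 t \<in> borel_measurable (aug_filtration M W1 W2 t)"
      "\<And>t. t \<in> {0..T} \<Longrightarrow> V2 t \<in> borel_measurable (aug_filtration M W1 W2 t)"
    and V_cont: "\<And>\<omega>. continuous_on {0..T} (\<lambda>t. V1 t \<omega>)" "\<And>\<omega>. continuous_on {0..T} (\<lambda>t. V2 t \<omega>)"
    and V_eq: "AE \<omega> in M. \<forall>t. V1 t \<omega> = W1 t \<omega> \<and> V2 t \<omega> = W2 t \<omega>"
    by (rule continuous_versions[OF prob_space_axioms T_pos brownian]) (rule that; assumption)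
  \<comment> \<open>The equation is solved with the everywhere continuous versions, which agree with
    the Brownian motions outside a null set.\<close>
  define Nz where "Nz t \<omega> = (sigma1 G *v V1 t \<omega>, (1 / sqrt \<epsilon>) *\<^sub>R (sigma2 G *v V2 t \<omega>))" for t \<omega>
  have mv: "(\<lambda>\<omega>. A *v V \<omega>) \<in> borel_measurable N" if "V \<in> borel_measurable N" for A :: "real^'c^'d" and V and N :: "'w measure"
    by (rule borel_measurable_continuous_onI[THEN measurable_compose[OF that]]) (intro continuous_intros)
  obtain X where X_meas: "\<And>t. t \<in> {0..T} \<Longrightarrow> X t \<in> borel_measurable (aug_filtration M W1 W2 t)"
    and X_cont: "\<And>\<omega>. \<omega> \<in> space M \<Longrightarrow> continuous_on {0..T} (\<lambda>t. X t \<omega>)"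
    and X_eq: "\<And>\<omega> t. \<omega> \<in> space M \<Longrightarrow> t \<in> {0..T} \<Longrightarrow> X t \<omega> = (x1, x2) + integral {0..t} (\<lambda>s. F s (X s \<omega>)) + Nz t \<omega>"
  proof (rule adapted_solution_exists[of "aug_filtration M W1 W2" "space M" Nz "(x1, x2)"])
    fix t assume t: "t \<in> {0..T}"
    show "Nz t \<in> borel_measurable (aug_filtration M W1 W2 t)"
      unfolding Nz_def[abs_def] by (intro borel_measurable_Pair borel_measurable_scaleR borel_measurable_const mv V_meas t)
  next
    fix \<omega> show "continuous_on {0..T} (\<lambda>t. Nz t \<omega>)" unfolding Nz_def by (intro continuous_intros V_cont)
  next
    fix s t :: real assume "s \<le> t"
    then show "sets (aug_filtration M W1 W2 s) \<subseteq> sets (aug_filtration M W1 W2 t)"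
      by (rule sets_aug_mono[OF prob_space_axioms T_pos brownian])
  qed (rule space_fil, (rule that; assumption))
  have AE_eq: "AE \<omega> in M. \<forall>t\<in>{0..T}. X t \<omega> = (x1, x2) + integral {0..t} (\<lambda>s. F s (X s \<omega>)) + noise t \<omega>"
    using V_eq AE_space by eventually_elim (auto simp: X_eq Nz_def)
  have X_measM: "X t \<in> borel_measurable M" if "t \<in> {0..T}" for t
    by (rule fil_meas[OF _ X_meas[OF that]]) (use that in auto)
  interpret sde: linear_sde T F M \<beta> v "(x1, x2)" X
    by (rule linear_sde_of_solution[OF X_measM X_cont AE_eq])
  obtain C where C: "C \<ge> 0" and X_sq: "\<And>t. t \<in> {0..T} \<Longrightarrow> integrable M (\<lambda>\<omega>. (norm (X t \<omega>))\<^sup>2)"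
      "\<And>t. t \<in> {0..T} \<Longrightarrow> expectation (\<lambda>\<omega>. (norm (X t \<omega>))\<^sup>2) \<le> C"
    using sde.second_moment by blast
  \<comment> \<open>Both feedbacks are linear in the state with uniformly bounded coefficients, so
    square integrability and adaptedness pass from the state to the controls.\<close>
  have adm: "admissible M T W1 W2 (\<lambda>t \<omega>. L t (X t \<omega>))"
    if lin: "\<And>t. linear (L t)" and cont: "continuous_on ({0..T} \<times> UNIV) (\<lambda>(t, x). L t x)"
    for L :: "real \<Rightarrow> (real^'n1) \<times> (real^'n2) \<Rightarrow> real^'c"
  proof -
    obtain l where l: "l \<ge> 0" "\<And>t x. t \<in> {0..T} \<Longrightarrow> norm (L t x) \<le> l * norm x"
      using linear_family_bound[OF lin cont] by blast
    have L_meas: "(\<lambda>\<omega>. L t (Y \<omega>)) \<in> borel_measurable N" if "Y \<in> borel_measurable N" for Y t and N :: "'w measure"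
      by (rule borel_measurable_continuous_onI[THEN measurable_compose[OF that]])
        (rule linear_continuous_on, rule lin[unfolded linear_conv_bounded_linear])
    have sq: "(norm (L t (X t \<omega>)))\<^sup>2 \<le> l\<^sup>2 * (norm (X t \<omega>))\<^sup>2" if "t \<in> {0..T}" for t \<omega>
      using power_mono[OF l(2)[OF that, of "X t \<omega>"] norm_ge_zero, of 2] by (simp add: power_mult_distrib)
    have int: "integrable M (\<lambda>\<omega>. (norm (L t (X t \<omega>)))\<^sup>2)" if t: "t \<in> {0..T}" for t
    proof (rule Bochner_Integration.integrable_bound[OF integrable_mult_right[OF X_sq(1)[OF t], of "l\<^sup>2"]])
      show "(\<lambda>\<omega>. (norm (L t (X t \<omega>)))\<^sup>2) \<in> borel_measurable M" using L_meas[OF X_measM[OF t], of t] by measurable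
    qed (use sq[OF t] in auto)
    show ?thesis
    proof (rule admissible_continuous_adapted[OF prob_space_axioms T_pos brownian, where C = "l\<^sup>2 * C"])
      fix t assume t: "t \<in> {0..T}"
      show "(\<lambda>\<omega>. L t (X t \<omega>)) \<in> borel_measurable (aug_filtration M W1 W2 t)" by (rule L_meas[OF X_meas[OF t]])
      show "integrable M (\<lambda>\<omega>. (norm (L t (X t \<omega>)))\<^sup>2)" by (rule int[OF t])
      have "expectation (\<lambda>\<omega>. (norm (L t (X t \<omega>)))\<^sup>2) \<le> expectation (\<lambda>\<omega>. l\<^sup>2 * (norm (X t \<omega>))\<^sup>2)"
        by (rule integral_mono[OF int[OF t] integrable_mult_right[OF X_sq(1)[OF t]] sq[OF t]])
      also have "\<dots> \<le> l\<^sup>2 * C" using X_sq(2)[OF t] by (simp add: mult_left_mono)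
      finally show "expectation (\<lambda>\<omega>. (norm (L t (X t \<omega>)))\<^sup>2) \<le> l\<^sup>2 * C" .
    next
      fix \<omega> assume \<omega>: "\<omega> \<in> space M"
      show "continuous_on {0..T} (\<lambda>t. L t (X t \<omega>))"
        by (rule continuous_on_field_comp[OF cont X_cont[OF \<omega>]])
    qed
  qed
  define X1 where "X1 t \<omega> = fst (X t \<omega>)" for t \<omega>
  define X2 where "X2 t \<omega> = snd (X t \<omega>)" for t \<omega>
  have XX: "(X1 t \<omega>, X2 t \<omega>) = X t \<omega>" for t \<omega> by (simp add: X1_def X2_def)
  have Xc: "continuous_on {0..T} (\<lambda>t. X1 t \<omega>)" "continuous_on {0..T} (\<lambda>t. X2 t \<omega>)" if "\<omega> \<in> space M" for \<omega>
    unfolding X1_def X2_def by (intro continuous_intros X_cont that)+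
  have "is_state G M T W1 W2 \<epsilon> x1 x2 (\<lambda>t \<omega>. K1 t (X t \<omega>)) (\<lambda>t \<omega>. K2 t (X t \<omega>)) (X1, X2)"
    unfolding is_state_def prod.case
  proof (intro conjI ballI)
    fix t assume t: "t \<in> {0..T}"
    have f: "fst \<in> borel_measurable borel" "snd \<in> borel_measurable borel"
      by (intro borel_measurable_continuous_onI continuous_intros)+
    show "X1 t \<in> borel_measurable (aug_filtration M W1 W2 t)" "X2 t \<in> borel_measurable (aug_filtration M W1 W2 t)"
      unfolding X1_def[abs_def] X2_def[abs_def]
      by (rule measurable_compose[OF X_meas[OF t] f(1)], rule measurable_compose[OF X_meas[OF t] f(2)])
  next
    fix \<omega> assume "\<omega> \<in> space M"
    then show "continuous_on {0..T} (\<lambda>t. X1 t \<omega>)" "continuous_on {0..T} (\<lambda>t. X2 t \<omega>)" by (rule Xc)+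
  next
    show "AE \<omega> in M. \<forall>t\<in>{0..T}.
        X1 t \<omega> = x1 + (LINT s:{0..t}|lborel. A11 G *v X1 s \<omega> + A12 G *v X2 s \<omega> + B11 G *v K1 s (X s \<omega>) + B12 G *v K2 s (X s \<omega>))
          + sigma1 G *v W1 t \<omega> \<and>
        X2 t \<omega> = x2 + (1 / \<epsilon>) *\<^sub>R (LINT s:{0..t}|lborel. A21 G *v X1 s \<omega> + A22 G *v X2 s \<omega> + B21 G *v K1 s (X s \<omega>) + B22 G *v K2 s (X s \<omega>))
          + (1 / sqrt \<epsilon>) *\<^sub>R (sigma2 G *v W2 t \<omega>)"
      using AE_eq AE_space
    proof eventually_elim
      case (elim \<omega>)
      show ?case
      proof
        fix t assume t: "t \<in> {0..T}"
        then have sub: "{0..t} \<subseteq> {0..T}" and t0: "t \<ge> 0" and tT: "t \<le> T" by auto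
        have Xt: "continuous_on {0..t} (\<lambda>s. X s \<omega>)" by (rule continuous_on_subset[OF X_cont[OF elim(2)] sub])
        have "(X1 t \<omega>, X2 t \<omega>) = (x1, x2) + integral {0..t} (\<lambda>s. drift G \<epsilon> (X1 s \<omega>, X2 s \<omega>) (K1 s (X s \<omega>)) (K2 s (X s \<omega>))) + noise t \<omega>"
          using elim(1) t unfolding XX F_def by blast
        from state_equation_iff[OF t0 continuous_on_subset[OF Xc(1)[OF elim(2)] sub] continuous_on_subset[OF Xc(2)[OF elim(2)] sub]
            K_path(1)[OF Xt tT] K_path(2)[OF Xt tT], THEN iffD2, OF this]
        show "X1 t \<omega> = x1 + (LINT s:{0..t}|lborel. A11 G *v X1 s \<omega> + A12 G *v X2 s \<omega> + B11 G *v K1 s (X s \<omega>) + B12 G *v K2 s (X s \<omega>))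
          + sigma1 G *v W1 t \<omega> \<and>
        X2 t \<omega> = x2 + (1 / \<epsilon>) *\<^sub>R (LINT s:{0..t}|lborel. A21 G *v X1 s \<omega> + A22 G *v X2 s \<omega> + B21 G *v K1 s (X s \<omega>) + B22 G *v K2 s (X s \<omega>))
          + (1 / sqrt \<epsilon>) *\<^sub>R (sigma2 G *v W2 t \<omega>)" .
      qed
    qed
  qed
  then have "closed_loop_state G M T W1 W2 \<epsilon> x1 x2 (P11, P12, P22) (X1, X2)"
    unfolding closed_loop_state_def feedback_abs XX
    using adm[OF K_linear(1) K_cont(1)] adm[OF K_linear(2) K_cont(2)] by blast
  then show ?thesis by (rule that)
qed

text \<open>\<open>cost_J\<close> evaluates a chosen state \<open>(Z1, Z2)\<close> driven by the
  feedback processes. It is indistinguishable from the closed-loop state, so the integrand becomes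
  the quadratic function \<open>k\<close> of that state, and the adjoint identity applies.\<close>

lemma closed_loop_cost:
  assumes "closed_loop_state G M T W1 W2 \<epsilon> x1 x2 (P11, P12, P22) X"
  shows "cost_J G M T W1 W2 \<epsilon> x1 x2 (feedback1 G \<epsilon> (P11, P12, P22) X) (feedback2 G \<epsilon> (P11, P12, P22) X)
    = 1/2 * (H 0 (x1, x2) \<bullet> (x1, x2)
       + integral {0..T} (\<lambda>t. (P11 t ** sigma1 G) \<bullet> sigma1 G + (P22 t ** sigma2 G) \<bullet> sigma2 G))"
proof -
  obtain X1 X2 where X: "X = (X1, X2)" by (cases X)
  note cl = assms[unfolded X]
  define x where "x t \<omega> = (X1 t \<omega>, X2 t \<omega>)" for t \<omega>
  define a where "a t \<omega> = K1 t (x t \<omega>)" for t \<omega>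
  define b where "b t \<omega> = K2 t (x t \<omega>)" for t \<omega>
  have fb: "feedback1 G \<epsilon> (P11, P12, P22) (X1, X2) = a" "feedback2 G \<epsilon> (P11, P12, P22) (X1, X2) = b"
    by (simp_all add: feedback_abs a_def[abs_def] b_def[abs_def] x_def)
  have st: "is_state G M T W1 W2 \<epsilon> x1 x2 a b (X1, X2)"
    using cl unfolding closed_loop_state_def fb by blast
  then have xc: "\<omega> \<in> space M \<Longrightarrow> continuous_on {0..T} (\<lambda>t. x t \<omega>)" for \<omega>
    by (auto simp: is_state_def x_def intro!: continuous_on_Pair)
  have ac: "\<omega> \<in> space M \<Longrightarrow> continuous_on {0..T} (\<lambda>t. a t \<omega>)" and bc: "\<omega> \<in> space M \<Longrightarrow> continuous_on {0..T} (\<lambda>t. b t \<omega>)" for \<omega>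
    unfolding a_def b_def by (intro K_path xc order.refl; assumption)+
  obtain Z1 Z2 where Z: "state_process G M T W1 W2 \<epsilon> x1 x2 a b = (Z1, Z2)" by fastforce
  have stZ: "is_state G M T W1 W2 \<epsilon> x1 x2 a b (Z1, Z2)"
    unfolding Z[symmetric] state_process_def by (rule someI[of "is_state G M T W1 W2 \<epsilon> x1 x2 a b", OF st])
  have abc: "\<forall>\<omega>\<in>space M. continuous_on {0..T} (\<lambda>t. a t \<omega>)" "\<forall>\<omega>\<in>space M. continuous_on {0..T} (\<lambda>t. b t \<omega>)"
    using ac bc by auto
  note sX = is_state_imp[OF st abc] and sZ = is_state_imp[OF stZ abc]
  interpret sde: linear_sde T F M \<beta> v "(x1, x2)" x
    unfolding x_def[abs_def] by (rule closed_loop_sde[OF cl])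
  have x_meas: "t \<in> {0..T} \<Longrightarrow> x t \<in> borel_measurable M" for t by (rule sde.X_meas)
  have TT: "T \<in> {0..T}" using T_pos by simp
  define c where "c t \<omega> = (Q1 G *v Z1 t \<omega>) \<bullet> Z1 t \<omega> + (Q2 G *v Z2 t \<omega>) \<bullet> Z2 t \<omega> - (norm (a t \<omega>))\<^sup>2 + (norm (b t \<omega>))\<^sup>2" for t \<omega>
  have mv: "(\<lambda>\<omega>. A *v V \<omega>) \<in> borel_measurable N" if "V \<in> borel_measurable N" for A :: "real^'c^'d" and V and N :: "'w measure"
    by (rule borel_measurable_continuous_onI[THEN measurable_compose[OF that]]) (intro continuous_intros)
  have Lm: "(\<lambda>\<omega>. L (Y \<omega>)) \<in> borel_measurable M" if "Y \<in> borel_measurable M" "linear L" for Y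
    and L :: "(real^'n1) \<times> (real^'n2) \<Rightarrow> real^'c"
    by (rule borel_measurable_continuous_onI[THEN measurable_compose[OF that(1)]])
      (rule linear_continuous_on, rule that(2)[unfolded linear_conv_bounded_linear])
  have ab_meas: "a t \<in> borel_measurable M" "b t \<in> borel_measurable M" if t: "t \<in> {0..T}" for t
    unfolding a_def[abs_def] b_def[abs_def] using Lm[OF x_meas[OF t] K_linear(1)] Lm[OF x_meas[OF t] K_linear(2)] by auto
  have c_path: "\<omega> \<in> space M \<Longrightarrow> continuous_on {0..T} (\<lambda>t. c t \<omega>)" for \<omega>
    unfolding c_def by (intro continuous_intros sZ ac bc; assumption)
  have pc: "cont_process M T c"
  proof
    fix s assume s: "s \<in> {0..T}"
    show "c s \<in> borel_measurable M"
      unfolding c_def[abs_def] using mv[OF sZ(1)[OF s], of "Q1 G"] mv[OF sZ(2)[OF s], of "Q2 G"] sZ(1,2)[OF s] ab_meas[OF s]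
      by measurable
  next
    fix \<omega> assume "\<omega> \<in> space M" then show "continuous_on {0..T} (\<lambda>s. c s \<omega>)" by (rule c_path)
  qed (use T_pos in simp)
  have kx: "k t (x t \<omega>) = (Q1 G *v X1 t \<omega>) \<bullet> X1 t \<omega> + (Q2 G *v X2 t \<omega>) \<bullet> X2 t \<omega> - (norm (a t \<omega>))\<^sup>2 + (norm (b t \<omega>))\<^sup>2" for t \<omega>
    by (simp add: k_def a_def b_def x_def)
  have pk: "cont_process M T (\<lambda>t \<omega>. k t (x t \<omega>))"
  proof
    fix s assume s: "s \<in> {0..T}"
    show "(\<lambda>\<omega>. k s (x s \<omega>)) \<in> borel_measurable M"
      unfolding kx using mv[OF sX(1)[OF s], of "Q1 G"] mv[OF sX(2)[OF s], of "Q2 G"] sX(1,2)[OF s] ab_meas[OF s]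
      by measurable
  next
    fix \<omega> assume "\<omega> \<in> space M" then show "continuous_on {0..T} (\<lambda>s. k s (x s \<omega>))"
      unfolding kx by (intro continuous_intros sX ac bc; assumption)
  qed (use T_pos in simp)
  have "AE \<omega> in M. \<forall>t\<in>{0..T}. (Z1 t \<omega>, Z2 t \<omega>) = (X1 t \<omega>, X2 t \<omega>)"
    using sX(5) sZ(5) AE_space
  proof eventually_elim
    case (elim \<omega>)
    have cp: "continuous_on {0..T} (\<lambda>t. (X1 t \<omega>, X2 t \<omega>))" "continuous_on {0..T} (\<lambda>t. (Z1 t \<omega>, Z2 t \<omega>))"
      by (intro continuous_intros sX(3,4) sZ(3,4) elim(3))+
    show ?case
    proof
      fix t assume t: "t \<in> {0..T}"
      show "(Z1 t \<omega>, Z2 t \<omega>) = (X1 t \<omega>, X2 t \<omega>)"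
        by (rule state_path_unique[OF cp ac[OF elim(3)] bc[OF elim(3)] bspec[OF elim(1)] bspec[OF elim(2)] t])
    qed
  qed
  then have AEq: "AE \<omega> in M. integral {0..T} (\<lambda>t. c t \<omega>) = integral {0..T} (\<lambda>t. k t (x t \<omega>))"
    by eventually_elim (auto simp: c_def kx intro!: Henstock_Kurzweil_Integration.integral_cong)
  have H_T: "H T y = 0" for y by (simp add: H_def P_final zero_prod_def)
  obtain Ck where Ck: "\<And>t x. t \<in> {0..T} \<Longrightarrow> \<bar>k t x\<bar> \<le> Ck * (norm x)\<^sup>2" using k_bound by blast
  have "cost_J G M T W1 W2 \<epsilon> x1 x2 a b = 1/2 * (LINT \<omega>|M. (LINT t:{0..T}|lborel. c t \<omega>))"
    unfolding cost_J_def Z c_def by simp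
  also have "(LINT \<omega>|M. (LINT t:{0..T}|lborel. c t \<omega>)) = expectation (\<lambda>\<omega>. integral {0..T} (\<lambda>t. c t \<omega>))"
    by (intro Bochner_Integration.integral_cong refl set_borel_integral_eq_integral(2) borel_integrable_atLeastAtMost' c_path)
  also have "\<dots> = expectation (\<lambda>\<omega>. integral {0..T} (\<lambda>t. k t (x t \<omega>)))"
    by (rule integral_cong_AE[OF cont_process.measurable_integral[OF pc TT] cont_process.measurable_integral[OF pk TT] AEq])
  also have "\<dots> = H 0 (x1, x2) \<bullet> (x1, x2) + integral {0..T} (\<lambda>t. \<Sum>j\<in>UNIV. H t (v j) \<bullet> v j)"
    by (rule sde.value_identity[OF H_linear(1) H_linear(2) H_deriv H_T k_identity k_cont Ck])
  finally show ?thesis unfolding X fb trace_term .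
qed

end

section \<open>Distance of the cost to its limit\<close>

lemma matrix_quadratic_bound: "\<bar>(A *v x) \<bullet> y\<bar> \<le> norm A * norm x * norm y" for A :: "real^'n^'m"
  by (rule order.trans[OF Cauchy_Schwarz_ineq2 mult_right_mono[OF norm_matrix_vector_mult_le norm_ge_zero]])

lemma matrix_inner_mult_bound: "\<bar>(A ** B) \<bullet> B\<bar> \<le> norm A * (norm B)\<^sup>2" for A :: "real^'n^'n" and B :: "real^'m^'n"
  using order.trans[OF Cauchy_Schwarz_ineq2 mult_right_mono[OF norm_matrix_mult_le[of A B] norm_ge_zero[of B]]]
  by (simp add: power2_eq_square mult.assoc)

lemma integral_exp_layer:
  fixes T \<epsilon> b :: real
  assumes "T \<ge> 0" "\<epsilon> > 0" "b > 0"
  shows "integral {0..T} (\<lambda>t. exp (- b * ((T - t) / \<epsilon>))) \<le> \<epsilon> / b"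
proof -
  have "((\<lambda>t. exp (- b * ((T - t) / \<epsilon>))) has_integral
      (\<epsilon> / b * exp (- b * ((T - T) / \<epsilon>)) - \<epsilon> / b * exp (- b * ((T - 0) / \<epsilon>)))) {0..T}"
  proof (rule fundamental_theorem_of_calculus[OF assms(1)])
    fix t
    have "((\<lambda>t. \<epsilon> / b * exp (- b * ((T - t) / \<epsilon>))) has_real_derivative exp (- b * ((T - t) / \<epsilon>))) (at t within {0..T})"
      using assms by (auto intro!: derivative_eq_intros)
    then show "((\<lambda>t. \<epsilon> / b * exp (- b * ((T - t) / \<epsilon>))) has_vector_derivative exp (- b * ((T - t) / \<epsilon>))) (at t within {0..T})"
      by (simp add: has_real_derivative_iff_has_vector_derivative)
  qed
  from integral_unique[OF this] show ?thesis using assms by simp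
qed

text \<open>In the quadratic form at time 0 the blocks \<open>P12\<close> and \<open>P22\<close>
  carry a factor \<epsilon>, so mere boundedness by \<open>B\<close> suffices there, although
  \<open>P22\<close> may be far from \<open>R\<close> pointwise near \<open>T\<close>. In the trace
  term closeness of \<open>P22\<close> is required only after integration in time.\<close>

lemma (in closed_loop_game) closed_loop_cost_near:
  assumes cl: "closed_loop_state G M T W1 W2 \<epsilon> x1 x2 (P11, P12, P22) X"
    and p: "continuous_on {0..T} p"
    and P11: "\<And>t. t \<in> {0..T} \<Longrightarrow> norm (P11 t - p t) \<le> K * \<epsilon>"
    and P22: "\<And>t. t \<in> {0..T} \<Longrightarrow> norm (P22 t - R) \<le> K * \<epsilon> + Kh * exp (- b * ((T - t) / \<epsilon>))"
    and B: "norm (P12 0) \<le> B" "norm (P22 0) \<le> B"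
    and b: "b > 0" and Kh: "Kh \<ge> 0"
  shows "\<bar>cost_J G M T W1 W2 \<epsilon> x1 x2 (feedback1 G \<epsilon> (P11, P12, P22) X) (feedback2 G \<epsilon> (P11, P12, P22) X)
      - V_bar G T p R x1 x2\<bar>
    \<le> (K * (norm x1)\<^sup>2 + 2 * (B * norm x2 * norm x1) + B * (norm x2)\<^sup>2
        + K * T * (norm (sigma1 G))\<^sup>2 + (K * T + Kh / b) * (norm (sigma2 G))\<^sup>2) * \<epsilon>"
proof -
  define s1 where "s1 = (norm (sigma1 G))\<^sup>2"
  define s2 where "s2 = (norm (sigma2 G))\<^sup>2"
  have s: "s1 \<ge> 0" "s2 \<ge> 0" by (simp_all add: s1_def s2_def)
  define e where "e t = ((P11 t - p t) ** sigma1 G) \<bullet> sigma1 G + ((P22 t - R) ** sigma2 G) \<bullet> sigma2 G" for t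
  define E where "E t = exp (- b * ((T - t) / \<epsilon>))" for t
  define bd where "bd t = (K * \<epsilon>) * s1 + (K * \<epsilon> + Kh * E t) * s2" for t
  have c: "continuous_on {0..T} (\<lambda>t. (P11 t ** sigma1 G) \<bullet> sigma1 G + (P22 t ** sigma2 G) \<bullet> sigma2 G)"
    "continuous_on {0..T} (\<lambda>t. (p t ** sigma1 G) \<bullet> sigma1 G)" "continuous_on {0..T} e" "continuous_on {0..T} E"
    "continuous_on {0..T} bd"
    unfolding e_def bd_def E_def using \<epsilon>_pos by (auto intro!: continuous_intros P_cont p)
  note i = c[THEN integrable_continuous_real]
  have e_le: "norm (integral {0..T} e) \<le> integral {0..T} bd"
  proof (rule integral_norm_bound_integral[OF i(3,5)])
    fix t assume t: "t \<in> {0..T}"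
    have "\<bar>((P11 t - p t) ** sigma1 G) \<bullet> sigma1 G\<bar> \<le> (K * \<epsilon>) * s1"
      unfolding s1_def by (rule order.trans[OF matrix_inner_mult_bound mult_right_mono[OF P11[OF t]]]) simp
    moreover have "\<bar>((P22 t - R) ** sigma2 G) \<bullet> sigma2 G\<bar> \<le> (K * \<epsilon> + Kh * E t) * s2"
      unfolding s2_def E_def by (rule order.trans[OF matrix_inner_mult_bound mult_right_mono[OF P22[OF t]]]) simp
    ultimately show "norm (e t) \<le> bd t" unfolding e_def bd_def real_norm_def by linarith
  qed
  have "integral {0..T} bd = integral {0..T} (\<lambda>t. (K * \<epsilon> * s1 + K * \<epsilon> * s2) + (Kh * s2) * E t)"
    by (simp add: bd_def[abs_def] algebra_simps)
  also have "\<dots> = T * (K * \<epsilon> * s1 + K * \<epsilon> * s2) + (Kh * s2) * integral {0..T} E"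
    using i(4) T_pos by (subst integral_add) (auto intro!: integrable_continuous_real continuous_intros c(4))
  also have "\<dots> \<le> T * (K * \<epsilon> * s1 + K * \<epsilon> * s2) + (Kh * s2) * (\<epsilon> / b)"
    using integral_exp_layer[of T \<epsilon> b] T_pos \<epsilon>_pos b Kh s by (intro add_left_mono mult_left_mono) (auto simp: E_def[abs_def])
  finally have bd_le: "integral {0..T} bd \<le> (K * T * s1 + (K * T + Kh / b) * s2) * \<epsilon>" by (simp add: algebra_simps)
  have q: "\<bar>((P11 0 - p 0) *v x1) \<bullet> x1\<bar> \<le> (K * \<epsilon>) * (norm x1)\<^sup>2"
    using order.trans[OF matrix_quadratic_bound[of "P11 0 - p 0" x1 x1]
        mult_right_mono[OF mult_right_mono[OF P11[of 0] norm_ge_zero[of x1]] norm_ge_zero[of x1]]] T_pos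
    by (simp add: power2_eq_square mult.assoc)
  have q12: "\<bar>(P12 0 *v x2) \<bullet> x1\<bar> \<le> B * norm x2 * norm x1"
    by (rule order.trans[OF matrix_quadratic_bound]) (intro mult_right_mono B norm_ge_zero)
  have q22: "\<bar>(P22 0 *v x2) \<bullet> x2\<bar> \<le> B * (norm x2)\<^sup>2"
    using order.trans[OF matrix_quadratic_bound[of "P22 0" x2 x2] mult_right_mono[OF mult_right_mono[OF B(2)]]]
    by (simp add: power2_eq_square mult.assoc)
  have H0: "H 0 (x1, x2) \<bullet> (x1, x2) - (p 0 *v x1) \<bullet> x1
      = ((P11 0 - p 0) *v x1) \<bullet> x1 + \<epsilon> * (2 * ((P12 0 *v x2) \<bullet> x1) + (P22 0 *v x2) \<bullet> x2)"
    by (simp add: H_def inner_prod_def matrix_vector_linear inner_add_left inner_diff_left inner_transpose_mult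
        inner_commute[of x1] algebra_simps del: transpose_matrix_vector)
  have "\<bar>\<epsilon> * (2 * ((P12 0 *v x2) \<bullet> x1) + (P22 0 *v x2) \<bullet> x2)\<bar>
      \<le> \<epsilon> * (2 * (B * norm x2 * norm x1) + B * (norm x2)\<^sup>2)"
    using q12 q22 \<epsilon>_pos by (auto simp: abs_mult intro!: mult_left_mono)
  then have "\<bar>H 0 (x1, x2) \<bullet> (x1, x2) - (p 0 *v x1) \<bullet> x1\<bar>
      \<le> (K * \<epsilon>) * (norm x1)\<^sup>2 + \<epsilon> * (2 * (B * norm x2 * norm x1) + B * (norm x2)\<^sup>2)"
    unfolding H0 using q by (intro order.trans[OF abs_triangle_ineq] add_mono)
  then have H_le: "\<bar>H 0 (x1, x2) \<bullet> (x1, x2) - (p 0 *v x1) \<bullet> x1\<bar>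
      \<le> (K * (norm x1)\<^sup>2 + 2 * (B * norm x2 * norm x1) + B * (norm x2)\<^sup>2) * \<epsilon>"
    by (simp add: algebra_simps)
  have half: "\<bar>1/2 * (u + d)\<bar> \<le> \<bar>u\<bar> + \<bar>d\<bar>" for u d :: real
    using abs_triangle_ineq[of u d] abs_ge_zero[of u] abs_ge_zero[of d] unfolding abs_mult by simp
  have arith: "v = 1/2 * (a + i + tr) \<Longrightarrow> j = d + i + tr \<Longrightarrow> 1/2 * (u + j) - v = 1/2 * (u - a + d)"
    for v a i tr j d u :: real by (simp add: field_simps)
  have "V_bar G T p R x1 x2 = 1/2 * ((p 0 *v x1) \<bullet> x1 + integral {0..T} (\<lambda>t. (p t ** sigma1 G) \<bullet> sigma1 G)
      + T * ((R ** sigma2 G) \<bullet> sigma2 G))"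
    unfolding V_bar_def set_borel_integral_eq_integral(2)[OF borel_integrable_atLeastAtMost'[OF c(2)]] by (simp add: algebra_simps)
  moreover have "integral {0..T} (\<lambda>t. (P11 t ** sigma1 G) \<bullet> sigma1 G + (P22 t ** sigma2 G) \<bullet> sigma2 G)
      = integral {0..T} e + integral {0..T} (\<lambda>t. (p t ** sigma1 G) \<bullet> sigma1 G) + T * ((R ** sigma2 G) \<bullet> sigma2 G)"
  proof -
    have "(\<lambda>t. (P11 t ** sigma1 G) \<bullet> sigma1 G + (P22 t ** sigma2 G) \<bullet> sigma2 G)
      = (\<lambda>t. e t + (p t ** sigma1 G) \<bullet> sigma1 G + (R ** sigma2 G) \<bullet> sigma2 G)"
      by (simp add: e_def bounded_bilinear.diff_left[OF bounded_bilinear_matrix_mult] inner_diff_left)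
    moreover have "((\<lambda>t. e t + (p t ** sigma1 G) \<bullet> sigma1 G + (R ** sigma2 G) \<bullet> sigma2 G) has_integral
        integral {0..T} e + integral {0..T} (\<lambda>t. (p t ** sigma1 G) \<bullet> sigma1 G) + (T - 0) *\<^sub>R ((R ** sigma2 G) \<bullet> sigma2 G)) {0..T}"
      using has_integral_const_real[of "(R ** sigma2 G) \<bullet> sigma2 G" 0 T] T_pos
      by (intro has_integral_add integrable_integral i) simp_all
    ultimately show ?thesis by (simp add: integral_unique)
  qed
  ultimately have "cost_J G M T W1 W2 \<epsilon> x1 x2 (feedback1 G \<epsilon> (P11, P12, P22) X) (feedback2 G \<epsilon> (P11, P12, P22) X)
      - V_bar G T p R x1 x2 = 1/2 * ((H 0 (x1, x2) \<bullet> (x1, x2) - (p 0 *v x1) \<bullet> x1) + integral {0..T} e)"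
    unfolding closed_loop_cost[OF cl] by (rule arith)
  also have "\<bar>\<dots>\<bar> \<le> \<bar>H 0 (x1, x2) \<bullet> (x1, x2) - (p 0 *v x1) \<bullet> x1\<bar> + \<bar>integral {0..T} e\<bar>"
    by (rule half)
  also have "\<dots> \<le> (K * (norm x1)\<^sup>2 + 2 * (B * norm x2 * norm x1) + B * (norm x2)\<^sup>2) * \<epsilon>
      + (K * T * s1 + (K * T + Kh / b) * s2) * \<epsilon>"
    using H_le e_le bd_le by (intro add_mono) auto
  finally show ?thesis by (simp add: s1_def s2_def algebra_simps)
qed

section \<open>Expansion of the value\<close>

text \<open>From an interior point one may still move outward by a small multiple of the point
  itself; the norm grows, so it was strictly below the radius.\<close>

lemma norm_less_of_interior:
  fixes R :: "real^'n^'n"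
  assumes "R \<in> (top_of_set sym_mats) interior_of (sym_cball q)"
  shows "norm R < q"
proof -
  obtain U where U: "open U" "R \<in> U" "sym_mats \<inter> U \<subseteq> sym_cball q" and R: "R \<in> sym_mats"
    using assms unfolding interior_of_def openin_open by auto
  obtain e where e: "e > 0" "\<And>P. dist P R < e \<Longrightarrow> P \<in> U"
    using U(1,2) unfolding open_dist by blast
  \<comment> \<open>At the origin no radial direction exists; the identity matrix serves as a
    nonzero symmetric one.\<close>
  define Z :: "real^'n^'n" where "Z = (if R = 0 then mat 1 else R)"
  have "mat 1 \<noteq> (0 :: real^'n^'n)"
    by (simp add: mat_def vec_eq_iff)
  then have Z: "Z \<noteq> 0" "Z \<in> sym_mats" using R by (auto simp: Z_def sym_mats_def)
  define c where "c = e / 2 / norm Z"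
  have c: "c > 0" "c * norm Z = e / 2" using e Z by (auto simp: c_def)
  have "R + c *\<^sub>R Z \<in> U" using e(1) c by (intro e(2)) (simp add: dist_norm)
  moreover have "R + c *\<^sub>R Z \<in> sym_mats"
    using R Z by (simp add: sym_mats_def transpose_linear_simps linear_scale[OF bounded_linear.linear[OF bounded_linear_transpose]])
  ultimately have "norm (R + c *\<^sub>R Z) \<le> q" using U(3) by (auto simp: sym_cball_def)
  moreover have "norm (R + c *\<^sub>R Z) = norm R + c * norm Z"
  proof (cases "R = 0")
    case False
    then have "R + c *\<^sub>R Z = (1 + c) *\<^sub>R R" and "Z = R" by (simp_all add: Z_def scaleR_add_left)
    moreover have "norm ((1 + c) *\<^sub>R R) = norm R + c * norm R"
      using c(1) unfolding norm_scaleR by (simp add: algebra_simps)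
    ultimately show ?thesis by simp
  qed (use c in simp)
  ultimately show ?thesis using c e by simp
qed

theorem theorem5p4:
  fixes G :: "('n1::finite, 'n2::finite, 'k1::finite, 'k2::finite, 'm1::finite, 'm2::finite) game"
    and M :: "'w measure"
    and W1 :: "real \<Rightarrow> 'w \<Rightarrow> real^'m1" and W2 :: "real \<Rightarrow> 'w \<Rightarrow> real^'m2"
    and T \<gamma> \<delta> q2 :: real
    and x1 :: "real^'n1" and x2 :: "real^'n2"
    and P11bar :: "real \<Rightarrow> real^'n1^'n1" and P22bar S :: "real^'n2^'n2"
  assumes T_pos: "T > 0"
    and sym_Q: "Q1 G \<in> sym_mats" "Q2 G \<in> sym_mats"
    and prob: "prob_space M" "complete_measure M"
    and brownian: "brownian_motion M T W1" "brownian_motion M T W2"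
    and indep: "independent_processes M T W1 W2"
    and cond_i: "invertible (Delta2 G)"
    and cond_ii: "P22bar \<in> sym_mats"
      "transpose (A22 G) ** P22bar + P22bar ** A22 G + P22bar ** Delta2 G ** P22bar + Q2 G = 0"
      "S = A22 G + Delta2 G ** P22bar"
      "\<forall>z. complex_eigenvalue S z \<longrightarrow> Re z < 0"
    and cond_iii: "reduced_solution G T P11bar"
      "\<forall>P. reduced_solution G T P \<longrightarrow> (\<forall>t\<in>{0..T}. P t = P11bar t)"
    and cond_iv: "\<gamma> > 0" "mat_le (sym_part S) (mat (- \<gamma>))"
    and cond_v: "0 < \<delta>" "\<delta> < \<gamma>"
      "largest_ball_radius (R_set S (Delta2 G) \<delta>) q2"
      "- P22bar \<in> (top_of_set sym_mats) interior_of (sym_cball q2)"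
  shows "\<exists>\<epsilon>star. tikhonov_threshold G T P11bar P22bar \<epsilon>star \<and>
    (\<exists>C. \<forall>\<epsilon> P. 0 < \<epsilon> \<and> \<epsilon> < \<epsilon>star \<and> full_solution G T \<epsilon> P \<longrightarrow>
       (\<exists>X. closed_loop_state G M T W1 W2 \<epsilon> x1 x2 P X) \<and>
       (\<forall>X. closed_loop_state G M T W1 W2 \<epsilon> x1 x2 P X \<longrightarrow>
          \<bar>cost_J G M T W1 W2 \<epsilon> x1 x2 (feedback1 G \<epsilon> P X) (feedback2 G \<epsilon> P X)
            - V_bar G T P11bar P22bar x1 x2\<bar> \<le> C * \<epsilon>))"
proof -
  have symR: "transpose P22bar = P22bar" using cond_ii(1) by (simp add: sym_mats_def)
  have diss: "((A22 G + Delta2 G ** P22bar) *v x) \<bullet> x \<le> - \<gamma> * (x \<bullet> x)" for x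
    using cond_iv(2) unfolding mat_le_sym_part_iff cond_ii(3) by blast
  \<comment> \<open>Assumption (iv) gives the damping \<gamma>, and assumption (v) gives the bound
    \<delta> on the ball of radius \<open>q2\<close>. The norms of \<open>P22bar\<close> and of
    \<open>- P22bar\<close> agree, so the interior condition yields \<open>R_small\<close>.\<close>
  interpret riccati_layer G P22bar \<gamma> \<delta> q2
  proof
    fix P :: "real^'n2^'n2" and x assume "transpose P = P" "norm P \<le> q2"
    then have "P \<in> R_set S (Delta2 G) \<delta>"
      using cond_v(3) by (auto simp: largest_ball_radius_def sym_cball_def sym_mats_def)
    then show "((A22 G + Delta2 G ** P22bar + Delta2 G ** P) *v x) \<bullet> x \<le> \<delta> * (x \<bullet> x)"
      unfolding R_set_def mat_le_sym_part_iff cond_ii(3) by blast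
  next
    show "norm P22bar < q2" using norm_less_of_interior[OF cond_v(4)] by simp
  qed (fact cond_i symR cond_ii(2) diss cond_v(1,2))+
  have barS: "t \<in> {0..T} \<Longrightarrow> transpose (P11bar t) = P11bar t" and bar0: "P11bar T = 0" for t
    using cond_iii(1) by (auto simp: reduced_solution_def sym_mats_def)
  have bar': "(P11bar has_vector_derivative - ric_f G (P11bar t) (h (P11bar t)) 0 0) (at t within {0..T})"
    \<comment> \<open>With its coefficients rewritten by \<open>reduced_rhs\<close>, the reduced
      equation is the slow equation along the equilibrium \<open>h\<close> of the fast one.\<close>
    if t: "t \<in> {0..T}" for t
  proof -
    obtain D where D: "(P11bar has_vector_derivative D) (at t within {0..T})"
      "D + transpose (A_red G) ** P11bar t + P11bar t ** A_red G + P11bar t ** M_red G ** P11bar t + N_red G = 0"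
      using cond_iii(1) t unfolding reduced_solution_def by blast
    have "ric_f G (P11bar t) (h (P11bar t)) 0 0
      = transpose (A_red G) ** P11bar t + P11bar t ** A_red G + P11bar t ** M_red G ** P11bar t + N_red G"
      unfolding h_def by (rule reduced_rhs[OF cond_i inv_S[unfolded S_def] symR cond_ii(2) barS[OF t], symmetric])
    then have "D + ric_f G (P11bar t) (h (P11bar t)) 0 0 = 0" using D(2) by (simp add: add.assoc)
    then show ?thesis using D(1) by (simp only: eq_neg_iff_add_eq_0[symmetric])
  qed
  have bar_cont: "continuous_on {0..T} P11bar"
    by (rule has_vector_derivative_continuous_on, erule bar')
  obtain Ph12 Ph22 Kh where layer: "boundary_layer G P22bar Ph12 Ph22" and Kh: "Kh \<ge> 0"
    "\<And>\<tau>. \<tau> \<ge> 0 \<Longrightarrow> norm (Ph12 \<tau>) \<le> Kh * exp (- \<beta> * \<tau>)" "\<And>\<tau>. \<tau> \<ge> 0 \<Longrightarrow> norm (Ph22 \<tau>) \<le> Kh * exp (- \<beta> * \<tau>)"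
    using boundary_layer_exists by blast
  interpret tikhonov_data G P22bar \<gamma> \<delta> q2 T "\<lambda>s. P11bar (T - s)" Ph12 Ph22 Kh
  proof
    fix s assume "s \<in> {0..T}"
    then have "T - s \<in> {0..T}" by auto
    from has_vector_derivative_reverse[OF bar'[OF this]]
    show "((\<lambda>s. P11bar (T - s)) has_vector_derivative ric_f G (P11bar (T - s)) (h (P11bar (T - s))) 0 0) (at s within {0..T})"
      by simp
  qed (use T_pos sym_Q bar0 layer Kh in \<open>auto simp: sym_mats_def\<close>)
  obtain \<epsilon>star K where thr: "tikhonov_threshold G T (\<lambda>t. P11bar (T - (T - t))) P22bar \<epsilon>star" and K: "K \<ge> 0"
    and est: "\<And>\<epsilon> P11 P12 P22 t. 0 < \<epsilon> \<Longrightarrow> \<epsilon> < \<epsilon>star \<Longrightarrow> full_solution G T \<epsilon> (P11, P12, P22) \<Longrightarrow> t \<in> {0..T} \<Longrightarrow>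
      norm (P11 t - P11bar (T - (T - t))) \<le> K * \<epsilon> \<and>
      norm (P12 t - h (P11bar (T - (T - t))) - Ph12 ((T - t) / \<epsilon>)) \<le> K * \<epsilon> \<and>
      norm (P22 t - P22bar - Ph22 ((T - t) / \<epsilon>)) \<le> K * \<epsilon>"
    using tikhonov by metis
  have star: "\<epsilon>star \<le> 1" using thr by (simp add: tikhonov_threshold_def)
  \<comment> \<open>At time 0 the matrices \<open>P12\<close> and \<open>P22\<close> differ from
    their limits by the layer, at most \<open>Kh\<close>, and by the error, at most \<open>K\<close>
    since \<epsilon> < 1.\<close>
  define B where "B = norm (h (P11bar 0)) + norm P22bar + Kh + K"
  define C where "C = K * (norm x1)\<^sup>2 + 2 * (B * norm x2 * norm x1) + B * (norm x2)\<^sup>2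
        + K * T * (norm (sigma1 G))\<^sup>2 + (K * T + Kh / \<beta>) * (norm (sigma2 G))\<^sup>2"
  have main: "(\<exists>X. closed_loop_state G M T W1 W2 \<epsilon> x1 x2 P X) \<and>
       (\<forall>X. closed_loop_state G M T W1 W2 \<epsilon> x1 x2 P X \<longrightarrow>
          \<bar>cost_J G M T W1 W2 \<epsilon> x1 x2 (feedback1 G \<epsilon> P X) (feedback2 G \<epsilon> P X)
            - V_bar G T P11bar P22bar x1 x2\<bar> \<le> C * \<epsilon>)"
    if \<epsilon>: "0 < \<epsilon>" "\<epsilon> < \<epsilon>star" and full: "full_solution G T \<epsilon> P" for \<epsilon> P
  proof -
    obtain P11 P12 P22 where P: "P = (P11, P12, P22)" by (cases P)
    interpret loop: closed_loop_game G M T W1 W2 x1 x2 \<epsilon> P11 P12 P22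
      by (rule closed_loop_game.intro[OF prob(1) closed_loop_game_axioms.intro[OF T_pos brownian indep \<epsilon>(1) full[unfolded P]]])
    note est' = est[OF \<epsilon> full[unfolded P], simplified]
    have layer_bound: "norm (Ph12 ((T - t) / \<epsilon>)) \<le> Kh * exp (- \<beta> * ((T - t) / \<epsilon>))"
      "norm (Ph22 ((T - t) / \<epsilon>)) \<le> Kh * exp (- \<beta> * ((T - t) / \<epsilon>))" if "t \<in> {0..T}" for t
      by (rule Kh(2), use that \<epsilon> in simp) (rule Kh(3), use that \<epsilon> in simp)
    have "K * \<epsilon> \<le> K * 1" using K \<epsilon> star by (intro mult_left_mono) auto
    moreover have "Kh * exp (- \<beta> * ((T - 0) / \<epsilon>)) \<le> Kh * 1"
      using Kh(1) \<beta>_pos T_pos \<epsilon> by (intro mult_left_mono) auto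
    ultimately have small: "K * \<epsilon> + Kh * exp (- \<beta> * ((T - 0) / \<epsilon>)) \<le> K + Kh" by linarith
    have tri: "norm p \<le> norm a + (k + k')" if "norm (p - a - b) \<le> k" "norm b \<le> k'"
      for p a b :: "'v::real_normed_vector" and k k'
      using norm_triangle_ineq[of "p - a - b" "a + b"] norm_triangle_ineq[of a b] that by simp
    have P22_near: "norm (P22 t - P22bar) \<le> K * \<epsilon> + Kh * exp (- \<beta> * ((T - t) / \<epsilon>))" if t: "t \<in> {0..T}" for t
      using tri[of "P22 t - P22bar" 0 "Ph22 ((T - t) / \<epsilon>)"] est'[of t] layer_bound(2)[OF t] t by simp
    have zero: "0 \<in> {0..T}" using T_pos by simp
    have B12: "norm (P12 0) \<le> B"
    proof -
      have "norm (P12 0 - h (P11bar 0) - Ph12 ((T - 0) / \<epsilon>)) \<le> K * \<epsilon>" using est'[of 0] zero by simp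
      from tri[OF this layer_bound(1)[OF zero]] show ?thesis using small norm_ge_zero[of P22bar] unfolding B_def by linarith
    qed
    have B22: "norm (P22 0) \<le> B"
    proof -
      have "norm (P22 0 - P22bar - Ph22 ((T - 0) / \<epsilon>)) \<le> K * \<epsilon>" using est'[of 0] zero by simp
      from tri[OF this layer_bound(2)[OF zero]] show ?thesis using small norm_ge_zero[of "h (P11bar 0)"] unfolding B_def by linarith
    qed
    have "\<bar>cost_J G M T W1 W2 \<epsilon> x1 x2 (feedback1 G \<epsilon> P X) (feedback2 G \<epsilon> P X)
            - V_bar G T P11bar P22bar x1 x2\<bar> \<le> C * \<epsilon>" if "closed_loop_state G M T W1 W2 \<epsilon> x1 x2 P X" for X
      unfolding C_def P
      by (rule loop.closed_loop_cost_near[OF that[unfolded P] bar_cont _ P22_near B12 B22 \<beta>_pos Kh(1)])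
        (use est' in auto)
    then show ?thesis using loop.closed_loop_exists unfolding P by metis
  qed
  have "tikhonov_threshold G T P11bar P22bar \<epsilon>star" using thr by simp
  with main show ?thesis by blast
qed

end
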